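(* Let $D$ be a non-commutative division ring with center $F$, and let $G$ be a subnormal subgroup of ${\rm GL}_n(D)$ with $n\geq 2$. Assume additionally that $F$ contains at least five elements. If $M$ is a solvable maximal subgroup of $G$, then $M$ is abelian. *)

theory Defs
  imports "HOL-Analysis.Analysis" "HOL-Algebra.Solvable_Groups"
begin

definition dr_center :: "'a::division_ring set" where
  "dr_center = {z. \<forall>x. z * x = x * z}"

definition GL :: "('a::division_ring ^'n^'n) monoid" where
  "GL = \<lparr>carrier = {A. invertible A}, mult = (\<lambda>A B. A ** B), one = mat 1\<rparr>"

definition subnormal :: "'a set \<Rightarrow> ('a, 'b) monoid_scheme \<Rightarrow> bool" where
  "subnormal H G \<longleftrightarrow> (\<exists>ks. ks \<noteq> [] \<and> hd ks = H \<and> last ks = carrier G \<and>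
     (\<forall>K \<in> set ks. subgroup K G) \<and>
     (\<forall>i < length ks - 1. ks ! i \<lhd> G\<lparr>carrier := ks ! (i + 1)\<rparr>))"

definition maximal_subgroup :: "'a set \<Rightarrow> ('a, 'b) monoid_scheme \<Rightarrow> bool" where
  "maximal_subgroup M G \<longleftrightarrow> subgroup M G \<and> M \<noteq> carrier G \<and>
     (\<forall>K. subgroup K G \<and> M \<subseteq> K \<longrightarrow> K = M \<or> K = carrier G)"

end

(* Matrices act on the right D-space of columns V, and a noncentral G contains the group E generated
   by all transvections (Iwasawa). If X is a proper subring normalized by M with a noncentral unit,
   then M is its normalizer in G, and [GL, GL] = E lies in G, so the commutators of units of X lie in
   M and the unit group of X is solvable. Hence M acts irreducibly on V, a division ring X must be
   commutative (Hua), and X contains no 2 x 2 matrix units.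

   Suppose M is not abelian. Let A be an abelian subgroup normalized by M and not central. Its
   centralizer is a field L. Choose a subgroup N of M, normalized by M and not inside L, with [N, N]
   inside L. If N modulo L were torsion-free, it would be orderable, its L-span would be an Ore domain
   with division ring of fractions, and this contradicts Hua's theorem. So some g in N has g^p in L,
   the powers of g span End(V) over L, and counting dimensions gives a contradiction. Hence A is
   central, and the same torsion argument with the center F in place of L produces a nonabelian group
   Q, generated by F^* and elements with p-th power 1 or -1, that is abelian modulo F. Its F-span either
   contains matrix units, or is everything and has a corner that is too small, except when p = 2 in
   characteristic 0, where a unit of norm 5 leads outside Q. *)
theory Submission
  imports Defs
begin

section \<open>Groups of units\<close>

text \<open>The proof keeps passing between a group, the ring it spans and centralizers, so all of
  them are kept as subsets of one ambient ring of class \<open>ring_1\<close>, and groups are groups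
  of its units. Maximality of M enters only through \<open>proper_ring\<close>; afterwards every
  contradiction comes from a noncommutative division ring with solvable unit group, from 2 x 2
  matrix units, from a copy of the multiplicative group of D in a proper invariant ring, or from a
  corner that would have to be commutative. The first two need a central f with f * f different from
  1, hence an element outside {0, 1, -1}. The fifth central element is used only for p = 3, to
  exclude a center in which every nonzero element is a cube root of 1. Chain conditions over D come
  from sets of pivot positions; comparisons of dimension over a subring come from homogeneous linear
  systems. Localizations need no abstract construction: once the nonzero elements of an Ore domain
  act injectively on V, they are already invertible in End(V).\<close>

definition ui :: "'r::ring_1 \<Rightarrow> 'r" where
  "ui x = (THE y. x * y = 1 \<and> y * x = 1)"

definition units :: "'r::ring_1 set" where
  "units = {x. \<exists>y. x * y = 1 \<and> y * x = 1}"

lemma ui_eq: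
  assumes "x * y = 1" "y * x = (1::'r::ring_1)" shows "ui x = y"
  unfolding ui_def
proof (rule the_equality)
  fix z assume z: "x * z = 1 \<and> z * x = 1"
  have "z = z * (x * y)" using assms by simp
  also have "\<dots> = (z * x) * y" by (simp add: mult.assoc)
  finally show "z = y" using z by simp
qed (use assms in simp)

lemma unitsI: "x * y = 1 \<Longrightarrow> y * x = 1 \<Longrightarrow> x \<in> units"
  unfolding units_def by blast

lemma ui_right [simp]: "x \<in> units \<Longrightarrow> x * ui x = 1"
  and ui_left [simp]: "x \<in> units \<Longrightarrow> ui x * x = 1"
  unfolding units_def using ui_eq by fastforce+

lemma ui_right2 [simp]: "x \<in> units \<Longrightarrow> x * (ui x * z) = z"
  and ui_left2 [simp]: "x \<in> units \<Longrightarrow> ui x * (x * z) = z"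
  by (simp_all add: mult.assoc[symmetric])

lemma ui_units [simp]: "x \<in> units \<Longrightarrow> ui x \<in> units"
  by (rule unitsI[of _ x]) simp_all

lemma ui_ui [simp]: "x \<in> units \<Longrightarrow> ui (ui x) = x"
  by (rule ui_eq) simp_all

lemma units_mult [simp]: "x \<in> units \<Longrightarrow> y \<in> units \<Longrightarrow> x * y \<in> units"
  by (rule unitsI[of _ "ui y * ui x"]) (simp_all add: mult.assoc)

lemma ui_mult [simp]: "x \<in> units \<Longrightarrow> y \<in> units \<Longrightarrow> ui (x * y) = ui y * ui x"
  by (rule ui_eq) (simp_all add: mult.assoc)

lemma units_1 [simp]: "1 \<in> units" by (rule unitsI[of _ 1]) simp_all

lemma ui_1 [simp]: "ui 1 = 1" by (rule ui_eq) simp_all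

lemma units_minus [simp]: "- x \<in> units \<longleftrightarrow> x \<in> units"
proof -
  have "- y \<in> units" if "y \<in> units" for y :: 'a
    by (rule unitsI[of _ "- ui y"]) (simp_all add: that)
  from this[of x] this[of "- x"] show ?thesis by auto
qed

lemma ui_minus [simp]: "x \<in> units \<Longrightarrow> ui (- x) = - ui x"
  by (rule ui_eq) simp_all

lemma units_power [simp]: "x \<in> units \<Longrightarrow> x ^ n \<in> units"
  by (induction n) simp_all

lemma ui_power: "x \<in> units \<Longrightarrow> ui (x ^ n) = ui x ^ n"
  by (induction n) (simp_all add: power_commutes)

lemma units_cancel_left: "x \<in> units \<Longrightarrow> x * y = x * z \<longleftrightarrow> y = z"
  by (metis ui_left2)

lemma units_cancel_right: "x \<in> units \<Longrightarrow> y * x = z * x \<longleftrightarrow> y = z"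
  by (metis mult.assoc mult_1_right ui_right)

lemma units_commute_ui:
  assumes "x \<in> units" "x * y = y * x" shows "ui x * y = y * ui x"
proof -
  have "ui x * y = ui x * (y * x) * ui x" using assms(1) by (simp add: mult.assoc)
  also have "\<dots> = ui x * (x * y) * ui x" using assms(2) by simp
  also have "\<dots> = y * ui x" using assms(1) by (simp add: mult.assoc)
  finally show ?thesis .
qed

lemma unit_nonzero: "x \<in> units \<Longrightarrow> x \<noteq> (0::'r::ring_1)"
  using ui_right by fastforce

definition comm :: "'r::ring_1 \<Rightarrow> 'r \<Rightarrow> 'r" where
  "comm x y = x * y * ui x * ui y"

lemma comm_units [simp]: "x \<in> units \<Longrightarrow> y \<in> units \<Longrightarrow> comm x y \<in> units"
  by (simp add: comm_def)

lemma comm_swap: "x \<in> units \<Longrightarrow> y \<in> units \<Longrightarrow> x * y = comm x y * (y * x)"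
  by (simp add: comm_def mult.assoc)

lemma comm_eq: "x \<in> units \<Longrightarrow> y \<in> units \<Longrightarrow> x * y = z * (y * x) \<Longrightarrow> comm x y = z"
  by (simp add: comm_def mult.assoc)

lemma comm_eq_1_iff: "x \<in> units \<Longrightarrow> y \<in> units \<Longrightarrow> comm x y = 1 \<longleftrightarrow> x * y = y * x"
  by (metis comm_eq comm_swap mult_1)

lemma conj_comm:
  "m \<in> units \<Longrightarrow> x \<in> units \<Longrightarrow> y \<in> units \<Longrightarrow>
    m * comm x y * ui m = comm (m * x * ui m) (m * y * ui m)"
  by (simp add: comm_def mult.assoc)

definition ugrp :: "'r::ring_1 set \<Rightarrow> bool" where
  "ugrp H \<longleftrightarrow> H \<subseteq> units \<and> 1 \<in> H \<and> (\<forall>x\<in>H. \<forall>y\<in>H. x * y \<in> H) \<and> (\<forall>x\<in>H. ui x \<in> H)"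

lemma ugrpD:
  assumes "ugrp H"
  shows "x \<in> H \<Longrightarrow> x \<in> units" "1 \<in> H" "x \<in> H \<Longrightarrow> y \<in> H \<Longrightarrow> x * y \<in> H" "x \<in> H \<Longrightarrow> ui x \<in> H"
  using assms unfolding ugrp_def by auto

lemma ugrp_power: "ugrp H \<Longrightarrow> x \<in> H \<Longrightarrow> x ^ n \<in> H"
  by (induction n) (auto simp: ugrpD)

lemma ugrp_comm: "ugrp H \<Longrightarrow> x \<in> H \<Longrightarrow> y \<in> H \<Longrightarrow> comm x y \<in> H"
  by (simp add: comm_def ugrpD)

definition normalizes :: "'r::ring_1 set \<Rightarrow> 'r set \<Rightarrow> bool" where
  "normalizes M H \<longleftrightarrow> (\<forall>m\<in>M. \<forall>h\<in>H. m * h * ui m \<in> H)"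

lemma normalizesD: "normalizes M H \<Longrightarrow> m \<in> M \<Longrightarrow> h \<in> H \<Longrightarrow> m * h * ui m \<in> H"
  unfolding normalizes_def by blast

inductive_set gen :: "'r::ring_1 set \<Rightarrow> 'r set" for S where
  one: "1 \<in> gen S"
| mult: "s \<in> S \<Longrightarrow> x \<in> gen S \<Longrightarrow> s * x \<in> gen S"
| inv: "s \<in> S \<Longrightarrow> x \<in> gen S \<Longrightarrow> ui s * x \<in> gen S"

lemma gen_units: assumes "S \<subseteq> units" "x \<in> gen S" shows "x \<in> units"
  using assms(2) by induction (use assms(1) in auto)

lemma gen_mult: "x \<in> gen S \<Longrightarrow> y \<in> gen S \<Longrightarrow> x * y \<in> gen S"
  by (induction rule: gen.induct) (auto simp: mult.assoc intro: gen.intros)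

lemma gen_base: "s \<in> S \<Longrightarrow> s \<in> gen S"
  using gen.mult[OF _ gen.one, of s S] by simp

lemma ugrp_gen: assumes S: "S \<subseteq> units" shows "ugrp (gen S)"
proof -
  have "ui x \<in> gen S" if "x \<in> gen S" for x
    using that
  proof induction
    case one then show ?case by (simp add: gen.one)
  next
    case (mult s x)
    then have "ui (s * x) = ui x * (ui s * 1)" using S gen_units[OF S] by auto
    then show ?case using mult gen_mult gen.inv gen.one by metis
  next
    case (inv s x)
    then have "ui (ui s * x) = ui x * s" using S gen_units[OF S] by auto
    then show ?case using inv gen_mult gen_base by metis
  qed
  then show ?thesis unfolding ugrp_def using S gen_units gen_mult gen.one by blast
qed

lemma gen_least:
  assumes "ugrp H" "S \<subseteq> H" shows "gen S \<subseteq> H"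
proof
  fix x assume "x \<in> gen S" then show "x \<in> H"
    by induction (use assms ugrpD in blast)+
qed

lemma normalizes_gen:
  assumes S: "S \<subseteq> units" and M: "M \<subseteq> units" and n: "normalizes M S"
  shows "normalizes M (gen S)"
  unfolding normalizes_def
proof (intro ballI)
  fix m h assume m: "m \<in> M" and "h \<in> gen S"
  then have mu: "m \<in> units" using M by auto
  show "m * h * ui m \<in> gen S" using \<open>h \<in> gen S\<close>
  proof induction
    case one then show ?case using mu by (simp add: gen.one)
  next
    case (mult s x)
    have "m * (s * x) * ui m = (m * s * ui m) * (m * x * ui m)" using mu by (simp add: mult.assoc)
    then show ?case using mult n m gen.mult normalizesD by metis
  next
    case (inv s x)
    then have su: "s \<in> units" using S by auto
    have "m * (ui s * x) * ui m = ui (m * s * ui m) * (m * x * ui m)" using mu su by (simp add: mult.assoc)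
    then show ?case using inv n m gen.inv normalizesD by metis
  qed
qed

text \<open>Solvability of length at most k through upper bounds: any group containing the
  commutators may stand in for the derived group, and H may be a mere subset. The notion therefore
  passes to subsets at once and pulls back along injective maps without computing derived
  groups.\<close>

fun sol :: "nat \<Rightarrow> 'r::ring_1 set \<Rightarrow> bool" where
  "sol 0 H \<longleftrightarrow> H \<subseteq> {1}"
| "sol (Suc k) H \<longleftrightarrow> (\<exists>N. ugrp N \<and> sol k N \<and> (\<forall>x\<in>H. \<forall>y\<in>H. comm x y \<in> N))"

lemma sol_mono: "sol k H \<Longrightarrow> H' \<subseteq> H \<Longrightarrow> sol k H'"
  by (cases k) (auto, blast+)

text \<open>The preimages of the groups in the chain form a chain again. Multiplicativity is all
  that is asked for, since the map used later,
  \<open>1 + out x (\<lambda>v. (a - 1) * \<phi> v)\<close>, is not additive.\<close>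

lemma sol_hom_inj:
  fixes f :: "'r::ring_1 \<Rightarrow> 's::ring_1"
  assumes "sol k H" "f ` units \<subseteq> units" "\<And>x y. x \<in> units \<Longrightarrow> y \<in> units \<Longrightarrow> f (x * y) = f x * f y"
    "inj_on f units" "f ` H' \<subseteq> H" "H' \<subseteq> units"
  shows "sol k H'"
  using assms(1,5,6)
proof (induction k arbitrary: H H')
  have "f 1 \<in> units" using assms(2) by auto
  then have f1: "f 1 = 1"
    using assms(3)[of 1 1] units_cancel_left[of "f 1" "f 1" 1] by simp
  {
    case 0
    show ?case
    proof (simp, rule subsetI)
      fix x assume "x \<in> H'"
      then have "f x = f 1" "x \<in> units" using 0 f1 by auto
      then show "x \<in> {1}" using assms(4) by (auto dest: inj_onD)
    qed
  next
    case (Suc k)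
    have fi: "f (ui x) = ui (f x)" if "x \<in> units" for x
      using assms(3)[of x "ui x"] assms(3)[of "ui x" x] that f1 by (intro ui_eq[symmetric]) auto
    have fc: "f (comm x y) = comm (f x) (f y)" if "x \<in> units" "y \<in> units" for x y
      using that by (simp add: comm_def assms(3) fi)
    obtain N where N: "ugrp N" "sol k N" "\<forall>x\<in>H. \<forall>y\<in>H. comm x y \<in> N" using Suc.prems by auto
    define N' where "N' = {x \<in> units. f x \<in> N}"
    have "ugrp N'" unfolding ugrp_def N'_def using N(1) f1 by (auto simp: assms(3) fi ugrpD)
    moreover have "sol k N'" by (rule Suc.IH[OF N(2)]) (auto simp: N'_def)
    moreover have "\<forall>x\<in>H'. \<forall>y\<in>H'. comm x y \<in> N'"
      using N(3) Suc.prems unfolding N'_def by (auto simp: subset_iff fc)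
    ultimately show ?case by auto
  }
qed

text \<open>Descend through groups generated by commutators and stop at the last one outside Z; the
  descent ends in {1}, which lies in Z. Being generated by commutators, each term stays normalized
  by M. Z is a mere set with 1 in it: it will be the center of a division ring, the field L, or
  F.\<close>

lemma last_derived:
  assumes "sol k N" "ugrp N" "M \<subseteq> units" "normalizes M N" "\<not> N \<subseteq> Z" "1 \<in> Z"
  shows "\<exists>N'\<subseteq>N. ugrp N' \<and> normalizes M N' \<and> \<not> N' \<subseteq> Z \<and> (\<forall>x\<in>N'. \<forall>y\<in>N'. comm x y \<in> Z)"
  using assms
proof (induction k arbitrary: N)
  case 0 then show ?case by auto
next
  case (Suc k)
  let ?S = "{comm x y | x y. x \<in> N \<and> y \<in> N}"
  have Su: "?S \<subseteq> units" using Suc.prems(2) by (auto simp: ugrpD)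
  have SN: "gen ?S \<subseteq> N" by (rule gen_least) (use Suc.prems(2) ugrp_comm in auto)
  show ?case
  proof (cases "gen ?S \<subseteq> Z")
    case True
    then have "\<forall>x\<in>N. \<forall>y\<in>N. comm x y \<in> Z" using gen_base[of _ ?S] by blast
    then show ?thesis using Suc.prems(2,4,5) by blast
  next
    case False
    obtain N1 where N1: "ugrp N1" "sol k N1" "\<forall>x\<in>N. \<forall>y\<in>N. comm x y \<in> N1" using Suc.prems by auto
    have "gen ?S \<subseteq> N1" by (rule gen_least) (use N1 in auto)
    then have "sol k (gen ?S)" using N1 sol_mono by blast
    moreover have "normalizes M (gen ?S)"
    proof (rule normalizes_gen[OF Su Suc.prems(3)])
      show "normalizes M ?S" unfolding normalizes_def
      proof (intro ballI)
        fix m h assume m: "m \<in> M" and "h \<in> ?S"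
        then obtain x y where h: "h = comm x y" "x \<in> N" "y \<in> N" by auto
        then have "m * h * ui m = comm (m * x * ui m) (m * y * ui m)"
          using conj_comm Suc.prems(2,3) m ugrpD(1) by blast
        then show "m * h * ui m \<in> ?S" using h m Suc.prems(4) normalizesD by fast
      qed
    qed
    ultimately obtain N' where "N' \<subseteq> gen ?S" and "ugrp N' \<and> normalizes M N' \<and> \<not> N' \<subseteq> Z \<and> (\<forall>x\<in>N'. \<forall>y\<in>N'. comm x y \<in> Z)"
      using Suc.IH[OF _ ugrp_gen[OF Su] Suc.prems(3) _ False Suc.prems(6)] by auto
    then show ?thesis using SN by blast
  qed
qed

section \<open>Non-solvability criteria\<close>

definition subrng :: "'r::ring_1 set \<Rightarrow> bool" where
  "subrng X \<longleftrightarrow> 0 \<in> X \<and> 1 \<in> X \<and> (\<forall>x\<in>X. \<forall>y\<in>X. x + y \<in> X \<and> x * y \<in> X) \<and> (\<forall>x\<in>X. - x \<in> X)"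

lemma subrngD:
  assumes "subrng X"
  shows "0 \<in> X" "1 \<in> X" "x \<in> X \<Longrightarrow> y \<in> X \<Longrightarrow> x + y \<in> X" "x \<in> X \<Longrightarrow> y \<in> X \<Longrightarrow> x * y \<in> X"
    "x \<in> X \<Longrightarrow> - x \<in> X" "x \<in> X \<Longrightarrow> y \<in> X \<Longrightarrow> x - y \<in> X"
  using assms unfolding subrng_def by (simp_all, metis diff_conv_add_uminus)

lemma subrng_power: "subrng X \<Longrightarrow> x \<in> X \<Longrightarrow> x ^ n \<in> X"
  by (induction n) (auto simp: subrngD)

lemma subrng_sum: "subrng X \<Longrightarrow> (\<And>i. i \<in> I \<Longrightarrow> f i \<in> X) \<Longrightarrow> sum f I \<in> X"
  by (induction I rule: infinite_finite_induct) (auto simp: subrngD)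

lemma subrng_of_nat: "subrng X \<Longrightarrow> of_nat n \<in> X"
  by (induction n) (auto simp: subrngD)

definition uset :: "'r::ring_1 set \<Rightarrow> 'r set" where
  "uset X = {x \<in> X. x \<in> units \<and> ui x \<in> X}"

lemma ugrp_uset: "subrng X \<Longrightarrow> ugrp (uset X)"
  unfolding ugrp_def uset_def by (auto simp: subrngD)

lemma uset_units: "x \<in> uset X \<Longrightarrow> x \<in> units" and uset_sub: "x \<in> uset X \<Longrightarrow> x \<in> X"
  unfolding uset_def by auto

definition centralizer :: "'r::ring_1 set \<Rightarrow> 'r set" where
  "centralizer A = {x. \<forall>a\<in>A. x * a = a * x}"

lemma centralizerD: "x \<in> centralizer A \<Longrightarrow> a \<in> A \<Longrightarrow> x * a = a * x"
  unfolding centralizer_def by blast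

lemma subrng_centralizer: "subrng (centralizer A)"
  unfolding subrng_def centralizer_def
  by (auto simp: algebra_simps) (metis mult.assoc)

lemma centralizer_ui: "x \<in> centralizer A \<Longrightarrow> x \<in> units \<Longrightarrow> ui x \<in> centralizer A"
  unfolding centralizer_def using units_commute_ui by blast

definition divring :: "'r::ring_1 set \<Rightarrow> bool" where
  "divring X \<longleftrightarrow> subrng X \<and> (\<forall>x\<in>X. x \<noteq> 0 \<longrightarrow> x \<in> units \<and> ui x \<in> X)"

lemma divringD: "divring X \<Longrightarrow> subrng X" "divring X \<Longrightarrow> x \<in> X \<Longrightarrow> x \<noteq> 0 \<Longrightarrow> x \<in> uset X"
  "divring X \<Longrightarrow> x \<in> X \<Longrightarrow> x \<noteq> 0 \<Longrightarrow> x \<in> units" "divring X \<Longrightarrow> x \<in> X \<Longrightarrow> x \<noteq> 0 \<Longrightarrow> ui x \<in> X"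
  unfolding divring_def uset_def by auto

lemma divring_mult_eq_0:
  "divring X \<Longrightarrow> x \<in> X \<Longrightarrow> x * y = 0 \<Longrightarrow> x = 0 \<or> y = 0"
  by (metis divringD(3) mult_zero_right ui_left2)

text \<open>Hua's computation. Conjugating b by x and by 1 + x gives c and d in N with c * x = x * b
  and d * (1 + x) = (1 + x) * b. Subtracting these writes x as a quotient of differences of elements
  of N, all of which commute with b.\<close>

lemma abelian_normal_division:
  assumes X: "divring X" and N: "ugrp N" "N \<subseteq> X" "normalizes (uset X) N"
    and ab: "\<And>x y. x \<in> N \<Longrightarrow> y \<in> N \<Longrightarrow> x * y = y * x"
  shows "N \<subseteq> centralizer X"
proof
  fix b assume b: "b \<in> N"
  have "b * x = x * b" if x: "x \<in> X" for x
  proof (rule ccontr)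
    assume ne: "b * x \<noteq> x * b"
    have x0: "x \<noteq> 0" and x1: "1 + x \<noteq> 0"
      using ne by (auto simp: add_eq_0_iff)
    have xu: "x \<in> uset X" "1 + x \<in> uset X"
      using divringD(2)[OF X] x x0 x1 subrngD[OF divringD(1)[OF X]] by auto
    define c where "c = x * b * ui x"
    define d where "d = (1 + x) * b * ui (1 + x)"
    have cN: "c \<in> N" and dN: "d \<in> N"
      using normalizesD[OF N(3)] xu b unfolding c_def d_def by auto
    have c: "c * x = x * b" and d: "d * (1 + x) = (1 + x) * b"
      unfolding c_def d_def using xu[THEN uset_units] by (simp_all add: mult.assoc)
    have eq: "(c - d) * x = d - b" using c d by (simp add: algebra_simps)
    show False
    proof (cases "c = d")
      case True
      then have "c = b" using eq by simp
      then show False using c ne by simp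
    next
      case False
      have "c - d \<in> X" using cN dN N(2) subrngD(6)[OF divringD(1)[OF X]] by blast
      then have u: "c - d \<in> units" using divringD(3)[OF X] False by auto
      have xe: "x = ui (c - d) * (d - b)" using eq u by (metis ui_left2)
      have "(c - d) * b = b * (c - d)" using ab b cN dN by (simp add: algebra_simps)
      then have "ui (c - d) * b = b * ui (c - d)" by (rule units_commute_ui[OF u])
      moreover have "(d - b) * b = b * (d - b)" using ab b dN by (simp add: algebra_simps)
      ultimately have "x * b = b * x" unfolding xe by (metis mult.assoc)
      then show False using ne by simp
    qed
  qed
  then show "b \<in> centralizer X" unfolding centralizer_def by auto
qed

text \<open>Conjugation by c multiplies t = f * b by a central y. Conjugating c by u = 1 + t leads
  to an element w of N, and centrality of the commutator of c and w is a quadratic equation for t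
  over Z. A second conjugation by c leaves only t * t = -1.\<close>

lemma class2_division_square:
  assumes X: "divring X" and Z: "Z = X \<inter> centralizer X"
    and N: "ugrp N" "N \<subseteq> X" "normalizes (uset X) N" "\<And>x y. x \<in> N \<Longrightarrow> y \<in> N \<Longrightarrow> comm x y \<in> Z"
    and bc: "b \<in> N" "c \<in> N" "b * c \<noteq> c * b" and f: "f \<in> Z" "f \<noteq> 0"
  shows "(f * b) * (f * b) = -1"
proof -
  note sX = subrngD[OF divringD(1)[OF X]]
  have bu: "b \<in> units" "c \<in> units" using bc N ugrpD by blast+
  have bX: "b \<in> X" "c \<in> X" using bc N by auto
  define y where "y = comm c b"
  have yZ: "y \<in> Z" unfolding y_def using N(4) bc by auto
  have y1: "y \<noteq> 1" using comm_eq_1_iff[OF bu(2,1)] bc(3) unfolding y_def by auto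
  have cent: "z * x = x * z" if "z \<in> Z" "x \<in> X" for z x using that Z centralizerD by blast
  have ZX: "z \<in> X" if "z \<in> Z" for z using that Z by auto
  have sZ: "subrng Z" unfolding Z using divringD(1)[OF X] subrng_centralizer[of X]
    unfolding subrng_def by auto
  note sZ' = subrngD[OF sZ]
  have Zu: "z \<in> units \<and> ui z \<in> Z" if "z \<in> Z" "z \<noteq> 0" for z
    using that divringD(3,4)[OF X] centralizer_ui[of z X] unfolding Z by auto
  define t where "t = f * b"
  have tX: "t \<in> X" unfolding t_def using f bX ZX sX by auto
  have ct: "c * t = (y * t) * c"
  proof -
    have "c * b = y * (b * c)" unfolding y_def using comm_swap bu by blast
    then show ?thesis unfolding t_def using cent[OF f(1) bX(2)] cent[OF f(1) ZX[OF yZ]] by (metis mult.assoc)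
  qed
  have tnZ: "t \<notin> Z"
  proof
    assume "t \<in> Z"
    then have "ui f * t \<in> Z" using Zu[OF f] sZ' by blast
    then have "b \<in> Z" unfolding t_def using Zu[OF f] by simp
    then show False using bc cent bX by blast
  qed
  define u where "u = 1 + t"
  define v where "v = 1 + y * t"
  define w2 where "w2 = 1 + y * y * t"
  have uX: "u \<in> X" "v \<in> X" "w2 \<in> X" unfolding u_def v_def w2_def using tX ZX[OF yZ] sX by auto
  have yt: "y * t = t * y" using cent yZ tX by blast
  have nz: "1 + s * t \<noteq> 0" if s: "s \<in> Z" "s \<noteq> 0" for s
  proof
    assume "1 + s * t = 0"
    then have "s * t = -1" by (simp add: add_eq_0_iff)
    then have "t = ui s * (-1)" using Zu[OF s] by (metis ui_left2)
    then show False using tnZ Zu[OF s] sZ' by auto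
  qed
  have ynz: "y \<noteq> 0" unfolding y_def using comm_units[OF bu(2,1)] unit_nonzero by blast
  have yynz: "y * y \<noteq> 0" using divring_mult_eq_0[OF X ZX[OF yZ]] ynz by blast
  have unz: "u \<noteq> 0" "v \<noteq> 0" "w2 \<noteq> 0"
    using nz[of 1] nz[of y] nz[of "y*y"] yZ ynz yynz sZ' divringD(1)[OF X]
    unit_nonzero[OF units_1] unfolding u_def v_def w2_def by auto
  have us: "u \<in> uset X" "v \<in> uset X" "w2 \<in> uset X" using divringD(2)[OF X] uX unz by auto
  note uu = us[THEN uset_units]
  have cu: "c * u = v * c" and cv: "c * v = w2 * c"
  proof -
    show "c * u = v * c" unfolding u_def v_def using ct by (simp add: algebra_simps)
    have "c * (y * t) = y * (c * t)" using cent[OF yZ bX(2)] by (metis mult.assoc)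
    then have "c * (y * t) = y * y * t * c" using ct by (simp add: mult.assoc)
    then show "c * v = w2 * c" unfolding v_def w2_def by (simp add: algebra_simps)
  qed
  \<comment> \<open>\<open>v\<close> is the conjugate of \<open>u\<close> by c, so \<open>w\<close>
    is the commutator of \<open>u\<close> and c; it lies in N because \<open>u\<close> normalizes
    N.\<close>
  define w where "w = u * ui v"
  have "w = comm u c"
  proof -
    have "c * ui u = ui v * c"
      using cu uu bu by (metis units_cancel_left mult.assoc mult_1_right ui_left ui_right units_mult mult_1)
    then have "c * ui u * ui c = ui v" using bu by (simp add: mult.assoc)
    then show ?thesis unfolding w_def comm_def by (simp add: mult.assoc)
  qed
  also have "\<dots> = (u * c * ui u) * ui c" by (simp add: comm_def)
  also have "\<dots> \<in> N" using normalizesD[OF N(3) us(1) bc(2)] bc(2) N(1) ugrpD by blast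
  finally have wN: "w \<in> N" .
  define z where "z = comm c w"
  have zZ: "z \<in> Z" unfolding z_def using N(4) bc wN by auto
  have cw: "c * w = z * (w * c)" unfolding z_def using comm_swap bu wN N(1) ugrpD by blast
  have "c * w = v * ui w2 * c"
  proof -
    have "c * ui v = ui w2 * c"
      using cv uu bu by (metis units_cancel_left mult.assoc mult_1_right ui_left ui_right units_mult mult_1)
    then show ?thesis unfolding w_def using cu by (metis mult.assoc)
  qed
  then have "v * ui w2 * c = (z * w) * c" using cw by (simp add: mult.assoc)
  then have e1: "v * ui w2 = z * (u * ui v)" using bu(2) units_cancel_right unfolding w_def by blast
  have com: "u * v = v * u" "v * w2 = w2 * v" "u * w2 = w2 * u"
    unfolding u_def v_def w2_def using yt by (simp_all add: algebra_simps) (metis mult.assoc)+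
  have e2: "v * v = z * (u * w2)"
  proof -
    have "v * ui w2 * w2 * v = z * (u * ui v) * w2 * v" using e1 by simp
    moreover have "ui v * (w2 * v) = w2" using com(2) uu by (metis ui_left2)
    ultimately show ?thesis using uu by (simp add: mult.assoc)
  qed
  have ty: "t * y = y * t" using yt by simp
  have tyz: "t * (y * r) = y * (t * r)" for r by (metis mult.assoc yt)
  have e3: "1 + 2 * (y * t) + y * y * (t * t) = z * (1 + (1 + y * y) * t + y * y * (t * t))"
    using e2 unfolding u_def v_def w2_def by (simp add: algebra_simps ty tyz mult_2)
  show ?thesis
  proof (cases "z = 1")
    case True
    then have "(1 - y) * ((1 - y) * t) = 0" using e3 by (simp add: algebra_simps mult_2)
    moreover have "1 - y \<in> X" using sX ZX[OF yZ] by auto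
    ultimately have "t = 0" using divring_mult_eq_0[OF X] y1 by (metis right_minus_eq)
    then show ?thesis using tnZ sZ' by auto
  next
    case False
    define q where "q = ui (1 - z)"
    have z1: "1 - z \<in> Z" "1 - z \<noteq> 0" using False zZ sZ' by auto
    have qZ: "q \<in> Z" "q * (1 - z) = 1" unfolding q_def using Zu[OF z1] by auto
    define \<beta> where "\<beta> = q * (2 * y - z * (1 + y * y))"
    have "2 \<in> Z" using sZ' by (metis one_add_one)
    then have bZ: "\<beta> \<in> Z" unfolding \<beta>_def using sZ' qZ yZ zZ by simp
    have "(1 - z) * (y * y * (t * t)) + (2 * y - z * (1 + y * y)) * t + (1 - z) = 0"
      using e3 by (simp add: algebra_simps)
    then have "q * ((1 - z) * (y * y * (t * t)) + (2 * y - z * (1 + y * y)) * t + (1 - z)) = 0" by simp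
    moreover have "q * ((1 - z) * r) = r" for r using qZ(2) by (metis mult.assoc mult_1)
    ultimately have e4: "y * y * (t * t) + \<beta> * t + 1 = 0"
      unfolding \<beta>_def using qZ(2) by (simp add: distrib_left mult.assoc)
    have tt: "c * (t * t) = y * y * (t * t) * c" using ct yt by (metis mult.assoc)
    \<comment> \<open>Conjugation by c replaces t by y * t. Eliminating t * t between the two
      equations would put t into Z unless the linear coefficient vanishes.\<close>
    have "c * (y * y * (t * t) + \<beta> * t + 1) = (y * y * (y * y * (t * t)) + \<beta> * (y * t) + 1) * c"
    proof -
      have "c * (y * y * (t * t)) = y * y * (c * (t * t))" using cent[OF yZ bX(2)] by (metis mult.assoc)
      moreover have "c * (\<beta> * t) = \<beta> * (c * t)" using cent[OF bZ bX(2)] by (metis mult.assoc)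
      ultimately show ?thesis using tt ct by (simp add: distrib_left distrib_right mult.assoc)
    qed
    then have e5: "y * y * (y * y * (t * t)) + \<beta> * (y * t) + 1 = 0"
      using e4 bu(2) by (metis mult_zero_left mult_zero_right units_cancel_right)
    have byz: "\<beta> * y = y * \<beta>" using cent bZ ZX[OF yZ] by blast
    have byr: "\<beta> * (y * r) = y * (\<beta> * r)" for r using byz by (metis mult.assoc)
    have "y * y * (y * y * (t * t) + \<beta> * t + 1) - (y * y * (y * y * (t * t)) + \<beta> * (y * t) + 1) = 0"
      using e4 e5 by simp
    then have e6: "(y * y - y) * (\<beta> * t) = 1 - y * y"
      by (simp add: algebra_simps byr)
    have "\<beta> = 0"
    proof (rule ccontr)
      assume b0: "\<beta> \<noteq> 0"
      have yy: "y * y - y \<in> Z" "y * y - y \<noteq> 0"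
        using yZ sZ' y1 ynz divring_mult_eq_0[OF X ZX[OF yZ], of "y - 1"] by (auto simp: algebra_simps)
      have "t = ui \<beta> * (ui (y * y - y) * (1 - y * y))"
        using e6 Zu[OF yy] Zu[OF bZ b0] by (metis ui_left2)
      then have "t \<in> Z" using Zu[OF yy] Zu[OF bZ b0] yZ sZ' by auto
      then show False using tnZ by auto
    qed
    then have "y * y = 1" using e6 by simp
    then have "t * t + 1 = 0" using e4 \<open>\<beta> = 0\<close> by simp
    then show ?thesis unfolding t_def[symmetric] by (simp add: eq_neg_iff_add_eq_0)
  qed
qed

text \<open>Hua's theorem on division rings with solvable unit group. Noncommuting b, c in the last
  noncentral term would give b * b = -1 and (f * b) * (f * b) = -1 at the same time, hence f * f =
  1.\<close>

lemma division_solvable_commutative: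
  assumes X: "divring X" and s: "sol k (uset X)"
    and f: "f \<in> X" "f \<in> centralizer X" "f \<noteq> 0" "f * f \<noteq> 1" and xy: "x \<in> X" "y \<in> X"
  shows "x * y = y * x"
proof (rule ccontr)
  assume ne: "x * y \<noteq> y * x"
  define Z where "Z = X \<inter> centralizer X"
  note sX = subrngD[OF divringD(1)[OF X]]
  have fZ: "f \<in> Z" "f \<noteq> 0" "1 \<in> Z" using f sX subrngD(2)[OF subrng_centralizer] unfolding Z_def by auto
  have "x \<noteq> 0" using ne by auto
  then have "x \<in> uset X" using divringD(2)[OF X xy(1)] by simp
  then have nZ: "\<not> uset X \<subseteq> Z" using ne xy centralizerD unfolding Z_def by blast
  have g: "ugrp (uset X)" by (rule ugrp_uset[OF divringD(1)[OF X]])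
  have "normalizes (uset X) (uset X)" unfolding normalizes_def using g by (simp add: ugrpD)
  moreover have "uset X \<subseteq> units" using uset_units by blast
  ultimately obtain N where N: "N \<subseteq> uset X" "ugrp N" "normalizes (uset X) N" "\<not> N \<subseteq> Z"
    "\<forall>x\<in>N. \<forall>y\<in>N. comm x y \<in> Z"
    using last_derived[OF s g _ _ nZ fZ(3)] by meson
  have N5: "\<And>x y. x \<in> N \<Longrightarrow> y \<in> N \<Longrightarrow> comm x y \<in> Z" using N(5) by blast
  have NX: "N \<subseteq> X" using N(1) uset_sub by blast
  obtain b c where bc: "b \<in> N" "c \<in> N" "b * c \<noteq> c * b"
    using abelian_normal_division[OF X N(2) NX N(3)] N(4) NX unfolding Z_def by blast
  have "b * b = -1" using class2_division_square[OF X Z_def N(2) NX N(3) N5 bc fZ(3)] unit_nonzero[OF units_1] by simp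
  moreover have "(f * b) * (f * b) = -1" by (rule class2_division_square[OF X Z_def N(2) NX N(3) N5 bc fZ(1,2)])
  moreover have "f * b = b * f" using bc(1) NX fZ(1) centralizerD unfolding Z_def by blast
  ultimately have "f * f * (-1) = -1" by (metis mult.assoc)
  then show False using f(4) by simp
qed

text \<open>For matrix units p and q the product is the Weyl element \<open>p - q\<close> on their
  corner, extended by the identity \<open>1 - p * q - q * p\<close> outside it.\<close>

lemma whitehead:
  fixes p q p' q' :: "'r::ring_1"
  assumes "p * p = 0" "q * q = 0" "p * q * p = p" "q * p * q = q"
  shows "(1 + p) * (1 - q) * (1 + p) = 1 - p * q - q * p + p - q"
proof -
  have "p * (q * p) = p" using assms by (simp add: mult.assoc)
  then show ?thesis using assms by (simp add: algebra_simps)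
qed

lemma one_plus_square_zero:
  assumes "p * p = (0::'r::ring_1)" shows "1 + p \<in> units" "ui (1 + p) = 1 - p" "1 - p \<in> units" "ui (1 - p) = 1 + p"
proof -
  have a: "(1 + p) * (1 - p) = 1" "(1 - p) * (1 + p) = 1" using assms by (simp_all add: algebra_simps)
  show "1 + p \<in> units" "ui (1 + p) = 1 - p" "1 - p \<in> units" "ui (1 - p) = 1 + p"
    using unitsI ui_eq a by blast+
qed

text \<open>Conjugation by \<^term>\<open>diag a (1/a)\<close> multiplies the elementary matrices by the squares of
  \<^term>\<open>a\<close> and of its inverse.\<close>

lemma matrix_units_commutator:
  fixes x y :: "'r::ring_1"
  assumes xy: "x * x = 0" "y * y = 0" "x * y * x = x" "y * x * y = y"
    and F: "divring F" "F \<subseteq> centralizer UNIV"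
    and a: "a \<in> F" "a \<noteq> 0" "a * a \<noteq> 1"
    and H: "ugrp H" "\<And>f. f \<in> F \<Longrightarrow> 1 + f * x \<in> H" "\<And>f. f \<in> F \<Longrightarrow> 1 + f * y \<in> H"
  shows "\<exists>d\<in>H. \<forall>f\<in>F. (\<exists>g\<in>F. 1 + f * x = comm d (1 + g * x)) \<and> (\<exists>g\<in>F. 1 + f * y = comm d (1 + g * y))"
proof -
  note sF = subrngD[OF divringD(1)[OF F(1)]]
  have cen: "f * r = r * f" if "f \<in> F" for f r using that F(2) centralizerD by blast
  define a' where "a' = ui a"
  have au: "a \<in> units" "a' \<in> F" "a * a' = 1" "a' * a = 1" unfolding a'_def using divringD(3,4)[OF F(1) a(1,2)] by auto
  have aa: "a * (a' * r) = r" "a' * (a * r) = r" for r using au by (metis mult.assoc mult_1)+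
  have xyx: "x * (y * x) = x" "y * (x * y) = y" "x * (x * r) = 0" "y * (y * r) = 0" for r
    using xy by (simp_all flip: mult.assoc)
  have xyr: "x * (y * (x * r)) = x * r" "y * (x * (y * r)) = y * r" for r
    using xy by (metis mult.assoc)+
  \<comment> \<open>\<open>x * y\<close> and \<open>y * x\<close> are orthogonal idempotents;
    \<open>d\<close> acts as \<open>a\<close> on the first, as the inverse of \<open>a\<close> on
    the second and as 1 on the complement.\<close>
  define d where "d = 1 - x * y - y * x + a * (x * y) + a' * (y * x)"
  define d' where "d' = 1 - x * y - y * x + a' * (x * y) + a * (y * x)"
  have c1: "x * (f * r) = f * (x * r)" "y * (f * r) = f * (y * r)" if "f \<in> F" for f r
    using cen[OF that] by (metis mult.assoc)+
  note cc = c1[OF a(1)] c1[OF au(2)]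
  have dd: "d * d' = 1" "d' * d = 1" unfolding d_def d'_def
    by (simp_all add: algebra_simps cc xyx xyr xy(1,2) aa au)
  have du: "d \<in> units" "ui d = d'" using dd unitsI ui_eq by auto
  have dH: "d \<in> H"
  proof -
    let ?p = "a * x" let ?q = "a' * y"
    have w1: "(1 + ?p) * (1 - ?q) * (1 + ?p) = 1 - ?p * ?q - ?q * ?p + ?p - ?q"
      by (rule whitehead) (simp_all add: mult.assoc cc xyx xyr xy(1,2) aa)
    have w2: "(1 + (-x)) * (1 - (-y)) * (1 + (-x)) = 1 - (-x) * (-y) - (-y) * (-x) + (-x) - (-y)"
      by (rule whitehead) (simp_all add: mult.assoc xyx xy(1,2))
    \<comment> \<open>Two Weyl elements, with parameters \<open>a\<close> and -1; each is a product
      of three elementary factors from H.\<close>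
    have "d = ((1 + ?p) * (1 - ?q) * (1 + ?p)) * ((1 + (-x)) * (1 - (-y)) * (1 + (-x)))"
      unfolding w1 w2 d_def by (simp add: algebra_simps cc xyx xyr xy(1,2) aa)
    moreover have "1 + ?p \<in> H" "1 + (- a') * y \<in> H" "1 + (-1) * x \<in> H" "1 + 1 * y \<in> H"
      using H(2,3) sF(2) sF(5)[OF sF(2)] a(1) au(2) sF(5)[OF au(2)] by blast+
    ultimately show ?thesis using ugrpD(3)[OF H(1)] by simp
  qed
  \<comment> \<open>The commutator with \<open>d\<close> sends the parameter f to
    \<open>e * f\<close>. As \<open>a * a\<close> is not 1, \<open>e\<close> is invertible in F and
    every parameter is reached; \<open>e'\<close> plays the same part for \<open>y\<close>.\<close>
  define e where "e = a * a - 1"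
  have eF: "e \<in> F" "e \<noteq> 0" unfolding e_def using a sF by auto
  have eu: "ui e \<in> F" "e * ui e = 1" using divringD(3,4)[OF F(1) eF] by auto
  define e' where "e' = a' * a' - 1"
  have e'F: "e' \<in> F" unfolding e'_def using au sF by auto
  have "e' \<noteq> 0"
  proof
    assume "e' = 0"
    then have "a' * a' = 1" unfolding e'_def by simp
    then have "a * (a * (a' * a')) = a * a" by simp
    then show False using a(3) aa au(3) by (metis mult.assoc mult_1_right)
  qed
  then have e'u: "ui e' \<in> F" "e' * ui e' = 1" using divringD(3,4)[OF F(1) e'F] by auto
  have sq: "(f * x) * (f * x) = 0" "(f * y) * (f * y) = 0" if "f \<in> F" for f
    using c1[OF that] xy(1,2) by (simp_all add: mult.assoc)
  have k1: "comm d (1 + f * x) = 1 + e * f * x" "comm d (1 + f * y) = 1 + e' * f * y" if f: "f \<in> F" for f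
  proof -
    note cf = c1[OF f] cen[OF f, of a, symmetric] cen[OF f, of a', symmetric]
    have "a * (f * r) = f * (a * r)" "a' * (f * r) = f * (a' * r)" for r
      using cf by (metis mult.assoc)+
    note cf = cf this
    have "d * (f * x) * d' = a * a * f * x" "d * (f * y) * d' = a' * a' * f * y"
      unfolding d_def d'_def by (simp_all add: algebra_simps cc cf xyx xyr xy(1,2) aa au)
    then have "d * (1 + f * x) * d' = 1 + a * a * f * x" "d * (1 + f * y) * d' = 1 + a' * a' * f * y"
      using dd by (simp_all add: distrib_left distrib_right)
    then show "comm d (1 + f * x) = 1 + e * f * x" "comm d (1 + f * y) = 1 + e' * f * y"
      unfolding comm_def du one_plus_square_zero(2)[OF sq(1)[OF f]] one_plus_square_zero(2)[OF sq(2)[OF f]] e_def e'_def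
      by (simp_all add: algebra_simps cc cf xy(1,2))
  qed
  show ?thesis
  proof (intro bexI[OF _ dH] ballI conjI)
    fix f assume f: "f \<in> F"
    have g: "ui e * f \<in> F" "ui e' * f \<in> F" using f eu e'u sF(4) by auto
    show "\<exists>g\<in>F. 1 + f * x = comm d (1 + g * x)"
      using k1(1)[OF g(1)] eu(2) by (intro bexI[OF _ g(1)]) (simp flip: mult.assoc)
    show "\<exists>g\<in>F. 1 + f * y = comm d (1 + g * y)"
      using k1(2)[OF g(2)] e'u(2) by (intro bexI[OF _ g(2)]) (simp flip: mult.assoc)
  qed
qed

text \<open>A group containing the commutators of H again contains all \<open>1 + f * x\<close> and
  \<open>1 + f * y\<close>, so no chain ever reaches the trivial group.\<close>

lemma matrix_units_not_sol:
  fixes x y :: "'r::ring_1"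
  assumes xy: "x * x = 0" "y * y = 0" "x * y * x = x" "y * x * y = y" "x \<noteq> 0"
    and F: "divring F" "F \<subseteq> centralizer UNIV"
    and a: "a \<in> F" "a \<noteq> 0" "a * a \<noteq> 1"
    and H: "ugrp H" "\<And>f. f \<in> F \<Longrightarrow> 1 + f * x \<in> H" "\<And>f. f \<in> F \<Longrightarrow> 1 + f * y \<in> H"
  shows "\<not> sol k H"
  using H
proof (induction k arbitrary: H)
  case 0
  have "1 + 1 * x \<in> H" using 0 subrngD(2)[OF divringD(1)[OF F(1)]] by blast
  then show ?case using xy(5) by auto
next
  case (Suc k)
  show ?case
  proof
    assume "sol (Suc k) H"
    then obtain N where N: "ugrp N" "sol k N" "\<forall>x\<in>H. \<forall>y\<in>H. comm x y \<in> N" by auto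
    obtain d where d: "d \<in> H" "\<forall>f\<in>F. (\<exists>g\<in>F. 1 + f * x = comm d (1 + g * x)) \<and> (\<exists>g\<in>F. 1 + f * y = comm d (1 + g * y))"
      using matrix_units_commutator[OF xy(1-4) F a Suc.prems] by blast
    have "1 + f * x \<in> N" "1 + f * y \<in> N" if f: "f \<in> F" for f
      using d f N(3) Suc.prems(2,3) by metis+
    then show False using Suc.IH[OF N(1)] N(2) by blast
  qed
qed

text \<open>Conjugation by \<open>d1\<close> and \<open>d2\<close> moves \<open>e1\<close> and
  \<open>e2\<close> out of the way inside N, so modulo N only the commutator of \<open>d1\<close>
  and \<open>d2\<close> remains.\<close>

lemma comm_mod:
  assumes N: "ugrp N" "e1 \<in> N" "e2 \<in> N" and d: "d1 \<in> units" "d2 \<in> units"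
    "normalizes {d1, d2} N" "comm d1 d2 \<in> N"
  shows "comm (e1 * d1) (e2 * d2) \<in> N"
proof -
  have e: "e1 \<in> units" "e2 \<in> units" using N ugrpD by blast+
  have n: "d1 * e2 * ui d1 \<in> N" "d2 * e1 * ui d2 \<in> N" using d(3) N unfolding normalizes_def by auto
  have "comm (e1 * d1) (e2 * d2) = (e1 * (d1 * e2 * ui d1)) * comm d1 d2 * ui (e2 * (d2 * e1 * ui d2))"
    unfolding comm_def using e d by (simp add: mult.assoc)
  then show ?thesis using n d(4) ugrpD(3,4)[OF N(1)] N(2,3) by simp
qed

lemma ring_matrix_units_not_sol:
  fixes x y :: "'r::ring_1"
  assumes xy: "x * x = 0" "y * y = 0" "x * y * x = x" "y * x * y = y" "x \<noteq> 0"
    and F: "divring F" "F \<subseteq> centralizer UNIV"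
    and a: "a \<in> F" "a \<noteq> 0" "a * a \<noteq> 1"
    and X: "subrng X" "F \<subseteq> X" "x \<in> X" "y \<in> X"
  shows "\<not> sol k (uset X)"
proof (rule matrix_units_not_sol[OF xy F a ugrp_uset[OF X(1)]])
  have cen: "f * r = r * f" if "f \<in> F" for f r using that F(2) centralizerD by blast
  fix f assume f: "f \<in> F"
  have "(f * x) * (f * x) = f * f * (x * x)" "(f * y) * (f * y) = f * f * (y * y)"
    using cen[OF f] by (metis mult.assoc)+
  then have s: "(f * x) * (f * x) = 0" "(f * y) * (f * y) = 0" using xy by simp_all
  have "f * x \<in> X" "f * y \<in> X" using f X subrngD(4)[OF X(1)] by auto
  then show "1 + f * x \<in> uset X" "1 + f * y \<in> uset X"
    unfolding uset_def using one_plus_square_zero[OF s(1)] one_plus_square_zero[OF s(2)] subrngD[OF X(1)] by auto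
qed

section \<open>Linear endomorphisms of the right space of column vectors\<close>

definition vr :: "'a::ring_1^'n \<Rightarrow> 'a \<Rightarrow> 'a^'n" (infixl "\<star>" 75) where
  "v \<star> a = (\<chi> i. v $ i * a)"

lemma vr_nth [simp]: "(v \<star> a) $ i = v $ i * a" by (simp add: vr_def)

lemma vr_simps [simp]:
  "v \<star> 1 = v" "v \<star> 0 = 0" "0 \<star> a = 0" "(v \<star> a) \<star> b = v \<star> (a * b)"
  "(- v) \<star> a = - (v \<star> a)" "v \<star> (- a) = - (v \<star> a)"
  by (simp_all add: vec_eq_iff mult.assoc)

lemma vr_distrib:
  "(v + w) \<star> a = v \<star> a + w \<star> a" "v \<star> (a + b) = v \<star> a + v \<star> b"
  "(v - w) \<star> a = v \<star> a - w \<star> a" "v \<star> (a - b) = v \<star> a - v \<star> b"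
  by (simp_all add: vec_eq_iff algebra_simps)

text \<open>Over a noncommutative D, matrices acting on the left of columns are linear for scalars
  acting on the right. Packed into a type, these maps are a \<open>ring_1\<close>, and the results
  on units and subrings apply to them directly.\<close>

typedef (overloaded) ('a::ring_1, 'n::finite) endo =
  "{f :: 'a^'n \<Rightarrow> 'a^'n. (\<forall>v w. f (v + w) = f v + f w) \<and> (\<forall>v a. f (v \<star> a) = f v \<star> a)}"
  morphisms ap Abs_endo
  by (rule exI[of _ "\<lambda>v. v"]) simp

lemma ap_add [simp]: "ap A (v + w) = ap A v + ap A w"
  and ap_vr [simp]: "ap A (v \<star> a) = ap A v \<star> a"
  using ap[of A] by auto

lemma ap_zero [simp]: "ap A 0 = 0" using ap_vr[of A 0 0] by simp
lemma ap_minus [simp]: "ap A (- v) = - ap A v" using ap_vr[of A v "-1"] by simp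
lemma ap_diff [simp]: "ap A (v - w) = ap A v - ap A w" using ap_add[of A v "- w"] by simp

lemma ap_Abs:
  assumes "\<And>v w. f (v + w) = f v + f w" "\<And>v a. f (v \<star> a) = f v \<star> a"
  shows "ap (Abs_endo f) v = f v"
  by (subst Abs_endo_inverse) (use assms in auto)

lemma endo_eqI: "(\<And>v. ap A v = ap B v) \<Longrightarrow> A = B"
  using ap_inject by blast

instantiation endo :: (ring_1, finite) ring_1
begin
definition "0 = Abs_endo (\<lambda>v. 0)"
definition "1 = Abs_endo (\<lambda>v. v)"
definition "A + B = Abs_endo (\<lambda>v. ap A v + ap B v)"
definition "- A = Abs_endo (\<lambda>v. - ap A v)"
definition "A - B = Abs_endo (\<lambda>v. ap A v - ap B v)"
definition "A * B = Abs_endo (\<lambda>v. ap A (ap B v))"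

lemma ap_ring [simp]:
  "ap 0 v = 0" "ap 1 v = v" "ap (A + B) v = ap A v + ap B v" "ap (- A) v = - ap A v"
  "ap (A - B) v = ap A v - ap B v" "ap (A * B) v = ap A (ap B v)"
  unfolding zero_endo_def one_endo_def plus_endo_def uminus_endo_def minus_endo_def times_endo_def
  by (rule ap_Abs; simp add: vr_distrib)+

instance
proof
  obtain i :: 'b where True by simp
  have "ap (1 :: ('a, 'b) endo) (axis i 1) \<noteq> ap 0 (axis i 1)"
    by (simp add: vec_eq_iff axis_def)
  then show "(0 :: ('a, 'b) endo) \<noteq> 1" by metis
qed (rule endo_eqI, simp add: algebra_simps)+
end

lemma ap_sum: "ap (sum f I) v = (\<Sum>i\<in>I. ap (f i) v)"
  by (induction I rule: infinite_finite_induct) auto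

lemma ap_sum_right: "ap A (sum f I) = (\<Sum>i\<in>I. ap A (f i))"
  by (induction I rule: infinite_finite_induct) auto

lemma ap_ui [simp]: "A \<in> units \<Longrightarrow> ap A (ap (ui A) v) = v" "A \<in> units \<Longrightarrow> ap (ui A) (ap A v) = v"
  by (metis ap_ring(2,6) ui_right) (metis ap_ring(2,6) ui_left)

lemma vec_axis_sum: "(v :: 'a::ring_1^'n) = (\<Sum>i\<in>UNIV. axis i 1 \<star> (v $ i))"
proof -
  have "(\<Sum>i\<in>UNIV. axis i 1 \<star> (v $ i)) $ j = v $ j" for j
  proof -
    have "(\<Sum>i\<in>UNIV. (axis i 1 :: 'a^'n) $ j * v $ i) = (\<Sum>i\<in>UNIV. if i = j then v $ i else 0)"
      by (rule sum.cong) (auto simp: axis_def)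
    then show ?thesis by simp
  qed
  then show ?thesis by (simp add: vec_eq_iff)
qed

lemma endo_axis_eqI: "(\<And>i. ap A (axis i 1) = ap B (axis i 1)) \<Longrightarrow> A = B"
  by (rule endo_eqI, subst (1 2) vec_axis_sum) (simp add: ap_sum_right)

definition lfun :: "('a::ring_1^'n \<Rightarrow> 'a) \<Rightarrow> bool" where
  "lfun \<phi> \<longleftrightarrow> (\<forall>v w. \<phi> (v + w) = \<phi> v + \<phi> w) \<and> (\<forall>v a. \<phi> (v \<star> a) = \<phi> v * a)"

lemma lfunD: assumes "lfun \<phi>"
  shows "\<phi> (v + w) = \<phi> v + \<phi> w" "\<phi> (v \<star> a) = \<phi> v * a" "\<phi> 0 = 0" "\<phi> (- v) = - \<phi> v" "\<phi> (v - w) = \<phi> v - \<phi> w"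
proof -
  show 1: "\<phi> (v + w) = \<phi> v + \<phi> w" "\<phi> (v \<star> a) = \<phi> v * a" for v w a using assms unfolding lfun_def by auto
  show "\<phi> 0 = 0" using 1(2)[of 0 0] by simp
  show 2: "\<phi> (- v) = - \<phi> v" for v using 1(2)[of v "-1"] by simp
  show "\<phi> (v - w) = \<phi> v - \<phi> w" using 1(1)[of v "-w"] 2 by simp
qed

lemma lfun_scale [simp]: "lfun \<phi> \<Longrightarrow> lfun (\<lambda>v. a * \<phi> v)"
  and lfun_add [simp]: "lfun \<phi> \<Longrightarrow> lfun \<psi> \<Longrightarrow> lfun (\<lambda>v. \<phi> v + \<psi> v)"
  and lfun_diff [simp]: "lfun \<phi> \<Longrightarrow> lfun \<psi> \<Longrightarrow> lfun (\<lambda>v. \<phi> v - \<psi> v)"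
  and lfun_minus [simp]: "lfun \<phi> \<Longrightarrow> lfun (\<lambda>v. - \<phi> v)"
  and lfun_zero [simp]: "lfun (\<lambda>v. 0)"
  and lfun_nth [simp]: "lfun (\<lambda>v. v $ i)"
  and lfun_ap: "lfun \<phi> \<Longrightarrow> lfun (\<lambda>v. \<phi> (ap A v))"
  unfolding lfun_def by (auto simp: algebra_simps mult.assoc)

text \<open>The rank-one map x tensor \<phi>. It is the source of transvections
  (\<open>\<phi> x = 0\<close>), of idempotents (\<open>\<phi> x = 1\<close>) and of matrix
  units.\<close>

definition out :: "'a::ring_1^'n \<Rightarrow> ('a^'n \<Rightarrow> 'a) \<Rightarrow> ('a, 'n) endo" where
  "out x \<phi> = Abs_endo (\<lambda>v. x \<star> \<phi> v)"

lemma ap_out [simp]: "lfun \<phi> \<Longrightarrow> ap (out x \<phi>) v = x \<star> \<phi> v"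
  unfolding out_def by (rule ap_Abs) (auto simp: lfunD vr_distrib)

lemma mult_out: "lfun \<phi> \<Longrightarrow> A * out x \<phi> = out (ap A x) \<phi>"
  by (rule endo_eqI) simp

lemma out_mult: "lfun \<phi> \<Longrightarrow> out x \<phi> * A = out x (\<lambda>v. \<phi> (ap A v))"
  by (rule endo_eqI) (simp add: lfun_ap)

lemma out_out: "lfun \<phi> \<Longrightarrow> lfun \<psi> \<Longrightarrow> out x \<phi> * out y \<psi> = out (x \<star> \<phi> y) \<psi>"
  by (simp add: mult_out)

lemma out_scale: "lfun \<phi> \<Longrightarrow> out x (\<lambda>v. a * \<phi> v) = out (x \<star> a) \<phi>"
  by (rule endo_eqI) (simp add: lfun_scale)

lemma out_zero [simp]: "lfun \<phi> \<Longrightarrow> out 0 \<phi> = 0"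
  by (rule endo_eqI) simp

lemma exists_lfun_1:
  fixes x :: "'a::division_ring^'n"
  assumes "x \<noteq> 0" obtains \<phi> where "lfun \<phi>" "\<phi> x = 1"
proof -
  obtain i where i: "x $ i \<noteq> 0" using assms by (auto simp: vec_eq_iff)
  show thesis by (rule that[of "\<lambda>v. inverse (x $ i) * v $ i"]) (use i lfun_nth lfun_scale in auto)
qed

text \<open>If entry i of x is nonzero, y differs in some entry j from the multiple of x that agrees
  with y at i; the functional measures this defect.\<close>

lemma exists_lfun_01:
  fixes x y :: "'a::division_ring^'n"
  assumes "\<And>d. y \<noteq> x \<star> d" obtains \<phi> where "lfun \<phi>" "\<phi> x = 0" "\<phi> y = 1"
proof (cases "x = 0")
  case True
  then have "y \<noteq> 0" using assms[of 0] by simp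
  then obtain \<phi> where p: "lfun \<phi>" "\<phi> y = 1" by (rule exists_lfun_1)
  then show thesis using that[OF p(1)] lfunD(3)[OF p(1)] True by simp
next
  case False
  then obtain i where i: "x $ i \<noteq> 0" by (auto simp: vec_eq_iff)
  have "y \<noteq> x \<star> (inverse (x $ i) * y $ i)" using assms by blast
  then obtain j where j: "y $ j \<noteq> x $ j * (inverse (x $ i) * y $ i)" by (auto simp: vec_eq_iff)
  define \<psi> where "\<psi> v = v $ j + (- (x $ j * inverse (x $ i))) * v $ i" for v :: "'a^'n"
  have p: "lfun \<psi>" unfolding \<psi>_def by (intro lfun_add lfun_nth lfun_scale)
  have "\<psi> x = 0" using i by (simp add: \<psi>_def mult.assoc)
  moreover have "\<psi> y \<noteq> 0" using j by (simp add: \<psi>_def mult.assoc)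
  ultimately show thesis using that[of "\<lambda>v. inverse (\<psi> y) * \<psi> v"] p lfun_scale by auto
qed

section \<open>Subspaces and the chain conditions\<close>

definition dsub :: "('a::ring_1^'n) set \<Rightarrow> bool" where
  "dsub W \<longleftrightarrow> 0 \<in> W \<and> (\<forall>v\<in>W. \<forall>w\<in>W. v + w \<in> W) \<and> (\<forall>v\<in>W. \<forall>a. v \<star> a \<in> W)"

lemma dsubD: assumes "dsub W"
  shows "0 \<in> W" "v \<in> W \<Longrightarrow> w \<in> W \<Longrightarrow> v + w \<in> W" "v \<in> W \<Longrightarrow> v \<star> a \<in> W" "v \<in> W \<Longrightarrow> - v \<in> W"
    "v \<in> W \<Longrightarrow> w \<in> W \<Longrightarrow> v - w \<in> W"
proof -
  show 1: "0 \<in> W" "v \<in> W \<Longrightarrow> w \<in> W \<Longrightarrow> v + w \<in> W" "v \<in> W \<Longrightarrow> v \<star> a \<in> W" for v w a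
    using assms unfolding dsub_def by auto
  show 2: "v \<in> W \<Longrightarrow> - v \<in> W" for v using 1(3)[of v "-1"] by simp
  show "v \<in> W \<Longrightarrow> w \<in> W \<Longrightarrow> v - w \<in> W" using 1(2)[of v "-w"] 2 by simp
qed

lemma dsub_UNIV: "dsub UNIV" and dsub_0: "dsub {0}" unfolding dsub_def by auto

lemma dsub_ker: "dsub {v. ap A v = 0}" unfolding dsub_def by simp

lemma dsub_image: assumes "dsub W" shows "dsub (ap A ` W)"
  unfolding dsub_def
proof (intro conjI ballI allI)
  show "0 \<in> ap A ` W" using dsubD(1)[OF assms] by (metis ap_zero image_eqI)
next
  fix v w assume "v \<in> ap A ` W" "w \<in> ap A ` W"
  then show "v + w \<in> ap A ` W" using dsubD(2)[OF assms] by (auto simp flip: ap_add)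
next
  fix v a assume "v \<in> ap A ` W"
  then show "v \<star> a \<in> ap A ` W" using dsubD(3)[OF assms] by (auto simp flip: ap_vr)
qed

definition vsum :: "('a::ring_1^'n) set \<Rightarrow> ('a^'n) set \<Rightarrow> ('a^'n) set" where
  "vsum U W = {u + w | u w. u \<in> U \<and> w \<in> W}"

lemma dsub_vsum: assumes "dsub U" "dsub W" shows "dsub (vsum U W)"
  unfolding dsub_def
proof (intro conjI ballI allI)
  show "0 \<in> vsum U W" unfolding vsum_def using dsubD(1) assms by force
next
  fix v w assume "v \<in> vsum U W" "w \<in> vsum U W"
  then obtain a b c d where "v = a + b" "w = c + d" "a \<in> U" "c \<in> U" "b \<in> W" "d \<in> W" unfolding vsum_def by auto
  moreover have "(a + b) + (c + d) = (a + c) + (b + d)" by (simp add: algebra_simps)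
  ultimately show "v + w \<in> vsum U W" unfolding vsum_def using dsubD(2) assms by blast
next
  fix v r assume "v \<in> vsum U W"
  then show "v \<star> r \<in> vsum U W" unfolding vsum_def using dsubD(3)[OF assms(1)] dsubD(3)[OF assms(2)] vr_distrib(1) by fast
qed

lemma vsum_supset: "dsub U \<Longrightarrow> dsub W \<Longrightarrow> U \<subseteq> vsum U W \<and> W \<subseteq> vsum U W"
  unfolding vsum_def using dsubD(1) by force

text \<open>An arbitrary numbering of the index type; the order it induces gives a meaning to the
  first nonzero entry of a vector.\<close>

definition idx :: "'n::finite \<Rightarrow> nat" where
  "idx = (SOME f. inj f)"

lemma inj_idx: "inj (idx :: 'n::finite \<Rightarrow> nat)"
proof -
  have "\<exists>f :: 'n \<Rightarrow> nat. inj f" using finite_imp_inj_to_nat_seg[of "UNIV :: 'n set"] by auto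
  then show ?thesis unfolding idx_def by (rule someI_ex)
qed

text \<open>The set of pivot positions of a subspace replaces its dimension: it is strictly monotone.\<close>

definition pivots :: "('a::ring_1^'n) set \<Rightarrow> 'n set" where
  "pivots W = {i. \<exists>w\<in>W. w $ i = 1 \<and> (\<forall>j. idx j < idx i \<longrightarrow> w $ j = 0)}"

lemma pivots_mono: "U \<subseteq> W \<Longrightarrow> pivots U \<subseteq> pivots W"
  unfolding pivots_def by auto

text \<open>Among the vectors of W outside U take one whose first nonzero entry comes as late as
  possible. U has a vector with the same pivot, and subtracting a multiple of it moves the first
  nonzero entry further.\<close>

lemma pivots_eq:
  fixes U W :: "('a::division_ring^'n) set"
  assumes U: "dsub U" and W: "dsub W" and UW: "U \<subseteq> W" and p: "pivots U = pivots W"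
  shows "U = W"
proof (rule ccontr)
  assume "U \<noteq> W"
  define P where "P i \<longleftrightarrow> (\<exists>w\<in>W - U. w $ i \<noteq> 0 \<and> (\<forall>j. idx j < idx i \<longrightarrow> w $ j = 0))" for i
  have ex: "\<exists>i. P i \<and> w $ i \<noteq> 0 \<and> (\<forall>j. idx j < idx i \<longrightarrow> w $ j = 0)" if w: "w \<in> W - U" for w
  proof -
    have "w \<noteq> 0" using w dsubD(1)[OF U] by auto
    then obtain i0 where "w $ i0 \<noteq> 0" by (auto simp: vec_eq_iff)
    then obtain i where i: "w $ i \<noteq> 0" "\<And>j. w $ j \<noteq> 0 \<Longrightarrow> idx i \<le> idx j"
      using ex_has_least_nat[of "\<lambda>i. w $ i \<noteq> 0" i0 idx] by blast
    then have "\<forall>j. idx j < idx i \<longrightarrow> w $ j = 0" by (metis not_less)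
    then show ?thesis using i w unfolding P_def by blast
  qed
  obtain w0 where "w0 \<in> W - U" using \<open>U \<noteq> W\<close> UW by auto
  then obtain i0 where "P i0" using ex by blast
  then obtain i where i: "P i" "\<And>j. P j \<Longrightarrow> idx j \<le> idx i"
    using ex_has_greatest_nat[of P i0 idx "Suc (Max (range idx))"]
    by (metis Max_ge finite finite_imageI less_Suc_eq_le rangeI)
  then obtain w where w: "w \<in> W - U" "w $ i \<noteq> 0" "\<forall>j. idx j < idx i \<longrightarrow> w $ j = 0" unfolding P_def by blast
  have "w \<star> inverse (w $ i) \<in> W" using w dsubD(3)[OF W] by auto
  moreover have "(w \<star> inverse (w $ i)) $ i = 1 \<and> (\<forall>j. idx j < idx i \<longrightarrow> (w \<star> inverse (w $ i)) $ j = 0)"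
    using w by simp
  ultimately have "i \<in> pivots W" unfolding pivots_def by blast
  then obtain u where u: "u \<in> U" "u $ i = 1" "\<forall>j. idx j < idx i \<longrightarrow> u $ j = 0"
    using p unfolding pivots_def by blast
  define v where "v = w - u \<star> (w $ i)"
  have "u \<star> (w $ i) \<in> U" using u dsubD(3)[OF U] by auto
  then have "v \<in> W - U" unfolding v_def using w(1) UW dsubD(5)[OF W] dsubD(2)[OF U]
    by (metis Diff_iff diff_add_cancel subsetD)
  then obtain k where k: "P k" "v $ k \<noteq> 0" "\<forall>j. idx j < idx k \<longrightarrow> v $ j = 0" using ex by blast
  have "v $ j = 0" if "idx j \<le> idx i" for j
  proof (cases "j = i")
    case True then show ?thesis using u by (simp add: v_def)
  next
    case False
    then have "idx j < idx i" using that inj_idx by (metis injD le_neq_implies_less)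
    then show ?thesis using u w by (simp add: v_def)
  qed
  then show False using k i(2)[OF k(1)] by blast
qed

text \<open>The descending chain condition: a member with the fewest pivots is minimal, because a
  smaller subspace with as many pivots is equal to it by \<open>pivots_eq\<close>.\<close>

lemma dsub_minimal:
  fixes P :: "('a::division_ring^'n) set \<Rightarrow> bool"
  assumes "P W0" "\<And>W. P W \<Longrightarrow> dsub W"
  obtains W where "P W" "\<And>W'. P W' \<Longrightarrow> W' \<subseteq> W \<Longrightarrow> W' = W"
proof -
  obtain W where W: "P W" "\<And>W'. P W' \<Longrightarrow> card (pivots W) \<le> card (pivots W')"
    using ex_has_least_nat[of P W0 "\<lambda>W. card (pivots W)"] assms(1) by blast
  have "W' = W" if "P W'" "W' \<subseteq> W" for W'
  proof -
    have "pivots W' = pivots W"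
      using card_seteq[of "pivots W" "pivots W'"] pivots_mono[OF that(2)] W(2)[OF that(1)] by simp
    then show ?thesis using pivots_eq assms(2) that W(1) by blast
  qed
  then show thesis using that W(1) by blast
qed

lemma dsub_maximal:
  fixes P :: "('a::division_ring^'n) set \<Rightarrow> bool"
  assumes "P W0" "\<And>W. P W \<Longrightarrow> dsub W"
  obtains W where "P W" "\<And>W'. P W' \<Longrightarrow> W \<subseteq> W' \<Longrightarrow> W' = W"
proof -
  have "card (pivots W) \<le> CARD('n)" for W :: "('a^'n) set" by (rule card_mono) auto
  then obtain W where W: "P W" "\<And>W'. P W' \<Longrightarrow> card (pivots W') \<le> card (pivots W)"
    using ex_has_greatest_nat[of P W0 "\<lambda>W. card (pivots W)" "Suc CARD('n)"] assms(1)
    by (metis less_Suc_eq_le)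
  have "W' = W" if "P W'" "W \<subseteq> W'" for W'
  proof -
    have "pivots W = pivots W'"
      using card_seteq[of "pivots W'" "pivots W"] pivots_mono[OF that(2)] W(2)[OF that(1)] by simp
    then show ?thesis using pivots_eq assms(2) that W(1) by blast
  qed
  then show thesis using that W(1) by blast
qed

text \<open>Fitting's argument. The images of the powers of A stabilize, so A^k v = A^(k+1) w for
  some k and w; injectivity of A^k then gives v = A w.\<close>

lemma inj_imp_unit:
  fixes A :: "('a::division_ring, 'n::finite) endo"
  assumes inj: "\<And>v. ap A v = 0 \<Longrightarrow> v = 0"
  shows "A \<in> units"
proof -
  obtain W where W: "\<exists>k. W = range (ap (A ^ k))" "\<And>W'. \<exists>k. W' = range (ap (A ^ k)) \<Longrightarrow> W' \<subseteq> W \<Longrightarrow> W' = W"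
    by (rule dsub_minimal[of "\<lambda>W. \<exists>k. W = range (ap (A ^ k))" "range (ap (A ^ 0))"])
      (blast intro: dsub_image[OF dsub_UNIV])+
  then obtain k where k: "W = range (ap (A ^ k))" by blast
  have "range (ap (A ^ Suc k)) \<subseteq> W" unfolding k by (auto simp: power_Suc2 simp del: power_Suc)
  then have eq: "range (ap (A ^ Suc k)) = W" using W(2) by blast
  have injk: "ap (A ^ k) v = 0 \<Longrightarrow> v = 0" for v
    by (induction k) (auto dest: inj)
  have surj: "\<exists>w. ap A w = v" for v
  proof -
    have "ap (A ^ k) v \<in> range (ap (A ^ Suc k))" unfolding eq k by blast
    then obtain w where "ap (A ^ k) v = ap (A ^ k) (ap A w)" by (auto simp: power_Suc2 simp del: power_Suc)
    then have "ap (A ^ k) (v - ap A w) = 0" by simp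
    then show ?thesis using injk by (metis eq_iff_diff_eq_0)
  qed
  define g where "g v = (SOME w. ap A w = v)" for v
  have g: "ap A (g v) = v" for v unfolding g_def by (rule someI_ex[OF surj])
  have uniq: "v = w" if "ap A v = ap A w" for v w using inj[of "v - w"] that by simp
  have "ap (Abs_endo g) v = g v" for v
    by (rule ap_Abs; rule uniq) (simp_all add: g)
  then have "A * Abs_endo g = 1" "Abs_endo g * A = 1"
    by (auto intro!: endo_eqI simp: g intro: uniq)
  then show ?thesis by (rule unitsI)
qed

lemma unit_iff_inj:
  fixes A :: "('a::division_ring, 'n::finite) endo"
  shows "A \<in> units \<longleftrightarrow> (\<forall>v. ap A v = 0 \<longrightarrow> v = 0)"
  using inj_imp_unit ap_ui(2) ap_zero by metis

lemma exists_projection: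
  fixes U W :: "('a::division_ring^'n) set"
  assumes U: "dsub U" and W: "dsub W" and i: "U \<inter> W = {0}" and s: "vsum U W = UNIV"
  obtains e where "\<And>u. u \<in> U \<Longrightarrow> ap e u = u" "\<And>w. w \<in> W \<Longrightarrow> ap e w = 0" "\<And>v. ap e v \<in> U" "e * e = e"
    "\<And>v. v - ap e v \<in> W"
proof -
  define f where "f v = (THE u. u \<in> U \<and> v - u \<in> W)" for v
  have feq: "f v = u" if "u \<in> U" "v - u \<in> W" for u v
    unfolding f_def
  proof (rule the_equality)
    fix u' assume "u' \<in> U \<and> v - u' \<in> W"
    then have "u - u' \<in> U" "(v - u') - (v - u) \<in> W" using that dsubD(5)[OF U] dsubD(5)[OF W] by blast+
    moreover have "(v - u') - (v - u) = u - u'" by simp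
    ultimately have "u - u' \<in> U \<inter> W" by simp
    then have "u - u' = 0" unfolding i by blast
    then show "u' = u" by simp
  qed (use that in simp)
  have f: "f v \<in> U" "v - f v \<in> W" for v
  proof -
    have "v \<in> vsum U W" using s by simp
    then obtain u w where "v = u + w" "u \<in> U" "w \<in> W" unfolding vsum_def by blast
    then show "f v \<in> U" "v - f v \<in> W" using feq[of u v] by auto
  qed
  have ap: "ap (Abs_endo f) v = f v" for v
  proof (rule ap_Abs)
    fix v w
    show "f (v + w) = f v + f w"
    proof (rule feq)
      show "f v + f w \<in> U" using f dsubD(2)[OF U] by auto
      have "(v - f v) + (w - f w) \<in> W" using f dsubD(2)[OF W] by auto
      then show "v + w - (f v + f w) \<in> W" by (simp add: algebra_simps)
    qed
  next
    fix v and a :: 'a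
    show "f (v \<star> a) = f v \<star> a"
    proof (rule feq)
      show "f v \<star> a \<in> U" using f dsubD(3)[OF U] by auto
      have "(v - f v) \<star> a \<in> W" using f dsubD(3)[OF W] by auto
      then show "v \<star> a - f v \<star> a \<in> W" by (simp add: vr_distrib)
    qed
  qed
  have 1: "ap (Abs_endo f) u = u" if "u \<in> U" for u unfolding ap using feq[of u u] that dsubD(1)[OF W] by simp
  show thesis
  proof (rule that[of "Abs_endo f"])
    show "ap (Abs_endo f) w = 0" if "w \<in> W" for w unfolding ap using feq[of 0 w] that dsubD(1)[OF U] by simp
    show "Abs_endo f * Abs_endo f = Abs_endo f" by (rule endo_eqI) (use 1 f(1) ap in simp)
  qed (use 1 ap f in auto)
qed

lemma projection_commute:
  assumes e: "\<And>u. u \<in> U \<Longrightarrow> ap e u = u" "\<And>w. w \<in> W \<Longrightarrow> ap e w = 0" "\<And>v. ap e v \<in> U" "\<And>v. v - ap e v \<in> W"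
    and s: "\<And>u. u \<in> U \<Longrightarrow> ap s u \<in> U" "\<And>w. w \<in> W \<Longrightarrow> ap s w \<in> W"
  shows "e * s = s * e"
proof (rule endo_eqI)
  fix v
  have "ap e (ap s (ap e v)) = ap s (ap e v)" using e(1,3) s(1) by blast
  moreover have "ap e (ap s (v - ap e v)) = 0" using e(2,4) s(2) by blast
  ultimately show "ap (e * s) v = ap (s * e) v" by simp
qed

section \<open>Transvections\<close>

definition transv :: "('a::division_ring, 'n::finite) endo set" where
  "transv = {1 + out x \<phi> | x \<phi>. lfun \<phi> \<and> \<phi> x = 0}"

abbreviation elem :: "('a::division_ring, 'n::finite) endo set" where
  "elem \<equiv> gen transv"

lemma out_square_zero: "lfun \<phi> \<Longrightarrow> \<phi> x = 0 \<Longrightarrow> out x \<phi> * out x \<phi> = 0"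
  by (simp add: out_out)

lemma transv_units: "transv \<subseteq> units"
  unfolding transv_def using one_plus_square_zero(1)[OF out_square_zero] by blast

lemma ugrp_elem: "ugrp elem" by (rule ugrp_gen[OF transv_units])

lemma elem_units: "e \<in> elem \<Longrightarrow> e \<in> units" using ugrpD(1)[OF ugrp_elem] .

lemma elem_mult [simp]: "e \<in> elem \<Longrightarrow> f \<in> elem \<Longrightarrow> e * f \<in> elem"
  and elem_ui [simp]: "e \<in> elem \<Longrightarrow> ui e \<in> elem"
  using ugrpD(3,4)[OF ugrp_elem] by blast+

lemma exists_other_index:
  assumes "CARD('n) \<ge> 2" obtains k :: "'n::finite" where "j \<noteq> k"
proof -
  have "\<exists>k. j \<noteq> k"
  proof (rule ccontr)
    assume "\<not> ?thesis"
    then have "(UNIV :: 'n set) = {j}" by auto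
    then have "CARD('n) = card {j}" by simp
    then show False using assms by simp
  qed
  then show thesis using that by blast
qed

lemma elem_out: "lfun \<phi> \<Longrightarrow> \<phi> x = 0 \<Longrightarrow> 1 + out x \<phi> \<in> elem"
  by (rule gen_base) (auto simp: transv_def)

lemma conj_out:
  assumes "g \<in> units" "lfun \<phi>"
  shows "g * (1 + out x \<phi>) * ui g = 1 + out (ap g x) (\<lambda>v. \<phi> (ap (ui g) v))"
  using assms by (simp add: distrib_left distrib_right mult_out out_mult lfun_ap)

lemma normalizes_elem: "normalizes units (elem :: ('a::division_ring, 'n::finite) endo set)"
proof (rule normalizes_gen[OF transv_units])
  show "normalizes units (transv :: ('a, 'n) endo set)" unfolding normalizes_def
  proof (intro ballI)
    fix g h :: "('a, 'n) endo" assume g: "g \<in> units" and "h \<in> transv"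
    then obtain x \<phi> where h: "h = 1 + out x \<phi>" "lfun \<phi>" "\<phi> x = 0" unfolding transv_def by auto
    have "g * h * ui g = 1 + out (ap g x) (\<lambda>v. \<phi> (ap (ui g) v))" unfolding h by (rule conj_out[OF g h(2)])
    then show "g * h * ui g \<in> transv" unfolding transv_def using h g lfun_ap[OF h(2)] by force
  qed
qed simp

text \<open>Take a functional that vanishes at x but at neither y nor z. The scalar d makes its
  values at y and at \<open>z \<star> d\<close> agree, so \<open>z \<star> d - y\<close> is a
  direction for a transvection, and this transvection fixes x.\<close>

lemma transvection_move:
  fixes x y z :: "'a::division_ring^'n"
  assumes y: "\<And>d. y \<noteq> x \<star> d" and z: "\<And>d. z \<noteq> x \<star> d"
  obtains t d where "t \<in> elem" "ap t x = x" "d \<noteq> 0" "ap t y = z \<star> d"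
proof -
  obtain \<phi>1 where 1: "lfun \<phi>1" "\<phi>1 x = 0" "\<phi>1 y = 1" using exists_lfun_01[OF y] by blast
  obtain \<phi>2 where 2: "lfun \<phi>2" "\<phi>2 x = 0" "\<phi>2 z = 1" using exists_lfun_01[OF z] by blast
  obtain \<phi> where p: "lfun \<phi>" "\<phi> x = 0" "\<phi> y = 1" "\<phi> z \<noteq> 0"
  proof (cases "\<phi>1 z = 0")
    case False then show ?thesis using that 1 by blast
  next
    case True
    show ?thesis
    proof (cases "\<phi>2 y = 0")
      case True
      with \<open>\<phi>1 z = 0\<close> show ?thesis using that[of "\<lambda>v. \<phi>1 v + \<phi>2 v"] 1 2 lfun_add by fastforce
    next
      case False
      then show ?thesis using that[of "\<lambda>v. inverse (\<phi>2 y) * \<phi>2 v"] 2 lfun_scale by fastforce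
    qed
  qed
  define d where "d = inverse (\<phi> z)"
  let ?w = "z \<star> d - y"
  have w: "\<phi> ?w = 0" using p lfunD[OF p(1)] by (simp add: d_def)
  show thesis
  proof (rule that[of "1 + out ?w \<phi>" d])
    show "1 + out ?w \<phi> \<in> elem" by (rule elem_out[OF p(1) w])
  qed (use p in \<open>auto simp: d_def\<close>)
qed

text \<open>Two vectors on different lines have the same factor because their sum is an eigenvector
  too. A nonzero vector is off the line of at least one of two basis vectors, so the factor is
  global, and multiplication by a fixed scalar on the right commutes with every right-linear
  map.\<close>

lemma scalar_of_lines:
  fixes h :: "('a::division_ring, 'n::finite) endo"
  assumes n: "CARD('n) \<ge> 2" and l: "\<And>v. \<exists>d. ap h v = v \<star> d"
  shows "h \<in> centralizer UNIV"
proof -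
  have same: "a = b" if h: "ap h x = x \<star> a" "ap h y = y \<star> b" "\<And>d. y \<noteq> x \<star> d" "x \<noteq> 0" for x y :: "'a^'n" and a b
  proof -
    obtain c where "ap h (x + y) = (x + y) \<star> c" using l by blast
    then have eq: "x \<star> a + y \<star> b = x \<star> c + y \<star> c" using h by (simp add: vr_distrib)
    obtain \<phi> where p: "lfun \<phi>" "\<phi> x = 0" "\<phi> y = 1" using exists_lfun_01[OF h(3)] by blast
    have "\<phi> (x \<star> a + y \<star> b) = \<phi> (x \<star> c + y \<star> c)" using eq by simp
    then have bc: "b = c" using p lfunD[OF p(1)] by simp
    then have xe: "x \<star> a = x \<star> c" using eq by simp
    obtain \<psi> where q: "lfun \<psi>" "\<psi> x = 1" using exists_lfun_1[OF h(4)] by blast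
    have "\<psi> (x \<star> a) = \<psi> (x \<star> c)" using xe by simp
    then show ?thesis using bc q lfunD[OF q(1)] by simp
  qed
  obtain i j :: 'n where ij: "i \<noteq> j" using n card_le_Suc0_iff_eq[of "UNIV :: 'n set"] by force
  define e where "e = (axis i 1 :: 'a^'n)"
  define f where "f = (axis j 1 :: 'a^'n)"
  have e0: "e \<noteq> 0" "f \<noteq> 0" unfolding e_def f_def by (auto simp: axis_eq_0_iff)
  have fe: "f \<noteq> e \<star> d" "e \<noteq> f \<star> d" for d using ij by (auto simp: e_def f_def vec_eq_iff axis_def)
  obtain a where a: "ap h e = e \<star> a" using l by blast
  obtain b where b: "ap h f = f \<star> b" using l by blast
  have ab: "a = b" by (rule same[OF a b fe(1) e0(1)])
  have ha: "ap h v = v \<star> a" for v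
  proof -
    obtain c where c: "ap h v = v \<star> c" using l by blast
    show ?thesis
    proof (cases "\<exists>d. v = e \<star> d")
      case False
      then have "a = c" using same[OF a c _ e0(1)] by blast
      then show ?thesis using c by simp
    next
      case True
      then obtain d where d: "v = e \<star> d" by blast
      show ?thesis
      proof (cases "v = 0")
        case False
        have "v \<noteq> f \<star> r" for r
        proof
          assume "v = f \<star> r"
          then have "e \<star> d = f \<star> r" using d by simp
          moreover have "d \<noteq> 0" using False d by auto
          ultimately have "e = f \<star> (r * inverse d)"
            by (metis right_inverse vr_simps(1) vr_simps(4))
          then show False using fe by blast
        qed
        then have "b = c" using same[OF b c _ e0(2)] by blast
        then show ?thesis using c ab by simp
      qed simp
    qed
  qed
  show ?thesis unfolding centralizer_def by (auto intro!: endo_eqI simp: ha)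
qed

text \<open>This is the perfectness of \<open>elem\<close>: a transvection is completed to a pair of
  matrix units whose elementary groups lie in \<open>elem\<close>, and there the commutator with a
  diagonal element reaches it.\<close>

lemma elementary_is_commutator:
  fixes x :: "'a::division_ring^'n"
  assumes F: "divring F" "F \<subseteq> centralizer UNIV" and a: "a \<in> F" "a \<noteq> 0" "a * a \<noteq> (1 :: ('a, 'n) endo)"
    and t: "t \<in> (transv :: ('a, 'n::finite) endo set)"
  shows "\<exists>d\<in>elem. \<exists>u\<in>elem. t = comm d u"
proof -
  obtain u \<phi> where u: "t = 1 + out u \<phi>" "lfun \<phi>" "\<phi> u = 0" using t unfolding transv_def by auto
  have "t = comm 1 1" if "t = 1" using that by (simp add: comm_def)
  moreover have "1 \<in> (elem :: ('a, 'n) endo set)" by (rule gen.one)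
  moreover have ?thesis if ne: "t \<noteq> 1"
  proof -
    have u0: "u \<noteq> 0" using ne u by auto
    have "out u \<phi> \<noteq> 0" using ne u by auto
    then obtain w0 where "\<phi> w0 \<noteq> 0" using endo_eqI[of "out u \<phi>" 0] u(2) by fastforce
    then obtain w1 where w1: "\<phi> w1 = 1" using lfunD(2)[OF u(2), of w0 "inverse (\<phi> w0)"] by auto
    obtain \<psi>0 where p: "lfun \<psi>0" "\<psi>0 u = 1" using exists_lfun_1[OF u0] by blast
    \<comment> \<open>\<open>w\<close> satisfies \<open>\<phi> w = 1\<close> and
      \<open>\<psi>0 w = 0\<close>, which turns \<open>out u \<phi>\<close> and
      \<open>out w \<psi>0\<close> into matrix units.\<close>
    define w where "w = w1 - u \<star> \<psi>0 w1"
    have w: "\<phi> w = 1" "\<psi>0 w = 0" unfolding w_def using w1 u p lfunD[OF u(2)] lfunD[OF p(1)] by simp_all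
    let ?x = "out u \<phi>" let ?y = "out w \<psi>0"
    have xy: "?x * ?x = 0" "?y * ?y = 0" "?x * ?y * ?x = ?x" "?y * ?x * ?y = ?y"
      using u p w by (simp_all add: out_out)
    have cen: "f * r = r * f" if "f \<in> F" for f r using that F(2) centralizerD by blast
    have fe: "1 + f * out v \<theta> \<in> elem" if "f \<in> F" "lfun \<theta>" "\<theta> v = 0" for f and v :: "'a^'n" and \<theta>
    proof -
      have "out v \<theta> * (f * out v \<theta>) = f * (out v \<theta> * out v \<theta>)" using cen[OF that(1)] by (metis mult.assoc)
      then have "out v \<theta> * (f * out v \<theta>) = 0" using out_square_zero[OF that(2,3)] by simp
      then have "out (v \<star> \<theta> (ap f v)) \<theta> = 0" using that(2) by (simp add: mult_out)
      have "\<theta> (ap f v) = 0"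
      proof (rule ccontr)
        assume nz: "\<theta> (ap f v) \<noteq> 0"
        have "f * (1 + out v \<theta>) = (1 + out v \<theta>) * f" using cen[OF that(1)] by blast
        then have "out v \<theta> * f = out (ap f v) \<theta>" using that(2) by (simp add: algebra_simps mult_out)
        then have "ap (out v \<theta> * f) v = ap (out (ap f v) \<theta>) v" by simp
        then have "v \<star> \<theta> (ap f v) = 0" using that(2,3) by simp
        then have "v = 0" using nz by (metis right_inverse vr_simps(1,3,4))
        then show False using nz lfunD(3)[OF that(2)] by simp
      qed
      then show ?thesis using elem_out[OF that(2), of "ap f v"] that(2) by (simp add: mult_out)
    qed
    obtain d where d: "d \<in> elem" "\<forall>f\<in>F. (\<exists>g\<in>F. 1 + f * ?x = comm d (1 + g * ?x)) \<and> (\<exists>g\<in>F. 1 + f * ?y = comm d (1 + g * ?y))"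
      using matrix_units_commutator[OF xy F a ugrp_elem fe[OF _ u(2,3)] fe[OF _ p(1) w(2)]] by blast
    have "1 \<in> F" using subrngD(2)[OF divringD(1)[OF F(1)]] .
    then obtain g where g: "g \<in> F" "1 + 1 * ?x = comm d (1 + g * ?x)" using d(2) by blast
    then show ?thesis using d(1) fe[OF g(1) u(2,3)] u(1) by auto
  qed
  ultimately show ?thesis by blast
qed

text \<open>Iwasawa's argument: the group is transitive on lines, so together with the abelian group of
  transvections along one line it generates all transvections; hence it contains the derived group
  of the perfect group \<^term>\<open>elem\<close>.\<close>

lemma elem_subset_normalized:
  fixes H :: "('a::division_ring, 'n::finite) endo set"
  assumes n: "CARD('n) \<ge> 2" and H: "ugrp H" "normalizes elem H" "\<not> H \<subseteq> centralizer UNIV"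
    and F: "divring F" "F \<subseteq> centralizer UNIV" and a: "a \<in> F" "a \<noteq> 0" "a * a \<noteq> (1 :: ('a, 'n) endo)"
  shows "elem \<subseteq> H"
proof -
  obtain h0 where h0: "h0 \<in> H" "h0 \<notin> centralizer UNIV" using H(3) by blast
  then obtain x where hx: "\<And>d. ap h0 x \<noteq> x \<star> d" using scalar_of_lines[OF n] by blast
  \<comment> \<open>A product of transvections fixing x moves \<open>ap h0 x\<close> to the line of
    any r off the line of x, so a conjugate of \<open>h0\<close> maps x to that line.\<close>
  have trans: "\<exists>g\<in>H. \<exists>d. d \<noteq> 0 \<and> ap g x = r \<star> d" if r: "r \<noteq> 0" for r
  proof (cases "\<exists>d. r = x \<star> d")
    case True
    then obtain d where d: "r = x \<star> d" by blast
    then have "d \<noteq> 0" using r by auto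
    then show ?thesis using d ugrpD(2)[OF H(1)] by (intro bexI[of _ 1] exI[of _ "inverse d"]) auto
  next
    case False
    then have rx: "r \<noteq> x \<star> d" for d by blast
    obtain e d where e: "e \<in> elem" "ap e x = x" "d \<noteq> 0" "ap e (ap h0 x) = r \<star> d"
      by (rule transvection_move[OF hx rx])
    have eu: "e \<in> units" using elem_units e by blast
    have "ap (ui e) x = x" using ap_ui(2)[OF eu, of x] e(2) by simp
    then have "ap (e * h0 * ui e) x = r \<star> d" using e by simp
    then show ?thesis using normalizesD[OF H(2) e(1) h0(1)] e(3) by blast
  qed
  \<comment> \<open>The abelian group of transvections along the one line of x. As it normalizes H,
    the products \<open>HA\<close> below form a group.\<close>
  define A where "A = {1 + out x \<phi> | \<phi>. lfun \<phi> \<and> \<phi> x = 0}"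
  have Ae: "a \<in> elem" if "a \<in> A" for a using that elem_out unfolding A_def by auto
  have A1: "1 \<in> A" unfolding A_def
    by (rule CollectI, rule exI[of _ "\<lambda>v. 0"]) (auto simp: lfun_def out_def zero_endo_def)
  have Aadd: "(1 + out x \<phi>) * (1 + out x \<psi>) = 1 + out x (\<lambda>v. \<phi> v + \<psi> v)" if "lfun \<phi>" "\<phi> x = 0" "lfun \<psi>" "\<psi> x = 0" for \<phi> \<psi>
    using that by (intro endo_eqI) (simp add: lfun_add vr_distrib lfunD)
  have Amult: "a * b \<in> A \<and> a * b = b * a" if ab: "a \<in> A" "b \<in> A" for a b
  proof -
    obtain \<phi> \<psi> where p: "a = 1 + out x \<phi>" "lfun \<phi>" "\<phi> x = 0" "b = 1 + out x \<psi>" "lfun \<psi>" "\<psi> x = 0"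
      using ab unfolding A_def by auto
    have "a * b = 1 + out x (\<lambda>v. \<phi> v + \<psi> v)" unfolding p by (rule Aadd[OF p(2,3,5,6)])
    moreover have "b * a = 1 + out x (\<lambda>v. \<psi> v + \<phi> v)" unfolding p by (rule Aadd[OF p(5,6,2,3)])
    moreover have "(\<lambda>v. \<phi> v + \<psi> v) = (\<lambda>v. \<psi> v + \<phi> v)" by (simp add: add.commute)
    moreover have "lfun (\<lambda>v. \<phi> v + \<psi> v)" "\<phi> x + \<psi> x = 0" using p lfun_add by auto
    then have "1 + out x (\<lambda>v. \<phi> v + \<psi> v) \<in> A" unfolding A_def by blast
    ultimately show ?thesis by metis
  qed
  have Ainv: "ui a \<in> A" if aA: "a \<in> A" for a
  proof -
    obtain \<phi> where p: "a = 1 + out x \<phi>" "lfun \<phi>" "\<phi> x = 0" using aA unfolding A_def by auto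
    have "ui a = 1 - out x \<phi>" unfolding p using one_plus_square_zero(2)[OF out_square_zero[OF p(2,3)]] .
    also have "\<dots> = 1 + out x (\<lambda>v. (-1) * \<phi> v)" using p by (intro endo_eqI) (simp add: lfun_scale)
    finally show ?thesis unfolding A_def using p lfun_scale[OF p(2), of "-1"] by force
  qed
  define HA where "HA = {h * a | h a. h \<in> H \<and> a \<in> A}"
  have Hu: "h \<in> units" if "h \<in> H" for h using that H(1) ugrpD by blast
  have Au: "a \<in> units" if "a \<in> A" for a using Ae[OF that] elem_units by blast
  have nA: "a * h * ui a \<in> H" if "a \<in> A" "h \<in> H" for a h using normalizesD[OF H(2) Ae] that by blast
  have HAI: "h * a \<in> HA" if "h \<in> H" "a \<in> A" for h a unfolding HA_def using that by blast
  have "ugrp HA" unfolding ugrp_def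
  proof (intro conjI ballI)
    show "HA \<subseteq> units" unfolding HA_def using Hu Au by auto
    show "1 \<in> HA" using HAI[OF ugrpD(2)[OF H(1)] A1] by simp
  next
    fix s t assume "s \<in> HA" "t \<in> HA"
    then obtain h a k b where st: "s = h * a" "t = k * b" "h \<in> H" "a \<in> A" "k \<in> H" "b \<in> A" unfolding HA_def by blast
    have "s * t = (h * (a * k * ui a)) * (a * b)" using st Au by (simp add: mult.assoc)
    then show "s * t \<in> HA" using HAI ugrpD(3)[OF H(1)] st nA Amult by simp
  next
    fix s assume "s \<in> HA"
    then obtain h a where st: "s = h * a" "h \<in> H" "a \<in> A" unfolding HA_def by blast
    have "ui s = (ui a * ui h * ui (ui a)) * ui a" using st Hu Au by (simp add: mult.assoc)
    then show "ui s \<in> HA" using HAI nA[OF Ainv] Ainv ugrpD(4)[OF H(1)] st by auto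
  qed
  moreover have "transv \<subseteq> HA"
  proof
    fix t :: "('a, 'n) endo" assume "t \<in> transv"
    then obtain r \<psi> where t: "t = 1 + out r \<psi>" "lfun \<psi>" "\<psi> r = 0" unfolding transv_def by auto
    show "t \<in> HA"
    proof (cases "r = 0")
      case True
      then show ?thesis using t HAI[OF ugrpD(2)[OF H(1)] A1] by simp
    next
      case False
      obtain g d where g: "g \<in> H" "d \<noteq> 0" "ap g x = r \<star> d" using trans[OF False] by blast
      have gu: "g \<in> units" using Hu g by blast
      have gr: "ap (ui g) r = x \<star> inverse d"
      proof -
        have "r = ap g (x \<star> inverse d)" using g by simp
        then show ?thesis using gu by simp
      qed
      \<comment> \<open>Conjugating t back by \<open>g\<close> gives a transvection along x, hence
        an element of A; the discrepancy between t and \<open>b\<close> is a commutator with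
        \<open>g\<close> and lies in H.\<close>
      define b where "b = ui g * t * ui (ui g)"
      have "b = 1 + out (x \<star> inverse d) (\<lambda>v. \<psi> (ap g v))"
        unfolding b_def t(1) using conj_out[of "ui g" \<psi> r] gu t(2) gr by simp
      also have "\<dots> = 1 + out x (\<lambda>v. inverse d * \<psi> (ap g v))" using out_scale[OF lfun_ap[OF t(2)]] by metis
      finally have "b \<in> A" unfolding A_def using lfun_scale[OF lfun_ap[OF t(2)]] g t lfunD(2)[OF t(2)] by force
      have "t = g * b * ui g" unfolding b_def using gu by (simp add: mult.assoc)
      also have "\<dots> = (g * (b * ui g * ui b)) * b" using gu Au[OF \<open>b \<in> A\<close>] by (simp add: mult.assoc)
      finally show ?thesis using HAI[OF _ \<open>b \<in> A\<close>] ugrpD(3,4)[OF H(1)] nA[OF \<open>b \<in> A\<close>] g(1) by simp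
    qed
  qed
  ultimately have EHA: "elem \<subseteq> HA" by (rule gen_least)
  have "transv \<subseteq> H"
  proof
    fix t :: "('a, 'n) endo" assume "t \<in> transv"
    then obtain s u where su: "s \<in> elem" "u \<in> elem" "t = comm s u"
      using elementary_is_commutator[OF F a] by blast
    obtain h1 a1 h2 a2 where e: "s = h1 * a1" "u = h2 * a2" "h1 \<in> H" "a1 \<in> A" "h2 \<in> H" "a2 \<in> A"
      using EHA su unfolding HA_def by blast
    \<comment> \<open>Modulo H the two factors may be replaced by their parts in A, which commute;
      so the commutator lies in H.\<close>
    have "comm a1 a2 = 1" using comm_eq_1_iff Au e Amult by blast
    then show "t \<in> H" unfolding su(3) e(1,2)
      using e by (intro comm_mod[OF H(1)]) (auto simp: Au ugrpD[OF H(1)] normalizes_def nA)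
  qed
  then show ?thesis by (rule gen_least[OF H(1)])
qed

section \<open>Commutators of linear automorphisms are elementary\<close>

definition dil :: "'n \<Rightarrow> 'a \<Rightarrow> ('a::division_ring, 'n::finite) endo" where
  "dil j a = 1 + out (axis j 1) (\<lambda>v. (a - 1) * v $ j)"

lemma ap_dil: "ap (dil j a) v = (\<chi> i. if i = j then a * v $ j else v $ i)"
  unfolding dil_def using lfun_scale[OF lfun_nth] by (simp add: vec_eq_iff axis_def algebra_simps)

lemma dil_mult: "dil j a * dil j b = dil j (a * b)"
  by (rule endo_eqI) (simp add: ap_dil vec_eq_iff mult.assoc)

lemma dil_1: "dil j 1 = 1"
  by (rule endo_eqI) (simp add: ap_dil vec_eq_iff)

lemma dil_units: "a \<noteq> 0 \<Longrightarrow> dil j a \<in> units" "a \<noteq> 0 \<Longrightarrow> ui (dil j a) = dil j (inverse a)"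
  by (rule unitsI[of _ "dil j (inverse a)"]; simp add: dil_mult dil_1)
     (rule ui_eq; simp add: dil_mult dil_1)

text \<open>The diagonal element is again a product of two Weyl elements with parameters a and -1,
  now in the coordinates i and j.\<close>

lemma whitehead_dil:
  assumes "i \<noteq> j" "a \<noteq> 0" shows "dil i a * dil j (inverse a) \<in> (elem :: ('a::division_ring, 'n::finite) endo set)"
proof -
  let ?p = "\<lambda>b. out (axis i 1) (\<lambda>v. b * v $ j) :: ('a, 'n) endo"
  let ?q = "\<lambda>b. out (axis j 1) (\<lambda>v. b * v $ i) :: ('a, 'n) endo"
  have l: "lfun (\<lambda>v. b * v $ k)" for b :: 'a and k :: 'n using lfun_scale[OF lfun_nth] .
  have e: "1 + ?p b \<in> elem" "1 + ?q b \<in> elem" for b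
    using assms by (auto intro!: elem_out l simp: axis_def)
  have ij: "(axis i 1 :: 'a^'n) $ j = 0" "(axis j 1 :: 'a^'n) $ i = 0" using assms by (auto simp: axis_def)
  have neg: "?q (- b) = - ?q b" for b
    by (rule endo_eqI) (simp add: l)
  have w: "(1 + ?p b) * (1 - ?q (inverse b)) * (1 + ?p b) = 1 - ?p b * ?q (inverse b) - ?q (inverse b) * ?p b + ?p b - ?q (inverse b)"
    if "b \<noteq> 0" for b
    by (rule whitehead; rule endo_eqI; simp add: l ij that flip: mult.assoc)
  have we: "1 - ?p b * ?q (inverse b) - ?q (inverse b) * ?p b + ?p b - ?q (inverse b) \<in> elem" if "b \<noteq> 0" for b
    unfolding w[OF that, symmetric] using e(1)[of b] e(2)[of "- inverse b"] unfolding neg by simp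
  have inv: "inverse a * (a * r) = r" "a * (inverse a * r) = r" for r
    using assms(2) by (simp_all flip: mult.assoc)
  have "dil i a * dil j (inverse a) =
    (1 - ?p a * ?q (inverse a) - ?q (inverse a) * ?p a + ?p a - ?q (inverse a)) *
    (1 - ?p (-1) * ?q (inverse (-1)) - ?q (inverse (-1)) * ?p (-1) + ?p (-1) - ?q (inverse (-1)))"
    by (rule endo_eqI) (use assms inv in \<open>auto simp: ap_dil l ij vec_eq_iff axis_def\<close>)
  then show ?thesis using we[OF assms(2)] we[of "-1"] ugrpD(3)[OF ugrp_elem] by simp
qed

lemma comm_dil_elem:
  assumes n: "CARD('n) \<ge> 2" and ab: "a \<noteq> 0" "b \<noteq> 0"
  shows "comm (dil j a) (dil j b) \<in> (elem :: ('a::division_ring, 'n::finite) endo set)"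
proof -
  obtain i where ij: "j \<noteq> (i :: 'n)" using exists_other_index[OF n] by blast
  \<comment> \<open>With this \<open>c\<close> the entries at the auxiliary index i multiply to 1,
    while those at j multiply to the commutator of a and b.\<close>
  define c where "c = inverse (b * a)"
  have c0: "c \<noteq> 0" using ab by (simp add: c_def)
  have sw: "dil i r * dil j s = dil j s * dil i r" for r s :: 'a
    by (rule endo_eqI) (use ij in \<open>auto simp: ap_dil vec_eq_iff\<close>)
  have dr2: "dil i r * (dil j s * x) = dil j s * (dil i r * x)" for r s :: 'a and x
    using arg_cong[OF sw[of r s], of "\<lambda>t. t * x"] by (simp add: mult.assoc)
  have dr: "dil i r * (dil i s * x) = dil i (r * s) * x" "dil j r * (dil j s * x) = dil j (r * s) * x" for r s :: 'a and x
    by (simp_all only: dil_mult mult.assoc[symmetric])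
  have "(dil j a * dil i (inverse a)) * (dil j b * dil i (inverse b)) * (dil j c * dil i (inverse c))
    = dil j (a * b * c) * dil i (inverse a * inverse b * inverse c)"
    by (simp add: mult.assoc dil_mult sw dr dr2)
  also have "inverse a * inverse b * inverse c = 1" using ab by (simp add: c_def mult.assoc) (metis mult.assoc left_inverse mult_1)
  finally have "dil j (a * b * c) \<in> elem"
    using whitehead_dil[OF ij] ab c0 ugrpD(3)[OF ugrp_elem] by (metis dil_1 mult_1_right)
  moreover have "comm (dil j a) (dil j b) = dil j (a * b * c)"
    unfolding comm_def using ab by (simp add: dil_units dil_mult c_def nonzero_inverse_mult_distrib mult.assoc)
  ultimately show ?thesis by simp
qed

text \<open>Gaussian elimination with transvections alone. One index j outside I and k has to stay
  free: its entry is made nonzero and then serves to turn the column k into a basis vector.\<close>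

lemma elem_clear:
  fixes g :: "('a::division_ring, 'n::finite) endo"
  assumes "finite I" "I \<noteq> UNIV" "g \<in> units"
  shows "\<exists>e\<in>elem. \<forall>i\<in>I. ap (e * g) (axis i 1) = axis i 1"
  using assms(1,2)
proof (induction I)
  case empty
  then show ?case using gen.one by blast
next
  case (insert k I)
  then obtain e where e: "e \<in> elem" "\<forall>i\<in>I. ap (e * g) (axis i 1) = axis i 1" by auto
  have eu: "e * g \<in> units" using elem_units[OF e(1)] assms(3) by simp
  define y where "y = ap (e * g) (axis k 1)"
  obtain j where j: "j \<notin> insert k I" using insert.prems by auto
  have fixI: "ap (1 + out x (\<lambda>v. a * v $ l)) (axis i 1) = axis i 1" if "l \<noteq> i" for x :: "'a^'n" and a l i
    using that lfun_scale[OF lfun_nth] by (simp add: axis_def)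
  \<comment> \<open>If the entry at j vanishes, some entry l outside I does not, since otherwise
    column k would be a combination of the finished columns; row l is then added to row j.\<close>
  have step: "\<exists>e'\<in>elem. (\<forall>i\<in>I. ap e' (axis i 1) = axis i 1) \<and> (ap e' y) $ j \<noteq> 0"
  proof (cases "y $ j = 0")
    case False
    then show ?thesis by (intro bexI[of _ 1]) (auto intro: gen.one)
  next
    case True
    have "\<exists>l. l \<notin> I \<and> y $ l \<noteq> 0"
    proof (rule ccontr)
      assume "\<not> ?thesis"
      then have z: "y $ l = 0" if "l \<notin> I" for l using that by blast
      define u where "u = (\<Sum>i\<in>I. axis i 1 \<star> (y $ i))"
      have "u = y"
      proof -
        have "u = (\<Sum>i\<in>UNIV. axis i 1 \<star> (y $ i))" unfolding u_def
          by (rule sum.mono_neutral_left) (use z in auto)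
        then show ?thesis using vec_axis_sum[of y] by simp
      qed
      have "ap (e * g) u = u" unfolding u_def using e(2) by (simp add: ap_sum_right del: ap_ring)
      then have "ap (e * g) (axis k 1 - u) = 0" using \<open>u = y\<close> y_def by (simp del: ap_ring)
      then have "axis k 1 = u" using eu unit_iff_inj by (metis eq_iff_diff_eq_0)
      then have "y $ k = 1" using \<open>u = y\<close> by (metis axis_nth)
      then show False using z insert.hyps by force
    qed
    then obtain l where l: "l \<notin> I" "y $ l \<noteq> 0" by blast
    let ?t = "1 + out (axis j 1) (\<lambda>v. 1 * v $ l) :: ('a, 'n) endo"
    have "l \<noteq> j" using l True by auto
    then have "?t \<in> elem" by (intro elem_out lfun_scale[OF lfun_nth]) (simp add: axis_def)
    moreover have "\<forall>i\<in>I. ap ?t (axis i 1) = axis i 1" using l(1) fixI[of l _ "axis j 1" 1] by metis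
    moreover have "(ap ?t y) $ j \<noteq> 0" using l True lfun_scale[OF lfun_nth, of 1] by (simp add: axis_def)
    ultimately show ?thesis by blast
  qed
  then obtain e' where e': "e' \<in> elem" "\<forall>i\<in>I. ap e' (axis i 1) = axis i 1" "(ap e' y) $ j \<noteq> 0" by blast
  define z where "z = ap e' y"
  have zj: "z $ j \<noteq> 0" using e' z_def by simp
  \<comment> \<open>Chosen with value 1 at both \<open>z\<close> and \<open>axis k 1\<close> and
    value 0 on the finished columns, so that the transvection along \<open>axis k 1 - z\<close>
    corrects column k and nothing else in I.\<close>
  define \<phi> where "\<phi> v = v $ k + ((1 - z $ k) * inverse (z $ j)) * v $ j" for v :: "'a^'n"
  have p: "lfun \<phi>" unfolding \<phi>_def by (intro lfun_add lfun_nth lfun_scale)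
  have jk: "j \<noteq> k" using j by auto
  have pz: "\<phi> z = 1" "\<phi> (axis k 1) = 1" unfolding \<phi>_def using zj jk by (auto simp: axis_def mult.assoc)
  let ?t = "1 + out (axis k 1 - z) \<phi>"
  have "?t \<in> elem" by (rule elem_out[OF p]) (simp add: lfunD[OF p] pz)
  moreover have "ap ?t (axis i 1) = axis i 1" if "i \<in> I" for i
  proof -
    have "i \<noteq> k" "i \<noteq> j" using that j insert.hyps by auto
    then have "\<phi> (axis i 1) = 0" unfolding \<phi>_def by (auto simp: axis_def)
    then show ?thesis using p by simp
  qed
  moreover have "ap ?t z = axis k 1" using p pz by simp
  ultimately have "?t * (e' * e) \<in> elem \<and> (\<forall>i\<in>insert k I. ap (?t * (e' * e) * g) (axis i 1) = axis i 1)"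
    using e e' y_def z_def by auto
  then show ?case by blast
qed

text \<open>Once all columns except j are cleared, invertibility makes the remaining diagonal entry
  nonzero, and the column splits into a shear and a dilation.\<close>

lemma elem_dil_decomposition:
  fixes g :: "('a::division_ring, 'n::finite) endo"
  assumes "g \<in> units"
  shows "\<exists>e\<in>elem. \<exists>a. a \<noteq> 0 \<and> g = e * dil j a"
proof -
  obtain e where e: "e \<in> elem" "\<forall>i\<in>UNIV - {j}. ap (e * g) (axis i 1) = axis i 1"
    using elem_clear[of "UNIV - {j}", OF _ _ assms] by auto
  have eu: "e \<in> units" "e * g \<in> units" using elem_units[OF e(1)] assms by auto
  define c where "c = ap (e * g) (axis j 1)"
  have cj: "c $ j \<noteq> 0"
  proof
    assume z: "c $ j = 0"
    define u where "u = (\<Sum>i\<in>UNIV - {j}. axis i 1 \<star> (c $ i))"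
    have "u = (\<Sum>i\<in>UNIV. axis i 1 \<star> (c $ i))" unfolding u_def
      by (rule sum.mono_neutral_left) (use z in auto)
    then have uc: "u = c" using vec_axis_sum[of c] by simp
    have "ap (e * g) u = u" unfolding u_def using e(2) by (simp add: ap_sum_right del: ap_ring)
    then have "ap (e * g) (axis j 1 - u) = 0" using uc c_def by (simp del: ap_ring)
    then have "axis j 1 = u" using eu unit_iff_inj by (metis eq_iff_diff_eq_0)
    then show False using uc z by (metis axis_nth zero_neq_one)
  qed
  define x where "x = (c - axis j 1 \<star> (c $ j)) \<star> inverse (c $ j)"
  let ?t = "1 + out x (\<lambda>v. v $ j)"
  have t: "?t \<in> elem" by (rule elem_out[OF lfun_nth]) (simp add: x_def axis_def)
  have "e * g = ?t * dil j (c $ j)"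
  proof (rule endo_axis_eqI)
    fix i
    show "ap (e * g) (axis i 1) = ap (?t * dil j (c $ j)) (axis i 1)"
    proof (cases "i = j")
      case True
      have "ap (dil j (c $ j)) (axis j 1) = axis j 1 \<star> (c $ j)" by (simp add: ap_dil vec_eq_iff axis_def)
      moreover have "ap ?t (axis j 1 \<star> (c $ j)) = c" using cj by (simp add: lfun_nth x_def vec_eq_iff axis_def mult.assoc)
      ultimately show ?thesis using True c_def by simp
    next
      case False
      have "ap (dil j (c $ j)) (axis i 1) = axis i 1" using False by (auto simp: ap_dil vec_eq_iff axis_def)
      moreover have "ap ?t (axis i 1) = axis i 1" using False by (simp add: lfun_nth axis_def)
      ultimately show ?thesis using False e by simp
    qed
  qed
  then have "g = (ui e * ?t) * dil j (c $ j)" using eu(1) by (metis mult.assoc ui_left2)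
  then show ?thesis using cj t e(1) ugrpD(3,4)[OF ugrp_elem] by metis
qed

lemma comm_in_elem:
  fixes g h :: "('a::division_ring, 'n::finite) endo"
  assumes "CARD('n) \<ge> 2" "g \<in> units" "h \<in> units"
  shows "comm g h \<in> elem"
proof -
  obtain j :: 'n where True by simp
  obtain e a where g: "e \<in> elem" "a \<noteq> 0" "g = e * dil j a" using elem_dil_decomposition[OF assms(2), of j] by blast
  obtain f b where h: "f \<in> elem" "b \<noteq> 0" "h = f * dil j b" using elem_dil_decomposition[OF assms(3), of j] by blast
  show ?thesis unfolding g(3) h(3)
    by (rule comm_mod[OF ugrp_elem g(1) h(1)])
      (use g h comm_dil_elem[OF assms(1)] in \<open>auto simp: normalizes_def dil_units(1) normalizesD[OF normalizes_elem]\<close>)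
qed

text \<open>Off-diagonal rank-one maps are transvections minus 1; a diagonal one is a product of two
  off-diagonal ones through a second index.\<close>

lemma elem_subring:
  fixes X :: "('a::division_ring, 'n::finite) endo set"
  assumes n: "CARD('n) \<ge> 2" and X: "subrng X" "elem \<subseteq> X" shows "X = UNIV"
proof -
  have o: "out x \<phi> \<in> X" if "lfun \<phi>" "\<phi> x = 0" for x \<phi>
  proof -
    have "1 + out x \<phi> \<in> X" using elem_out[OF that] X(2) by blast
    then have "(1 + out x \<phi>) - 1 \<in> X" using subrngD(2,6)[OF X(1)] by blast
    then show ?thesis by simp
  qed
  have ax: "out (axis i a) (\<lambda>v. v $ j) \<in> X" for i j :: 'n and a :: 'a
  proof (cases "i = j")
    case False
    then show ?thesis by (intro o[OF lfun_nth]) (simp add: axis_def)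
  next
    case True
    obtain k where k: "j \<noteq> (k :: 'n)" using exists_other_index[OF n] by blast
    have "out (axis i a) (\<lambda>v. v $ j) = out (axis i a) (\<lambda>v. v $ k) * out (axis k 1) (\<lambda>v. v $ j)"
      by (simp add: out_out lfun_nth axis_def)
    moreover have "out (axis i a) (\<lambda>v. v $ k) \<in> X" "out (axis k 1) (\<lambda>v. v $ j) \<in> X"
      using True k by (auto intro!: o[OF lfun_nth] simp: axis_def)
    ultimately show ?thesis using subrngD(4)[OF X(1)] by simp
  qed
  have "A \<in> X" for A :: "('a, 'n) endo"
  proof -
    have "A = (\<Sum>j\<in>UNIV. \<Sum>i\<in>UNIV. out (axis i (ap A (axis j 1) $ i)) (\<lambda>v. v $ j))"
    proof (rule endo_axis_eqI)
      fix k
      have "ap (\<Sum>j\<in>UNIV. \<Sum>i\<in>UNIV. out (axis i (ap A (axis j 1) $ i)) (\<lambda>v. v $ j)) (axis k 1)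
        = (\<Sum>j\<in>UNIV. \<Sum>i\<in>UNIV. axis i (ap A (axis j 1) $ i) \<star> (axis k 1 $ j))"
        by (simp add: ap_sum lfun_nth)
      also have "\<dots> = (\<Sum>j\<in>UNIV. if j = k then ap A (axis k 1) else 0)"
      proof (rule sum.cong[OF refl])
        fix j
        have "axis i b = axis i 1 \<star> b" for i :: 'n and b :: 'a by (auto simp: vec_eq_iff axis_def)
        then have "(\<Sum>i\<in>UNIV. axis i (ap A (axis k 1) $ i)) = (\<Sum>i\<in>UNIV. axis i 1 \<star> (ap A (axis k 1) $ i))"
          by (rule sum.cong[OF refl])
        then have "(\<Sum>i\<in>UNIV. axis i (ap A (axis k 1) $ i)) = ap A (axis k 1)"
          using vec_axis_sum[of "ap A (axis k 1)"] by metis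
        then show "(\<Sum>i\<in>UNIV. axis i (ap A (axis j 1) $ i) \<star> (axis k 1 $ j)) = (if j = k then ap A (axis k 1) else 0)"
          by (cases "j = k") (simp_all, simp add: axis_def)
      qed
      finally show "ap A (axis k 1) = ap (\<Sum>j\<in>UNIV. \<Sum>i\<in>UNIV. out (axis i (ap A (axis j 1) $ i)) (\<lambda>v. v $ j)) (axis k 1)"
        by simp
    qed
    also have "\<dots> \<in> X" by (intro subrng_sum[OF X(1)] ax)
    finally show ?thesis .
  qed
  then show ?thesis by blast
qed

section \<open>Solvable maximal subgroups: invariant subrings\<close>

abbreviation cen :: "'r::ring_1 set" where "cen \<equiv> centralizer UNIV"

lemma cen_commute: "z \<in> cen \<Longrightarrow> z * r = r * z"
  by (simp add: centralizer_def)

lemma cen_sub_centralizer: "cen \<subseteq> centralizer A"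
  unfolding centralizer_def by auto

lemma divring_cen: "divring (cen :: ('a::division_ring, 'n::finite) endo set)"
  unfolding divring_def
proof (intro conjI ballI impI)
  fix z :: "('a, 'n) endo" assume z: "z \<in> cen" "z \<noteq> 0"
  show u: "z \<in> units"
  proof (rule inj_imp_unit, rule ccontr)
    fix v assume v: "ap z v = 0" "v \<noteq> 0"
    obtain \<phi> where p: "lfun \<phi>" "\<phi> v = 1" using exists_lfun_1[OF v(2)] by blast
    have "ap z w = 0" for w
    proof -
      have "z * out w \<phi> = out w \<phi> * z" using cen_commute[OF z(1)] by blast
      then have "ap (z * out w \<phi>) v = ap (out w \<phi> * z) v" by simp
      then show ?thesis using p v by simp
    qed
    then have "z = 0" by (intro endo_eqI) simp
    then show False using z by simp
  qed
  show "ui z \<in> cen" by (rule centralizer_ui[OF z(1) u])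
qed (rule subrng_centralizer)

text \<open>Otherwise the rank-one summand would be a nonzero central map, hence invertible,
  although its functional has a nonzero kernel when there are at least two coordinates.\<close>

lemma rank_one_not_central:
  fixes x :: "'a::division_ring^'n"
  assumes n: "CARD('n) \<ge> 2" and p: "lfun \<phi>" "\<phi> x = 1" and a: "a \<noteq> 0"
  shows "1 + out x (\<lambda>v. a * \<phi> v) \<notin> (cen :: ('a, 'n::finite) endo set)"
proof
  assume "1 + out x (\<lambda>v. a * \<phi> v) \<in> (cen :: ('a, 'n) endo set)"
  then have "(1 + out x (\<lambda>v. a * \<phi> v)) - 1 \<in> (cen :: ('a, 'n) endo set)"
    using subrngD(2,6)[OF subrng_centralizer] by blast
  then have c: "out x (\<lambda>v. a * \<phi> v) \<in> (cen :: ('a, 'n) endo set)" by simp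
  have x0: "x \<noteq> 0" using p lfunD(3)[OF p(1)] by auto
  have "ap (out x (\<lambda>v. a * \<phi> v)) x = x \<star> a" using p by simp
  moreover have "x \<star> a \<noteq> 0"
  proof
    assume "x \<star> a = 0"
    then have "(x \<star> a) \<star> inverse a = 0" by simp
    then show False using a x0 by simp
  qed
  ultimately have "out x (\<lambda>v. a * \<phi> v) \<noteq> 0" by fastforce
  then have u: "out x (\<lambda>v. a * \<phi> v) \<in> units" using divringD(3)[OF divring_cen c] by simp
  have "\<exists>y. y \<noteq> 0 \<and> \<phi> y = 0"
  proof (rule ccontr)
    assume "\<not> ?thesis"
    then have inj: "\<phi> y = 0 \<Longrightarrow> y = 0" for y by blast
    have all: "y = x \<star> \<phi> y" for y using inj[of "y - x \<star> \<phi> y"] lfunD[OF p(1)] p(2) by simp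
    obtain i :: 'n where True by simp
    obtain j where ij: "i \<noteq> j" using exists_other_index[OF n, of i] by blast
    have e1: "axis i 1 = x \<star> \<phi> (axis i 1)" and e2: "axis j 1 = x \<star> \<phi> (axis j 1)" using all by blast+
    have "x $ j * \<phi> (axis i 1) = 0" using arg_cong[OF e1, of "\<lambda>v. v $ j"] ij by (simp add: axis_def)
    moreover have "\<phi> (axis i 1) \<noteq> 0" using inj[of "axis i 1"] by (auto simp: axis_eq_0_iff)
    ultimately have "x $ j = 0" by simp
    then show False using arg_cong[OF e2, of "\<lambda>v. v $ j"] by (simp add: axis_def)
  qed
  then obtain y where "y \<noteq> 0" "\<phi> y = 0" by blast
  then show False using u unit_iff_inj p(1) by (metis ap_out lfun_scale mult_zero_right vr_simps(2))
qed

text \<open>Multiplication of columns by central scalars embeds the center of D into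
  \<open>cen\<close>, so lower bounds on its size carry over.\<close>

lemma cen_avoid:
  assumes center5: "\<And>S. finite S \<Longrightarrow> card S < 5 \<Longrightarrow> \<exists>f\<in>(dr_center :: 'a::division_ring set). f \<notin> S"
    and S: "finite S" "card S < 5"
  shows "\<exists>f\<in>(cen :: ('a, 'n::finite) endo set). f \<notin> S"
proof -
  define sc where "sc z = (Abs_endo (\<lambda>v. v \<star> z) :: ('a, 'n) endo)" for z :: 'a
  have aps: "ap (sc z) v = v \<star> z" if "z \<in> dr_center" for z and v :: "'a^'n"
  proof -
    have "a * z = z * a" for a using that unfolding dr_center_def by auto
    then show ?thesis unfolding sc_def by (subst ap_Abs) (auto simp: vr_distrib)
  qed
  have scF: "sc z \<in> cen" if "z \<in> dr_center" for z
    unfolding centralizer_def using that by (auto intro!: endo_eqI simp: aps)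
  define T where "T = {z \<in> dr_center. sc z \<in> S}"
  have inj: "inj_on sc T"
  proof (rule inj_onI)
    fix x y assume "x \<in> T" "y \<in> T" "sc x = sc y"
    obtain i :: 'n where True by simp
    have "ap (sc x) (axis i 1) = ap (sc y) (axis i 1)" using \<open>sc x = sc y\<close> by simp
    then have "(axis i 1 \<star> x) $ i = (axis i 1 \<star> y) $ i" using \<open>x \<in> T\<close> \<open>y \<in> T\<close> aps T_def by auto
    then show "x = y" by simp
  qed
  have im: "sc ` T \<subseteq> S" unfolding T_def by auto
  have "finite T" using inj_on_finite[OF inj im S(1)] .
  moreover have "card T < 5" using card_inj_on_le[OF inj im S(1)] S(2) by simp
  ultimately obtain z where "z \<in> dr_center" "z \<notin> T" using center5 by blast
  then show ?thesis using scF T_def by blast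
qed

lemma cen_square:
  assumes center5: "\<And>S. finite S \<Longrightarrow> card S < 5 \<Longrightarrow> \<exists>f\<in>(dr_center :: 'a::division_ring set). f \<notin> S"
  shows "\<exists>f\<in>(cen :: ('a, 'n::finite) endo set). f \<noteq> 0 \<and> f * f \<noteq> 1"
proof -
  have "\<exists>f\<in>(cen :: ('a, 'n) endo set). f \<notin> {0, 1, -1}"
    by (rule cen_avoid[OF center5]) (simp_all add: card_insert_if)
  then obtain f :: "('a, 'n) endo" where f: "f \<in> cen" "f \<notin> {0, 1, -1}" by blast
  have "f * f \<noteq> 1"
  proof
    assume "f * f = 1"
    then have "(f - 1) * (f + 1) = 0" by (simp add: algebra_simps)
    moreover have "f - 1 \<in> (cen :: ('a, 'n) endo set)" using f subrngD(2,6)[OF subrng_centralizer] by blast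
    ultimately have "f - 1 = 0 \<or> f + 1 = 0" using divring_mult_eq_0[OF divring_cen] by blast
    then show False using f by (auto simp: add_eq_0_iff2)
  qed
  then show ?thesis using f by blast
qed

text \<open>The noncentral alternative for G, transported to \<open>endo\<close>. The size of the
  center is stated as the ability to avoid small sets: this covers finite and infinite centers alike
  and is the form in which it is applied.\<close>

locale maximal_solvable =
  fixes G M :: "('a::division_ring, 'n::finite) endo set" and k :: nat
  assumes n2: "CARD('n) \<ge> 2" and noncomm: "\<exists>a b :: 'a. a * b \<noteq> b * a"
    and center5: "\<And>S. finite S \<Longrightarrow> card S < 5 \<Longrightarrow> \<exists>f\<in>(dr_center :: 'a set). f \<notin> S"
    and elem_G: "elem \<subseteq> G" and grp_G: "ugrp G" and grp_M: "ugrp M" and M_G: "M \<subseteq> G" "M \<noteq> G"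
    and maximal: "\<And>K. ugrp K \<Longrightarrow> M \<subseteq> K \<Longrightarrow> K \<subseteq> G \<Longrightarrow> K = M \<or> K = G"
    and sol_M: "sol k M"
begin

abbreviation F :: "('a, 'n) endo set" where "F \<equiv> cen"

lemma F_avoid: "finite S \<Longrightarrow> card S < 5 \<Longrightarrow> \<exists>f\<in>F. f \<notin> S"
  by (rule cen_avoid[OF center5])

lemma F_square: "\<exists>f\<in>F. f \<noteq> 0 \<and> f * f \<noteq> 1"
  by (rule cen_square[OF center5])

definition Minv :: "('a, 'n) endo set \<Rightarrow> bool" where
  "Minv X \<longleftrightarrow> (\<forall>m\<in>M. \<forall>x\<in>X. m * x * ui m \<in> X)"

lemma MinvD: "Minv X \<Longrightarrow> m \<in> M \<Longrightarrow> x \<in> X \<Longrightarrow> m * x * ui m \<in> X"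
  unfolding Minv_def by blast

lemma MinvD2: "Minv X \<Longrightarrow> m \<in> M \<Longrightarrow> x \<in> X \<Longrightarrow> ui m * x * m \<in> X"
  using MinvD[of X "ui m" x] ugrpD[OF grp_M] by simp

lemma M_units: "m \<in> M \<Longrightarrow> m \<in> units" using ugrpD(1)[OF grp_M] .

lemma Minv_centralizer: assumes "Minv Y" shows "Minv (centralizer Y)"
  unfolding Minv_def
proof (intro ballI)
  fix m s assume m: "m \<in> M" and s: "s \<in> centralizer Y"
  have "(m * s * ui m) * y = y * (m * s * ui m)" if y: "y \<in> Y" for y
  proof -
    have "s * (ui m * y * m) = (ui m * y * m) * s" using centralizerD[OF s MinvD2[OF assms m y]] .
    then have "m * (s * (ui m * y * m)) * ui m = m * ((ui m * y * m) * s) * ui m" by simp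
    then show ?thesis using M_units[OF m] by (simp add: mult.assoc)
  qed
  then show "m * s * ui m \<in> centralizer Y" unfolding centralizer_def by blast
qed

text \<open>An M-invariant proper subring is normalized by no group containing all transvections, so M is
  its full normalizer in G; and G contains all commutators of units.\<close>

lemma proper_ring:
  assumes X: "subrng X" "Minv X" "X \<noteq> UNIV" and u: "u \<in> uset X" "u \<notin> F"
  shows "x \<in> uset X \<Longrightarrow> y \<in> uset X \<Longrightarrow> comm x y \<in> M" "sol (Suc k) (uset X)"
proof -
  \<comment> \<open>The normalizer of X in G; both directions of conjugation are listed so that
    inverses stay inside.\<close>
  define K where "K = {g \<in> G. \<forall>x\<in>X. g * x * ui g \<in> X \<and> ui g * x * g \<in> X}"
  have Gu: "g \<in> units" if "g \<in> G" for g using ugrpD(1)[OF grp_G that] .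
  have K: "ugrp K" unfolding ugrp_def
  proof (intro conjI ballI)
    show "K \<subseteq> units" unfolding K_def using Gu by auto
    show "1 \<in> K" unfolding K_def using ugrpD(2)[OF grp_G] by auto
    show "x * y \<in> K" if xy: "x \<in> K" "y \<in> K" for x y
    proof -
      have "(x * y) * z * ui (x * y) = x * (y * z * ui y) * ui x"
        "ui (x * y) * z * (x * y) = ui y * (ui x * z * x) * y" for z
        using xy Gu unfolding K_def by (auto simp: mult.assoc)
      then show ?thesis using xy ugrpD(3)[OF grp_G] unfolding K_def by auto
    qed
    show "ui x \<in> K" if "x \<in> K" for x using that ugrpD(4)[OF grp_G] Gu unfolding K_def by auto
  qed
  have "M \<subseteq> K" unfolding K_def using M_G MinvD[OF X(2)] MinvD2[OF X(2)] by auto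
  moreover have "K \<noteq> G"
  proof
    assume KG: "K = G"
    have "normalizes elem (uset X)" unfolding normalizes_def
    proof (intro ballI)
      fix e h assume e: "e \<in> (elem :: ('a, 'n) endo set)" and h: "h \<in> uset X"
      have eK: "e \<in> K" using KG elem_G e by auto
      have eu: "e \<in> units" using elem_units[OF e] .
      have "e * h * ui e \<in> X" "e * ui h * ui e \<in> X" using eK h unfolding K_def uset_def by auto
      moreover have "ui (e * h * ui e) = e * ui h * ui e" using eu uset_units[OF h] by (simp add: mult.assoc)
      ultimately show "e * h * ui e \<in> uset X" unfolding uset_def using eu uset_units[OF h] by simp
    qed
    moreover obtain a where a: "a \<in> F" "a \<noteq> 0" "a * a \<noteq> 1" using F_square by blast
    ultimately have "elem \<subseteq> uset X"
      using elem_subset_normalized[OF n2 ugrp_uset[OF X(1)] _ _ divring_cen order_refl a] u by blast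
    then have "elem \<subseteq> X" using uset_sub by blast
    then show False using elem_subring[OF n2 X(1)] X(3) by blast
  qed
  ultimately have "K = M" using maximal[OF K] K_def by blast
  then have *: "x \<in> M" if "x \<in> uset X" "x \<in> G" for x
    using that subrngD(4)[OF X(1)] unfolding K_def uset_def by blast
  have c: "comm x y \<in> M" if xy: "x \<in> uset X" "y \<in> uset X" for x y
  proof (rule *)
    show "comm x y \<in> uset X" using ugrp_comm[OF ugrp_uset[OF X(1)] xy] .
    show "comm x y \<in> G" using comm_in_elem[OF n2] xy[THEN uset_units] elem_G by blast
  qed
  show "x \<in> uset X \<Longrightarrow> y \<in> uset X \<Longrightarrow> comm x y \<in> M" by (rule c)
  show "sol (Suc k) (uset X)" using c grp_M sol_M by auto
qed

lemma base_units_not_sol: "\<not> sol l (units :: 'a set)"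
proof
  assume s: "sol l (units :: 'a set)"
  have u: "x \<in> units" if "x \<noteq> 0" for x :: 'a using that unitsI[of x "inverse x"] by simp
  have X: "divring (UNIV :: 'a set)" unfolding divring_def subrng_def using u by auto
  have "card {0, 1, -1 :: 'a} < 5"  by (simp add: card_insert_if)
  then obtain f :: 'a where f: "f \<in> dr_center" "f \<notin> {0, 1, -1}" using center5[of "{0, 1, -1}"] by blast
  have "f * f \<noteq> 1"
  proof
    assume "f * f = 1"
    then have "(f - 1) * (f + 1) = 0" by (simp add: algebra_simps)
    then show False using f by (auto simp: add_eq_0_iff2)
  qed
  moreover have "f \<in> centralizer UNIV" using f(1) unfolding dr_center_def centralizer_def by auto
  moreover have "sol l (uset (UNIV :: 'a set))" using s by (simp add: uset_def)
  ultimately have "x * y = y * x" for x y :: 'a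
    using division_solvable_commutative[OF X] f by blast
  then show False using noncomm by blast
qed

text \<open>The maps 1 + x tensor (a - 1) \<phi>, for nonzero a in D, form a copy of the
  multiplicative group of D inside X. If X is proper its unit group is solvable, which contradicts
  Hua's theorem for D.\<close>

lemma no_base_embedding:
  assumes X: "subrng X" "Minv X" "X \<noteq> UNIV"
    and p: "lfun \<phi>" "\<phi> x = 1" "\<And>a. out x (\<lambda>v. a * \<phi> v) \<in> X"
  shows False
proof -
  define f where "f a = 1 + out x (\<lambda>v. (a - 1) * \<phi> v)" for a
  have fX: "f a \<in> X" for a unfolding f_def using p(3)[of "a - 1"] subrngD(2,3)[OF X(1)] by blast
  have fm: "f (a * b) = f a * f b" for a b
    by (rule endo_eqI) (simp add: f_def p lfunD(1)[OF p(1)] lfunD(2)[OF p(1)], simp add: p algebra_simps vr_distrib)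
  have f1: "f 1 = 1" unfolding f_def by (rule endo_eqI) (simp add: p)
  have fu: "f a \<in> uset X" if "a \<in> units" for a
  proof -
    have "f a * f (ui a) = 1" "f (ui a) * f a = 1" using that f1 by (simp_all flip: fm)
    then have "f a \<in> units" "ui (f a) = f (ui a)" using unitsI ui_eq by blast+
    then show ?thesis unfolding uset_def using fX by simp
  qed
  have "inj f"
  proof (rule injI)
    fix a b assume "f a = f b"
    then have "ap (f a) x = ap (f b) x" by simp
    then have "x \<star> (a - 1) = x \<star> (b - 1)" unfolding f_def by (simp add: p)
    then have "\<phi> (x \<star> (a - 1)) = \<phi> (x \<star> (b - 1))" by simp
    then show "a = b" using p lfunD[OF p(1)] by simp
  qed
  obtain a :: 'a where a: "a \<in> dr_center" "a \<notin> {0, 1}" using center5[of "{0, 1}"] by (auto simp: card_insert_if)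
  have "a \<in> units" using a unitsI[of a "inverse a"] by simp
  then have "f a \<in> uset X" using fu by blast
  moreover have "f a \<notin> F" unfolding f_def by (rule rank_one_not_central[OF n2 p(1,2)]) (use a in auto)
  ultimately have "sol (Suc k) (uset X)" by (rule proper_ring(2)[OF X])
  then have "sol (Suc k) (units :: 'a set)"
    by (rule sol_hom_inj[of _ _ f]) (use fu uset_units fm \<open>inj f\<close> in \<open>auto intro: inj_on_subset\<close>)
  then show False using base_units_not_sol by blast
qed

text \<open>The stabilizer ring of a nontrivial invariant W contains all rank-one maps with image in
  a line of W, and \<open>no_base_embedding\<close> excludes this.\<close>

lemma irreducible:
  assumes W: "dsub W" "\<And>m w. m \<in> M \<Longrightarrow> w \<in> W \<Longrightarrow> ap m w \<in> W"
  shows "W = {0} \<or> W = UNIV"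
proof (rule ccontr)
  assume "\<not> ?thesis"
  then obtain x y where xy: "x \<in> W" "x \<noteq> 0" "y \<notin> W" using dsubD(1)[OF W(1)] by blast
  define X where "X = {r. \<forall>w\<in>W. ap r w \<in> W}"
  obtain \<phi> where p: "lfun \<phi>" "\<phi> x = 1" using exists_lfun_1[OF xy(2)] by blast
  show False
  proof (rule no_base_embedding[OF _ _ _ p])
    show "subrng X" unfolding subrng_def X_def using dsubD[OF W(1)] by auto
    show "Minv X" unfolding Minv_def X_def using W(2) ugrpD(4)[OF grp_M] by auto
    have "ap (out y \<phi>) x \<notin> W" using p xy by simp
    then show "X \<noteq> UNIV" unfolding X_def using xy(1) by blast
    show "out x (\<lambda>v. a * \<phi> v) \<in> X" for a unfolding X_def using p xy dsubD(3)[OF W(1)] by simp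
  qed
qed

section \<open>Centralizers of abelian normal subgroups\<close>

context
  fixes A :: "('a, 'n) endo set"
  assumes A_units: "A \<subseteq> units" and A_inv: "Minv A" and A_ab: "\<And>a b. a \<in> A \<Longrightarrow> b \<in> A \<Longrightarrow> a * b = b * a"
    and A_nc: "\<not> A \<subseteq> F"
begin

text \<open>\<open>L\<close> turns out to be the center of \<open>S\<close>, because the commutative
  A lies in \<open>S\<close>, and \<open>S\<close> is in turn the centralizer of \<open>L\<close>.
  Hence endomorphisms of V over \<open>L\<close> are the elements of \<open>S\<close>, and
  properties of \<open>S\<close> are read off from the \<open>L\<close>-submodules of V.\<close>

definition S where "S = centralizer A"
definition L where "L = centralizer S"

lemma A_S: "A \<subseteq> S" unfolding S_def centralizer_def using A_ab by auto
lemma L_S: "L \<subseteq> S" unfolding L_def S_def using A_S unfolding centralizer_def S_def by auto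
lemma L_comm: "x \<in> L \<Longrightarrow> s \<in> S \<Longrightarrow> x * s = s * x" unfolding L_def by (rule centralizerD)
lemma S_def2: "S = centralizer L"
proof
  show "S \<subseteq> centralizer L" using L_comm unfolding centralizer_def by auto
  have "A \<subseteq> L" unfolding L_def S_def centralizer_def by auto
  then show "centralizer L \<subseteq> S" unfolding S_def centralizer_def by auto
qed
lemma inv_S: "Minv S" unfolding S_def by (rule Minv_centralizer[OF A_inv])
lemma inv_L: "Minv L" unfolding L_def by (rule Minv_centralizer[OF inv_S])
lemma sub_S: "subrng S" and sub_L: "subrng L" unfolding S_def L_def by (rule subrng_centralizer)+

text \<open>Idempotents of L commute, so for a minimal one e and any other f the product f * e is e
  or 0. Rank-one maps that live on the image of e therefore commute with all idempotents of L, and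
  the centralizer of these idempotents is a proper invariant ring containing a copy of D.\<close>

lemma L_idempotent:
  assumes e0: "e0 \<in> L" "e0 * e0 = e0" shows "e0 = 0 \<or> e0 = 1"
proof (rule ccontr)
  assume n: "\<not> ?thesis"
  define I where "I = {e \<in> L. e * e = e}"
  have "Minv I" unfolding Minv_def I_def using MinvD[OF inv_L] M_units
    by (auto simp: mult.assoc) (metis mult.assoc)
  obtain W where W: "\<exists>e\<in>I. e \<noteq> 0 \<and> W = range (ap e)" "\<And>W'. \<exists>e\<in>I. e \<noteq> 0 \<and> W' = range (ap e) \<Longrightarrow> W' \<subseteq> W \<Longrightarrow> W' = W"
  proof (rule dsub_minimal[of "\<lambda>W. \<exists>e\<in>I. e \<noteq> 0 \<and> W = range (ap e)" "range (ap e0)"])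
    show "\<exists>e\<in>I. e \<noteq> 0 \<and> range (ap e0) = range (ap e)" using e0 n unfolding I_def by blast
  qed (blast intro: dsub_image[OF dsub_UNIV])+
  then obtain e where e: "e \<in> I" "e \<noteq> 0" "W = range (ap e)" by blast
  have com: "f * g = g * f" if "f \<in> I" "g \<in> I" for f g
    using L_comm L_S that unfolding I_def by blast
  have ef: "f * e = e \<or> f * e = 0" if f: "f \<in> I" for f
  proof (cases "f * e = 0")
    case False
    have "(f * e) * (f * e) = (f * f) * (e * e)" using com[OF f e(1)] by (metis mult.assoc)
    then have "f * e \<in> I" using f e(1) subrngD(4)[OF sub_L] unfolding I_def by auto
    moreover have "range (ap (f * e)) \<subseteq> W" unfolding e(3) com[OF f e(1)] by auto
    ultimately have "range (ap (f * e)) = W" using W(2) False by blast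
    have "f * e = e"
    proof (rule endo_eqI)
      fix v
      have "ap e v \<in> range (ap (f * e))" using \<open>range (ap (f * e)) = W\<close> e(3) by blast
      then obtain w where w: "ap e v = ap f (ap e w)" by auto
      have "ap f (ap e v) = ap (f * f) (ap e w)" using w by simp
      also have "\<dots> = ap e v" using w f unfolding I_def by simp
      finally show "ap (f * e) v = ap e v" by simp
    qed
    then show ?thesis ..
  qed simp
  obtain v where v: "ap e v \<noteq> 0" using e(2) endo_eqI[of e 0] by auto
  obtain \<phi>0 where p: "lfun \<phi>0" "\<phi>0 (ap e v) = 1" using exists_lfun_1[OF v] by blast
  have ee: "ap e (ap e w) = ap e w" for w
  proof -
    have "e * e = e" using e(1) unfolding I_def by blast
    then show ?thesis by (metis ap_ring(6))
  qed
  show False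
  proof (rule no_base_embedding[of "centralizer I" "\<lambda>w. \<phi>0 (ap e w)" "ap e v"])
    show "subrng (centralizer I)" by (rule subrng_centralizer)
    show "Minv (centralizer I)" by (rule Minv_centralizer[OF \<open>Minv I\<close>])
    show "lfun (\<lambda>w. \<phi>0 (ap e w))" by (rule lfun_ap[OF p(1)])
    show "\<phi>0 (ap e (ap e v)) = 1" using p ee by simp
    show "centralizer I \<noteq> UNIV"
    proof
      assume "centralizer I = UNIV"
      then have "r \<in> centralizer I" for r by blast
      then have "e0 * r = r * e0" for r using centralizerD[of r I e0] e0 unfolding I_def by simp
      then have "e0 \<in> F" unfolding centralizer_def by auto
      then have "e0 \<in> units" using divringD(3)[OF divring_cen] n by blast
      then have "e0 = 1" using e0 by (metis ui_left2 ui_left)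
      then show False using n by blast
    qed
    show "out (ap e v) (\<lambda>w. a * \<phi>0 (ap e w)) \<in> centralizer I" for a
    proof -
      have "out (ap e v) (\<lambda>w. a * \<phi>0 (ap e w)) * f = f * out (ap e v) (\<lambda>w. a * \<phi>0 (ap e w))" if f: "f \<in> I" for f
      proof (rule endo_eqI)
        fix w
        have l: "lfun (\<lambda>w. \<phi>0 (ap e w))" by (rule lfun_ap[OF p(1)])
        have 1: "ap e (ap f w) = ap (f * e) w" using com[OF f e(1)] by (metis ap_ring(6))
        have 2: "ap f (ap e v) = ap (f * e) v" by simp
        show "ap (out (ap e v) (\<lambda>w. a * \<phi>0 (ap e w)) * f) w = ap (f * out (ap e v) (\<lambda>w. a * \<phi>0 (ap e w))) w"
          using ef[OF f] l by (auto simp: 1 2 lfunD(3)[OF p(1)] simp del: ap_ring(6)) (auto simp: 1 2 lfunD(3)[OF p(1)])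
      qed
      then show ?thesis unfolding centralizer_def by blast
    qed
  qed
qed

definition Lst :: "('a^'n) set \<Rightarrow> bool" where
  "Lst W \<longleftrightarrow> dsub W \<and> (\<forall>y\<in>L. \<forall>w\<in>W. ap y w \<in> W)"

lemma LstD: "Lst W \<Longrightarrow> dsub W" "Lst W \<Longrightarrow> y \<in> L \<Longrightarrow> w \<in> W \<Longrightarrow> ap y w \<in> W"
  unfolding Lst_def by auto

lemma L_ap_commute: "y \<in> L \<Longrightarrow> s \<in> S \<Longrightarrow> ap y (ap s v) = ap s (ap y v)"
  using L_comm by (metis ap_ring(6))

lemma Lst_ker: "s \<in> S \<Longrightarrow> Lst {v. ap s v = 0}"
  unfolding Lst_def using dsub_ker[of s] L_ap_commute[symmetric] by auto

lemma Lst_range: "s \<in> S \<Longrightarrow> Lst (range (ap s))"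
  unfolding Lst_def using dsub_image[OF dsub_UNIV] L_ap_commute[of _ s] rangeI[of "ap s"] by fastforce

lemma simple_exists:
  obtains U where "Lst U" "U \<noteq> {0}" "\<And>W. Lst W \<Longrightarrow> W \<noteq> {0} \<Longrightarrow> W \<subseteq> U \<Longrightarrow> W = U"
proof -
  obtain v :: "'a^'n" where v: "v \<noteq> 0" using zero_neq_one endo_eqI[of "0 :: ('a,'n) endo" 1] by (metis ap_ring(1,2))
  have "Lst UNIV" unfolding Lst_def using dsub_UNIV by auto
  moreover have "UNIV \<noteq> {0 :: 'a^'n}" using v by auto
  ultimately have P0: "Lst UNIV \<and> UNIV \<noteq> {0 :: 'a^'n}" by blast
  obtain U where U: "Lst U \<and> U \<noteq> {0}" "\<And>W. Lst W \<and> W \<noteq> {0} \<Longrightarrow> W \<subseteq> U \<Longrightarrow> W = U"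
    by (rule dsub_minimal[of "\<lambda>W. Lst W \<and> W \<noteq> {0}", OF P0]) (use LstD(1) in blast)+
  show thesis by (rule that[of U]) (use U in blast)+
qed

text \<open>Clifford's argument for semisimplicity. If U2 + Y with Y maximal were proper,
  irreducibility of M would give a translate of a simple submodule U not contained in it; by
  simplicity that translate meets the sum in 0, and it enlarges Y.\<close>

lemma Lst_complement:
  assumes U2: "Lst U2"
  obtains Y where "Lst Y" "U2 \<inter> Y = {0}" "vsum U2 Y = UNIV"
proof -
  obtain U where U: "Lst U" "U \<noteq> {0}" "\<And>W. Lst W \<Longrightarrow> W \<noteq> {0} \<Longrightarrow> W \<subseteq> U \<Longrightarrow> W = U"
    using simple_exists by blast
  have L0: "Lst {0}" unfolding Lst_def using dsub_0 by auto
  obtain Y where Y: "Lst Y \<and> U2 \<inter> Y = {0}" "\<And>Y'. Lst Y' \<and> U2 \<inter> Y' = {0} \<Longrightarrow> Y \<subseteq> Y' \<Longrightarrow> Y' = Y"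
    by (rule dsub_maximal[of "\<lambda>Y. Lst Y \<and> U2 \<inter> Y = {0}" "{0}"]) (use L0 LstD(1) dsubD(1)[OF LstD(1)[OF U2]] in auto)
  define Z where "Z = vsum U2 Y"
  have dU: "dsub U2" "dsub Y" "dsub U" using U2 Y U LstD(1) by auto
  have dZ: "dsub Z" unfolding Z_def by (rule dsub_vsum[OF dU(1,2)])
  have ZL: "ap y z \<in> Z" if "y \<in> L" "z \<in> Z" for y z
    using that LstD(2)[OF U2 that(1)] LstD(2)[OF conjunct1[OF Y(1)] that(1)] unfolding Z_def vsum_def by fastforce
  have YZ: "Y \<subseteq> Z" using vsum_supset[OF dU(1,2)] Z_def by simp
  have "Z = UNIV"
  proof (rule ccontr)
    assume nZ: "Z \<noteq> UNIV"
    \<comment> \<open>The largest M-stable subspace of \<open>Z\<close>; it is 0 by irreducibility,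
      so some translate of U leaves \<open>Z\<close>.\<close>
    define T where "T = {v. \<forall>m\<in>M. ap m v \<in> Z}"
    have "T = {0} \<or> T = UNIV"
    proof (rule irreducible)
      show "dsub T" unfolding dsub_def T_def using dsubD[OF dZ] by auto
      fix m w assume "m \<in> M" "w \<in> T"
      then have "ap (m' * m) w \<in> Z" if "m' \<in> M" for m' using that ugrpD(3)[OF grp_M] unfolding T_def by blast
      then show "ap m w \<in> T" unfolding T_def by simp
    qed
    moreover have "T \<noteq> UNIV"
    proof
      assume "T = UNIV"
      then have "ap 1 v \<in> Z" for v using ugrpD(2)[OF grp_M] unfolding T_def by blast
      then show False using nZ by auto
    qed
    ultimately have "T = {0}" by blast
    then have "\<not> U \<subseteq> T" using U(2) dsubD(1)[OF dU(3)] by blast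
    then obtain m where m: "m \<in> M" "\<not> ap m ` U \<subseteq> Z" unfolding T_def by blast
    have mu: "m \<in> units" using M_units m by blast
    have ym: "ap y (ap m v) = ap m (ap (ui m * y * m) v)" for y v using mu by simp
    have mY: "ap m (ap y v) = ap (m * y * ui m) (ap m v)" for y v using mu by simp
    have LmU: "Lst (ap m ` U)" unfolding Lst_def
      using dsub_image[OF dU(3)] ym LstD(2)[OF U(1)] MinvD2[OF inv_L m(1)] by blast
    \<comment> \<open>The intersection of the translate with \<open>Z\<close>, pulled back to U; it
      is stable under L because m normalizes L.\<close>
    define U' where "U' = {u \<in> U. ap m u \<in> Z}"
    have "Lst U'" unfolding Lst_def
    proof (intro conjI ballI)
      show "dsub U'" unfolding dsub_def U'_def using dsubD[OF dZ] dsubD[OF dU(3)] by auto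
      fix y w assume y: "y \<in> L" and w: "w \<in> U'"
      have "ap (m * y * ui m) (ap m w) \<in> Z" using ZL[OF MinvD[OF inv_L m(1) y]] w unfolding U'_def by blast
      then have "ap m (ap y w) \<in> Z" unfolding mY .
      then show "ap y w \<in> U'" using w LstD(2)[OF U(1) y] unfolding U'_def by blast
    qed
    moreover have "U' \<subseteq> U" "U' \<noteq> U" unfolding U'_def using m(2) by auto
    ultimately have U'0: "U' = {0}" using U(3) by blast
    define Y' where "Y' = vsum Y (ap m ` U)"
    have dmU: "dsub (ap m ` U)" using LmU LstD(1) by blast
    have "Lst Y'" unfolding Lst_def
    proof (intro conjI ballI)
      show "dsub Y'" unfolding Y'_def by (rule dsub_vsum[OF dU(2) dmU])
      fix y w assume "y \<in> L" "w \<in> Y'"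
      then show "ap y w \<in> Y'" unfolding Y'_def vsum_def
        using LstD(2)[OF conjunct1[OF Y(1)]] LstD(2)[OF LmU] by fastforce
    qed
    moreover have "U2 \<inter> Y' = {0}"
    proof -
      have "v = 0" if v: "v \<in> U2" "v \<in> Y'" for v
      proof -
        obtain y u where yu: "v = y + ap m u" "y \<in> Y" "u \<in> U" using v(2) unfolding Y'_def vsum_def by blast
        have "v \<in> Z" using vsum_supset[OF dU(1,2)] v(1) unfolding Z_def by blast
        then have "v - y \<in> Z" using dsubD(5)[OF dZ] YZ yu(2) by blast
        then have "u \<in> U'" unfolding U'_def using yu by simp
        then have "u = 0" using U'0 by blast
        then have "v \<in> U2 \<inter> Y" using v yu by simp
        then show "v = 0" using Y(1) by blast
      qed
      then show ?thesis using dsubD(1)[OF dU(1)] dsubD(1)[OF LstD(1)[OF \<open>Lst Y'\<close>]] by blast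
    qed
    moreover have "Y \<subseteq> Y'" "ap m ` U \<subseteq> Y'" using vsum_supset[OF dU(2) dmU] unfolding Y'_def by auto
    ultimately have "ap m ` U \<subseteq> Y" using Y(2) by blast
    then show False using m(2) YZ by blast
  qed
  then show thesis using that Y(1) unfolding Z_def by blast
qed

lemma Lst_projection_S:
  assumes "Lst U" "Lst W"
    and e: "\<And>u. u \<in> U \<Longrightarrow> ap e u = u" "\<And>w. w \<in> W \<Longrightarrow> ap e w = 0" "\<And>v. ap e v \<in> U" "\<And>v. v - ap e v \<in> W"
  shows "e \<in> S"
  unfolding S_def2 centralizer_def
  using projection_commute[OF e] LstD(2)[OF assms(1)] LstD(2)[OF assms(2)] by blast

text \<open>Von Neumann regularity: with L-stable complements of kernel and image, x is inverted
  from its image to the complement of its kernel, and the inverse is extended by 0.\<close>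

lemma S_regular:
  assumes x: "x \<in> S" shows "\<exists>y\<in>S. x * y * x = x"
proof -
  obtain C where C: "Lst C" "{v. ap x v = 0} \<inter> C = {0}" "vsum {v. ap x v = 0} C = UNIV"
    using Lst_complement[OF Lst_ker[OF x]] by blast
  obtain C' where C': "Lst C'" "range (ap x) \<inter> C' = {0}" "vsum (range (ap x)) C' = UNIV"
    using Lst_complement[OF Lst_range[OF x]] by blast
  obtain p where p: "\<And>u. u \<in> range (ap x) \<Longrightarrow> ap p u = u" "\<And>w. w \<in> C' \<Longrightarrow> ap p w = 0"
    "\<And>v. ap p v \<in> range (ap x)" "\<And>v. v - ap p v \<in> C'"
    by (rule exists_projection[OF LstD(1)[OF Lst_range[OF x]] LstD(1)[OF C'(1)] C'(2,3)]) blast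
  have pS: "p \<in> S" by (rule Lst_projection_S[OF Lst_range[OF x] C'(1) p])
  define f where "f v = (THE c. c \<in> C \<and> ap x c = ap p v)" for v
  note dC = dsubD[OF LstD(1)[OF C(1)]]
  have feq: "f v = c" if "c \<in> C" "ap x c = ap p v" for v c
    unfolding f_def
  proof (rule the_equality)
    fix c' assume c': "c' \<in> C \<and> ap x c' = ap p v"
    then have "c' - c \<in> {v. ap x v = 0} \<inter> C" using that dC(5) by auto
    then have "c' - c = 0" unfolding C(2) by blast
    then show "c' = c" by simp
  qed (use that in simp)
  have f: "f v \<in> C \<and> ap x (f v) = ap p v" for v
  proof -
    obtain w where w: "ap p v = ap x w" using p(3) by blast
    have "w \<in> vsum {v. ap x v = 0} C" using C(3) by simp
    then obtain u c where "w = u + c" "ap x u = 0" "c \<in> C" unfolding vsum_def by blast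
    then show ?thesis using feq[of c v] w by simp
  qed
  have ap: "ap (Abs_endo f) v = f v" for v
    by (rule ap_Abs; rule feq) (use f dC in \<open>simp_all\<close>)
  have "Abs_endo f \<in> S" unfolding S_def2 centralizer_def
  proof safe
    fix y assume y: "y \<in> L"
    show "Abs_endo f * y = y * Abs_endo f"
    proof (rule endo_eqI, simp add: ap, rule feq)
      fix v
      show "ap y (f v) \<in> C" using LstD(2)[OF C(1) y] f by blast
      show "ap x (ap y (f v)) = ap p (ap y v)"
        using L_ap_commute[OF y x] L_ap_commute[OF y pS] f by metis
    qed
  qed
  moreover have "x * Abs_endo f * x = x" by (rule endo_eqI) (use f p(1) ap in simp)
  ultimately show ?thesis by blast
qed

lemma S_proper: "S \<noteq> UNIV"
proof
  assume "S = UNIV"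
  then have "a * r = r * a" if "a \<in> A" for a r using centralizerD[of r A a] that unfolding S_def by simp
  then have "A \<subseteq> F" unfolding centralizer_def by auto
  then show False using A_nc by blast
qed

lemma sol_S: "sol (Suc k) (uset S)"
proof -
  obtain a where a: "a \<in> A" "a \<notin> F" using A_nc by blast
  have "a \<in> uset S" unfolding uset_def using a A_S A_units centralizer_ui[of a A] unfolding S_def by auto
  then show ?thesis using proper_ring(2)[OF sub_S inv_S S_proper] a by blast
qed

text \<open>Regularity completes x to a pair of matrix units inside S, which the solvability of its
  unit group forbids.\<close>

lemma S_no_square_zero:
  assumes x: "x \<in> S" "x * x = 0" shows "x = 0"
proof (rule ccontr)
  assume x0: "x \<noteq> 0"
  obtain y0 where y0: "y0 \<in> S" "x * y0 * x = x" using S_regular[OF x(1)] by blast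
  define y where "y = y0 * x * y0"
  have yS: "y \<in> S" unfolding y_def using y0 x subrngD(4)[OF sub_S] by auto
  have r: "x * (y0 * x) = x" "x * (x * r) = 0" "x * (y0 * (x * r)) = x * r" for r
    using y0(2) x(2) by (simp_all flip: mult.assoc)
  have xyx: "x * y * x = x" and yxy: "y * x * y = y" unfolding y_def by (simp_all add: mult.assoc r)
  have r': "x * (y * x) = x" "y * (x * y) = y" "x * (y * (x * r)) = x * r" "y * (x * (y * r)) = y * r" for r
    using xyx yxy by (simp_all flip: mult.assoc)
  \<comment> \<open>The square of \<open>y\<close> may be nonzero. The factor
    \<open>1 - x * y\<close> corrects this, because y * (1 - x * y) = 0.\<close>
  define z where "z = (1 - x * y) * y"
  have zS: "z \<in> S" unfolding z_def using x yS subrngD[OF sub_S] by auto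
  have z: "z * z = 0" "x * z * x = x" "z * x * z = z" unfolding z_def
    using r(2) x(2) by (simp_all add: algebra_simps r')
  obtain a where a: "a \<in> F" "a \<noteq> 0" "a * a \<noteq> 1" using F_square by blast
  have "F \<subseteq> S" unfolding S_def by (rule cen_sub_centralizer)
  then have "\<not> sol (Suc k) (uset S)"
    using ring_matrix_units_not_sol[OF x(2) z x0 divring_cen order_refl a sub_S _ x(1) zS] by blast
  then show False using sol_S by blast
qed

text \<open>Without elements of square zero, the two off-diagonal corners of an idempotent of S
  vanish. The projection to W is thus central in S, so it is an idempotent of L and trivial.\<close>

lemma S_simple:
  assumes W: "Lst W" shows "W = {0} \<or> W = UNIV"
proof (rule ccontr)
  assume n: "\<not> ?thesis"
  obtain Y where Y: "Lst Y" "W \<inter> Y = {0}" "vsum W Y = UNIV" using Lst_complement[OF W] by blast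
  obtain e where e: "\<And>u. u \<in> W \<Longrightarrow> ap e u = u" "\<And>w. w \<in> Y \<Longrightarrow> ap e w = 0"
    "\<And>v. ap e v \<in> W" "e * e = e" "\<And>v. v - ap e v \<in> Y"
    by (rule exists_projection[OF LstD(1)[OF W] LstD(1)[OF Y(1)] Y(2,3)]) blast
  have eS: "e \<in> S" by (rule Lst_projection_S[OF W Y(1) e(1-3,5)])
  have "e * s = s * e" if s: "s \<in> S" for s
  proof -
    have ee: "e * (e * r) = e * r" for r using e(4) by (simp flip: mult.assoc)
    have 1: "e * s * (1 - e) = 0"
      by (rule S_no_square_zero) (use eS s subrngD[OF sub_S] in \<open>auto simp: algebra_simps ee\<close>)
    have 2: "(1 - e) * s * e = 0"
      by (rule S_no_square_zero) (use eS s subrngD[OF sub_S] in \<open>auto simp: algebra_simps ee e(4)\<close>)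
    have "e * s - e * s * e = 0" using 1 by (simp add: right_diff_distrib)
    moreover have "s * e - e * s * e = 0" using 2 by (simp add: left_diff_distrib)
    ultimately have "e * s = e * s * e" "s * e = e * s * e" by simp_all
    then show ?thesis by metis
  qed
  then have "e \<in> L" unfolding L_def centralizer_def by blast
  then have "e = 0 \<or> e = 1" using L_idempotent e(4) by blast
  then show False
  proof
    assume "e = 0"
    then have "W \<subseteq> {0}" using e(1) by fastforce
    then show False using n dsubD(1)[OF LstD(1)[OF W]] by blast
  next
    assume "e = 1"
    then have "v \<in> W" for v using e(3)[of v] by simp
    then show False using n by blast
  qed
qed

lemma divring_S: "divring S"
  unfolding divring_def
proof (intro conjI ballI impI)
  fix x assume x: "x \<in> S" "x \<noteq> 0"
  have "{v. ap x v = 0} \<noteq> UNIV" using x(2) endo_eqI[of x 0] by auto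
  then have "{v. ap x v = 0} = {0}" using S_simple[OF Lst_ker[OF x(1)]] by blast
  then show u: "x \<in> units" by (intro inj_imp_unit) blast
  show "ui x \<in> S" using centralizer_ui x u unfolding S_def by blast
qed (rule sub_S)

lemma S_commutative: "x \<in> S \<Longrightarrow> y \<in> S \<Longrightarrow> x * y = y * x"
proof -
  obtain a where a: "a \<in> F" "a \<noteq> 0" "a * a \<noteq> 1" using F_square by blast
  have "a \<in> S" "a \<in> centralizer S" using a cen_sub_centralizer unfolding S_def by blast+
  then show "x \<in> S \<Longrightarrow> y \<in> S \<Longrightarrow> x * y = y * x"
    using division_solvable_commutative[OF divring_S sol_S] a by blast
qed

end

theorem centralizer_abelian_normal:
  assumes "A \<subseteq> units" "Minv A" "\<And>a b. a \<in> A \<Longrightarrow> b \<in> A \<Longrightarrow> a * b = b * a" "\<not> A \<subseteq> F"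
  shows "divring (centralizer A)" "\<And>x y. x \<in> centralizer A \<Longrightarrow> y \<in> centralizer A \<Longrightarrow> x * y = y * x"
  using divring_S[OF assms] S_commutative[OF assms] S_def[OF assms] by simp_all

end

section \<open>Linear systems over a division subring\<close>

text \<open>Gaussian elimination over the possibly noncommutative K with the unknowns as left
  coefficients: an equation r with a nonzero entry is solved for the unknown
  \<open>t0\<close>.\<close>

lemma homogeneous_system:
  fixes m :: "'t \<Rightarrow> 's \<Rightarrow> 'r::ring_1"
  assumes K: "divring K" and "finite R" "finite T" "card R < card T" "\<And>t r. t \<in> T \<Longrightarrow> r \<in> R \<Longrightarrow> m t r \<in> K"
  shows "\<exists>c. (\<forall>t. c t \<in> K) \<and> (\<exists>t\<in>T. c t \<noteq> 0) \<and> (\<forall>r\<in>R. (\<Sum>t\<in>T. c t * m t r) = 0)"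
  using assms(2-5)
proof (induction R arbitrary: T m rule: finite_induct)
  case empty
  then obtain t where "t \<in> T" by fastforce
  then have "\<exists>t\<in>T. (1::'r) \<noteq> 0" using unit_nonzero[OF units_1] by blast
  then show ?case using subrngD(2)[OF divringD(1)[OF K]] by (intro exI[of _ "\<lambda>_. 1"]) simp
next
  case (insert r R)
  note sK = subrngD[OF divringD(1)[OF K]]
  show ?case
  proof (cases "\<forall>t\<in>T. m t r = 0")
    case True
    have "card R < card T" using insert by simp
    then obtain c where "\<forall>t. c t \<in> K" "\<exists>t\<in>T. c t \<noteq> 0" "\<forall>r\<in>R. (\<Sum>t\<in>T. c t * m t r) = 0"
      using insert.IH[of T m] insert.prems(1,3) by auto
    then show ?thesis using True by (intro exI[of _ c]) auto
  next
    case False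
    then obtain t0 where t0: "t0 \<in> T" "m t0 r \<noteq> 0" by blast
    define u where "u = ui (m t0 r)"
    have mu: "m t0 r \<in> units" "u \<in> K" unfolding u_def using divringD(3,4)[OF K] insert.prems t0 by auto
    define T' where "T' = T - {t0}"
    define m' where "m' t s = m t s - m t r * u * m t0 s" for t s
    have T': "finite T'" "card R < card T'" "t0 \<notin> T'" "T = insert t0 T'"
      unfolding T'_def using insert t0 by auto
    obtain c' where c': "\<forall>t. c' t \<in> K" "\<exists>t\<in>T'. c' t \<noteq> 0" "\<forall>s\<in>R. (\<Sum>t\<in>T'. c' t * m' t s) = 0"
      using insert.IH[of T' m'] T' insert.prems t0 mu sK unfolding m'_def by auto
    define c where "c t = (if t = t0 then - (\<Sum>t\<in>T'. c' t * m t r * u) else c' t)" for t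
    have "c' t * m t r * u \<in> K" if "t \<in> T'" for t
      using that c'(1) T' insert.prems(3) mu sK(4) by auto
    then have "(\<Sum>t\<in>T'. c' t * m t r * u) \<in> K" by (rule subrng_sum[OF divringD(1)[OF K]])
    then have "c t0 \<in> K" unfolding c_def using sK(5) by auto
    then have 1: "\<forall>t. c t \<in> K" using c'(1) unfolding c_def by auto
    have 2: "\<exists>t\<in>T. c t \<noteq> 0" using c'(2) T' unfolding c_def by auto
    have e: "(\<Sum>t\<in>T. c t * m t s) = (\<Sum>t\<in>T'. c' t * (m t s - m t r * u * m t0 s))" for s
    proof -
      have "(\<Sum>t\<in>T. c t * m t s) = c t0 * m t0 s + (\<Sum>t\<in>T'. c t * m t s)" using T' by simp
      also have "(\<Sum>t\<in>T'. c t * m t s) = (\<Sum>t\<in>T'. c' t * m t s)"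
        by (rule sum.cong) (use T' in \<open>auto simp: c_def\<close>)
      also have "c t0 * m t0 s = - (\<Sum>t\<in>T'. c' t * (m t r * u * m t0 s))"
        unfolding c_def by (simp add: sum_distrib_right mult.assoc)
      finally show ?thesis by (simp add: right_diff_distrib sum_subtractf)
    qed
    have "(\<Sum>t\<in>T. c t * m t s) = 0" if "s \<in> insert r R" for s
    proof (cases "s = r")
      case True
      have "m t r * u * m t0 r = m t r" for t using mu(1) unfolding u_def by (simp add: mult.assoc)
      then show ?thesis unfolding e True by simp
    next
      case False
      then show ?thesis using that c'(3) unfolding e m'_def by simp
    qed
    then show ?thesis using 1 2 by blast
  qed
qed

text \<open>Left fractions are formed inside the ambient ring, where the denominators are already
  invertible. Common left multiples give common denominators for sums and move a denominator past a
  numerator in products.\<close>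

lemma divring_ore_quotients:
  fixes T :: "'r::ring_1 set"
  assumes T: "subrng T" "\<And>a. a \<in> T \<Longrightarrow> a \<noteq> 0 \<Longrightarrow> a \<in> units"
    and ore: "\<And>a b. a \<in> T \<Longrightarrow> b \<in> T \<Longrightarrow> a \<noteq> 0 \<Longrightarrow> b \<noteq> 0 \<Longrightarrow> \<exists>p\<in>T. \<exists>q\<in>T. p * a = q * b \<and> p * a \<noteq> 0"
  shows "divring {ui a * b | a b. a \<in> T \<and> b \<in> T \<and> a \<noteq> 0}" (is "divring ?X")
proof -
  note sT = subrngD[OF T(1)]
  have XI: "ui a * b \<in> ?X" if "a \<in> T" "b \<in> T" "a \<noteq> 0" for a b using that by blast
  have 1: "1 \<noteq> (0::'r)" using unit_nonzero[OF units_1] .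
  have nz: "p \<noteq> 0" if "p * a \<noteq> 0" for p a :: 'r using that by auto
  have X0: "0 \<in> ?X" using XI[OF sT(2,1) 1] by simp
  have sub: "subrng ?X" unfolding subrng_def
  proof (intro conjI ballI)
    show "0 \<in> ?X" by (rule X0)
    show "1 \<in> ?X" using XI[OF sT(2,2) 1] by simp
  next
    fix x y assume "x \<in> ?X" "y \<in> ?X"
    then obtain a b c d where xy: "x = ui a * b" "y = ui c * d" "a \<in> T" "b \<in> T" "a \<noteq> 0" "c \<in> T" "d \<in> T" "c \<noteq> 0"
      by blast
    have u: "a \<in> units" "c \<in> units" using T(2) xy by auto
    obtain p q where pq: "p \<in> T" "q \<in> T" "p * a = q * c" "p * a \<noteq> 0" using ore[OF xy(3,6,5,8)] by blast
    have pqu: "p \<in> units" "q \<in> units" using T(2) pq nz[of p a] nz[of q c] by auto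
    have "x = ui (p * a) * (p * b)" using u pqu xy by (simp add: mult.assoc)
    moreover have "y = ui (p * a) * (q * d)" unfolding pq(3) using u pqu xy by (simp add: mult.assoc)
    ultimately have "x + y = ui (p * a) * (p * b + q * d)" by (simp add: distrib_left)
    then show "x + y \<in> ?X" using XI[of "p * a" "p * b + q * d"] pq xy sT by simp
    show "x * y \<in> ?X"
    proof (cases "b = 0")
      case True
      then show ?thesis using X0 xy by simp
    next
      case False
      obtain p q where pq: "p \<in> T" "q \<in> T" "p * b = q * c" "p * b \<noteq> 0" using ore[OF xy(4,6) False xy(8)] by blast
      have pu: "p \<in> units" using T(2)[OF pq(1)] nz[OF pq(4)] by simp
      have "b * ui c = ui p * q"
      proof -
        have "b = ui p * (q * c)" using pq(3) pu by (metis ui_left2)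
        then show ?thesis using u by (simp add: mult.assoc)
      qed
      then have "x * y = ui a * (ui p * q) * d" using xy by (metis mult.assoc)
      then have "x * y = ui (p * a) * (q * d)" using pu u by (simp add: mult.assoc)
      moreover have "p * a \<noteq> 0" using unit_nonzero[OF units_mult[OF pu u(1)]] .
      ultimately show ?thesis using XI[of "p * a" "q * d"] pq xy sT by simp
    qed
  next
    fix x assume "x \<in> ?X"
    then obtain a b where x: "x = ui a * b" "a \<in> T" "b \<in> T" "a \<noteq> 0" by blast
    then have "- x = ui a * (- b)" by simp
    then show "- x \<in> ?X" using XI[OF x(2) sT(5)[OF x(3)] x(4)] by simp
  qed
  show ?thesis unfolding divring_def
  proof (intro conjI sub ballI impI)
    fix x assume "x \<in> ?X" "x \<noteq> 0"
    then obtain a b where x: "x = ui a * b" "a \<in> T" "b \<in> T" "a \<noteq> 0" by blast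
    have b0: "b \<noteq> 0" using x(1) \<open>x \<noteq> 0\<close> by auto
    have u: "a \<in> units" "b \<in> units" using T(2) x b0 by auto
    then show "x \<in> units" using x by simp
    have "ui x = ui b * a" using x u by simp
    then show "ui x \<in> ?X" using XI[OF x(3,2) b0] by simp
  qed
qed

section \<open>Spans of groups over a field they normalize\<close>

text \<open>Left K-combinations of N form a ring because \<open>n * x = (n * x * ui n) * n\<close>
  moves coefficients to the left.\<close>

locale norm_span =
  fixes K N :: "'r::ring_1 set"
  assumes subK: "subrng K" and grp_N: "ugrp N" and K_norm: "\<And>n x. n \<in> N \<Longrightarrow> x \<in> K \<Longrightarrow> n * x * ui n \<in> K"
begin

lemmas sK = subrngD[OF subK]
lemmas N_units = ugrpD(1)[OF grp_N]
lemmas N_mult = ugrpD(3)[OF grp_N]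
lemmas N_ui = ugrpD(4)[OF grp_N]

definition kspan :: "'r set \<Rightarrow> 'r set" where
  "kspan P = {x. \<exists>I c. finite I \<and> I \<subseteq> P \<and> (\<forall>i\<in>I. c i \<in> K) \<and> x = (\<Sum>i\<in>I. c i * i)}"

lemma kspanI: "finite I \<Longrightarrow> I \<subseteq> P \<Longrightarrow> (\<And>i. i \<in> I \<Longrightarrow> c i \<in> K) \<Longrightarrow> (\<Sum>i\<in>I. c i * i) \<in> kspan P"
  unfolding kspan_def by blast

lemma kspan_mono: "P \<subseteq> Q \<Longrightarrow> kspan P \<subseteq> kspan Q"
  unfolding kspan_def by blast

lemma kspan_0: "0 \<in> kspan P" using kspanI[of "{}" P] by simp

lemma kspan_base: "n \<in> P \<Longrightarrow> c \<in> K \<Longrightarrow> c * n \<in> kspan P"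
  using kspanI[of "{n}" P "\<lambda>_. c"] by simp

lemma kspan_base1: "n \<in> P \<Longrightarrow> n \<in> kspan P"
  using kspan_base[OF _ sK(2)] by fastforce

lemma kspan_add: assumes "x \<in> kspan P" "y \<in> kspan P" shows "x + y \<in> kspan P"
proof -
  obtain I c J d where x: "finite I" "I \<subseteq> P" "\<forall>i\<in>I. c i \<in> K" "x = (\<Sum>i\<in>I. c i * i)"
    and y: "finite J" "J \<subseteq> P" "\<forall>i\<in>J. d i \<in> K" "y = (\<Sum>i\<in>J. d i * i)" using assms unfolding kspan_def by blast
  define c' where "c' i = (if i \<in> I then c i else 0)" for i
  define d' where "d' i = (if i \<in> J then d i else 0)" for i
  have "x = (\<Sum>i\<in>I\<union>J. c' i * i)" unfolding x(4) c'_def using x y by (intro sum.mono_neutral_cong_left) auto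
  moreover have "y = (\<Sum>i\<in>I\<union>J. d' i * i)" unfolding y(4) d'_def using x y by (intro sum.mono_neutral_cong_left) auto
  ultimately have "x + y = (\<Sum>i\<in>I\<union>J. (c' i + d' i) * i)" by (simp add: sum.distrib distrib_right)
  moreover have "c' i + d' i \<in> K" for i unfolding c'_def d'_def using x y sK by auto
  ultimately show ?thesis using kspanI[of "I \<union> J" P "\<lambda>i. c' i + d' i"] x y by simp
qed

lemma kspan_scale: assumes "x \<in> kspan P" "a \<in> K" shows "a * x \<in> kspan P"
proof -
  obtain I c where x: "finite I" "I \<subseteq> P" "\<forall>i\<in>I. c i \<in> K" "x = (\<Sum>i\<in>I. c i * i)" using assms unfolding kspan_def by blast
  then have "a * x = (\<Sum>i\<in>I. (a * c i) * i)" by (simp add: sum_distrib_left mult.assoc)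
  then show ?thesis using kspanI[of I P "\<lambda>i. a * c i"] x sK(4)[OF assms(2)] by auto
qed

lemma kspan_minus: "x \<in> kspan P \<Longrightarrow> - x \<in> kspan P"
  using kspan_scale[of x P "-1"] sK(2,5) by simp

lemma kspan_diff: "x \<in> kspan P \<Longrightarrow> y \<in> kspan P \<Longrightarrow> x - y \<in> kspan P"
  using kspan_add[of x P "- y"] kspan_minus by simp

lemma kspan_sum: "(\<And>i. i \<in> I \<Longrightarrow> f i \<in> kspan P) \<Longrightarrow> sum f I \<in> kspan P"
  by (induction I rule: infinite_finite_induct) (auto intro: kspan_0 kspan_add)

lemma kspan_least:
  assumes "\<And>n. n \<in> P \<Longrightarrow> n \<in> kspan Q" shows "kspan P \<subseteq> kspan Q"
proof
  fix x assume "x \<in> kspan P"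
  then obtain I c where x: "finite I" "I \<subseteq> P" "\<forall>i\<in>I. c i \<in> K" "x = (\<Sum>i\<in>I. c i * i)" unfolding kspan_def by blast
  show "x \<in> kspan Q" unfolding x(4) by (rule kspan_sum) (use x assms kspan_scale in blast)
qed

lemma move_K: "n \<in> N \<Longrightarrow> n * x = (n * x * ui n) * n"
  using N_units by (simp add: mult.assoc)

lemma kspan_mult:
  assumes PN: "P \<subseteq> N" and PQ: "\<And>p q. p \<in> P \<Longrightarrow> q \<in> Q \<Longrightarrow> p * q \<in> kspan R"
    and x: "x \<in> kspan P" and y: "y \<in> kspan Q"
  shows "x * y \<in> kspan R"
proof -
  obtain I c where x: "finite I" "I \<subseteq> P" "\<forall>i\<in>I. c i \<in> K" "x = (\<Sum>i\<in>I. c i * i)" using x unfolding kspan_def by blast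
  obtain J d where y: "finite J" "J \<subseteq> Q" "\<forall>i\<in>J. d i \<in> K" "y = (\<Sum>i\<in>J. d i * i)" using y unfolding kspan_def by blast
  have "x * y = (\<Sum>i\<in>I. \<Sum>j\<in>J. (c i * i) * (d j * j))" unfolding x(4) y(4) by (rule sum_product)
  moreover have "(c i * i) * (d j * j) \<in> kspan R" if ij: "i \<in> I" "j \<in> J" for i j
  proof -
    have iN: "i \<in> N" using ij x PN by blast
    have "(c i * i) * (d j * j) = c i * (i * d j) * j" by (simp add: mult.assoc)
    also have "\<dots> = c i * ((i * d j * ui i) * i) * j" using move_K[OF iN, of "d j"] by simp
    also have "\<dots> = (c i * (i * d j * ui i)) * (i * j)" by (simp add: mult.assoc)
    also have "\<dots> \<in> kspan R"
      by (rule kspan_scale[OF PQ]) (use ij x y K_norm[OF iN] sK(4) in blast)+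
    finally show ?thesis .
  qed
  ultimately show ?thesis by (auto intro!: kspan_sum)
qed

lemma subrng_kspan: "subrng (kspan N)"
proof -
  have "x * y \<in> kspan N" if "x \<in> kspan N" "y \<in> kspan N" for x y
    by (rule kspan_mult[OF order_refl kspan_base1[OF N_mult] that])
  then show ?thesis unfolding subrng_def using kspan_0 kspan_base1[OF ugrpD(2)[OF grp_N]] kspan_add kspan_minus by blast
qed

end

text \<open>A crossed product inside a given ring: conjugation by w in \<Omega> fixes K and
  multiplies n in N by the factor \<open>comm n w\<close> of K, and these characters separate the
  cosets of K. Used with K = L and \<open>\<Omega> = L - {0}\<close>, and with K = F and \<Omega>
  the group itself.\<close>

locale crossed =
  fixes K N \<Omega> :: "'r::ring_1 set"
  assumes divK: "divring K" and K_comm: "\<And>x y. x \<in> K \<Longrightarrow> y \<in> K \<Longrightarrow> x * y = y * x"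
    and grp_N': "ugrp N" and K_norm': "\<And>n x. n \<in> N \<Longrightarrow> x \<in> K \<Longrightarrow> n * x * ui n \<in> K"
    and Om_units: "\<Omega> \<subseteq> units" and Om_K: "\<And>w x. w \<in> \<Omega> \<Longrightarrow> x \<in> K \<Longrightarrow> w * x = x * w"
    and Om_N: "\<And>n w. n \<in> N \<Longrightarrow> w \<in> \<Omega> \<Longrightarrow> comm n w \<in> K"
    and faithful: "\<And>n. n \<in> N \<Longrightarrow> (\<And>w. w \<in> \<Omega> \<Longrightarrow> n * w = w * n) \<Longrightarrow> n \<in> K"
begin

sublocale norm_span K N
  using divringD(1)[OF divK] grp_N' K_norm' by unfold_locales

lemmas Ku = divringD(3,4)[OF divK]

lemma K_uset: "x \<in> K \<Longrightarrow> x \<in> units \<Longrightarrow> ui x \<in> K"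
  using Ku(2) unit_nonzero by blast

lemma conj_char:
  assumes n: "n \<in> N" and w: "w \<in> \<Omega>" shows "ui w * n * w = comm n w * n"
proof -
  have wu: "w \<in> units" using w Om_units by blast
  have "n * w = comm n w * (w * n)" by (rule comm_swap[OF N_units[OF n] wu])
  also have "\<dots> = w * (comm n w * n)" using Om_K[OF w Om_N[OF n w]] by (simp flip: mult.assoc)
  finally show ?thesis using wu by (simp add: mult.assoc)
qed

lemma K_equiv_sym: "m \<in> N \<Longrightarrow> n \<in> N \<Longrightarrow> m * ui n \<in> K \<longleftrightarrow> n * ui m \<in> K"
  using K_uset[of "m * ui n"] K_uset[of "n * ui m"] N_units by auto

text \<open>If m and n had the same character, \<open>ui n * m\<close> would commute with \<Omega>
  and lie in K by faithfulness.\<close>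

lemma distinct_char:
  assumes "m \<in> N" "n \<in> N" "m * ui n \<notin> K" shows "\<exists>w\<in>\<Omega>. comm m w \<noteq> comm n w"
proof (rule ccontr)
  assume "\<not> ?thesis"
  then have eq: "comm m w = comm n w" if "w \<in> \<Omega>" for w using that by blast
  have u: "m \<in> units" "n \<in> units" using N_units assms by auto
  have "ui n * m \<in> K"
  proof (rule faithful)
    show "ui n * m \<in> N" using assms N_mult N_ui by blast
    fix w assume w: "w \<in> \<Omega>"
    have wu: "w \<in> units" using w Om_units by blast
    have c: "comm n w \<in> units" using u wu by simp
    have "ui w * (ui n * m) * w = ui (ui w * n * w) * (ui w * m * w)" using u wu by (simp add: mult.assoc)
    also have "\<dots> = ui n * m" unfolding conj_char[OF assms(1) w] conj_char[OF assms(2) w] eq[OF w]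
      using u c by (simp add: mult.assoc)
    finally have "w * (ui w * (ui n * m) * w) = w * (ui n * m)" by simp
    then show "ui n * m * w = w * (ui n * m)" using wu by (simp add: mult.assoc)
  qed
  then have "n * (ui n * m) * ui n \<in> K" by (rule K_norm[OF assms(2)])
  then show False using assms(3) u by (simp add: mult.assoc)
qed

text \<open>Conjugation by \<^term>\<open>w \<in> \<Omega>\<close> is \<^term>\<open>K\<close>-linear and has the elements of \<^term>\<open>N\<close> as eigenvectors.\<close>

lemma independent:
  assumes n: "n \<in> N" shows "n \<notin> kspan {m \<in> N. m * ui n \<notin> K}"
proof -
  have "\<And>I c. finite I \<Longrightarrow> card I = j \<Longrightarrow> I \<subseteq> {m \<in> N. m * ui n \<notin> K} \<Longrightarrow> (\<forall>i\<in>I. c i \<in> K) \<Longrightarrow> n \<noteq> (\<Sum>i\<in>I. c i * i)" for j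
  proof (induction j rule: less_induct)
    case (less j)
    show ?case
    proof
      assume eq: "n = (\<Sum>i\<in>I. c i * i)"
      have "I \<noteq> {}" using eq unit_nonzero[OF N_units[OF n]] by auto
      then obtain m0 where m0: "m0 \<in> I" by blast
      have m0N: "m0 \<in> N" "m0 * ui n \<notin> K" using m0 less.prems(3) by auto
      obtain w where w: "w \<in> \<Omega>" "comm m0 w \<noteq> comm n w" using distinct_char[OF m0N(1) n m0N(2)] by blast
      have wu: "w \<in> units" using w Om_units by blast
      define h where "h i = comm i w" for i
      have hK: "h i \<in> K" if "i \<in> N" for i unfolding h_def using Om_N[OF that w(1)] .
      define J where "J = I - {m0}"
      have J: "finite J" "card J < j" "J \<subseteq> {m \<in> N. m * ui n \<notin> K}" "I = insert m0 J" "m0 \<notin> J"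
        unfolding J_def using less.prems(1-3) m0 card_Diff1_less[of I m0] by auto
      have IN: "i \<in> N" if "i \<in> I" for i using that less.prems by blast
      have cK: "c i \<in> K" if "i \<in> I" for i using that less.prems by blast
      have "h n * n = ui w * n * w" unfolding h_def using conj_char[OF n w(1)] by simp
      also have "\<dots> = (\<Sum>i\<in>I. ui w * (c i * i) * w)"
        by (subst (1) eq) (simp add: sum_distrib_left sum_distrib_right mult.assoc)
      also have "\<dots> = (\<Sum>i\<in>I. c i * h i * i)"
      proof (rule sum.cong[OF refl])
        fix i assume i: "i \<in> I"
        have "ui w * c i = c i * ui w" by (rule units_commute_ui[OF wu Om_K[OF w(1) cK[OF i]]])
        then have "ui w * (c i * i) * w = c i * (ui w * i * w)" by (metis mult.assoc)
        then show "ui w * (c i * i) * w = c i * h i * i" unfolding h_def using conj_char[OF IN[OF i] w(1)] by (simp add: mult.assoc)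
      qed
      finally have "(\<Sum>i\<in>I. c i * h i * i) - h n * (\<Sum>i\<in>I. c i * i) = 0" using eq by simp
      then have z: "(\<Sum>i\<in>I. (c i * h i - h n * c i) * i) = 0"
        by (simp add: sum_distrib_left sum_subtractf left_diff_distrib mult.assoc)
      \<comment> \<open>Conjugating the relation by \<open>w\<close> and subtracting
        \<open>h n\<close> times the relation removes n. In the result \<open>m0\<close> has a
        nonzero coefficient whenever \<open>c m0\<close> is nonzero, so \<open>m0\<close> can be
        eliminated from the original sum.\<close>
      define d where "d i = c i * (h i - h n)" for i
      have "c i * h i - h n * c i = d i" if "i \<in> I" for i
        unfolding d_def using K_comm[OF hK[OF n] cK[OF that]] by (simp add: algebra_simps)
      then have "(\<Sum>i\<in>I. d i * i) = 0" using z by simp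
      then have z2: "d m0 * m0 = - (\<Sum>i\<in>J. d i * i)" using J by (simp add: eq_neg_iff_add_eq_0)
      have dK: "d i \<in> K" if "i \<in> I" for i unfolding d_def using cK[OF that] hK[OF IN[OF that]] hK[OF n] sK by auto
      show False
      proof (cases "c m0 = 0")
        case True
        then have "n = (\<Sum>i\<in>J. c i * i)" using eq J by simp
        then show False using less.IH[OF J(2) J(1) refl J(3)] cK J(4) by blast
      next
        case False
        then have "d m0 \<noteq> 0" unfolding d_def
          using divring_mult_eq_0[OF divK cK[OF m0]] w(2) h_def by (metis right_minus_eq)
        then have du: "d m0 \<in> units" "ui (d m0) \<in> K" using Ku dK[OF m0] by auto
        have "m0 = ui (d m0) * (- (\<Sum>i\<in>J. d i * i))" using z2 du by (metis ui_left2)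
        then have "c m0 * m0 = c m0 * (ui (d m0) * (- (\<Sum>i\<in>J. d i * i)))" by simp
        then have m0e: "c m0 * m0 = - (\<Sum>i\<in>J. (c m0 * ui (d m0) * d i) * i)"
          by (simp add: sum_distrib_left mult.assoc)
        have "n = c m0 * m0 + (\<Sum>i\<in>J. c i * i)" using eq J by simp
        also have "\<dots> = (\<Sum>i\<in>J. (c i - c m0 * ui (d m0) * d i) * i)"
          unfolding m0e by (simp add: left_diff_distrib sum_subtractf)
        finally have "n = (\<Sum>i\<in>J. (c i - c m0 * ui (d m0) * d i) * i)" .
        moreover have "\<forall>i\<in>J. c i - c m0 * ui (d m0) * d i \<in> K" using cK dK du m0 J(4) sK by auto
        ultimately show False using less.IH[OF J(2) J(1) refl J(3), of "\<lambda>i. c i - c m0 * ui (d m0) * d i"] by blast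
      qed
    qed
  qed
  then show ?thesis unfolding kspan_def by blast
qed

lemma independent_sum:
  assumes R: "finite R" "R \<subseteq> N" "\<And>r s. r \<in> R \<Longrightarrow> s \<in> R \<Longrightarrow> r \<noteq> s \<Longrightarrow> r * ui s \<notin> K"
    and c: "\<And>r. r \<in> R \<Longrightarrow> c r \<in> K" "(\<Sum>r\<in>R. c r * r) = 0" and r: "r \<in> R"
  shows "c r = 0"
proof (rule ccontr)
  assume "c r \<noteq> 0"
  then have u: "c r \<in> units" "ui (c r) \<in> K" using Ku c(1)[OF r] by auto
  have "c r * r = - (\<Sum>s\<in>R - {r}. c s * s)" using c(2) sum.remove[OF R(1) r, of "\<lambda>r. c r * r"] by (simp add: eq_neg_iff_add_eq_0)
  then have "r = ui (c r) * (- (\<Sum>s\<in>R - {r}. c s * s))" using u by (metis ui_left2)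
  moreover have "(\<Sum>s\<in>R - {r}. c s * s) \<in> kspan {m \<in> N. m * ui r \<notin> K}"
    by (rule kspanI) (use R c r in auto)
  then have "ui (c r) * (- (\<Sum>s\<in>R - {r}. c s * s)) \<in> kspan {m \<in> N. m * ui r \<notin> K}"
    by (rule kspan_scale[OF kspan_minus u(2)])
  ultimately have "r \<in> kspan {m \<in> N. m * ui r \<notin> K}" by simp
  then show False using independent R(2) r by blast
qed

end

section \<open>Torsion-free abelian quotients\<close>

locale crossed_torsion_free = crossed +
  assumes comm_N: "\<And>x y. x \<in> N \<Longrightarrow> y \<in> N \<Longrightarrow> comm x y \<in> K"
    and torsion_free: "\<And>x j. x \<in> N \<Longrightarrow> j \<ge> 1 \<Longrightarrow> x ^ j \<in> K \<Longrightarrow> x \<in> K"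
begin

text \<open>The positive cone of a partial order on N modulo N \<inter> K, pulled back to N.
  Invariance under conjugation is automatic, as commutators lie in N \<inter> K.\<close>

definition cone :: "'a set \<Rightarrow> bool" where
  "cone P \<longleftrightarrow> P \<subseteq> N \<and> N \<inter> K \<subseteq> P \<and> (\<forall>x\<in>P. \<forall>y\<in>P. x * y \<in> P) \<and> (\<forall>x\<in>P. ui x \<in> P \<longrightarrow> x \<in> K)"

lemma NK_comm: "x \<in> N \<Longrightarrow> y \<in> N \<Longrightarrow> comm x y \<in> N \<inter> K"
  using comm_N ugrp_comm[OF grp_N] by blast

lemma swap_power:
  assumes "x \<in> N" "y \<in> N" shows "\<exists>z\<in>N \<inter> K. x * y = z * (y * x)"
  using NK_comm[OF assms] comm_swap[OF N_units[OF assms(1)] N_units[OF assms(2)]] by blast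

text \<open>A maximal cone is total because the quotient is torsion-free.\<close>

lemma total_cone: obtains P where "cone P" "\<And>x. x \<in> N \<Longrightarrow> x \<in> P \<or> ui x \<in> P"
proof -
  have "\<exists>P\<in>{P. cone P}. \<forall>X\<in>{P. cone P}. P \<subseteq> X \<longrightarrow> X = P"
  proof (rule Zorn_Lemma2, rule ballI)
    fix C assume C: "C \<in> chains {P. cone P}"
    then have cC: "cone P" if "P \<in> C" for P using that by (auto simp: chains_def)
    have ch: "P \<subseteq> Q \<or> Q \<subseteq> P" if "P \<in> C" "Q \<in> C" for P Q using C that by (auto simp: chains_def chain_subset_def)
    show "\<exists>U\<in>{P. cone P}. \<forall>X\<in>C. X \<subseteq> U"
    proof (cases "C = {}")
      case True
      have "cone (N \<inter> K)" unfolding cone_def using N_mult sK(4) by auto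
      then show ?thesis using True by blast
    next
      case False
      have "cone (\<Union>C)" unfolding cone_def
      proof (intro conjI ballI impI)
        show "\<Union>C \<subseteq> N" using cC unfolding cone_def by blast
        show "N \<inter> K \<subseteq> \<Union>C" using cC False unfolding cone_def by blast
      next
        fix x y assume "x \<in> \<Union>C" "y \<in> \<Union>C"
        then obtain P where "P \<in> C" "x \<in> P" "y \<in> P" using ch by blast
        then show "x * y \<in> \<Union>C" using cC unfolding cone_def by blast
      next
        fix x assume "x \<in> \<Union>C" "ui x \<in> \<Union>C"
        then obtain P where "P \<in> C" "x \<in> P" "ui x \<in> P" using ch by blast
        then show "x \<in> K" using cC unfolding cone_def by blast
      qed
      then show ?thesis by blast
    qed
  qed
  then obtain P where P: "cone P" "\<And>X. cone X \<Longrightarrow> P \<subseteq> X \<Longrightarrow> X = P" by blast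
  have PN: "P \<subseteq> N" "N \<inter> K \<subseteq> P" and Pm: "\<And>x y. x \<in> P \<Longrightarrow> y \<in> P \<Longrightarrow> x * y \<in> P"
    and PK: "\<And>x. x \<in> P \<Longrightarrow> ui x \<in> P \<Longrightarrow> x \<in> K"
    using P(1) unfolding cone_def by auto
  have pow: "\<exists>m\<ge>1. ui n ^ m \<in> P" if n: "n \<in> N" "n \<notin> P" for n
  proof -
    \<comment> \<open>The result of adjoining n to P. By maximality it fails to be a cone, and this
      failure forces a power of \<open>ui n\<close> into P.\<close>
    define Q where "Q = {p * n ^ i | p i. p \<in> P}"
    have nu: "n \<in> units" using N_units n by blast
    have QI: "p * n ^ i \<in> Q" if "p \<in> P" for p i unfolding Q_def using that by blast
    have mul: "\<exists>r\<in>P. (p * n ^ i) * (q * n ^ j) = r * n ^ (i + j)" if pq: "p \<in> P" "q \<in> P" for p q i j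
    proof -
      have nN: "n ^ i \<in> N" using ugrp_power[OF grp_N n(1)] .
      obtain z where z: "z \<in> N \<inter> K" "n ^ i * q = z * (q * n ^ i)" using swap_power[OF nN, of q] pq PN by blast
      have "(p * n ^ i) * (q * n ^ j) = p * (n ^ i * q) * n ^ j" by (simp add: mult.assoc)
      also have "\<dots> = (p * z * q) * n ^ (i + j)" unfolding z(2) by (simp add: mult.assoc power_add)
      finally show ?thesis using Pm pq z(1) PN(2) by blast
    qed
    have 1: "1 \<in> P" using PN(2) ugrpD(2)[OF grp_N] sK(2) by blast
    have "P \<subseteq> Q" using QI[of _ 0] by auto
    moreover have "n \<in> Q" using QI[OF 1, of 1] by simp
    ultimately have "\<not> cone Q" using P(2) n(2) by blast
    moreover have "Q \<subseteq> N" unfolding Q_def using PN N_mult ugrp_power[OF grp_N n(1)] by blast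
    moreover have "N \<inter> K \<subseteq> Q" using PN \<open>P \<subseteq> Q\<close> by blast
    moreover have "\<forall>x\<in>Q. \<forall>y\<in>Q. x * y \<in> Q"
    proof (intro ballI)
      fix x y assume "x \<in> Q" "y \<in> Q"
      then obtain p i q j where "x = p * n ^ i" "y = q * n ^ j" "p \<in> P" "q \<in> P" unfolding Q_def by blast
      then show "x * y \<in> Q" using mul[of p q i j] QI by auto
    qed
    ultimately obtain x where x: "x \<in> Q" "ui x \<in> Q" "x \<notin> K" unfolding cone_def by blast
    then obtain p i q j where pq: "x = p * n ^ i" "ui x = q * n ^ j" "p \<in> P" "q \<in> P" unfolding Q_def by blast
    have xu: "x \<in> units" using x(1) \<open>Q \<subseteq> N\<close> N_units by blast
    obtain r where r: "r \<in> P" "x * ui x = r * n ^ (i + j)" using mul[OF pq(3,4), of i j] pq(1,2) by metis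
    then have rn: "r * n ^ (i + j) = 1" using xu by simp
    have "i + j \<noteq> 0"
    proof
      assume "i + j = 0"
      then have "x = p" "ui x = q" using pq by auto
      then show False using PK pq x(3) by metis
    qed
    moreover have "ui n ^ (i + j) = r"
    proof -
      have "ui n ^ (i + j) = ui (n ^ (i + j))" using ui_power[OF nu] by simp
      also have "\<dots> = (r * n ^ (i + j)) * ui (n ^ (i + j))" using rn by simp
      also have "\<dots> = r" using nu by (simp add: mult.assoc)
      finally show ?thesis .
    qed
    ultimately show ?thesis using r(1) by (intro exI[of _ "i + j"]) auto
  qed
  have Ppow: "x ^ m \<in> P" if "x \<in> P" for x m
    using that Pm PN ugrpD(2)[OF grp_N] sK(2) by (induction m) auto
  \<comment> \<open>If x and its inverse were both outside, powers of both would lie in P; at a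
    common exponent a power of x is in K, hence x is.\<close>
  have "x \<in> P \<or> ui x \<in> P" if x: "x \<in> N" for x
  proof (rule ccontr)
    assume n: "\<not> ?thesis"
    have xu: "x \<in> units" using N_units x by blast
    obtain m where m: "m \<ge> 1" "ui x ^ m \<in> P" using pow[OF x] n by blast
    obtain m' where m': "m' \<ge> 1" "x ^ m' \<in> P" using pow[OF N_ui[OF x]] n xu by auto
    have "x ^ (m' * m) \<in> P" "ui x ^ (m * m') \<in> P" using Ppow m m' by (simp_all add: power_mult)
    then have "x ^ (m' * m) \<in> K" using PK[of "x ^ (m' * m)"] ui_power[OF xu] by (simp add: mult.commute)
    then have "x \<in> K" using torsion_free[OF x, of "m' * m"] m m' by simp
    then show False using n x PN by blast
  qed
  then show thesis using that P(1) by blast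
qed

definition pos :: "'a set" where
  "pos = (SOME P. cone P \<and> (\<forall>x\<in>N. x \<in> P \<or> ui x \<in> P))"

lemma pos: "cone pos" "x \<in> N \<Longrightarrow> x \<in> pos \<or> ui x \<in> pos"
proof -
  have "\<exists>P. cone P \<and> (\<forall>x\<in>N. x \<in> P \<or> ui x \<in> P)" using total_cone by metis
  then have "cone pos \<and> (\<forall>x\<in>N. x \<in> pos \<or> ui x \<in> pos)" unfolding pos_def by (rule someI_ex)
  then show "cone pos" "x \<in> N \<Longrightarrow> x \<in> pos \<or> ui x \<in> pos" by auto
qed

lemma posD: "x \<in> pos \<Longrightarrow> x \<in> N" "x \<in> N \<Longrightarrow> x \<in> K \<Longrightarrow> x \<in> pos" "x \<in> pos \<Longrightarrow> y \<in> pos \<Longrightarrow> x * y \<in> pos"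
  "x \<in> pos \<Longrightarrow> ui x \<in> pos \<Longrightarrow> x \<in> K"
  using pos(1) unfolding cone_def by auto

lemma pos_strict_mult:
  assumes "x \<in> pos" "y \<in> pos" "y \<notin> K" shows "x * y \<in> pos - K"
proof
  show "x * y \<in> pos" using assms posD by blast
  show "x * y \<notin> K"
  proof
    assume c: "x * y \<in> K"
    have u: "x \<in> units" "y \<in> units" using assms posD N_units by auto
    have xyN: "x * y \<in> N" using assms posD(1) N_mult by blast
    have "ui (x * y) \<in> pos" by (rule posD(2)[OF N_ui[OF xyN] K_uset[OF c N_units[OF xyN]]])
    then have "ui (x * y) * x \<in> pos" using posD(3) assms(1) by blast
    then have "ui y \<in> pos" using u by (simp add: mult.assoc)
    then show False using posD(4) assms by blast
  qed
qed

lemma pos_conj: "n \<in> N \<Longrightarrow> x \<in> pos - K \<Longrightarrow> n * x * ui n \<in> pos - K"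
proof -
  assume n: "n \<in> N" and x: "x \<in> pos - K"
  have u: "n \<in> units" "x \<in> units" using n x posD(1) N_units by auto
  have "n * x * ui n = comm n x * x" using u by (simp add: comm_def mult.assoc)
  moreover have "comm n x \<in> pos" using NK_comm[OF n posD(1), of x] x posD(2)[of "comm n x"] by blast
  ultimately show ?thesis using pos_strict_mult[of "comm n x" x] x by auto
qed

text \<open>The elements strictly below n in the total order, where a quotient in K counts as
  equality.\<close>

definition low :: "'a \<Rightarrow> 'a set" where
  "low n = {m \<in> N. n * ui m \<in> pos - K}"

lemma low_mult:
  assumes "n \<in> N" "m \<in> N"
  shows "y \<in> low m \<Longrightarrow> n * y \<in> low (n * m)" "x \<in> low n \<Longrightarrow> x * m \<in> low (n * m)"
    "x \<in> low n \<Longrightarrow> y \<in> low m \<Longrightarrow> x * y \<in> low (n * m)"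
proof -
  have u: "n \<in> units" "m \<in> units" using N_units assms by auto
  show 1: "n * y \<in> low (n * m)" if y: "y \<in> low m" for y
  proof -
    have yN: "y \<in> N" "y \<in> units" and p: "m * ui y \<in> pos - K" using y N_units unfolding low_def by auto
    have "(n * m) * ui (n * y) = n * (m * ui y) * ui n" using u yN by (simp add: mult.assoc)
    then show ?thesis unfolding low_def using pos_conj[OF assms(1) p] N_mult assms yN by simp
  qed
  show "x * m \<in> low (n * m)" if x: "x \<in> low n" for x
  proof -
    have xN: "x \<in> N" "x \<in> units" and p: "n * ui x \<in> pos - K" using x N_units unfolding low_def by auto
    have "(n * m) * ui (x * m) = n * ui x" using u xN by (simp add: mult.assoc)
    then show ?thesis unfolding low_def using p N_mult assms xN by simp
  qed
  show "x * y \<in> low (n * m)" if x: "x \<in> low n" and y: "y \<in> low m"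
  proof -
    have xN: "x \<in> N" "x \<in> units" and p: "n * ui x \<in> pos - K" using x N_units unfolding low_def by auto
    have yN: "y \<in> N" "y \<in> units" and q: "m * ui y \<in> pos - K" using y N_units unfolding low_def by auto
    have "(n * m) * ui (x * y) = (n * (m * ui y) * ui n) * (n * ui x)" using u xN yN by (simp add: mult.assoc)
    moreover have "(n * (m * ui y) * ui n) * (n * ui x) \<in> pos - K"
      by (rule pos_strict_mult) (use pos_conj[OF assms(1) q] p in auto)
    ultimately show ?thesis unfolding low_def using N_mult xN yN by simp
  qed
qed

lemma exists_max:
  assumes "finite I" "I \<noteq> {}" "I \<subseteq> N" shows "\<exists>n\<in>I. \<forall>i\<in>I. n * ui i \<in> pos"
  using assms
proof (induction rule: finite_ne_induct)
  case (singleton x)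
  then show ?case using posD(2)[OF ugrpD(2)[OF grp_N] sK(2)] N_units by auto
next
  case (insert x I)
  then obtain n where n: "n \<in> I" "\<forall>i\<in>I. n * ui i \<in> pos" by auto
  have N: "x \<in> N" "n \<in> N" "I \<subseteq> N" using insert n by auto
  have u: "x \<in> units" "n \<in> units" using N N_units by auto
  have xx: "x * ui x \<in> pos" using posD(2)[OF ugrpD(2)[OF grp_N] sK(2)] u by simp
  have "n * ui x \<in> pos \<or> x * ui n \<in> pos" using pos(2)[of "n * ui x"] N N_mult N_ui u by auto
  then show ?case
  proof
    assume "x * ui n \<in> pos"
    then have "x * ui i \<in> pos" if "i \<in> I" for i
      using posD(3)[OF _ bspec[OF n(2) that], of "x * ui n"] u by (simp add: mult.assoc)
    then show ?thesis using xx by blast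
  qed (use n in auto)
qed

text \<open>The terms in the coset of the maximal element are merged into one coefficient. If it
  vanishes, the whole coset drops out and the shorter sum is treated.\<close>

lemma leading_term:
  assumes "x \<in> kspan N" "x \<noteq> 0"
  shows "\<exists>n\<in>N. \<exists>c\<in>K. \<exists>r\<in>kspan (low n). c \<noteq> 0 \<and> x = c * n + r"
proof -
  have "\<And>I c x. finite I \<Longrightarrow> card I = j \<Longrightarrow> I \<subseteq> N \<Longrightarrow> (\<forall>i\<in>I. c i \<in> K) \<Longrightarrow> x = (\<Sum>i\<in>I. c i * i) \<Longrightarrow> x \<noteq> 0 \<Longrightarrow>
    \<exists>n\<in>N. \<exists>c\<in>K. \<exists>r\<in>kspan (low n). c \<noteq> 0 \<and> x = c * n + r" for j
  proof (induction j rule: less_induct)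
    case (less j)
    have "I \<noteq> {}" using less.prems by auto
    then obtain n where n: "n \<in> I" "\<forall>i\<in>I. n * ui i \<in> pos" using exists_max[OF less.prems(1) _ less.prems(3)] by blast
    have nN: "n \<in> N" "n \<in> units" using n less.prems N_units by auto
    define J where "J = {i \<in> I. i * ui n \<in> K}"
    define R where "R = I - J"
    have IN: "i \<in> N" "i \<in> units" if "i \<in> I" for i using that less.prems N_units by auto
    have nJ: "n \<in> J" unfolding J_def using n nN sK(2) by simp
    define a where "a = (\<Sum>i\<in>J. c i * (i * ui n))"
    have aK: "a \<in> K" unfolding a_def
      by (rule subrng_sum[OF divringD(1)[OF divK]]) (use less.prems(4) sK(4) J_def in auto)
    have "(\<Sum>i\<in>J. c i * i) = a * n" unfolding a_def using nN by (simp add: sum_distrib_right mult.assoc)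
    moreover have "I = J \<union> R" "J \<inter> R = {}" "finite J" "finite R" unfolding J_def R_def using less.prems(1) by auto
    ultimately have xe: "x = a * n + (\<Sum>i\<in>R. c i * i)" using less.prems(5) by (simp add: sum.union_disjoint)
    show ?case
    proof (cases "a = 0")
      case False
      have "R \<subseteq> low n"
      proof
        fix i assume i: "i \<in> R"
        then have "i \<in> I" "i * ui n \<notin> K" unfolding R_def J_def by auto
        then show "i \<in> low n" unfolding low_def using n IN nN K_equiv_sym[of i n] by auto
      qed
      then have "(\<Sum>i\<in>R. c i * i) \<in> kspan (low n)"
        using \<open>finite R\<close> less.prems(4) by (intro kspanI) (auto simp: R_def)
      then show ?thesis using xe False aK nN by blast
    next
      case True
      then have "x = (\<Sum>i\<in>R. c i * i)" using xe by simp
      moreover have "card R < j" using less.prems(1,2) n(1) nJ unfolding R_def by (metis DiffE Diff_subset psubsetI psubset_card_mono)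
      ultimately show ?thesis using less.IH[of "card R" R c x] less.prems R_def by auto
    qed
  qed
  then show ?thesis using assms unfolding kspan_def by blast
qed

text \<open>The leading terms multiply to a nonzero multiple of n * m, all other products are
  combinations of strictly smaller elements, and \<open>independent\<close> rules out
  cancellation.\<close>

lemma kspan_no_zero_divisors:
  assumes "x \<in> kspan N" "y \<in> kspan N" "x \<noteq> 0" "y \<noteq> 0" shows "x * y \<noteq> 0"
proof
  assume z: "x * y = 0"
  obtain n c r where x: "n \<in> N" "c \<in> K" "r \<in> kspan (low n)" "c \<noteq> 0" "x = c * n + r" using leading_term assms by blast
  obtain m d s where y: "m \<in> N" "d \<in> K" "s \<in> kspan (low m)" "d \<noteq> 0" "y = d * m + s" using leading_term assms by blast
  have lN: "low n \<subseteq> N" unfolding low_def by auto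
  have "(c * n) * s \<in> kspan (low (n * m))"
    by (rule kspan_mult[of "{n}" "low m"]) (use x y low_mult(1)[OF x(1) y(1)] kspan_base kspan_base1 in auto)
  moreover have "r * (d * m) \<in> kspan (low (n * m))"
    by (rule kspan_mult[of "low n" "{m}"]) (use lN x y low_mult(2)[OF x(1) y(1)] kspan_base kspan_base1 in auto)
  moreover have "r * s \<in> kspan (low (n * m))"
    by (rule kspan_mult[of "low n" "low m"]) (use lN x y low_mult(3)[OF x(1) y(1)] kspan_base1 in auto)
  ultimately have q: "(c * n) * s + r * (d * m) + r * s \<in> kspan (low (n * m))" using kspan_add by blast
  define e where "e = c * (n * d * ui n)"
  have nu: "n \<in> units" using x N_units by blast
  have du: "d \<in> units" "c \<in> units" using Ku x y by auto
  have eK: "e \<in> K" unfolding e_def using x y K_norm sK(4) by blast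
  have eu: "e \<in> units" unfolding e_def using nu du by simp
  have "(c * n) * (d * m) = e * (n * m)" unfolding e_def using nu by (simp add: mult.assoc)
  then have "e * (n * m) + ((c * n) * s + r * (d * m) + r * s) = 0" using z x(5) y(5) by (simp add: algebra_simps)
  then have "e * (n * m) = - ((c * n) * s + r * (d * m) + r * s)" by (rule eq_neg_iff_add_eq_0[THEN iffD2])
  then have "n * m = ui e * (- ((c * n) * s + r * (d * m) + r * s))" using eu by (metis ui_left2)
  then have "n * m \<in> kspan (low (n * m))" using kspan_scale[OF kspan_minus[OF q] K_uset[OF eK eu]] by simp
  moreover have "low (n * m) \<subseteq> {k \<in> N. k * ui (n * m) \<notin> K}"
    unfolding low_def using K_equiv_sym N_mult[OF x(1) y(1)] by auto
  ultimately show False using independent[OF N_mult[OF x(1) y(1)]] kspan_mono by blast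
qed

text \<open>Ordered monomials in the listed generators with exponents at most j. Up to factors from
  K they absorb one more generator when j grows by 1, while their number is polynomial in j.\<close>

fun box :: "nat \<Rightarrow> 'a list \<Rightarrow> 'a set" where
  "box j [] = {1}"
| "box j (s # ss) = (\<lambda>(i, b). s ^ i * b) ` ({..j} \<times> box j ss)"

lemma box_finite: "finite (box j ss) \<and> card (box j ss) \<le> (j + 1) ^ length ss"
proof (induction ss)
  case (Cons s ss)
  have f: "finite ({..j} \<times> box j ss)" using Cons by simp
  have "card (box j (s # ss)) \<le> card ({..j} \<times> box j ss)" unfolding box.simps by (rule card_image_le[OF f])
  also have "\<dots> = (j + 1) * card (box j ss)" by (simp add: card_cartesian_product)
  also have "\<dots> \<le> (j + 1) * (j + 1) ^ length ss" using Cons by (intro mult_le_mono2) simp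
  finally show ?case using f by simp
qed simp

lemma box_N: "set ss \<subseteq> N \<Longrightarrow> box j ss \<subseteq> N"
  by (induction ss) (auto intro!: ugrpD(2)[OF grp_N] N_mult ugrp_power[OF grp_N])

lemma boxI: "i \<le> j \<Longrightarrow> b \<in> box j ss \<Longrightarrow> s ^ i * b \<in> box j (s # ss)"
  by force

lemma box_mono: "b \<in> box j ss \<Longrightarrow> b \<in> box (Suc j) ss"
proof (induction ss arbitrary: b)
  case (Cons s ss)
  then obtain i b0 where "b = s ^ i * b0" "i \<le> j" "b0 \<in> box j ss" by auto
  then show ?case using Cons.IH[of b0] boxI[of i "Suc j" b0 ss s] by simp
qed simp

lemma box_step:
  "set ss \<subseteq> N \<Longrightarrow> s \<in> set ss \<Longrightarrow> b \<in> box j ss \<Longrightarrow> \<exists>b'\<in>box (Suc j) ss. \<exists>z\<in>N \<inter> K. b * s = z * b'"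
proof (induction ss arbitrary: b)
  case (Cons t ss)
  then obtain i b0 where b: "b = t ^ i * b0" "i \<le> j" "b0 \<in> box j ss" by auto
  have N: "t \<in> N" "b0 \<in> N" "s \<in> N" using Cons.prems b box_N[of ss j] by auto
  show ?case
  proof (cases "s = t")
    case True
    obtain z where z: "z \<in> N \<inter> K" "b0 * t = z * (t * b0)" using swap_power[OF N(2,1)] by blast
    have tN: "t ^ i \<in> N" using ugrp_power[OF grp_N N(1)] .
    obtain y where y: "y \<in> N \<inter> K" "t ^ i * z = y * (z * t ^ i)" using swap_power[OF tN, of z] z by blast
    have "b * s = t ^ i * (b0 * t)" using b True by (simp add: mult.assoc)
    also have "\<dots> = (t ^ i * z) * (t * b0)" unfolding z(2) by (simp add: mult.assoc)
    also have "\<dots> = (y * z) * (t ^ Suc i * b0)" unfolding y(2) by (simp add: mult.assoc power_Suc2 del: power_Suc)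
    finally have "b * s = (y * z) * (t ^ Suc i * b0)" .
    moreover have "t ^ Suc i * b0 \<in> box (Suc j) (t # ss)" using b(2) by (intro boxI box_mono[OF b(3)]) simp
    moreover have "y * z \<in> N \<inter> K" using y z N_mult sK(4) by blast
    ultimately show ?thesis by blast
  next
    case False
    then have "s \<in> set ss" using Cons.prems by auto
    then obtain b' z where b': "b' \<in> box (Suc j) ss" "z \<in> N \<inter> K" "b0 * s = z * b'" using Cons.IH[of b0] Cons.prems b by auto
    have tN: "t ^ i \<in> N" using ugrp_power[OF grp_N N(1)] .
    obtain y where y: "y \<in> N \<inter> K" "t ^ i * z = y * (z * t ^ i)" using swap_power[OF tN, of z] b' by blast
    have "b * s = (t ^ i * z) * b'" using b b' by (simp add: mult.assoc)
    also have "\<dots> = (y * z) * (t ^ i * b')" unfolding y(2) by (simp add: mult.assoc)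
    finally have "b * s = (y * z) * (t ^ i * b')" .
    moreover have "t ^ i * b' \<in> box (Suc j) (t # ss)" using b(2) by (intro boxI b'(1)) simp
    moreover have "y * z \<in> N \<inter> K" using y b' N_mult sK(4) by blast
    ultimately show ?thesis by blast
  qed
qed simp

lemma power_less_exp: "\<exists>j. (j + 1) ^ l < (2::nat) ^ j"
proof -
  \<comment> \<open>With j + 1 = 2^(2l+2) the left side becomes 2^(l(2l+2)), so it remains to
    compare l(2l+2) with j.\<close>
  define j where "j = 2 ^ (2 * l + 2) - (1::nat)"
  have "l * (2 * l + 2) < j"
  proof -
    have "l + 1 \<le> 2 ^ l" by (induction l) auto
    then have "(l + 1) * (l + 1) \<le> 2 ^ l * 2 ^ l" by (intro mult_mono) auto
    also have "\<dots> = (2::nat) ^ (2 * l)" by (simp flip: power_add mult_2)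
    finally have "4 * ((l + 1) * (l + 1)) \<le> 2 ^ (2 * l + 2)" by simp
    then show ?thesis unfolding j_def by (simp add: algebra_simps)
  qed
  moreover have "(j + 1) ^ l = 2 ^ (l * (2 * l + 2))"
  proof -
    have "j + 1 = 2 ^ (2 * l + 2)" unfolding j_def by simp
    then show ?thesis by (simp only: power_mult[symmetric] mult.commute)
  qed
  ultimately have "(j + 1) ^ l < 2 ^ j" by (metis one_less_numeral_iff power_strict_increasing semiring_norm(76))
  then show ?thesis by blast
qed

definition cls :: "'a \<Rightarrow> 'a set" where "cls n = {m \<in> N. m * ui n \<in> K}"

lemma cls_eq: "m \<in> N \<Longrightarrow> n \<in> N \<Longrightarrow> cls m = cls n \<longleftrightarrow> m * ui n \<in> K"
proof -
  assume N: "m \<in> N" "n \<in> N"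
  have u: "m \<in> units" "n \<in> units" using N N_units by auto
  have "m \<in> cls m" unfolding cls_def using N u sK(2) by simp
  moreover have "cls m \<subseteq> cls n" if "m * ui n \<in> K" "m \<in> N" "n \<in> N" for m n
  proof
    fix x assume x: "x \<in> cls m"
    then have "(x * ui m) * (m * ui n) \<in> K" using that sK(4) unfolding cls_def by blast
    then show "x \<in> cls n" using x N_units[OF that(2)] unfolding cls_def by (simp add: mult.assoc)
  qed
  ultimately show ?thesis using N K_equiv_sym[OF N] unfolding cls_def by blast
qed

text \<open>Polynomial growth of the boxes forces a common left multiple.\<close>

lemma ore:
  assumes a: "a \<in> kspan N" "a \<noteq> 0" and b: "b \<in> kspan N" "b \<noteq> 0"
  shows "\<exists>p\<in>kspan N. \<exists>q\<in>kspan N. p * a = q * b \<and> p * a \<noteq> 0"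
proof -
  obtain I where I: "finite I" "I \<subseteq> N" "a \<in> kspan I" using a(1) unfolding kspan_def by blast
  obtain J where J: "finite J" "J \<subseteq> N" "b \<in> kspan J" using b(1) unfolding kspan_def by blast
  obtain ss where ss: "set ss = I \<union> J" using finite_list I(1) J(1) by blast
  have ssN: "set ss \<subseteq> N" using ss I J by auto
  have ab: "a \<in> kspan (set ss)" "b \<in> kspan (set ss)" using I J ss kspan_mono by blast+
  define B where "B j = box j ss" for j
  have BN: "B j \<subseteq> N" for j unfolding B_def by (rule box_N[OF ssN])
  have Bf: "finite (B j)" for j unfolding B_def using box_finite by blast
  define d where "d j = card (cls ` B j)" for j
  \<comment> \<open>\<open>d\<close> counts the cosets of K met by a box; doubling at every step
    would outgrow the polynomial bound.\<close>
  have "\<exists>j. d (Suc j) < 2 * d j"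
  proof (rule ccontr)
    assume "\<not> ?thesis"
    then have step: "2 * d j \<le> d (Suc j)" for j by (metis not_less)
    have "B 0 \<noteq> {}" unfolding B_def by (induction ss) auto
    then have "d 0 \<ge> 1" unfolding d_def using Bf[of 0] by (simp add: Suc_leI card_gt_0_iff)
    then have "2 ^ j \<le> d j" for j by (induction j) (auto intro: order_trans[OF _ step])
    moreover have "d j \<le> (j + 1) ^ length ss" for j
      unfolding d_def B_def using box_finite[of j ss] card_image_le[of "box j ss" cls] by linarith
    ultimately show False using power_less_exp[of "length ss"] by (metis le_trans not_less)
  qed
  then obtain j where j: "d (Suc j) < 2 * d j" by blast
  have sub: "\<exists>R\<subseteq>B j. inj_on cls R \<and> cls ` B j = cls ` R" for j
    using subset_image_inj[of "cls ` B j" cls "B j"] by simp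
  obtain R where R: "R \<subseteq> B j" "inj_on cls R" "cls ` B j = cls ` R" using sub[of j] by blast
  obtain Q where Q: "Q \<subseteq> B (Suc j)" "inj_on cls Q" "cls ` B (Suc j) = cls ` Q"
    using sub[of "Suc j"] by blast
  have fR: "finite R" "finite Q" using finite_subset[OF R(1) Bf] finite_subset[OF Q(1) Bf] by simp_all
  have cR: "card R = d j" unfolding d_def R(3) by (rule card_image[OF R(2), symmetric])
  have cQ: "card Q = d (Suc j)" unfolding d_def Q(3) by (rule card_image[OF Q(2), symmetric])
  have RN: "R \<subseteq> N" "Q \<subseteq> N" using order_trans[OF R(1) BN] order_trans[OF Q(1) BN] by simp_all
  have BQ: "n \<in> kspan Q" if n: "n \<in> B (Suc j)" for n
  proof -
    obtain q where q: "q \<in> Q" "cls n = cls q" using n Q(3) by blast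
    then have "n * ui q \<in> K" using cls_eq n BN RN by blast
    then have "(n * ui q) * q \<in> kspan Q" using kspan_base q by blast
    then show ?thesis using N_units q RN by (auto simp: mult.assoc)
  qed
  have RQ: "r * x \<in> kspan Q" if r: "r \<in> R" and x: "x \<in> kspan (set ss)" for r x
  proof (rule kspan_mult[of "{r}" "set ss"])
    show "{r} \<subseteq> N" using r RN by blast
    fix p s assume "p \<in> {r}" and s: "s \<in> set ss"
    then have "p \<in> box j ss" using r R B_def by auto
    then obtain b' z where "b' \<in> B (Suc j)" "z \<in> N \<inter> K" "p * s = z * b'"
      using box_step[OF ssN s, of p j] unfolding B_def by blast
    then show "p * s \<in> kspan Q" using BQ kspan_scale by auto
  qed (use x kspan_base1 in auto)
  \<comment> \<open>Two copies of R index the unknown coefficients of p and q: 2 * d j unknowns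
    against d (Suc j) equations.\<close>
  define T where "T = R \<times> (UNIV :: bool set)"
  define v where "v t = fst t * (if snd t then a else b)" for t :: "'a \<times> bool"
  have vQ: "v t \<in> kspan Q" if "t \<in> T" for t using that RQ ab unfolding v_def T_def by auto
  have "\<forall>t\<in>T. \<exists>m. (\<forall>q\<in>Q. m q \<in> K) \<and> v t = (\<Sum>q\<in>Q. m q * q)"
  proof
    fix t assume "t \<in> T"
    from vQ[OF this] obtain I c where I: "finite I" "I \<subseteq> Q" "\<forall>i\<in>I. c i \<in> K" "v t = (\<Sum>i\<in>I. c i * i)" unfolding kspan_def by blast
    have "v t = (\<Sum>q\<in>Q. (if q \<in> I then c q else 0) * q)" unfolding I(4)
      by (rule sum.mono_neutral_cong_left) (use I fR in auto)
    then show "\<exists>m. (\<forall>q\<in>Q. m q \<in> K) \<and> v t = (\<Sum>q\<in>Q. m q * q)"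
      using I sK(1) by (intro exI[of _ "\<lambda>q. if q \<in> I then c q else 0"]) auto
  qed
  then obtain m where m: "\<And>t q. t \<in> T \<Longrightarrow> q \<in> Q \<Longrightarrow> m t q \<in> K" "\<And>t. t \<in> T \<Longrightarrow> v t = (\<Sum>q\<in>Q. m t q * q)" by metis
  have "finite T" "card Q < card T" unfolding T_def using fR cR cQ j by (auto simp: card_cartesian_product)
  then obtain c where c: "\<forall>t. c t \<in> K" "\<exists>t\<in>T. c t \<noteq> 0" "\<forall>q\<in>Q. (\<Sum>t\<in>T. c t * m t q) = 0"
    using homogeneous_system[OF divK fR(2), of T m] m(1) by blast
  have "(\<Sum>t\<in>T. c t * v t) = (\<Sum>t\<in>T. \<Sum>q\<in>Q. c t * m t q * q)"
    by (rule sum.cong) (use m in \<open>auto simp: sum_distrib_left mult.assoc\<close>)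
  also have "\<dots> = (\<Sum>q\<in>Q. (\<Sum>t\<in>T. c t * m t q) * q)" by (subst sum.swap) (simp add: sum_distrib_right)
  also have "\<dots> = 0" using c(3) by simp
  finally have z: "(\<Sum>t\<in>T. c t * v t) = 0" .
  define p where "p = (\<Sum>r\<in>R. c (r, True) * r)"
  define q where "q = (\<Sum>r\<in>R. c (r, False) * r)"
  have "(\<Sum>t\<in>T. c t * v t) = (\<Sum>r\<in>R. \<Sum>w\<in>UNIV. c (r, w) * v (r, w))" unfolding T_def by (simp add: sum.cartesian_product)
  also have "\<dots> = p * a + q * b" unfolding p_def q_def v_def by (simp add: UNIV_bool sum.distrib sum_distrib_right mult.assoc)
  finally have pq: "p * a + q * b = 0" using z by simp
  have pqN: "p \<in> kspan N" "q \<in> kspan N" unfolding p_def q_def using kspanI[OF fR(1) RN(1)] c(1) by auto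
  have ind: "r * ui s \<notin> K" if "r \<in> R" "s \<in> R" "r \<noteq> s" for r s
    using that R(2) cls_eq RN by (metis inj_onD subsetD)
  have "p \<noteq> 0 \<or> q \<noteq> 0"
  proof (rule ccontr)
    assume "\<not> ?thesis"
    then have "p = 0" "q = 0" by auto
    then have "c (r, True) = 0" "c (r, False) = 0" if "r \<in> R" for r
      using independent_sum[OF fR(1) RN(1) ind, of "\<lambda>r. c (r, True)" r] independent_sum[OF fR(1) RN(1) ind, of "\<lambda>r. c (r, False)" r]
        c(1) that unfolding p_def q_def by auto
    then show False using c(2) unfolding T_def by (auto, metis (full_types))
  qed
  moreover have "p * a = (- q) * b" using pq by (simp add: eq_neg_iff_add_eq_0)
  moreover have "p * a \<noteq> 0 \<or> q * b \<noteq> 0" using calculation(1) kspan_no_zero_divisors pqN a b by blast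
  ultimately show ?thesis using pqN kspan_minus by (intro bexI[of _ p] bexI[of _ "- q"]) auto
qed

end

section \<open>Torsion in abelian sections of M\<close>

context maximal_solvable
begin

lemma Minv_kspan:
  assumes cr: "norm_span K N" and inv: "Minv K" "Minv P"
  shows "Minv (norm_span.kspan K P)"
proof -
  interpret norm_span K N by (rule cr)
  show ?thesis unfolding Minv_def
  proof (intro ballI)
    fix m x assume m: "m \<in> M" and "x \<in> kspan P"
    then obtain I c where x: "finite I" "I \<subseteq> P" "\<forall>i\<in>I. c i \<in> K" "x = (\<Sum>i\<in>I. c i * i)" unfolding kspan_def by blast
    have "m * x * ui m = (\<Sum>i\<in>I. (m * c i * ui m) * (m * i * ui m))"
      unfolding x(4) using M_units[OF m] by (simp add: sum_distrib_left sum_distrib_right mult.assoc)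
    also have "\<dots> \<in> kspan P" by (rule kspan_sum, rule kspan_base) (use x MinvD[OF inv(1) m] MinvD[OF inv(2) m] in auto)
    finally show "m * x * ui m \<in> kspan P" .
  qed
qed

text \<open>The Ore condition makes the vectors killed by some nonzero element of the span into a
  subspace. It is M-stable, hence 0, so nonzero elements of the span are injective and therefore
  units, and fractions exist inside the ring. Commutativity of the fractions contradicts
  faithfulness of \<Omega>.\<close>

lemma torsion_exists:
  assumes cr: "crossed K N \<Omega>" and inv: "Minv K" "Minv N" and FK: "F \<subseteq> K"
    and comm_N: "\<And>x y. x \<in> N \<Longrightarrow> y \<in> N \<Longrightarrow> comm x y \<in> K" and NK: "\<not> N \<subseteq> K"
    and Om: "\<Omega> \<subseteq> norm_span.kspan K N"
  shows "\<exists>x\<in>N. \<exists>j\<ge>1. x \<notin> K \<and> x ^ j \<in> K"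
proof (rule ccontr)
  assume n: "\<not> ?thesis"
  interpret crossed K N \<Omega> by (rule cr)
  interpret crossed_torsion_free K N \<Omega> by unfold_locales (use comm_N n in auto)
  let ?T = "kspan N"
  have invT: "Minv ?T" by (rule Minv_kspan[OF norm_span_axioms inv])
  define W where "W = {v. \<exists>a\<in>?T. a \<noteq> 0 \<and> ap a v = 0}"
  have join: "\<exists>e\<in>?T. e \<noteq> 0 \<and> ap e v = 0 \<and> ap e w = 0"
    if ab: "a \<in> ?T" "a \<noteq> 0" "ap a v = 0" "b \<in> ?T" "b \<noteq> 0" "ap b w = 0" for a b v w
  proof -
    obtain p q where pq: "p \<in> ?T" "q \<in> ?T" "p * a = q * b" "p * a \<noteq> 0" using ore[OF ab(1,2,4,5)] by blast
    have "ap (p * a) v = 0" using ab by simp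
    moreover have "ap (p * a) w = 0" unfolding pq(3) using ab by simp
    moreover have "p * a \<in> ?T" using subrngD(4)[OF subrng_kspan] pq ab by blast
    ultimately show ?thesis using pq(4) by blast
  qed
  have "W = {0} \<or> W = UNIV"
  proof (rule irreducible)
    show "dsub W" unfolding dsub_def
    proof (intro conjI ballI allI)
      show "0 \<in> W" unfolding W_def using kspan_base1[OF ugrpD(2)[OF grp_N]] unit_nonzero[OF units_1] ap_zero by blast
    next
      fix v w assume "v \<in> W" "w \<in> W"
      then obtain e where "e \<in> ?T" "e \<noteq> 0" "ap e v = 0" "ap e w = 0" using join unfolding W_def by blast
      then show "v + w \<in> W" unfolding W_def by auto
    qed (auto simp: W_def)
    fix m w assume m: "m \<in> M" and "w \<in> W"
    then obtain a where a: "a \<in> ?T" "a \<noteq> 0" "ap a w = 0" unfolding W_def by blast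
    have "ap (m * a * ui m) (ap m w) = 0" using a M_units[OF m] by simp
    moreover have "m * a * ui m \<noteq> 0"
    proof
      assume "m * a * ui m = 0"
      then have "ui m * (m * a * ui m) * m = 0" by simp
      then show False using a(2) M_units[OF m] by (simp add: mult.assoc)
    qed
    ultimately show "ap m w \<in> W" unfolding W_def using MinvD[OF invT m a(1)] by blast
  qed
  moreover have "W \<noteq> UNIV"
  proof
    assume U: "W = UNIV"
    \<comment> \<open>If every vector were killed by something, common left multiples would produce
      one nonzero element killing a whole basis.\<close>
    have kill: "\<exists>e\<in>?T. e \<noteq> 0 \<and> (\<forall>i\<in>I. ap e (axis i 1) = 0)" if "finite I" for I :: "'n set"
      using that
    proof induction
      case empty
      then show ?case using kspan_base1[OF ugrpD(2)[OF grp_N]] unit_nonzero[OF units_1] by blast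
    next
      case (insert i I)
      then obtain e where e: "e \<in> ?T" "e \<noteq> 0" "\<forall>i\<in>I. ap e (axis i 1) = 0" by blast
      have "axis i 1 \<in> W" using U by blast
      then obtain a where a: "a \<in> ?T" "a \<noteq> 0" "ap a (axis i 1) = 0" unfolding W_def by blast
      obtain p q where pq: "p \<in> ?T" "q \<in> ?T" "p * a = q * e" "p * a \<noteq> 0" using ore a e by blast
      have "ap (p * a) (axis i 1) = 0" using a by simp
      moreover have "\<forall>l\<in>I. ap (p * a) (axis l 1) = 0" unfolding pq(3) using e by simp
      moreover have "p * a \<in> ?T" using subrngD(4)[OF subrng_kspan] pq a by blast
      ultimately show ?case using pq(4) by blast
    qed
    obtain e where "e \<in> ?T" "e \<noteq> 0" "\<forall>i\<in>UNIV. ap e (axis i 1) = 0" using kill[OF finite_class.finite_UNIV] by blast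
    then show False using endo_axis_eqI[of e 0] by simp
  qed
  ultimately have W0: "W = {0}" by blast
  have Tu: "a \<in> units" if "a \<in> ?T" "a \<noteq> 0" for a
    by (rule inj_imp_unit) (use that W0 W_def in blast)
  define X where "X = {ui a * b | a b. a \<in> ?T \<and> b \<in> ?T \<and> a \<noteq> 0}"
  have divX: "divring X" unfolding X_def by (rule divring_ore_quotients[OF subrng_kspan Tu ore]) auto
  have TX: "?T \<subseteq> X"
  proof
    fix x assume "x \<in> ?T"
    then have "ui 1 * x \<in> X" unfolding X_def using kspan_base1[OF ugrpD(2)[OF grp_N]] unit_nonzero[OF units_1] by blast
    then show "x \<in> X" by simp
  qed
  have invX: "Minv X" unfolding Minv_def
  proof (intro ballI)
    fix m x assume m: "m \<in> M" and "x \<in> X"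
    then obtain a b where x: "x = ui a * b" "a \<in> ?T" "b \<in> ?T" "a \<noteq> 0" unfolding X_def by blast
    have u: "m \<in> units" "a \<in> units" using M_units m Tu x by auto
    have "m * x * ui m = ui (m * a * ui m) * (m * b * ui m)" using x u by (simp add: mult.assoc)
    moreover have "m * a * ui m \<noteq> 0" using u unit_nonzero[of "m * a * ui m"] by simp
    ultimately show "m * x * ui m \<in> X" unfolding X_def using MinvD[OF invT m] x by blast
  qed
  have XU: "X \<noteq> UNIV"
  proof
    assume U: "X = UNIV"
    obtain i :: 'n where True by simp
    obtain j where ij: "i \<noteq> j" using exists_other_index[OF n2, of i] by blast
    let ?o = "out (axis i 1) (\<lambda>v. v $ j) :: ('a, 'n) endo"
    have "ap ?o (axis j 1) = axis i 1" by simp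
    then have "?o \<noteq> 0" by (metis ap_ring(1) axis_eq_0_iff zero_neq_one)
    then have "?o \<in> units" using divringD(3)[OF divX] U by blast
    moreover have "ap ?o (axis i 1) = 0" using ij by (simp add: axis_def)
    ultimately show False using unit_iff_inj[of ?o] by (metis axis_eq_0_iff zero_neq_one)
  qed
  obtain x where x: "x \<in> N" "x \<notin> K" using NK by blast
  obtain w where w: "w \<in> \<Omega>" "x * w \<noteq> w * x" using faithful[OF x(1)] x(2) by blast
  have xX: "x \<in> X" "w \<in> X" using TX kspan_base1[OF x(1)] w Om by blast+
  have "x \<in> uset X" using divringD(2)[OF divX xX(1)] unit_nonzero[OF N_units[OF x(1)]] by blast
  moreover have "x \<notin> F" using FK x by blast
  ultimately have s: "sol (Suc k) (uset X)" using proper_ring(2)[OF divringD(1)[OF divX] invX XU] by blast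
  obtain a where a: "a \<in> F" "a \<noteq> 0" "a * a \<noteq> 1" using F_square by blast
  have "a \<in> X" using a FK kspan_base[OF ugrpD(2)[OF grp_N]] TX by fastforce
  then have "x * w = w * x"
    using division_solvable_commutative[OF divX s _ _ a(2,3) xX] a(1) cen_sub_centralizer by blast
  then show False using w by blast
qed

text \<open>Take the least positive exponent j that brings some element from outside K into K, and a
  prime factor p of j; the power of that element with exponent j / p is still outside K.\<close>

lemma prime_torsion_exists:
  assumes "crossed K N \<Omega>" "Minv K" "Minv N" "F \<subseteq> K"
    "\<And>x y. x \<in> N \<Longrightarrow> y \<in> N \<Longrightarrow> comm x y \<in> K" "\<not> N \<subseteq> K" "\<Omega> \<subseteq> norm_span.kspan K N"
  obtains x p where "x \<in> N" "x \<notin> K" "prime p" "x ^ p \<in> K"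
proof -
  obtain x0 j0 where "x0 \<in> N \<and> j0 \<ge> (1::nat) \<and> x0 \<notin> K \<and> x0 ^ j0 \<in> K" using torsion_exists[OF assms] by blast
  then obtain j where j: "\<exists>x. x \<in> N \<and> j \<ge> 1 \<and> x \<notin> K \<and> x ^ j \<in> K"
    "\<And>i. \<exists>x. x \<in> N \<and> i \<ge> 1 \<and> x \<notin> K \<and> x ^ i \<in> K \<Longrightarrow> j \<le> i"
    using ex_has_least_nat[of "\<lambda>j. \<exists>x. x \<in> N \<and> j \<ge> 1 \<and> x \<notin> K \<and> x ^ j \<in> K" j0 "\<lambda>j. j"] by blast
  then obtain x where x: "x \<in> N" "j \<ge> 1" "x \<notin> K" "x ^ j \<in> K" by blast
  have gN: "ugrp N" using assms(1) unfolding crossed_def by blast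
  have "j \<noteq> 1" using x by auto
  then obtain p where p: "prime p" "p dvd j" using prime_factor_nat by blast
  then obtain i where i: "j = p * i" by (auto elim: dvdE)
  have i1: "i \<ge> 1" using x i by (cases i) auto
  have "i < j" using i i1 prime_gt_1_nat[OF p(1)] by simp
  then have "x ^ i \<notin> K" using j(2)[of i] x i1 by auto
  moreover have "x ^ i \<in> N" using ugrp_power[OF gN x(1)] .
  moreover have "(x ^ i) ^ p \<in> K" using x(4) i by (simp add: power_mult[symmetric] mult.commute)
  ultimately show thesis using that p(1) by blast
qed

end

text \<open>The comparison of an independent with a spanning family, which is all that the later
  dimension count requires.\<close>

lemma family_card_le:
  fixes v :: "'t \<Rightarrow> 'r::ring_1" and w :: "'s \<Rightarrow> 'r"
  assumes K: "divring K" and fin: "finite T" "finite S"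
    and sp: "\<And>t. t \<in> T \<Longrightarrow> \<exists>m. (\<forall>s\<in>S. m s \<in> K) \<and> v t = (\<Sum>s\<in>S. m s * w s)"
    and ind: "\<And>c t. (\<And>t. c t \<in> K) \<Longrightarrow> (\<Sum>t\<in>T. c t * v t) = 0 \<Longrightarrow> t \<in> T \<Longrightarrow> c t = 0"
  shows "card T \<le> card S"
proof (rule ccontr)
  assume n: "\<not> ?thesis"
  obtain m where m: "\<And>t s. t \<in> T \<Longrightarrow> s \<in> S \<Longrightarrow> m t s \<in> K" "\<And>t. t \<in> T \<Longrightarrow> v t = (\<Sum>s\<in>S. m t s * w s)" using sp by metis
  obtain c where c: "\<forall>t. c t \<in> K" "\<exists>t\<in>T. c t \<noteq> 0" "\<forall>s\<in>S. (\<Sum>t\<in>T. c t * m t s) = 0"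
    using homogeneous_system[OF K fin(2,1), of m] n m(1) by auto
  have "(\<Sum>t\<in>T. c t * v t) = (\<Sum>t\<in>T. \<Sum>s\<in>S. c t * m t s * w s)"
    by (rule sum.cong) (use m in \<open>auto simp: sum_distrib_left mult.assoc\<close>)
  also have "\<dots> = (\<Sum>s\<in>S. (\<Sum>t\<in>T. c t * m t s) * w s)" by (subst sum.swap) (simp add: sum_distrib_right)
  also have "\<dots> = 0" using c(3) by simp
  finally show False using ind c(1,2) by blast
qed

lemma geometric_sum:
  fixes y :: "'r::ring_1"
  shows "(1 - y) * (\<Sum>i<p. y ^ i) = 1 - y ^ p" "(\<Sum>i<p. y ^ i) * (1 - y) = 1 - y ^ p"
proof -
  show "(1 - y) * (\<Sum>i<p. y ^ i) = 1 - y ^ p"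
  proof (induction p)
    case (Suc p)
    have "(1 - y) * (\<Sum>i<Suc p. y ^ i) = (1 - y) * (\<Sum>i<p. y ^ i) + (1 - y) * y ^ p" by (simp add: distrib_left)
    then show ?case unfolding Suc by (simp add: left_diff_distrib)
  qed simp
  show "(\<Sum>i<p. y ^ i) * (1 - y) = 1 - y ^ p"
  proof (induction p)
    case (Suc p)
    have "(\<Sum>i<Suc p. y ^ i) * (1 - y) = (\<Sum>i<p. y ^ i) * (1 - y) + y ^ p * (1 - y)" by (simp add: distrib_right)
    then show ?case unfolding Suc by (simp add: right_diff_distrib power_commutes)
  qed simp
qed

text \<open>As d and p are coprime, Bezout expresses g through powers of g^p and g^d.\<close>

lemma prime_power_mem:
  assumes L: "divring L" and g: "g \<in> units" "g ^ p \<in> L" "g ^ d \<in> L" and p: "prime p" "0 < d" "d < p"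
  shows "g \<in> L"
proof -
  note sL = subrng_power[OF divringD(1)[OF L]]
  have "coprime d p" using p by (metis coprime_commute nat_dvd_not_less prime_imp_coprime)
  obtain e x y where e: "e dvd d" "e dvd p" "d * x = p * y + e" using bezout_add_strong_nat[of d p] p(2) by auto
  then have "e = 1" using \<open>coprime d p\<close> coprime_common_divisor_nat by blast
  then have "(g ^ d) ^ x = (g ^ p) ^ y * g" using e(3) by (simp flip: power_mult add: power_commutes)
  then have "g = ui ((g ^ p) ^ y) * (g ^ d) ^ x" using g(1) by simp
  moreover have "ui ((g ^ p) ^ y) \<in> L" using divringD(4)[OF L sL[OF g(2)]] unit_nonzero[of "(g ^ p) ^ y"] g(1) by simp
  ultimately show ?thesis using sL[OF g(3)] subrngD(4)[OF divringD(1)[OF L]] by metis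
qed

section \<open>Elements of prime order modulo the field L, and the dimension count\<close>

context maximal_solvable
begin

text \<open>For p = 3 all elements of F other than 0 and 1 are roots of f * f + f + 1. A quadratic
  polynomial has at most two roots in the field F, which leaves room for four elements at
  most.\<close>

lemma F_roots_exponent:
  assumes p: "prime p" and f: "\<And>f. f \<in> F \<Longrightarrow> f \<noteq> 0 \<Longrightarrow> f ^ p = 1" shows "p \<ge> 5"
proof -
  note sF = subrngD[OF subrng_centralizer[of UNIV]]
  have "p \<noteq> 2"
  proof
    assume "p = 2"
    obtain a where a: "a \<in> F" "a \<noteq> 0" "a * a \<noteq> 1" using F_square by blast
    then show False using f[OF a(1,2)] \<open>p = 2\<close> by (simp add: power2_eq_square)
  qed
  moreover have "p \<noteq> 3"
  proof
    assume p3: "p = 3"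
    have r: "f * f + f + 1 = 0" if ff: "f \<in> F" "f \<notin> {0, 1}" for f :: "('a, 'n) endo"
    proof -
      have "(f - 1) * (f * f + f + 1) = f ^ 3 - 1" by (simp add: algebra_simps power3_eq_cube)
      also have "\<dots> = 0" using f[OF ff(1)] ff p3 by simp
      finally show ?thesis using divring_mult_eq_0[OF divring_cen, of "f - 1"] sF(6)[OF ff(1) sF(2)] ff(2) by auto
    qed
    have s: "b = -1 - a" if "a \<in> F" "b \<in> F" "a \<notin> {0, 1}" "b \<notin> {0, 1, a}" for a b
    proof -
      have "(a - b) * (a + b + 1) = (a * a + a + 1) - (b * b + b + 1)"
        using cen_commute[OF that(1), of b] by (simp add: algebra_simps)
      also have "\<dots> = 0" using r[OF that(1,3)] r[OF that(2)] that(4) by simp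
      finally have "a + b + 1 = 0" using divring_mult_eq_0[OF divring_cen, of "a - b"] sF(6)[OF that(1,2)] that(4) by auto
      then show ?thesis by (simp add: algebra_simps eq_neg_iff_add_eq_0)
    qed
    have c: "card {0, 1} < 5" "card {0, 1, x} < 5" "card {0, 1, x, y} < 5" for x y :: "('a, 'n) endo"
      by (simp_all add: card_insert_if)
    obtain a where a: "a \<in> F" "a \<notin> {0, 1}" using F_avoid[OF _ c(1)] by blast
    obtain b where b: "b \<in> F" "b \<notin> {0, 1, a}" using F_avoid[OF _ c(2)[of a]] by blast
    obtain d where d: "d \<in> F" "d \<notin> {0, 1, a, b}" using F_avoid[OF _ c(3)[of a b]] by blast
    have "b = -1 - a" using s[OF a(1) b(1) a(2) b(2)] .
    moreover have "d = -1 - a" using s[OF a(1) d(1) a(2)] d(2) by blast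
    ultimately show False using d(2) by blast
  qed
  moreover have "p \<noteq> 4" using p by auto
  ultimately show ?thesis using prime_ge_2_nat[OF p] by linarith
qed

context
  fixes A L :: "('a, 'n) endo set"
  assumes A_units: "A \<subseteq> units" and A_inv: "Minv A" and A_ab: "\<And>a b. a \<in> A \<Longrightarrow> b \<in> A \<Longrightarrow> a * b = b * a"
    and A_nc: "\<not> A \<subseteq> F" and L_eq: "L = centralizer A"
begin

lemma div_L: "divring L" and com_L: "x \<in> L \<Longrightarrow> y \<in> L \<Longrightarrow> x * y = y * x"
  using centralizer_abelian_normal[OF A_units A_inv A_ab A_nc] L_eq by auto

lemma F_L: "F \<subseteq> L" unfolding L_eq by (rule cen_sub_centralizer)
lemma inv_L': "Minv L" unfolding L_eq by (rule Minv_centralizer[OF A_inv])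
lemma self_centralizing: "(\<And>y. y \<in> L \<Longrightarrow> x * y = y * x) \<Longrightarrow> x \<in> L"
  unfolding L_eq centralizer_def using A_ab by auto

text \<open>The full normalizer of L among the units. Independence of cosets is wanted in all of it,
  because the comparison of coefficients involves elements z known only to normalize L.\<close>

definition NL :: "('a, 'n) endo set" where
  "NL = {n \<in> units. \<forall>x\<in>L. n * x * ui n \<in> L \<and> ui n * x * n \<in> L}"

lemma ugrp_NL: "ugrp NL"
  unfolding ugrp_def
proof (intro conjI ballI)
  show "1 \<in> NL" unfolding NL_def by simp
  fix x y assume xy: "x \<in> NL" "y \<in> NL"
  have "(x * y) * z * ui (x * y) = x * (y * z * ui y) * ui x"
    "ui (x * y) * z * (x * y) = ui y * (ui x * z * x) * y" for z
    using xy unfolding NL_def by (auto simp: mult.assoc)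
  then show "x * y \<in> NL" using xy unfolding NL_def by auto
qed (auto simp: NL_def)

lemma M_NL: "M \<subseteq> NL"
  unfolding NL_def using M_units MinvD[OF inv_L'] MinvD2[OF inv_L'] by blast

lemma crossed_L:
  assumes "ugrp N" "N \<subseteq> NL" shows "crossed L N (L - {0})"
proof
  show "divring L" "ugrp N" using div_L assms by auto
  show "x * y = y * x" if "x \<in> L" "y \<in> L" for x y using com_L that .
  show "n * x * ui n \<in> L" if "n \<in> N" "x \<in> L" for n x using that assms unfolding NL_def by blast
  show "L - {0} \<subseteq> units" using divringD(3)[OF div_L] by blast
  show "w * x = x * w" if "w \<in> L - {0}" "x \<in> L" for w x using com_L that by blast
  show "comm n w \<in> L" if "n \<in> N" "w \<in> L - {0}" for n w
  proof -
    have "n * w * ui n \<in> L" using that assms unfolding NL_def by blast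
    moreover have "ui w \<in> L" using divringD(4)[OF div_L] that by blast
    ultimately show ?thesis unfolding comm_def using subrngD(4)[OF divringD(1)[OF div_L]] by blast
  qed
  show "n \<in> L" if "n \<in> N" "\<And>w. w \<in> L - {0} \<Longrightarrow> n * w = w * n" for n
    by (rule self_centralizing) (use that in \<open>metis Diff_iff insertE mult_zero_left mult_zero_right singletonD\<close>)
qed

interpretation NL: crossed L NL "L - {0}" by (rule crossed_L[OF ugrp_NL order_refl])

lemma L_NL: "x \<in> L \<Longrightarrow> x \<noteq> 0 \<Longrightarrow> x \<in> NL"
  unfolding NL_def using NL.Ku com_L by (auto simp: mult.assoc) (metis NL.sK(4) mult.assoc)+

text \<open>If the span is proper, each of its units \<^term>\<open>u\<close> satisfies \<^term>\<open>u * l = z * u\<close> for nonzero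
  \<^term>\<open>l \<in> L\<close>, with \<^term>\<open>z\<close> normalizing \<^term>\<open>L\<close>. Comparing coefficients for \<^term>\<open>u = 1 + f * g\<close> shows that
  \<^term>\<open>g\<close> centralizes \<^term>\<open>L\<close>. If \<^term>\<open>(- (f * g)) ^ p = 1\<close> for all \<^term>\<open>f\<close>, that element need not be a unit;
  then \<^term>\<open>p \<ge> 5\<close>, and \<^term>\<open>1 + f * s\<close> with \<^term>\<open>s\<close> the sum of the powers of \<^term>\<open>- g\<close> takes its place.\<close>

lemma span_torsion:
  assumes N0: "N0 \<subseteq> M" "ugrp N0" "Minv N0" and g: "g \<in> N0" "g \<notin> L" and p: "prime p" "g ^ p \<in> L"
  shows "NL.kspan N0 = UNIV"
proof (rule ccontr)
  assume X: "NL.kspan N0 \<noteq> UNIV"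
  have N0L: "N0 \<subseteq> NL" using N0(1) M_NL by blast
  interpret N0: crossed L N0 "L - {0}" by (rule crossed_L[OF N0(2) N0L])
  let ?X = "NL.kspan N0"
  note sX = subrngD[OF N0.subrng_kspan]
  have invX: "Minv ?X" by (rule Minv_kspan[OF NL.norm_span_axioms inv_L' N0(3)])
  have LX: "x \<in> ?X" if "x \<in> L" for x using NL.kspan_base[OF ugrpD(2)[OF N0(2)] that] by simp
  have gX: "g \<in> ?X" "ui g \<in> ?X" using NL.kspan_base1 g ugrpD(4)[OF N0(2)] by blast+
  have gu: "g \<in> units" using ugrpD(1)[OF N0(2) g(1)] .
  have gN: "g \<in> NL" using g N0L by blast
  have "g \<in> uset ?X" "g \<notin> F" unfolding uset_def using gX gu g F_L by auto
  then have cM: "comm x y \<in> M" if "x \<in> uset ?X" "y \<in> uset ?X" for x y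
    using proper_ring(1)[OF N0.subrng_kspan invX X] that by blast
  have Lu: "x \<in> uset ?X" if "x \<in> L" "x \<noteq> 0" for x unfolding uset_def using LX that NL.Ku by auto
  \<comment> \<open>The commutator of u and l lies in M by \<open>proper_ring\<close>, hence
    normalizes L, and multiplying it by l keeps it in \<open>NL\<close>.\<close>
  have key: "\<exists>z\<in>NL. u * l = z * u" if u: "u \<in> uset ?X" and l: "l \<in> L" "l \<noteq> 0" for u l
  proof -
    have uu: "u \<in> units" "l \<in> units" using u l uset_units NL.Ku by auto
    have "comm u l * l \<in> NL" using cM[OF u Lu[OF l]] M_NL L_NL[OF l] NL.N_mult by blast
    moreover have "u * l = (comm u l * l) * u" using uu by (simp add: comm_def mult.assoc)
    ultimately show ?thesis by blast
  qed
  obtain l' where l': "l' \<in> L" "g * l' \<noteq> l' * g" using self_centralizing[of g] g(2) by blast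
  have Fc: "f * x = x * f" if "f \<in> F" for f x :: "('a, 'n) endo" using cen_commute that by blast
  show False
  proof (cases "\<exists>f\<in>F. f \<noteq> 0 \<and> (- (f * g)) ^ p \<noteq> 1")
    case True
    then obtain f where f: "f \<in> F" "f \<noteq> 0" "(- (f * g)) ^ p \<noteq> 1" by blast
    have fL: "f \<in> L" using f F_L by blast
    define y where "y = - (f * g)"
    have yp: "y ^ j = (- f) ^ j * g ^ j" for j
    proof (induction j)
      case (Suc j)
      have "y ^ Suc j = (- f) * (g * (- f) ^ j) * g ^ j" using Suc by (simp add: y_def mult.assoc)
      also have "g * (- f) ^ j = (- f) ^ j * g"
        using Fc[OF subrng_power[OF subrng_centralizer subrngD(5)[OF subrng_centralizer f(1)]], of j g] by simp
      finally show ?case by (simp add: mult.assoc)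
    qed simp
    have ypL: "1 - y ^ p \<in> L" unfolding yp
      using NL.sK(2,4,6) subrng_power[OF divringD(1)[OF div_L] NL.sK(5)[OF fL]] p(2) by blast
    have yp0: "1 - y ^ p \<noteq> 0" using f(3) unfolding y_def by simp
    define e where "e = 1 - y ^ p"
    have eu: "e \<in> units" "ui e \<in> L" using NL.Ku ypL yp0 unfolding e_def by auto
    define u where "u = 1 + f * g"
    have u1: "u = 1 - y" unfolding u_def y_def by simp
    \<comment> \<open>The inverse of 1 - y: the geometric sum divided by \<open>1 - y ^ p\<close>, a
      nonzero element of the field L.\<close>
    define v where "v = ui e * (\<Sum>i<p. y ^ i)"
    have "e * (1 - y) = (1 - y) * e" unfolding e_def by (simp add: algebra_simps power_commutes)
    then have uy: "ui e * (1 - y) = (1 - y) * ui e" by (rule units_commute_ui[OF eu(1)])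
    have "v * u = 1" unfolding v_def u1 mult.assoc geometric_sum(2) using eu unfolding e_def by simp
    moreover have "u * v = 1"
    proof -
      have "u * v = ui e * ((1 - y) * (\<Sum>i<p. y ^ i))" unfolding v_def u1 by (simp only: mult.assoc[symmetric] uy)
      then show ?thesis unfolding geometric_sum(1) using eu unfolding e_def by simp
    qed
    ultimately have uu: "u \<in> units" "ui u = v" using unitsI ui_eq by blast+
    have yX: "y \<in> ?X" unfolding y_def using sX(4,5) LX[OF fL] gX by blast
    have "u \<in> ?X" unfolding u1 using sX(2,6) yX by blast
    moreover have "v \<in> ?X" unfolding v_def
      by (intro sX(4) LX[OF eu(2)] subrng_sum[OF N0.subrng_kspan] subrng_power[OF N0.subrng_kspan yX])
    ultimately have uX: "u \<in> uset ?X" unfolding uset_def using uu by simp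
    \<comment> \<open>With s the conjugate of l by g, the relation reads l + f * s * g = z + f * z *
      g. If z were neither in L nor in the coset of g, its coset would occur only once; z in L
      forces s = l. So z = b * g, and then g * g must lie in L.\<close>
    have main: "l = f * f * (g * l * ui g) * (g * g)" if l: "l \<in> L" "g * l \<noteq> l * g" for l
    proof -
      define s where "s = g * l * ui g"
      have sL: "s \<in> L" unfolding s_def using NL.K_norm[OF gN l(1)] .
      have gl: "g * l = s * g" unfolding s_def using gu by (simp add: mult.assoc)
      have sl: "s \<noteq> l" using gl l(2) by auto
      have l0: "l \<noteq> 0" using l(2) by auto
      obtain z where z: "z \<in> NL" "u * l = z * u" using key[OF uX l(1) l0] by blast
      have zu: "z \<in> units" using NL.N_units z by blast
      have eq: "l + f * s * g = z + f * (z * g)"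
      proof -
        have "u * l = l + f * s * g" unfolding u_def by (simp add: distrib_right mult.assoc gl)
        moreover have "z * (f * g) = f * (z * g)" using Fc[OF f(1), of z] by (simp flip: mult.assoc)
        then have "z * u = z + f * (z * g)" unfolding u_def by (simp add: distrib_left)
        ultimately show ?thesis using z(2) by simp
      qed
      have g_coeff: "a = 0" if "a \<in> L" "a * g \<in> L" for a
      proof (rule ccontr)
        assume "a \<noteq> 0"
        then have au: "ui a \<in> L" "a \<in> units" using NL.Ku[OF that(1)] by auto
        then have "ui a * (a * g) \<in> L" using NL.sK(4)[OF _ that(2)] by blast
        then show False using g(2) au by simp
      qed
      have zL: "z \<notin> L"
      proof
        assume zL: "z \<in> L"
        have "(f * (s - z)) * g = z - l" using eq by (simp add: algebra_simps)
        then have "f * (s - z) = 0" using g_coeff[of "f * (s - z)"] NL.sK fL sL zL l(1) by auto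
        then have "s - z = 0" using divring_mult_eq_0[OF div_L fL] f(2) by blast
        then have "s = z" by simp
        moreover have "z = l" using eq \<open>s = z\<close> by (simp add: mult.assoc)
        ultimately show False using sl by simp
      qed
      have zg: "z * ui g \<in> L"
      proof (rule ccontr)
        assume nz: "z * ui g \<notin> L"
        let ?P = "{m \<in> NL. m * ui z \<notin> L}"
        have "1 \<in> ?P" using ugrpD(2)[OF ugrp_NL] zL zu NL.K_equiv_sym[OF z(1) ugrpD(2)[OF ugrp_NL]] by simp
        moreover have "g \<in> ?P" using gN nz NL.K_equiv_sym[OF z(1) gN] by simp
        moreover have "z * g \<in> ?P"
        proof -
          have "z * g * ui z \<notin> L"
          proof
            assume "z * g * ui z \<in> L"
            then have "ui z * (z * g * ui z) * z \<in> L" using z(1) unfolding NL_def by blast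
            then show False using g(2) zu by (simp add: mult.assoc)
          qed
          then show ?thesis using NL.N_mult[OF z(1) gN] by simp
        qed
        ultimately have "l * 1 + (f * s) * g - f * (z * g) \<in> NL.kspan ?P"
          by (intro NL.kspan_diff NL.kspan_add NL.kspan_base) (use l fL sL NL.sK in auto)
        moreover have "l * 1 + (f * s) * g - f * (z * g) = z" using eq by simp
        ultimately show False using NL.independent[OF z(1)] by simp
      qed
      define b where "b = z * ui g"
      have bL: "b \<in> L" and zb: "z = b * g" unfolding b_def using zg gu by (simp_all add: mult.assoc)
      have eq2: "l + f * s * g = b * g + f * b * (g * g)" using eq unfolding zb by (simp add: mult.assoc)
      have gg: "g * g \<in> L"
      proof (rule ccontr)
        assume ng: "g * g \<notin> L"
        let ?P = "{m \<in> NL. m * ui 1 \<notin> L}"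
        have "(b - f * s) * g + (f * b) * (g * g) \<in> NL.kspan ?P"
          by (intro NL.kspan_add NL.kspan_base) (use gN NL.N_mult[OF gN gN] g(2) ng bL fL sL NL.sK in auto)
        moreover have "(b - f * s) * g + (f * b) * (g * g) = l" using eq2 by (simp add: algebra_simps)
        ultimately have "l \<in> NL.kspan ?P" by metis
        then have "ui l * l \<in> NL.kspan ?P" using NL.kspan_scale NL.Ku(2)[OF l(1) l0] by blast
        then have "1 \<in> NL.kspan ?P" using NL.Ku(1)[OF l(1) l0] by simp
        then show False using NL.independent[OF ugrpD(2)[OF ugrp_NL]] by blast
      qed
      have "(f * s - b) * g = f * b * (g * g) - l" using eq2 by (simp add: algebra_simps)
      then have "f * s - b = 0" using g_coeff[of "f * s - b"] NL.sK fL sL bL gg l(1) by auto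
      then have bs: "b = f * s" by simp
      then have "l = f * b * (g * g)" using eq2 by simp
      then show ?thesis unfolding bs s_def by (simp add: mult.assoc)
    qed
    \<comment> \<open>Applying \<open>main\<close> to l' and to l' + 1 and subtracting gives f * f *
      (g * g) = 1; then l' is fixed by conjugation with g.\<close>
    have "g * (l' + 1) \<noteq> (l' + 1) * g" using l'(2) by (simp add: algebra_simps)
    then have m1: "l' + 1 = f * f * (g * (l' + 1) * ui g) * (g * g)" using main l'(1) NL.sK(2,3) by blast
    have m2: "l' = f * f * (g * l' * ui g) * (g * g)" using main l' by blast
    have "g * (l' + 1) * ui g = g * l' * ui g + 1" using gu by (simp add: distrib_left distrib_right)
    then have "l' + 1 = l' + f * f * (g * g)" using m1 m2 by (metis distrib_left distrib_right mult_1_right)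
    then have ffg: "f * f * (g * g) = 1" by simp
    have "l' = (g * l' * ui g) * (f * f * (g * g))" using m2 Fc[OF f(1)] by (metis mult.assoc)
    then have "l' = g * l' * ui g" using ffg by simp
    then have "l' * g = g * l'" using gu by (metis mult.assoc mult_1_right ui_left)
    then show False using l'(2) by simp
  next
    case False
    then have all1: "(- (f * g)) ^ p = 1" if "f \<in> F" "f \<noteq> 0" for f using that by blast
    \<comment> \<open>Taking f = 1 gives h^p = 1, and then f^p = 1 for every nonzero f. The sum s of
      the powers of \<open>h\<close> is killed by 1 - h and satisfies s * s = p * s.\<close>
    define h where "h = - g"
    have F1: "1 \<in> F" using subrngD(2)[OF subrng_centralizer] .
    have hp: "h ^ p = 1" unfolding h_def using all1[OF F1] unit_nonzero[OF units_1] by simp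
    have hu: "h \<in> units" and hN: "h \<in> NL" unfolding h_def using gu gN unfolding NL_def by auto
    have hL: "h \<notin> L" unfolding h_def using g(2) NL.sK(5)[of "- g"] by auto
    have fp: "f ^ p = 1" if f: "f \<in> F" "f \<noteq> 0" for f
    proof -
      have "(f * h) ^ j = f ^ j * h ^ j" for j
      proof (induction j)
        case (Suc j)
        have "(f * h) ^ Suc j = f * (h * f ^ j) * h ^ j" using Suc by (simp add: mult.assoc)
        also have "h * f ^ j = f ^ j * h" using Fc[OF subrng_power[OF subrng_centralizer f(1)]] by simp
        finally show ?case by (simp add: mult.assoc)
      qed simp
      then have "(f * h) ^ p = f ^ p" using hp by simp
      moreover have "f * h = - (f * g)" unfolding h_def by simp
      ultimately show ?thesis using all1[OF f] by simp
    qed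
    have p5: "p \<ge> 5" by (rule F_roots_exponent[OF p(1) fp])
    obtain q where q: "p = Suc q" using p5 by (cases p) auto
    define s where "s = (\<Sum>i<p. h ^ i)"
    have sh: "s * (1 - h) = 0" "h * s = s" unfolding s_def using geometric_sum(2)[where y = h and p = p] geometric_sum(1)[where y = h and p = p] hp
      by (simp_all add: algebra_simps)
    have "h ^ i * s = s" for i using sh(2) by (induction i) (simp_all add: mult.assoc)
    then have ss: "s * s = of_nat p * s" by (subst (1) s_def) (simp add: sum_distrib_right)
    \<comment> \<open>Avoiding -1/p keeps t = 1 + f * p nonzero, and 1 + f * s then has the inverse
      1 - (f / t) * s. If p vanishes in F, then t = 1 whatever value \<open>ui\<close> takes
      there.\<close>
    have "\<exists>f\<in>F. f \<notin> {0, - ui (of_nat p)}" by (rule F_avoid) (simp_all add: card_insert_if)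
    then obtain f where f: "f \<in> F" "f \<noteq> 0" "f \<noteq> - ui (of_nat p)" by blast
    have pF: "of_nat p \<in> F" by (rule subrng_of_nat[OF subrng_centralizer])
    define t where "t = 1 + f * of_nat p"
    have tF: "t \<in> F" unfolding t_def using subrngD(2,3,4)[OF subrng_centralizer] f pF by blast
    have t0: "t \<noteq> 0"
    proof
      assume t0: "t = 0"
      then have pn: "of_nat p \<noteq> (0 :: ('a, 'n) endo)" unfolding t_def by auto
      have pu: "of_nat p \<in> (units :: ('a, 'n) endo set)" using divringD(3)[OF divring_cen pF pn] .
      have "f * of_nat p = -1" using t0 unfolding t_def by (simp add: eq_neg_iff_add_eq_0 add.commute)
      then have "f * of_nat p * ui (of_nat p) = - ui (of_nat p)" by simp
      then show False using f(3) pu by (simp add: mult.assoc)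
    qed
    have tu: "t \<in> units" "ui t \<in> F" using divringD(3,4)[OF divring_cen tF t0] by auto
    define u where "u = 1 + f * s"
    define v where "v = 1 - f * ui t * s"
    have c1: "s * f = f * s" "s * (f * x) = f * (s * x)" "s * (ui t * x) = ui t * (s * x)"
      "of_nat p * (f * x) = f * (of_nat p * x)" "of_nat p * (ui t * x) = ui t * (of_nat p * x)"
      "ui t * (f * x) = f * (ui t * x)" for x
      using Fc[OF f(1)] Fc[OF tu(2)] by (metis mult.assoc)+
    have te: "f * s = f * (ui t * s) + f * (ui t * (f * (of_nat p * s)))"
    proof -
      have "f * s = f * (ui t * (t * s))" using tu by simp
      then show ?thesis unfolding t_def by (simp add: distrib_left distrib_right mult.assoc)
    qed
    have "u * v = 1 + (f * s - (f * (ui t * s) + f * (ui t * (f * (of_nat p * s)))))"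
      "v * u = 1 + (f * s - (f * (ui t * s) + f * (ui t * (f * (of_nat p * s)))))"
      unfolding u_def v_def by (simp_all add: algebra_simps c1 ss mult.assoc)
    then have "u * v = 1" "v * u = 1" unfolding te[symmetric] by simp_all
    then have uu: "u \<in> units" "ui u = v" using unitsI ui_eq by blast+
    have hX: "h \<in> ?X" unfolding h_def using gX sX by blast
    have sX': "s \<in> ?X" unfolding s_def by (intro subrng_sum[OF N0.subrng_kspan] subrng_power[OF N0.subrng_kspan hX])
    have fX: "f \<in> ?X" "ui t \<in> ?X" using LX F_L f tu by blast+
    have "u \<in> ?X" "v \<in> ?X" unfolding u_def v_def using sX sX' fX by auto
    then have uX: "u \<in> uset ?X" unfolding uset_def using uu by simp
    have l0: "l' \<noteq> 0" using l'(2) by auto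
    obtain z where z: "z \<in> NL" "u * l' = z * u" using key[OF uX l'(1) l0] by blast
    define a where "a i = h ^ i * l' * ui (h ^ i)" for i
    have hiN: "h ^ i \<in> NL" for i using ugrp_power[OF ugrp_NL hN] .
    have aL: "a i \<in> L" for i unfolding a_def by (rule NL.K_norm[OF hiN l'(1)])
    have ah: "h ^ i * l' = a i * h ^ i" for i unfolding a_def using hu by (simp add: mult.assoc)
    have a_ne: "a (Suc i) \<noteq> a i" for i
    proof
      assume "a (Suc i) = a i"
      then have "ui (h ^ i) * a (Suc i) * h ^ i = ui (h ^ i) * a i * h ^ i" by simp
      then have "h * l' * ui h = l'" unfolding a_def using hu by (simp add: mult.assoc power_Suc2 del: power_Suc)
      then have "h * l' = l' * h" using hu by (metis mult.assoc mult_1_right ui_left)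
      then show False using l'(2) unfolding h_def by simp
    qed
    \<comment> \<open>The coefficients \<open>a\<close> shifted cyclically by one; the case i = 0 is
      the wrap-around through h^p = 1.\<close>
    define b where "b i = (if i = 0 then a q else a (i - 1))" for i
    have b_sum: "(\<Sum>i<p. b i * h ^ i) = (\<Sum>i<p. a i * h ^ Suc i)"
    proof -
      have "(\<Sum>i<p. b i * h ^ i) = b 0 + (\<Sum>i<q. b (Suc i) * h ^ Suc i)" unfolding q by (subst sum.lessThan_Suc_shift) simp
      also have "\<dots> = a q * h ^ Suc q + (\<Sum>i<q. a i * h ^ Suc i)" using hp unfolding b_def q by simp
      also have "\<dots> = (\<Sum>i<p. a i * h ^ Suc i)" unfolding q by (simp del: power_Suc)
      finally show ?thesis .
    qed
    have sl: "s * l' * (1 - h) = (\<Sum>i<p. (a i - b i) * h ^ i)"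
    proof -
      have "s * l' = (\<Sum>i<p. a i * h ^ i)" unfolding s_def by (simp add: sum_distrib_right ah)
      then have "s * l' * (1 - h) = (\<Sum>i<p. a i * h ^ i) - (\<Sum>i<p. a i * h ^ Suc i)"
        by (simp add: right_diff_distrib sum_distrib_right mult.assoc power_commutes)
      then show ?thesis unfolding b_sum[symmetric] by (simp add: left_diff_distrib sum_subtractf)
    qed
    \<comment> \<open>Multiplication by 1 - h on the right turns u into 1 and so leaves only the
      cosets of z and z * h on the right-hand side.\<close>
    have "u * l' * (1 - h) = z * (u * (1 - h))" unfolding z(2) mult.assoc ..
    also have "u * (1 - h) = 1 - h" unfolding u_def using sh(1) by (simp add: distrib_right mult.assoc)
    finally have "u * l' * (1 - h) = z - z * h" by (simp only: right_diff_distrib mult_1_right)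
    moreover have "u * l' * (1 - h) = l' * (1 - h) + f * (s * l' * (1 - h))"
      unfolding u_def by (simp only: distrib_right mult_1_left mult.assoc)
    ultimately have "l' * (1 - h) + f * (s * l' * (1 - h)) = z - z * h" by simp
    then have rel: "l' * 1 - l' * h + f * (\<Sum>i<p. (a i - b i) * h ^ i) = z - z * h"
      unfolding sl by (simp add: right_diff_distrib)
    have neq: "h ^ i * ui (h ^ j) \<notin> L" if ij: "i < p" "j < p" "i \<noteq> j" for i j
    proof -
      have lt: "h ^ i * ui (h ^ j) \<notin> L" if "j < i" "i < p" for i j
      proof
        assume m: "h ^ i * ui (h ^ j) \<in> L"
        have "h ^ i = h ^ (i - j) * h ^ j" using that by (simp flip: power_add)
        then have "h ^ (i - j) \<in> L" using m hu by (simp add: mult.assoc)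
        then have "h \<in> L" using prime_power_mem[OF div_L hu _ _ p(1), of "i - j"] that hp NL.sK(2) by auto
        then show False using hL by simp
      qed
      show ?thesis using lt[of j i] lt[of i j] NL.K_equiv_sym[OF hiN hiN, of i j] ij by (metis linorder_neqE_nat)
    qed
    \<comment> \<open>For exponents j from 2 to p - 1 the left side has the coefficient f * (a j - b
      j), nonzero because consecutive conjugates of l' differ. Independence then puts h^j into one
      of the two cosets.\<close>
    have zz: "h ^ j * ui z \<in> L \<or> h ^ j * ui (z * h) \<in> L" if j: "2 \<le> j" "j < p" for j
    proof (rule ccontr)
      assume n: "\<not> ?thesis"
      let ?P = "{m \<in> NL. m * ui (h ^ j) \<notin> L}"
      have zhN: "z * h \<in> NL" using NL.N_mult[OF z(1) hN] .
      have zP: "z \<in> ?P" "z * h \<in> ?P" using n z(1) zhN NL.K_equiv_sym[OF hiN z(1), of j] NL.K_equiv_sym[OF hiN zhN, of j] by auto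
      have hP: "h ^ i \<in> ?P" if "i < p" "i \<noteq> j" for i using hiN neq[OF that(1) j(2) that(2)] by simp
      have oP: "1 \<in> ?P" "h \<in> ?P" using hP[of 0] hP[of 1] j by auto
      have ab: "a i - b i \<in> L" for i unfolding b_def using aL NL.sK by auto
      have fL: "f \<in> L" using f F_L by blast
      have e1: "f * (\<Sum>i<p. (a i - b i) * h ^ i) = z - z * h - l' * 1 + l' * h" using rel by (simp add: algebra_simps)
      have "(\<Sum>i<p. (a i - b i) * h ^ i) = (a j - b j) * h ^ j + (\<Sum>i\<in>{..<p} - {j}. (a i - b i) * h ^ i)"
        using j(2) by (subst sum.remove[of _ j]) auto
      then have e2: "f * (\<Sum>i<p. (a i - b i) * h ^ i) = (f * (a j - b j)) * h ^ j + f * (\<Sum>i\<in>{..<p} - {j}. (a i - b i) * h ^ i)"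
        by (simp only: distrib_left mult.assoc)
      have e: "(f * (a j - b j)) * h ^ j = z - z * h - l' * 1 + l' * h - f * (\<Sum>i\<in>{..<p} - {j}. (a i - b i) * h ^ i)"
        by (rule iffD2[OF eq_diff_eq], rule trans[OF e2[symmetric] e1])
      have "\<dots> \<in> NL.kspan ?P"
      proof (intro NL.kspan_diff NL.kspan_add)
        show "f * (\<Sum>i\<in>{..<p} - {j}. (a i - b i) * h ^ i) \<in> NL.kspan ?P"
          by (intro NL.kspan_scale NL.kspan_sum NL.kspan_base hP ab fL) auto
      qed (use zP NL.kspan_base1 NL.kspan_base[OF oP(1) l'(1)] NL.kspan_base[OF oP(2) l'(1)] in auto)
      then have m: "(f * (a j - b j)) * h ^ j \<in> NL.kspan ?P" using e by simp
      have "a j - b j \<noteq> 0" using a_ne[of "j - 1"] j unfolding b_def by simp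
      then have "f * (a j - b j) \<noteq> 0" using divring_mult_eq_0[OF div_L fL] f(2) by blast
      moreover have "f * (a j - b j) \<in> L" using fL ab NL.sK(4) by blast
      ultimately have cu: "f * (a j - b j) \<in> units" "ui (f * (a j - b j)) \<in> L" using NL.Ku by auto
      have "ui (f * (a j - b j)) * ((f * (a j - b j)) * h ^ j) \<in> NL.kspan ?P" by (rule NL.kspan_scale[OF m cu(2)])
      then have "h ^ j \<in> NL.kspan ?P" using cu(1) by simp
      then show False using NL.independent[OF hiN] by blast
    qed
    have two: False if ij: "i < p" "j < p" "i \<noteq> j" and w: "w \<in> NL" "h ^ i * ui w \<in> L" "h ^ j * ui w \<in> L" for i j w
    proof -
      have "w * ui (h ^ j) \<in> L" using NL.K_equiv_sym[OF hiN w(1), of j] w(3) by simp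
      then have "(h ^ i * ui w) * (w * ui (h ^ j)) \<in> L" using NL.sK(4) w(2) by blast
      then have "h ^ i * ui (h ^ j) \<in> L" using NL.N_units[OF w(1)] by (simp add: mult.assoc)
      then show False using neq[OF ij] by simp
    qed
    have zhN: "z * h \<in> NL" using NL.N_mult[OF z(1) hN] .
    \<comment> \<open>Pigeonhole: the exponents 2, 3 and 4 cannot share two cosets, and p >= 5 makes
      all three available.\<close>
    show False
      using zz[of 2] zz[of 3] zz[of 4] two[of 2 3] two[of 2 4] two[of 3 4] z(1) zhN p5 by auto
  qed
qed

text \<open>A normalizing element outside all cosets of N0 would be independent of N0.\<close>

lemma kspan_member_equiv:
  assumes N0: "N0 \<subseteq> NL" and m: "m \<in> NL" "m \<in> NL.kspan N0" shows "\<exists>n\<in>N0. m * ui n \<in> L"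
proof (rule ccontr)
  assume n: "\<not> ?thesis"
  have "N0 \<subseteq> {n \<in> NL. n * ui m \<notin> L}" using n N0 NL.K_equiv_sym[OF m(1)] by blast
  then show False using NL.independent[OF m(1)] m(2) NL.kspan_mono by blast
qed

lemma comm_mod_L:
  assumes N0: "n \<in> NL" "n' \<in> NL" "comm n n' \<in> L" and a: "a \<in> L" "a' \<in> L" and u: "a * n \<in> units" "a' * n' \<in> units"
  shows "comm (a * n) (a' * n') \<in> L"
proof -
  have nu: "n \<in> units" "n' \<in> units" using N0 NL.N_units by auto
  have au: "a \<in> units" "a' \<in> units"
  proof -
    have "a = (a * n) * ui n" "a' = (a' * n') * ui n'" using nu by (simp_all add: mult.assoc)
    then show "a \<in> units" "a' \<in> units" using units_mult[OF u(1) ui_units[OF nu(1)]] units_mult[OF u(2) ui_units[OF nu(2)]] by simp_all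
  qed
  define b where "b = n * a' * ui n"
  define b' where "b' = n' * a * ui n'"
  have b: "b \<in> L" "b' \<in> L" unfolding b_def b'_def using NL.K_norm N0 a by auto
  have bu: "b \<in> units" "b' \<in> units" unfolding b_def b'_def using nu au by auto
  have "(a * n) * (a' * n') = a * b * (n * n')" unfolding b_def using nu by (simp add: mult.assoc)
  also have "n * n' = comm n n' * (n' * n)" by (rule comm_swap[OF nu])
  also have "a * b * (comm n n' * (n' * n)) = (a * b * comm n n' * ui (a' * b')) * ((a' * n') * (a * n))"
  proof -
    have "(a' * n') * (a * n) = a' * b' * (n' * n)" unfolding b'_def using nu by (simp add: mult.assoc)
    then show ?thesis using au bu by (simp add: mult.assoc)
  qed
  finally have "comm (a * n) (a' * n') = a * b * comm n n' * ui (a' * b')" by (rule comm_eq[OF u])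
  moreover have "ui (a' * b') \<in> L" using NL.K_uset NL.sK(4) a b au bu by simp
  ultimately show ?thesis using NL.sK(4) a b N0(3) by simp
qed

text \<open>The whole ring is spanned over the field \<^term>\<open>L\<close> by the powers of \<^term>\<open>g\<close>, so it has dimension
  the prime \<^term>\<open>p\<close>; this is also the number of columns times the dimension of one corner.\<close>

lemma field_contradiction:
  assumes nonab: "\<exists>x\<in>M. \<exists>y\<in>M. x * y \<noteq> y * x"
  shows False
proof -
  have nML: "\<not> M \<subseteq> L" using nonab com_L by blast
  have nn: "normalizes M M" unfolding normalizes_def using ugrpD(3,4)[OF grp_M] by simp
  have Mu: "M \<subseteq> units" using M_units by blast
  obtain N where N: "N \<subseteq> M" "ugrp N" "normalizes M N" "\<not> N \<subseteq> L" "\<forall>x\<in>N. \<forall>y\<in>N. comm x y \<in> L"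
    using last_derived[OF sol_M grp_M Mu nn nML NL.sK(2)] by meson
  have invN: "Minv N" using N(3) unfolding Minv_def normalizes_def .
  have NNL: "N \<subseteq> NL" using N(1) M_NL by blast
  have Om: "L - {0} \<subseteq> NL.kspan N"
    using NL.kspan_base[OF ugrpD(2)[OF N(2)]] by fastforce
  obtain g p where g: "g \<in> N" "g \<notin> L" "prime p" "g ^ p \<in> L"
    using prime_torsion_exists[OF crossed_L[OF N(2) NNL] inv_L' invN F_L _ N(4) Om] N(5) by blast
  have gM: "g \<in> M" "g \<in> NL" "g \<in> units" using g N(1) M_NL M_units by auto
  have span: "NL.kspan N = UNIV" by (rule span_torsion[OF N(1,2) invN g])
  \<comment> \<open>As N spans everything, each element of M is an L-multiple of an element of N, so
    M and not only N is abelian modulo L.\<close>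
  have commM: "comm x y \<in> L" if xy: "x \<in> M" "y \<in> M" for x y
  proof -
    obtain n where n: "n \<in> N" "x * ui n \<in> L" using kspan_member_equiv[OF NNL, of x] span xy M_NL by blast
    obtain n' where n': "n' \<in> N" "y * ui n' \<in> L" using kspan_member_equiv[OF NNL, of y] span xy M_NL by blast
    have u: "n \<in> units" "n' \<in> units" using n n' NNL NL.N_units by auto
    have "x = (x * ui n) * n" "y = (y * ui n') * n'" using u by (simp_all add: mult.assoc)
    then show ?thesis using comm_mod_L[of n n' "x * ui n" "y * ui n'"] n n' N(5) NNL M_units xy by (metis subsetD)
  qed
  have giN: "g ^ i \<in> NL" "g ^ i \<in> M" for i using ugrp_power[OF ugrp_NL gM(2)] ugrp_power[OF grp_M gM(1)] by auto
  \<comment> \<open>The part of M inside the cosets of the powers of g. It is invariant by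
    \<open>commM\<close>, so \<open>span_torsion\<close> applies to it and the first p powers of g
    already span.\<close>
  define H where "H = {m \<in> M. \<exists>i. \<exists>a\<in>L. m = a * g ^ i}"
  have HM: "H \<subseteq> M" unfolding H_def by blast
  have mv: "g ^ i * b = (g ^ i * b * ui (g ^ i)) * g ^ i" for i b using gM(3) by (simp add: mult.assoc)
  have cj: "g ^ i * b * ui (g ^ i) \<in> L" if "b \<in> L" for i b by (rule NL.K_norm[OF giN(1) that])
  have "ugrp H" unfolding ugrp_def
  proof (intro conjI ballI)
    show "H \<subseteq> units" using HM M_units by blast
    show "1 \<in> H" unfolding H_def using ugrpD(2)[OF grp_M] NL.sK(2) by (auto intro!: exI[of _ 0])
  next
    fix x y assume "x \<in> H" "y \<in> H"
    then obtain i j a b where xy: "x \<in> M" "y \<in> M" "a \<in> L" "b \<in> L" "x = a * g ^ i" "y = b * g ^ j" unfolding H_def by blast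
    have "x * y = a * (g ^ i * b) * g ^ j" using xy by (simp add: mult.assoc)
    also have "\<dots> = (a * (g ^ i * b * ui (g ^ i))) * g ^ (i + j)" by (subst mv) (simp add: mult.assoc power_add)
    finally show "x * y \<in> H" unfolding H_def using NL.sK(4)[OF xy(3) cj[OF xy(4)]] ugrpD(3)[OF grp_M] xy(1,2) by blast
  next
    fix x assume "x \<in> H"
    then obtain i a where x: "x \<in> M" "a \<in> L" "x = a * g ^ i" unfolding H_def by blast
    have au: "a \<in> units"
    proof -
      have "a = x * ui (g ^ i)" using x gM(3) by (simp add: mult.assoc)
      then show ?thesis using M_units[OF x(1)] gM(3) by simp
    qed
    have aL: "ui a \<in> L" using NL.K_uset x au by blast
    define j where "j = (p - 1) * i"
    have "i + j = p * i" unfolding j_def using prime_gt_0_nat[OF g(3)] by (cases p) auto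
    then have gij: "g ^ i * g ^ j = (g ^ p) ^ i" by (simp flip: power_add power_mult)
    have dL: "(g ^ p) ^ i \<in> L" using subrng_power[OF divringD(1)[OF div_L] g(4)] .
    have "g ^ i * (g ^ j * ui ((g ^ p) ^ i)) = 1" unfolding mult.assoc[symmetric] gij using gM(3) by simp
    then have "ui (g ^ i) * (g ^ i * (g ^ j * ui ((g ^ p) ^ i))) = ui (g ^ i)" by simp
    then have "ui (g ^ i) = g ^ j * ui ((g ^ p) ^ i)" using gM(3) by simp
    then have "ui x = g ^ j * (ui ((g ^ p) ^ i) * ui a)" using x au gM(3) by (simp add: mult.assoc)
    then have "ui x = (g ^ j * (ui ((g ^ p) ^ i) * ui a) * ui (g ^ j)) * g ^ j" by (rule trans[OF _ mv])
    moreover have "ui ((g ^ p) ^ i) * ui a \<in> L" using NL.sK(4) aL NL.K_uset[OF dL] gM(3) by simp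
    then have "g ^ j * (ui ((g ^ p) ^ i) * ui a) * ui (g ^ j) \<in> L" by (rule cj)
    ultimately show "ui x \<in> H" unfolding H_def using ugrpD(4)[OF grp_M x(1)] by blast
  qed
  moreover have "Minv H" unfolding Minv_def
  proof (intro ballI)
    fix m x assume m: "m \<in> M" and "x \<in> H"
    then obtain i a where x: "x \<in> M" "a \<in> L" "x = a * g ^ i" unfolding H_def by blast
    have mu: "m \<in> units" using M_units m by blast
    have "m * x * ui m = (m * a * ui m) * (comm m (g ^ i) * g ^ i)" unfolding x(3) comm_def using mu gM(3) by (simp add: mult.assoc)
    then have "m * x * ui m = ((m * a * ui m) * comm m (g ^ i)) * g ^ i" by (simp add: mult.assoc)
    moreover have "(m * a * ui m) * comm m (g ^ i) \<in> L" using NL.sK(4) MinvD[OF inv_L' m x(2)] commM[OF m giN(2)] by blast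
    moreover have "m * x * ui m \<in> M" using ugrpD(3,4)[OF grp_M] m x(1) by blast
    ultimately show "m * x * ui m \<in> H" unfolding H_def by blast
  qed
  moreover have "g \<in> H" unfolding H_def using gM(1) NL.sK(2) by (auto intro!: exI[of _ 1] bexI[of _ 1])
  ultimately have spanH: "NL.kspan H = UNIV" using span_torsion[OF HM _ _ _ g(2,3,4)] by blast
  define S where "S = (\<lambda>i. g ^ i) ` {..<p}"
  have SNL: "S \<subseteq> NL" unfolding S_def using giN by blast
  have "m \<in> NL.kspan S" if "m \<in> H" for m
  proof -
    obtain i a where x: "a \<in> L" "m = a * g ^ i" using \<open>m \<in> H\<close> unfolding H_def by blast
    have "m = (a * (g ^ p) ^ (i div p)) * g ^ (i mod p)" unfolding x(2)
      by (simp add: mult.assoc flip: power_mult power_add)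
    moreover have "g ^ (i mod p) \<in> S" unfolding S_def using prime_gt_0_nat[OF g(3)] by auto
    moreover have "a * (g ^ p) ^ (i div p) \<in> L" using NL.sK(4)[OF x(1) subrng_power[OF divringD(1)[OF div_L] g(4)]] .
    ultimately show ?thesis using NL.kspan_base by metis
  qed
  then have spanS: "NL.kspan S = UNIV" using NL.kspan_least[of H S] spanH by blast
  have neq: "g ^ i * ui (g ^ j) \<notin> L" if ij: "i < p" "j < p" "i \<noteq> j" for i j
  proof -
    have lt: "g ^ i * ui (g ^ j) \<notin> L" if ji: "j < i" "i < p" for i j
    proof
      assume m: "g ^ i * ui (g ^ j) \<in> L"
      have "g ^ i = g ^ (i - j) * g ^ j" using ji by (simp flip: power_add)
      then have "g ^ (i - j) \<in> L" using m gM(3) by (simp add: mult.assoc)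
      then have "g \<in> L" using prime_power_mem[OF div_L gM(3) g(4) _ g(3), of "i - j"] ji by auto
      then show False using g(2) by simp
    qed
    show ?thesis using lt[of j i] lt[of i j] NL.K_equiv_sym[OF giN(1) giN(1), of i j] ij by (metis linorder_neqE_nat)
  qed
  have inj: "inj_on (\<lambda>i. g ^ i) {..<p}"
  proof (rule inj_onI, rule ccontr)
    fix i j assume ij: "i \<in> {..<p}" "j \<in> {..<p}" "g ^ i = g ^ j" "i \<noteq> j"
    then have "g ^ i * ui (g ^ j) = 1" using gM(3) by simp
    then show False using neq[of i j] ij NL.sK(2) by auto
  qed
  have fS: "finite S" "card S = p" unfolding S_def using card_image[OF inj] by auto
  have indS: "c t = 0" if c: "\<And>t. c t \<in> L" "(\<Sum>t\<in>S. c t * t) = 0" "t \<in> S" for c t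
    by (rule NL.independent_sum[OF fS(1) SNL _ c(1,2,3)]) (use neq S_def in auto)
  obtain j0 :: 'n where True by simp
  let ?E = "\<lambda>i j. out (axis i 1) (\<lambda>v. v $ j) :: ('a, 'n) endo"
  have EE: "?E i j * ?E j' k = (if j = j' then ?E i k else 0)" for i j j' k
    by (auto simp: out_out axis_def)
  have sumE: "r = (\<Sum>c\<in>UNIV. r * ?E c j0 * ?E j0 c)" for r
  proof -
    have "(\<Sum>c\<in>UNIV. ?E c c) = 1"
      by (rule endo_eqI, subst (2) vec_axis_sum) (simp add: ap_sum)
    then have "r = r * (\<Sum>c\<in>UNIV. ?E c c)" by simp
    then show ?thesis by (simp add: sum_distrib_left mult.assoc EE)
  qed
  \<comment> \<open>The maps supported on the single column j0. Over L the whole ring is a sum of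
    CARD('n) copies of \<open>W\<close>.\<close>
  define W where "W = (\<lambda>r. r * ?E j0 j0) ` UNIV"
  have WE: "x * ?E j0 j0 = x" if "x \<in> W" for x using that unfolding W_def by (auto simp: mult.assoc EE)
  have WI: "x \<in> W" if "x * ?E j0 j0 = x" for x unfolding W_def using that by (metis rangeI)
  have "\<exists>B. finite B \<and> B \<subseteq> W \<and> W \<subseteq> NL.kspan B"
  proof (intro exI conjI)
    show "finite ((\<lambda>r. r * ?E j0 j0) ` S)" using fS by simp
    show "(\<lambda>r. r * ?E j0 j0) ` S \<subseteq> W" unfolding W_def by blast
    show "W \<subseteq> NL.kspan ((\<lambda>r. r * ?E j0 j0) ` S)"
    proof
      fix x assume x: "x \<in> W"
      have "x \<in> NL.kspan S" using spanS by simp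
      then obtain I c where I: "I \<subseteq> S" "\<forall>i\<in>I. c i \<in> L" "x = (\<Sum>i\<in>I. c i * i)" unfolding NL.kspan_def by blast
      have "x = (\<Sum>i\<in>I. c i * (i * ?E j0 j0))"
        by (subst WE[OF x, symmetric], subst I(3)) (simp add: sum_distrib_right mult.assoc)
      also have "\<dots> \<in> NL.kspan ((\<lambda>r. r * ?E j0 j0) ` S)" by (intro NL.kspan_sum NL.kspan_base) (use I in auto)
      finally show "x \<in> NL.kspan ((\<lambda>r. r * ?E j0 j0) ` S)" .
    qed
  qed
  then obtain B0 where "finite B0 \<and> B0 \<subseteq> W \<and> W \<subseteq> NL.kspan B0" by blast
  \<comment> \<open>A spanning set of \<open>W\<close> of least size serves as a basis over
    L.\<close>
  then obtain B where B: "finite B" "B \<subseteq> W" "W \<subseteq> NL.kspan B"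
    "\<And>B'. finite B' \<and> B' \<subseteq> W \<and> W \<subseteq> NL.kspan B' \<Longrightarrow> card B \<le> card B'"
    using ex_has_least_nat[of "\<lambda>B. finite B \<and> B \<subseteq> W \<and> W \<subseteq> NL.kspan B" B0 card] by blast
  have indB: "c b = 0" if c: "\<And>b. c b \<in> L" "(\<Sum>b\<in>B. c b * b) = 0" "b \<in> B" for c b
  proof (rule ccontr)
    assume "c b \<noteq> 0"
    then have u: "c b \<in> units" "ui (c b) \<in> L" using NL.Ku c(1) by auto
    have "c b * b = - (\<Sum>d\<in>B - {b}. c d * d)"
      using c(2) sum.remove[OF B(1) c(3), of "\<lambda>b. c b * b"] by (simp add: eq_neg_iff_add_eq_0)
    then have "b = ui (c b) * (- (\<Sum>d\<in>B - {b}. c d * d))" using u(1) by (metis ui_left2)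
    moreover have "(\<Sum>d\<in>B - {b}. c d * d) \<in> NL.kspan (B - {b})" by (rule NL.kspanI) (use B c in auto)
    then have "ui (c b) * (- (\<Sum>d\<in>B - {b}. c d * d)) \<in> NL.kspan (B - {b})" by (rule NL.kspan_scale[OF NL.kspan_minus u(2)])
    ultimately have "b \<in> NL.kspan (B - {b})" by simp
    then have "x \<in> NL.kspan (B - {b})" if "x \<in> B" for x using that NL.kspan_base1[of x "B - {b}"] by blast
    then have "W \<subseteq> NL.kspan (B - {b})" using NL.kspan_least[of B "B - {b}"] B(3) by blast
    then have "card B \<le> card (B - {b})" using B(4)[of "B - {b}"] B(1,2) by auto
    then show False using card_Diff1_less[OF B(1) c(3)] by simp
  qed
  define T where "T = B \<times> (UNIV :: 'n set)"
  define w where "w t = fst t * ?E j0 (snd t)" for t :: "('a, 'n) endo \<times> 'n"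
  have fT: "finite T" "card T = card B * CARD('n)" unfolding T_def using B(1) by (auto simp: card_cartesian_product)
  have rep: "\<exists>m. (\<forall>q\<in>Q. m q \<in> L) \<and> x = (\<Sum>q\<in>Q. m q * q)" if "x \<in> NL.kspan Q" "finite Q" for x Q
  proof -
    obtain I c where I: "finite I" "I \<subseteq> Q" "\<forall>i\<in>I. c i \<in> L" "x = (\<Sum>i\<in>I. c i * i)" using \<open>x \<in> NL.kspan Q\<close> unfolding NL.kspan_def by blast
    have "x = (\<Sum>q\<in>Q. (if q \<in> I then c q else 0) * q)" unfolding I(4)
      by (rule sum.mono_neutral_cong_left) (use I \<open>finite Q\<close> in auto)
    then show ?thesis using I NL.sK(1) by (intro exI[of _ "\<lambda>q. if q \<in> I then c q else 0"]) auto
  qed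
  have indT: "c t = 0" if c: "\<And>t. c t \<in> L" "(\<Sum>t\<in>T. c t * w t) = 0" "t \<in> T" for c t
  proof -
    obtain b i where t: "t = (b, i)" "b \<in> B" using c(3) unfolding T_def by blast
    have "(\<Sum>t\<in>T. c t * w t) * ?E i j0 = (\<Sum>b\<in>B. \<Sum>j\<in>UNIV. c (b, j) * (b * (?E j0 j * ?E i j0)))"
      unfolding T_def w_def by (simp add: sum.cartesian_product sum_distrib_right mult.assoc case_prod_unfold)
    also have "\<dots> = (\<Sum>b\<in>B. \<Sum>j\<in>UNIV. if j = i then c (b, i) * b else 0)"
      by (intro sum.cong refl) (use WE B(2) in \<open>auto simp: EE\<close>)
    also have "\<dots> = (\<Sum>b\<in>B. c (b, i) * b)" by simp
    finally have "(\<Sum>b\<in>B. c (b, i) * b) = 0" using c(2) by simp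
    then show ?thesis using indB[of "\<lambda>b. c (b, i)" b] c(1) t by auto
  qed
  have spT: "\<exists>m. (\<forall>t\<in>T. m t \<in> L) \<and> x = (\<Sum>t\<in>T. m t * w t)" for x
  proof -
    have "\<forall>i. \<exists>m. (\<forall>b\<in>B. m b \<in> L) \<and> x * ?E i j0 = (\<Sum>b\<in>B. m b * b)"
    proof
      fix i
      have "x * ?E i j0 \<in> W" by (rule WI) (simp add: mult.assoc EE)
      then show "\<exists>m. (\<forall>b\<in>B. m b \<in> L) \<and> x * ?E i j0 = (\<Sum>b\<in>B. m b * b)" using rep[OF _ B(1)] B(3) by blast
    qed
    then obtain m where mm: "\<forall>i. (\<forall>b\<in>B. m i b \<in> L) \<and> x * ?E i j0 = (\<Sum>b\<in>B. m i b * b)" using choice by meson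
    have m: "\<And>i b. b \<in> B \<Longrightarrow> m i b \<in> L" "\<And>i. x * ?E i j0 = (\<Sum>b\<in>B. m i b * b)" using mm by auto
    have "x = (\<Sum>i\<in>UNIV. (\<Sum>b\<in>B. m i b * b) * ?E j0 i)" by (subst sumE[of x]) (simp add: m(2))
    also have "\<dots> = (\<Sum>b\<in>B. \<Sum>i\<in>UNIV. m i b * (b * ?E j0 i))" by (subst sum.swap) (simp add: sum_distrib_right mult.assoc)
    also have "\<dots> = (\<Sum>t\<in>T. m (snd t) (fst t) * w t)" unfolding T_def w_def by (simp add: sum.cartesian_product case_prod_unfold)
    finally show ?thesis using m(1) unfolding T_def by (intro exI[of _ "\<lambda>t. m (snd t) (fst t)"]) auto
  qed
  have "card S \<le> card T"
    by (rule family_card_le[OF div_L fS(1) fT(1), of "\<lambda>x. x" w]) (use spT indS in blast)+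
  moreover have "card T \<le> card S"
    by (rule family_card_le[OF div_L fT(1) fS(1), of w "\<lambda>x. x"]) (use rep[OF _ fS(1)] spanS indT in blast)+
  ultimately have "p = card B * CARD('n)" using fS(2) fT(2) by simp
  then have "CARD('n) dvd p" by simp
  \<comment> \<open>A prime has no divisor of at least 2 other than itself, so \<open>W\<close> has
    dimension 1 over L.\<close>
  then have "CARD('n) = p" using g(3) n2 by (metis One_nat_def Suc_1 not_less_eq_eq order_refl prime_nat_iff)
  then have "card B = 1" using \<open>p = card B * CARD('n)\<close> prime_gt_0_nat[OF g(3)] by simp
  then obtain b where b: "B = {b}" by (rule card_1_singletonE)
  have bW: "b * ?E j0 j0 = b" using B(2) b WE by blast
  have "?E j0 j0 \<in> W" by (rule WI) (simp add: EE)
  moreover have "?E j0 j0 \<noteq> 0"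
  proof
    assume "?E j0 j0 = 0"
    then have "ap (?E j0 j0) (axis j0 1) = 0" by simp
    then show False by (simp add: axis_eq_0_iff)
  qed
  moreover have "x = 0" if "b = 0" "x \<in> W" for x using rep[OF _ B(1), of x] B(3) that b by auto
  ultimately have b0: "b \<noteq> 0" by blast
  let ?D = "\<lambda>d. out (axis j0 1) (\<lambda>v. d * v $ j0) :: ('a, 'n) endo"
  have DD: "?D d * ?D d' = ?D (d * d')" for d d' by (rule endo_eqI) (simp add: mult.assoc)
  \<comment> \<open>Right multiplication by D acts on the one-dimensional \<open>W\<close> through
    L, and so D would be commutative.\<close>
  have "\<exists>l\<in>L. b * ?D d = l * b" for d
  proof -
    have "b * ?D d \<in> W"
    proof (rule WI)
      have "?D d * ?E j0 j0 = ?D d" by (rule endo_eqI) simp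
      then show "b * ?D d * ?E j0 j0 = b * ?D d" by (simp only: mult.assoc)
    qed
    then show ?thesis using rep[OF _ B(1), of "b * ?D d"] B(3) b by auto
  qed
  then obtain l where l: "\<And>d. l d \<in> L" "\<And>d. b * ?D d = l d * b" by metis
  have "b * ?D (d * d') = l d * l d' * b" for d d'
  proof -
    have "b * ?D (d * d') = (b * ?D d) * ?D d'" unfolding DD[symmetric] by (simp only: mult.assoc)
    also have "\<dots> = l d * (b * ?D d')" unfolding l(2)[of d] by (simp only: mult.assoc)
    finally show ?thesis unfolding l(2)[of d'] by (simp only: mult.assoc)
  qed
  then have beq: "b * ?D (d * d') = b * ?D (d' * d)" for d d' using com_L[OF l(1) l(1), of d d'] by metis
  have v0: "ap b (axis j0 1) \<noteq> 0"
  proof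
    assume z: "ap b (axis j0 1) = 0"
    have "b = 0"
    proof (rule endo_eqI)
      fix v
      have "ap b v = ap (b * ?E j0 j0) v" using bW by simp
      then show "ap b v = ap 0 v" using z by simp
    qed
    then show False using b0 by simp
  qed
  obtain \<phi> where ph: "lfun \<phi>" "\<phi> (ap b (axis j0 1)) = 1" using exists_lfun_1[OF v0] by blast
  have "d * d' = d' * d" for d d' :: 'a
  proof -
    have "ap (b * ?D (d * d')) (axis j0 1) = ap (b * ?D (d' * d)) (axis j0 1)" using beq by simp
    then have "ap b (axis j0 1) \<star> (d * d') = ap b (axis j0 1) \<star> (d' * d)" by simp
    then have "\<phi> (ap b (axis j0 1) \<star> (d * d')) = \<phi> (ap b (axis j0 1) \<star> (d' * d))" by simp
    then show ?thesis using lfunD(2)[OF ph(1)] ph(2) by simp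
  qed
  then show False using noncomm by blast
qed

end

theorem abelian_normal_central:
  assumes "A \<subseteq> units" "Minv A" "\<And>a b. a \<in> A \<Longrightarrow> b \<in> A \<Longrightarrow> a * b = b * a"
    and "\<exists>x\<in>M. \<exists>y\<in>M. x * y \<noteq> y * x"
  shows "A \<subseteq> F"
  using field_contradiction[OF assms(1-3) _ refl assms(4)] by blast

end

section \<open>Power identities\<close>

lemma twisted_commute_power:
  fixes b c z :: "'r::ring_1"
  assumes "z * c = c * z" "c * b = z * (b * c)" shows "c ^ n * b = z ^ n * (b * c ^ n)"
proof (induction n)
  case (Suc n)
  have zc: "c * z ^ n = z ^ n * c" using assms(1) by (induction n) (simp_all, metis mult.assoc)
  have "c ^ Suc n * b = (c * z ^ n) * (b * c ^ n)" using Suc by (simp add: mult.assoc)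
  also have "\<dots> = z ^ n * (c * b) * c ^ n" unfolding zc by (simp add: mult.assoc)
  also have "\<dots> = z ^ Suc n * (b * c ^ Suc n)" unfolding assms(2) by (simp add: mult.assoc power_Suc2 del: power_Suc) (simp add: power_commutes)
  finally show ?case .
qed simp

lemma twisted_power:
  fixes b c z :: "'r::ring_1"
  assumes z: "z * c = c * z" "z * b = b * z" and cb: "c * b = z * (b * c)"
  shows "(b * c) ^ n = z ^ (\<Sum>i<n. i) * (b ^ n * c ^ n)"
proof (induction n)
  case (Suc n)
  have zb: "b ^ n * z ^ n = z ^ n * b ^ n" by (metis power_commuting_commutes z(2))
  have "(b * c) ^ Suc n = z ^ (\<Sum>i<n. i) * (b ^ n * (c ^ n * b) * c)" unfolding power_Suc2 Suc by (simp add: mult.assoc)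
  also have "\<dots> = z ^ (\<Sum>i<n. i) * ((b ^ n * z ^ n) * (b * c ^ n) * c)"
    unfolding twisted_commute_power[OF z(1) cb] by (simp add: mult.assoc)
  also have "\<dots> = z ^ ((\<Sum>i<n. i) + n) * (b ^ Suc n * c ^ Suc n)"
    unfolding zb by (simp add: mult.assoc power_add power_Suc2 del: power_Suc)
  finally show ?case by simp
qed simp

lemma sum_lessThan_double: "2 * (\<Sum>i<n. i) = n * (n - (1::nat))"
proof (induction n)
  case (Suc n)
  then show ?case by (cases n) (simp_all add: algebra_simps)
qed simp

text \<open>The exponent is p (p - 1) / 2, a multiple of p for odd p. At p = 2 a sign can remain,
  which is why p-th powers are later allowed to be -1.\<close>

lemma power_triangular:
  fixes z :: "'r::ring_1"
  assumes p: "prime p" "z ^ p = 1" shows "z ^ (\<Sum>i<p. i) = 1 \<or> (p = 2 \<and> z ^ (\<Sum>i<p. i) = z)"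
proof (cases "p = 2")
  case True
  then show ?thesis by (simp add: numeral_2_eq_2)
next
  case False
  then have "coprime p 2" using p(1) by (metis primes_coprime two_is_prime_nat)
  moreover have "p dvd 2 * (\<Sum>i<p. i)" unfolding sum_lessThan_double by simp
  ultimately have "p dvd (\<Sum>i<p. i)" by (metis coprime_dvd_mult_right_iff)
  then obtain j where "(\<Sum>i<p. i) = p * j" by (auto elim: dvdE)
  then show ?thesis using p(2) by (simp add: power_mult)
qed

lemma binomial_one_plus: "(1 + t) ^ n = (\<Sum>k\<le>n. of_nat (n choose k) * (t :: 'r::ring_1) ^ k)"
proof (induction n)
  case (Suc n)
  have "(\<Sum>k\<le>Suc n. of_nat (Suc n choose k) * t ^ k) = 1 + (\<Sum>k\<le>n. of_nat (Suc n choose Suc k) * t ^ Suc k)"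
    by (subst sum.atMost_Suc_shift) simp
  also have "\<dots> = (1 + (\<Sum>k\<le>n. of_nat (n choose Suc k) * t ^ Suc k)) + (\<Sum>k\<le>n. of_nat (n choose k) * t ^ Suc k)"
    by (simp add: distrib_right sum.distrib algebra_simps del: power_Suc)
  also have "1 + (\<Sum>k\<le>n. of_nat (n choose Suc k) * t ^ Suc k) = (\<Sum>k\<le>Suc n. of_nat (n choose k) * t ^ k)"
    by (subst sum.atMost_Suc_shift) simp
  also have "\<dots> = (\<Sum>k\<le>n. of_nat (n choose k) * t ^ k)" by (simp add: binomial_eq_0)
  also have "(\<Sum>k\<le>n. of_nat (n choose k) * t ^ Suc k) = (\<Sum>k\<le>n. of_nat (n choose k) * t ^ k) * t"
    by (simp add: sum_distrib_right mult.assoc power_Suc2 del: power_Suc)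
  finally show ?case unfolding power_Suc2 Suc by (simp add: distrib_left)
qed simp

text \<open>In characteristic p the binomial formula gives (z - 1)^p = z^p - 1 = 0, impossible for a
  nonzero element of a division ring.\<close>

lemma primitive_root_char:
  fixes z :: "'r::ring_1"
  assumes F: "divring F" "z \<in> F" and p: "prime p" and z: "z ^ p = 1" "z \<noteq> 1"
  shows "of_nat p \<noteq> (0 :: 'r)"
proof
  assume p0: "of_nat p = (0 :: 'r)"
  define t where "t = z - 1"
  obtain q where q: "p = Suc q" "q > 0" using prime_gt_1_nat[OF p] by (cases p) auto
  have "of_nat (p choose k) = (0 :: 'r)" if "k \<in> {0<..<p}" for k
  proof -
    have "p dvd (p choose k)" using that p by (intro dvd_choose_prime) auto
    then obtain j where "p choose k = p * j" by (auto elim: dvdE)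
    then show ?thesis using p0 by simp
  qed
  then have "(\<Sum>k\<in>{0<..<p}. of_nat (p choose k) * t ^ k) = 0" by simp
  moreover have "{..p} = insert 0 (insert p {0<..<p})" using q by auto
  ultimately have "(1 + t) ^ p = 1 + t ^ p" unfolding binomial_one_plus using q by simp
  then have "t ^ p = 0" using z(1) unfolding t_def by simp
  moreover have "t \<in> units" using divringD(3)[OF F(1)] subrngD(2,6)[OF divringD(1)[OF F(1)]] F(2) z(2) unfolding t_def by simp
  ultimately show False using unit_nonzero units_power by metis
qed

text \<open>For arguments up to (p - 1) / 2 the squares and the numbers -1 - j * j each take (p + 1)
  / 2 residues, too many to be disjoint.\<close>

lemma sum_two_squares_mod_prime:
  assumes p: "prime (p::nat)" "odd p" shows "\<exists>i j :: nat. p dvd i * i + j * j + 1"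
proof (rule ccontr)
  assume n: "\<not> ?thesis"
  define h where "h = (p - 1) div 2"
  have ph: "p = 2 * h + 1" using p(2) unfolding h_def by (metis add_diff_cancel_right' nonzero_mult_div_cancel_left oddE zero_neq_numeral)
  define f where "f i = (int i * int i) mod int p" for i
  define g where "g i = (- 1 - int i * int i) mod int p" for i
  have p0: "int p > 0" using ph by simp
  have key: "i = j" if ij: "int p dvd int i * int i - int j * int j" "i \<le> h" "j \<le> h" for i j
  proof (rule ccontr)
    assume ne: "i \<noteq> j"
    have "int i * int i - int j * int j = (int i - int j) * (int i + int j)" by (simp add: algebra_simps)
    then have "int p dvd int i - int j \<or> int p dvd int i + int j"
      using ij(1) p(1) prime_dvd_mult_iff[of "int p"] by (simp add: prime_nat_int_transfer)
    moreover have "\<bar>int i - int j\<bar> < int p" "0 < \<bar>int i - int j\<bar>" "int i + int j < int p" "0 < int i + int j"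
      using ij(2,3) ph ne by auto
    ultimately show False using zdvd_not_zless[of "int i + int j" "int p"] zdvd_not_zless[of "\<bar>int i - int j\<bar>" "int p"] by auto
  qed
  have "inj_on f {..h}"
  proof (rule inj_onI)
    fix i j assume ij: "i \<in> {..h}" "j \<in> {..h}" "f i = f j"
    then have "int p dvd int i * int i - int j * int j" unfolding f_def by (simp add: mod_eq_dvd_iff)
    then show "i = j" using key ij by simp
  qed
  moreover have "inj_on g {..h}"
  proof (rule inj_onI)
    fix i j assume ij: "i \<in> {..h}" "j \<in> {..h}" "g i = g j"
    then have "int p dvd (- 1 - int j * int j) - (- 1 - int i * int i)" unfolding g_def by (metis mod_eq_dvd_iff)
    then have "int p dvd int i * int i - int j * int j" by (simp add: algebra_simps)
    then show "i = j" using key ij by simp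
  qed
  moreover have "f ` {..h} \<inter> g ` {..h} = {}"
  proof (rule ccontr)
    assume "\<not> ?thesis"
    then obtain i j where "f i = g j" by auto
    then have "int p dvd int i * int i - (- 1 - int j * int j)" unfolding f_def g_def by (simp add: mod_eq_dvd_iff)
    moreover have "int i * int i - (- 1 - int j * int j) = int (i * i + j * j + 1)" by simp
    ultimately have "p dvd i * i + j * j + 1" by (metis int_dvd_int_iff)
    then show False using n by blast
  qed
  ultimately have "card (f ` {..h} \<union> g ` {..h}) = 2 * (h + 1)" by (simp add: card_Un_disjoint card_image)
  moreover have "f ` {..h} \<union> g ` {..h} \<subseteq> {0..<int p}" unfolding f_def g_def using p0 by auto
  then have "card (f ` {..h} \<union> g ` {..h}) \<le> p" using card_mono[of "{0..<int p}"] by simp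
  ultimately show False using ph by simp
qed

section \<open>Normal subgroups that are abelian modulo the center\<close>

context maximal_solvable
begin

text \<open>Rank-one maps on a vector in the image of e, compressed by e, multiply like elements of
  D.\<close>

lemma noncommutative_corner:
  assumes e: "e * e = (e :: ('a, 'n) endo)" "e \<noteq> 0"
  shows "\<exists>r s. (e * r * e) * (e * s * e) \<noteq> (e * s * e) * (e * r * e)"
proof -
  obtain v where v: "ap e v \<noteq> 0" using e(2) endo_eqI[of e 0] by auto
  obtain \<phi> where p: "lfun \<phi>" "\<phi> (ap e v) = 1" using exists_lfun_1[OF v] by blast
  have ee: "ap e (ap e w) = ap e w" for w using e(1) by (metis ap_ring(6))
  let ?o = "\<lambda>a. out (ap e v) (\<lambda>w. a * \<phi> w)"
  obtain a b :: 'a where ab: "a * b \<noteq> b * a" using noncomm by blast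
  have m: "(e * ?o a * e) * (e * ?o b * e) = e * ?o (a * b) * e" for a b
    by (rule endo_eqI) (simp add: p ee mult.assoc lfunD[OF p(1)])
  have "e * ?o (a * b) * e \<noteq> e * ?o (b * a) * e"
  proof
    assume "e * ?o (a * b) * e = e * ?o (b * a) * e"
    then have "\<phi> (ap (e * ?o (a * b) * e) v) = \<phi> (ap (e * ?o (b * a) * e) v)" by simp
    then show False using ab by (simp add: p ee lfunD[OF p(1)])
  qed
  then show ?thesis unfolding m[symmetric] by blast
qed

lemma Fc: "f \<in> F \<Longrightarrow> f * x = x * f" using cen_commute by blast

lemma Fc2: "f \<in> F \<Longrightarrow> x * (f * y) = f * (x * y)" using cen_commute[of f x] by (simp flip: mult.assoc)

lemmas sF = subrngD[OF divringD(1)[OF divring_cen]]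

lemma Fmult_power: "f \<in> F \<Longrightarrow> (f * x) ^ n = f ^ n * x ^ n"
proof (induction n)
  case (Suc n)
  then show ?case using Fc2[OF subrng_power[OF subrng_centralizer Suc.prems(1)], of x n "x ^ n"] by (simp add: mult.assoc)
qed simp

lemma comm_power_1:
  assumes "x \<in> units" "y \<in> units" "comm x y \<in> F" "x ^ p \<in> F" shows "comm x y ^ p = 1"
proof -
  define z where "z = comm x y"
  have z: "z \<in> F" "x * y = z * (y * x)" unfolding z_def using assms comm_swap by blast+
  have "x ^ p * y = z ^ p * (y * x ^ p)" by (rule twisted_commute_power[OF Fc[OF z(1)] z(2)])
  moreover have "x ^ p * y = y * x ^ p" using Fc[OF assms(4)] .
  ultimately have "z ^ p * (y * x ^ p) = 1 * (y * x ^ p)" by simp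
  moreover have "y * x ^ p \<in> units" using assms by simp
  ultimately show ?thesis unfolding z_def using units_cancel_right by blast
qed

lemma crossed_F:
  assumes N: "ugrp N" and "\<And>x y. x \<in> N \<Longrightarrow> y \<in> N \<Longrightarrow> comm x y \<in> F"
    and "\<And>x. x \<in> N \<Longrightarrow> (\<And>y. y \<in> N \<Longrightarrow> x * y = y * x) \<Longrightarrow> x \<in> F"
  shows "crossed F N N"
proof
  show "divring F" by (rule divring_cen)
  show "x * y = y * x" if "x \<in> F" "y \<in> F" for x y using Fc that by blast
  show "ugrp N" by (rule N)
  show "n * x * ui n \<in> F" if "n \<in> N" "x \<in> F" for n x
    using that Fc[OF that(2), of n] ugrpD(1)[OF N that(1)] by (metis mult.assoc mult_1_right ui_right)
  show "N \<subseteq> units" using ugrpD(1)[OF N] by blast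
  show "w * x = x * w" if "w \<in> N" "x \<in> F" for w x using Fc that by metis
  show "comm n w \<in> F" if "n \<in> N" "w \<in> N" for n w using assms(2) that .
  show "n \<in> F" if "n \<in> N" "\<And>w. w \<in> N \<Longrightarrow> n * w = w * n" for n using assms(3) that .
qed

end

text \<open>The final contradiction is derived from these properties alone, independently of how Q
  is obtained from M. The sign in \<open>pow_Q\<close> matters for p = 2; for odd p it is absorbed
  by f.\<close>

locale class_two = maximal_solvable G M k for G M :: "('a::division_ring, 'n::finite) endo set" and k +
  fixes Q :: "('a, 'n) endo set" and p :: nat
  assumes p: "prime p" and grp_Q: "ugrp Q" and inv_Q: "Minv Q" and comm_Q: "\<And>x y. x \<in> Q \<Longrightarrow> y \<in> Q \<Longrightarrow> comm x y \<in> F"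
    and F_Q: "\<And>f. f \<in> F \<Longrightarrow> f \<noteq> 0 \<Longrightarrow> f \<in> Q"
    and pow_Q: "\<And>x. x \<in> Q \<Longrightarrow> \<exists>f\<in>F. f \<noteq> 0 \<and> ((f * x) ^ p = 1 \<or> (f * x) ^ p = -1)"
    and center_Q: "\<And>x. x \<in> Q \<Longrightarrow> (\<And>y. y \<in> Q \<Longrightarrow> x * y = y * x) \<Longrightarrow> x \<in> F"
    and noncomm_Q: "\<exists>x\<in>Q. \<exists>y\<in>Q. x * y \<noteq> y * x"
begin

lemma Q_units: "x \<in> Q \<Longrightarrow> x \<in> units" using ugrpD(1)[OF grp_Q] .

sublocale Q: crossed F Q Q
  using center_Q comm_Q by (intro crossed_F[OF grp_Q]) blast+

lemma scale_Q: "f \<in> F \<Longrightarrow> f \<noteq> 0 \<Longrightarrow> x \<in> Q \<Longrightarrow> f * x \<in> Q"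
  using F_Q Q.N_mult by blast

lemma scale_commute: "f \<in> F \<Longrightarrow> f \<noteq> 0 \<Longrightarrow> (f * x) * y = y * (f * x) \<longleftrightarrow> x * y = y * x"
  using Fc2 units_cancel_left[of f] Q.Ku(1) by (simp add: mult.assoc)

lemma scale_F: "f \<in> F \<Longrightarrow> f \<noteq> 0 \<Longrightarrow> f * x \<in> F \<longleftrightarrow> x \<in> F"
  using sF(4) Q.Ku by (metis ui_left2)

lemma pow_in_F: assumes "x \<in> Q" shows "x ^ p \<in> F"
proof -
  obtain f where f: "f \<in> F" "f \<noteq> 0" "(f * x) ^ p = 1 \<or> (f * x) ^ p = -1" using pow_Q[OF assms] by blast
  have fp: "f ^ p \<in> F" "f ^ p \<noteq> 0" using subrng_power[OF subrng_centralizer f(1)] Q.Ku(1)[OF f(1,2)] unit_nonzero units_power by auto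
  have "f ^ p * x ^ p \<in> F" using f(3) sF(2) sF(5)[OF sF(2)] unfolding Fmult_power[OF f(1)] by auto
  then show ?thesis using scale_F[OF fp] by blast
qed

lemma comm_swap_Q: "x \<in> Q \<Longrightarrow> y \<in> Q \<Longrightarrow> x * y = comm x y * (y * x)"
  using comm_swap Q_units by blast

lemma comm_pow: "x \<in> Q \<Longrightarrow> y \<in> Q \<Longrightarrow> comm x y ^ p = 1"
  using comm_power_1[OF Q_units Q_units comm_Q pow_in_F] by blast

lemma root_exists: obtains z where "z \<in> F" "z ^ p = 1" "z \<noteq> 1"
proof -
  obtain x y where xy: "x \<in> Q" "y \<in> Q" "x * y \<noteq> y * x" using noncomm_Q by blast
  then have "comm x y \<noteq> 1" using comm_eq_1_iff Q_units by blast
  then show thesis using that[of "comm x y"] comm_Q comm_pow xy by blast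
qed

lemma char_p: "of_nat p \<noteq> (0 :: ('a, 'n) endo)"
  using root_exists primitive_root_char[OF divring_cen _ p] by metis

definition ip :: "('a, 'n) endo" where "ip = ui (of_nat p)"

lemma ip: "ip \<in> F" "ip * of_nat p = 1" "ip \<noteq> 0"
proof -
  have pF: "of_nat p \<in> F" by (rule subrng_of_nat[OF subrng_centralizer])
  show "ip \<in> F" "ip * of_nat p = 1" unfolding ip_def using Q.Ku[OF pF char_p] by auto
  then show "ip \<noteq> 0" using unit_nonzero[OF units_1] by fastforce
qed

abbreviation X :: "('a, 'n) endo set" where "X \<equiv> Q.kspan Q"

lemma inv_X: "Minv X"
proof (rule Minv_kspan[OF Q.norm_span_axioms _ inv_Q])
  have "m * f * ui m = f" if "m \<in> M" "f \<in> F" for m f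
    using M_units[OF that(1)] Fc[OF that(2), of m, symmetric] by (simp add: mult.assoc)
  then show "Minv F" unfolding Minv_def by simp
qed

lemma exists_noncentral: "\<exists>x\<in>Q. x \<notin> F"
  using noncomm_Q Fc by blast

lemma Q_X: "x \<in> Q \<Longrightarrow> x \<in> X" by (rule Q.kspan_base1)

lemma F_X: "f \<in> F \<Longrightarrow> f \<in> X" using Q.kspan_base[OF ugrpD(2)[OF grp_Q]] by fastforce

lemma sol_X: "X \<noteq> UNIV \<Longrightarrow> sol (Suc k) (uset X)"
proof -
  obtain x where x: "x \<in> Q" "x \<notin> F" using exists_noncentral by blast
  have "x \<in> uset X" unfolding uset_def using Q_X x Q_units Q.N_ui by blast
  then show "X \<noteq> UNIV \<Longrightarrow> sol (Suc k) (uset X)" using proper_ring(2)[OF Q.subrng_kspan inv_X] x(2) by blast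
qed

text \<open>The two vanishing conditions make \<open>e * y\<close> and \<open>ui y * e\<close> a
  pair of matrix units, which a proper span cannot contain.\<close>

lemma matrix_units_X:
  assumes e: "e \<in> X" "e * e = e" "e \<noteq> 0" and y: "y \<in> X" "y \<in> units" "ui y \<in> X" "e * y * e = 0" "e * ui y * e = 0"
  shows "X = UNIV"
proof (rule ccontr)
  assume n: "X \<noteq> UNIV"
  obtain a where a: "a \<in> F" "a \<noteq> 0" "a * a \<noteq> 1" using F_square by blast
  have eyr: "e * (y * (e * r)) = 0" "e * (ui y * (e * r)) = 0" "e * (e * r) = e * r" for r
    using y(4,5) e(2) by (metis mult.assoc mult_zero_left)+
  have 1: "(e * y) * (e * y) = 0" "(ui y * e) * (ui y * e) = 0" using eyr[of y] y(5) by (simp_all add: mult.assoc)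
  have 2: "(e * y) * (ui y * e) * (e * y) = e * y" "(ui y * e) * (e * y) * (ui y * e) = ui y * e"
    using y(2) e(2) eyr by (simp_all add: mult.assoc)
  have 3: "e * y \<noteq> 0"
  proof
    assume "e * y = 0"
    then have "e * y * ui y = 0" by simp
    then show False using e(3) y(2) by (simp add: mult.assoc)
  qed
  have "e * y \<in> X" "ui y * e \<in> X" using subrngD(4)[OF Q.subrng_kspan] e y by blast+
  then have "\<not> sol (Suc k) (uset X)"
    using ring_matrix_units_not_sol[OF 1 2 3 divring_cen order_refl a Q.subrng_kspan] F_X by blast
  then show False using sol_X n by blast
qed

text \<open>For r of order dividing p, the average over its powers: the projection to the eigenvalue
  1. Division by p is possible by \<open>char_p\<close>.\<close>

definition proj :: "('a, 'n) endo \<Rightarrow> ('a, 'n) endo" where "proj r = ip * (\<Sum>i<p. r ^ i)"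

lemma proj:
  assumes r: "r ^ p = 1"
  shows "r * proj r = proj r" "proj r * r = proj r" "proj r * proj r = proj r"
proof -
  define s where "s = (\<Sum>i<p. r ^ i)"
  have rs: "r * s = s" "s * r = s" unfolding s_def
    using geometric_sum(1)[where y = r and p = p] geometric_sum(2)[where y = r and p = p] r by (simp_all add: algebra_simps)
  have "r ^ i * s = s" for i using rs(1) by (induction i) (simp_all add: mult.assoc)
  then have "s * s = of_nat p * s" by (subst (1) s_def) (simp add: sum_distrib_right)
  then have ss: "ip * (s * s) = s" using ip(2) by (simp flip: mult.assoc)
  show "r * proj r = proj r" "proj r * r = proj r" "proj r * proj r = proj r"
    unfolding proj_def s_def[symmetric] using rs ss Fc2[OF ip(1)] by (simp_all add: mult.assoc)
qed

lemma proj_commute: assumes "r * c = c * r" shows "proj r * c = c * proj r"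
proof -
  have "r ^ i * c = c * r ^ i" for i using assms by (metis power_commuting_commutes)
  then have "(\<Sum>i<p. r ^ i) * c = c * (\<Sum>i<p. r ^ i)" by (simp add: sum_distrib_left sum_distrib_right)
  then show ?thesis unfolding proj_def using Fc2[OF ip(1)] by (simp add: mult.assoc)
qed

text \<open>c multiplies eigenvalues of r by the commutator z, so it maps the eigenspace for 1 into
  that for z, which differs from 1.\<close>

lemma proj_kill:
  assumes r: "r \<in> Q" "r ^ p = 1" and c: "c \<in> Q" "r * c \<noteq> c * r"
  shows "proj r * c * proj r = 0"
proof -
  define z where "z = comm r c"
  have z: "z \<in> F" "r * c = z * (c * r)" "z \<noteq> 1" unfolding z_def
    using comm_Q[OF r(1) c(1)] comm_swap_Q[OF r(1) c(1)] comm_eq_1_iff[OF Q_units[OF r(1)] Q_units[OF c(1)]] c(2) by simp_all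
  let ?e = "proj r"
  have "?e * c * ?e = ?e * (r * c) * ?e" using proj(2)[OF r(2)] by (metis mult.assoc)
  also have "\<dots> = z * (?e * c * (r * ?e))" unfolding z(2) using Fc2[OF z(1)] by (simp add: mult.assoc)
  also have "\<dots> = z * (?e * c * ?e)" unfolding proj(1)[OF r(2)] ..
  finally have "(1 - z) * (?e * c * ?e) = 0" by (simp add: left_diff_distrib)
  then show ?thesis using divring_mult_eq_0[OF divring_cen sF(6)[OF sF(2) z(1)]] z(3) by auto
qed

lemma proj_X: "r \<in> X \<Longrightarrow> proj r \<in> X"
  unfolding proj_def by (rule subrngD(4)[OF Q.subrng_kspan F_X[OF ip(1)] subrng_sum[OF Q.subrng_kspan subrng_power[OF Q.subrng_kspan]]])

lemma proj_nonzero: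
  assumes r: "r \<in> Q" "r ^ p = 1" "r \<notin> F" shows "proj r \<noteq> 0"
proof
  assume "proj r = 0"
  then have s0: "(\<Sum>i<p. r ^ i) = 0" unfolding proj_def using divring_mult_eq_0[OF divring_cen ip(1)] ip(3) by blast
  obtain q where q: "p = Suc q" using prime_gt_0_nat[OF p] by (cases p) auto
  have "(\<Sum>i<p. r ^ i) = 1 + (\<Sum>i<q. r ^ Suc i)" unfolding q by (subst sum.lessThan_Suc_shift) simp
  then have e: "1 = - (\<Sum>i<q. r ^ Suc i)" using s0 by (simp add: eq_neg_iff_add_eq_0)
  let ?P = "{m \<in> Q. m * ui 1 \<notin> F}"
  have "r ^ Suc i \<in> ?P" if "i < q" for i
    using prime_power_mem[OF divring_cen Q_units[OF r(1)] _ _ p, of "Suc i"] r sF(2) that q ugrp_power[OF grp_Q r(1), of "Suc i"] by auto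
  then have "(\<Sum>i<q. r ^ Suc i) \<in> Q.kspan ?P" by (intro Q.kspan_sum Q.kspan_base1) auto
  then have "- (\<Sum>i<q. r ^ Suc i) \<in> Q.kspan ?P" by (rule Q.kspan_minus)
  then have "1 \<in> Q.kspan ?P" unfolding e[symmetric] .
  then show False using Q.independent[OF ugrpD(2)[OF grp_Q]] by blast
qed

lemma root_X:
  assumes r: "r \<in> Q" "r ^ p = 1" "r \<notin> F" shows "X = UNIV"
proof -
  obtain c where c: "c \<in> Q" "r * c \<noteq> c * r" using center_Q[OF r(1)] r(3) by blast
  have "r * ui c \<noteq> ui c * r"
  proof
    assume "r * ui c = ui c * r"
    then have "ui (ui c) * r = r * ui (ui c)" using units_commute_ui[of "ui c" r] Q_units[OF c(1)] by simp
    then show False using c Q_units[OF c(1)] by simp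
  qed
  then show ?thesis
    using matrix_units_X[OF proj_X[OF Q_X[OF r(1)]] proj(3)[OF r(2)] proj_nonzero[OF r] Q_X[OF c(1)] Q_units[OF c(1)] Q_X[OF Q.N_ui[OF c(1)]]]
      proj_kill[OF r(1,2) c] proj_kill[OF r(1,2) Q.N_ui[OF c(1)]] by blast
qed

text \<open>In the corner of a minimal good idempotent, elements of \<^term>\<open>Q\<close> with p-th power 1 become
  central scalars.\<close>

definition good :: "('a, 'n) endo \<Rightarrow> bool" where
  "good e \<longleftrightarrow> e \<noteq> 0 \<and> e * e = e \<and> (\<forall>b\<in>Q. e * b * e = 0 \<or> e * b = b * e)"

text \<open>The projections to the p eigenspaces of b, obtained from the elements
  \<open>z ^ j * b\<close>, add up to 1. One of them is nonzero on the image of e, and since b is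
  not scalar there it cuts e down properly.\<close>

lemma good_shrink:
  assumes e: "good e" and b: "b \<in> Q" "b ^ p = 1" "e * b = b * e" "\<not> (\<exists>f\<in>F. b * e = f * e)"
  shows "\<exists>e'. good e' \<and> e' * e = e' \<and> e * e' = e' \<and> e' \<noteq> e"
proof -
  obtain z where z: "z \<in> F" "z ^ p = 1" "z \<noteq> 1" by (rule root_exists)
  have zp: "(z ^ j * b) ^ p = 1" for j
    using subrng_power[OF subrng_centralizer z(1), of j] b(2) z(2) by (simp add: Fmult_power flip: power_mult) (simp add: power_mult mult.commute[of j])
  have "z \<noteq> 0" using z(2) prime_gt_0_nat[OF p] unit_nonzero[OF units_1] by (auto simp: power_0_left)
  then have zu: "z \<in> units" "z \<noteq> 0" using Q.Ku(1)[OF z(1)] by auto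
  \<comment> \<open>Orthogonality of characters: the sum over j is geometric in z^i, a p-th root of
    1 different from 1.\<close>
  have orth: "(\<Sum>j<p. (z ^ j * b) ^ i) = 0" if i: "0 < i" "i < p" for i
  proof -
    have "z ^ i \<noteq> 1"
    proof
      assume zi: "z ^ i = 1"
      have "coprime i p" using i p by (metis coprime_commute nat_dvd_not_less prime_imp_coprime)
      obtain d x y where e: "d dvd i" "d dvd p" "i * x = p * y + d" using bezout_add_strong_nat[of i p] i(1) by auto
      then have "d = 1" using \<open>coprime i p\<close> coprime_common_divisor_nat by blast
      then have "z ^ (i * x) = z ^ (p * y) * z" using e(3) by (simp add: power_commutes)
      then show False using zi z by (simp add: power_mult)
    qed
    moreover have "(1 - z ^ i) * (\<Sum>j<p. (z ^ i) ^ j) = 0" unfolding geometric_sum(1) using z(2)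
      by (simp flip: power_mult) (simp add: power_mult mult.commute[of i])
    ultimately have "(\<Sum>j<p. (z ^ i) ^ j) = 0"
      using divring_mult_eq_0[OF divring_cen sF(6)[OF sF(2) subrng_power[OF subrng_centralizer z(1)]]] by auto
    moreover have "(\<Sum>j<p. (z ^ j * b) ^ i) = (\<Sum>j<p. (z ^ i) ^ j) * b ^ i"
      using subrng_power[OF subrng_centralizer z(1)] by (simp add: Fmult_power sum_distrib_right mult.commute flip: power_mult)
    ultimately show ?thesis by simp
  qed
  have "(\<Sum>j<p. \<Sum>i<p. (z ^ j * b) ^ i) = (\<Sum>i<p. \<Sum>j<p. (z ^ j * b) ^ i)" by (rule sum.swap)
  also have "\<dots> = (\<Sum>i<p. if i = 0 then of_nat p else 0)" by (rule sum.cong) (use orth in auto)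
  also have "\<dots> = of_nat p" using prime_gt_0_nat[OF p] by simp
  finally have "(\<Sum>j<p. proj (z ^ j * b)) = 1" unfolding proj_def using ip(2) by (simp flip: sum_distrib_left)
  then have "(\<Sum>j<p. e * proj (z ^ j * b)) = e" by (simp flip: sum_distrib_left)
  moreover have "e \<noteq> 0" using e unfolding good_def by blast
  ultimately obtain j where j: "e * proj (z ^ j * b) \<noteq> 0" by (metis sum.neutral)
  define c where "c = z ^ j * b"
  have zj: "z ^ j \<in> F" "z ^ j \<noteq> 0" using subrng_power[OF subrng_centralizer z(1)] zu(1) unit_nonzero units_power by auto
  have c: "c \<in> Q" "c ^ p = 1" unfolding c_def using scale_Q[OF zj b(1)] zp by auto
  have "c * e = e * c" unfolding c_def using b(3) Fc2[OF zj(1)] by (simp add: mult.assoc)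
  then have qe: "proj c * e = e * proj c" by (rule proj_commute)
  define e' where "e' = e * proj c"
  have ee: "e * e = e" "e * (e * r) = e * r" for r using e unfolding good_def by (auto simp flip: mult.assoc)
  have qq: "proj c * proj c = proj c" "proj c * (proj c * r) = proj c * r" for r using proj(3)[OF c(2)] by (auto simp flip: mult.assoc)
  have qer: "proj c * (e * r) = e * (proj c * r)" for r using qe by (simp flip: mult.assoc)
  have "good e'" unfolding good_def
  proof (intro conjI ballI)
    show "e' \<noteq> 0" unfolding e'_def c_def by (rule j)
    show "e' * e' = e'" unfolding e'_def by (simp add: mult.assoc qer ee qq)
    fix d assume d: "d \<in> Q"
    show "e' * d * e' = 0 \<or> e' * d = d * e'"
    proof (cases "e * d * e = 0")
      case True
      have "e' * d * e' = proj c * (e * d * e) * proj c" unfolding e'_def by (simp add: mult.assoc qer)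
      then show ?thesis using True by simp
    next
      case False
      then have ed: "e * d = d * e" using e d unfolding good_def by blast
      show ?thesis
      \<comment> \<open>Goodness is inherited: d commutes with c and hence with its projection, or
        it is killed between two copies of that projection.\<close>
      proof (cases "c * d = d * c")
        case True
        have "e' * d = e * (proj c * d)" unfolding e'_def by (simp add: mult.assoc)
        also have "\<dots> = (e * d) * proj c" unfolding proj_commute[OF True] by (simp add: mult.assoc)
        also have "\<dots> = d * e'" unfolding ed e'_def by (simp add: mult.assoc)
        finally show ?thesis ..
      next
        case False
        have "e' * d * e' = e * (proj c * d * (e * proj c))" unfolding e'_def by (simp add: mult.assoc)
        also have "e * proj c = proj c * e" using qe by simp
        also have "e * (proj c * d * (proj c * e)) = e * (proj c * d * proj c) * e" by (simp add: mult.assoc)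
        also have "\<dots> = 0" unfolding proj_kill[OF c d False] by simp
        finally show ?thesis ..
      qed
    qed
  qed
  moreover have "e' * e = e'" "e * e' = e'" unfolding e'_def by (simp_all add: mult.assoc qer ee qe)
  moreover have "e' \<noteq> e"
  proof
    assume "e' = e"
    then have "c * e = c * (proj c * e)" unfolding e'_def using qe by simp
    also have "\<dots> = proj c * e" using proj(1)[OF c(2)] by (simp flip: mult.assoc)
    also have "\<dots> = e" using \<open>e' = e\<close> qe unfolding e'_def by simp
    finally have "z ^ j * (b * e) = e" unfolding c_def by (simp add: mult.assoc)
    then have "b * e = ui (z ^ j) * e" using Q.Ku(1)[OF zj] by (metis ui_left2)
    then show False using b(4) Q.Ku(2)[OF zj] by blast
  qed
  ultimately show ?thesis by blast
qed

lemma minimal_good: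
  obtains e where "good e" "\<And>b. b \<in> Q \<Longrightarrow> b ^ p = 1 \<Longrightarrow> e * b = b * e \<Longrightarrow> \<exists>f\<in>F. b * e = f * e"
proof -
  have g1: "good 1" unfolding good_def by simp
  obtain W where W: "\<exists>e. good e \<and> W = range (ap e)" "\<And>W'. \<exists>e. good e \<and> W' = range (ap e) \<Longrightarrow> W' \<subseteq> W \<Longrightarrow> W' = W"
  proof (rule dsub_minimal[of "\<lambda>W. \<exists>e. good e \<and> W = range (ap e)" "range (ap 1)"])
    show "\<exists>e. good e \<and> range (ap 1) = range (ap e)" using g1 by blast
  qed (blast intro: dsub_image[OF dsub_UNIV])+
  then obtain e where e: "good e" "W = range (ap e)" by blast
  show thesis
  proof (rule that[OF e(1)], rule ccontr)
    fix b assume b: "b \<in> Q" "b ^ p = 1" "e * b = b * e" "\<not> (\<exists>f\<in>F. b * e = f * e)"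
    obtain e' where e': "good e'" "e' * e = e'" "e * e' = e'" "e' \<noteq> e" using good_shrink[OF e(1) b] by blast
    have "range (ap e') \<subseteq> range (ap e)" using e'(3) by (metis ap_ring(6) image_subsetI rangeI)
    then have r: "range (ap e') = range (ap e)" using W(2) e e'(1) by blast
    have "e' * e = e"
    proof (rule endo_eqI)
      fix v
      obtain w where w: "ap e v = ap e' w" using r by (metis rangeE rangeI)
      have "e' * e' = e'" using e'(1) unfolding good_def by blast
      then have "ap e' (ap e' w) = ap e' w" by (metis ap_ring(6))
      then show "ap (e' * e) v = ap e v" using w by simp
    qed
    then show False using e'(2,4) by simp
  qed
qed

text \<open>Q spans the whole ring, so if all of Q is scalar in the corner of e, the corner is
  commutative.\<close>

lemma scalar_corner:
  assumes X: "X = UNIV" and e: "e * e = e" "e \<noteq> 0" and sc: "\<And>b. b \<in> Q \<Longrightarrow> \<exists>f\<in>F. e * b * e = f * e"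
  shows False
proof -
  have all: "\<exists>f\<in>F. e * r * e = f * e" for r
  proof -
    have "r \<in> X" using X by simp
    then obtain I c where I: "finite I" "I \<subseteq> Q" "\<forall>i\<in>I. c i \<in> F" "r = (\<Sum>i\<in>I. c i * i)" unfolding Q.kspan_def by blast
    obtain f where f: "\<And>b. b \<in> Q \<Longrightarrow> f b \<in> F \<and> e * b * e = f b * e" using sc by metis
    have "e * r * e = (\<Sum>i\<in>I. c i * (e * i * e))" unfolding I(4) sum_distrib_left sum_distrib_right
    proof (rule sum.cong[OF refl])
      fix i assume "i \<in> I"
      then have "c i \<in> F" using I by blast
      then show "e * (c i * i) * e = c i * (e * i * e)" using Fc2[of "c i" e] by (simp add: mult.assoc)
    qed
    also have "\<dots> = (\<Sum>i\<in>I. c i * f i) * e" unfolding sum_distrib_right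
      by (rule sum.cong) (use I f in \<open>auto simp: mult.assoc\<close>)
    finally have "e * r * e = (\<Sum>i\<in>I. c i * f i) * e" .
    moreover have "(\<Sum>i\<in>I. c i * f i) \<in> F" by (rule subrng_sum[OF subrng_centralizer sF(4)]) (use I f in auto)
    ultimately show ?thesis by blast
  qed
  obtain r s where rs: "(e * r * e) * (e * s * e) \<noteq> (e * s * e) * (e * r * e)" using noncommutative_corner[OF e] by blast
  obtain f g where "f \<in> F" "g \<in> F" "e * r * e = f * e" "e * s * e = g * e" using all by metis
  then have fg: "f \<in> F" "g \<in> F" and "(f * e) * (g * e) \<noteq> (g * e) * (f * e)" using rs by simp_all
  moreover have "(f * e) * (g * e) = f * (g * (e * e))" "(g * e) * (f * e) = g * (f * (e * e))"
    using Fc2[OF fg(2), of e e] Fc2[OF fg(1), of e e] by (simp_all add: mult.assoc)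
  moreover have "f * (g * (e * e)) = g * (f * (e * e))" using Fc2[OF fg(2)] by blast
  ultimately show False by simp
qed

lemma split_contradiction:
  assumes sp: "\<And>x. x \<in> Q \<Longrightarrow> \<exists>f\<in>F. f \<noteq> 0 \<and> (f * x) ^ p = 1"
  shows False
proof -
  obtain x where x: "x \<in> Q" "x \<notin> F" using exists_noncentral by blast
  obtain f where f: "f \<in> F" "f \<noteq> 0" "(f * x) ^ p = 1" using sp[OF x(1)] by blast
  have X: "X = UNIV" using root_X[OF scale_Q[OF f(1,2) x(1)] f(3)] scale_F[OF f(1,2)] x(2) by blast
  obtain e where e: "good e" "\<And>b. b \<in> Q \<Longrightarrow> b ^ p = 1 \<Longrightarrow> e * b = b * e \<Longrightarrow> \<exists>f\<in>F. b * e = f * e" by (rule minimal_good) blast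
  have e': "e * e = e" "e \<noteq> 0" using e(1) unfolding good_def by auto
  show False
  proof (rule scalar_corner[OF X e'])
    fix b assume b: "b \<in> Q"
    show "\<exists>f\<in>F. e * b * e = f * e"
    proof (cases "e * b * e = 0")
      case True
      then have "e * b * e = 0 * e" by simp
      then show ?thesis using sF(1) by blast
    next
      case False
      then have eb: "e * b = b * e" using e(1) b unfolding good_def by blast
      obtain f where f: "f \<in> F" "f \<noteq> 0" "(f * b) ^ p = 1" using sp[OF b] by blast
      have "e * (f * b) = (f * b) * e" using eb Fc2[OF f(1)] by (simp add: mult.assoc)
      then obtain g where g: "g \<in> F" "(f * b) * e = g * e" using e(2)[OF scale_Q[OF f(1,2) b] f(3)] by blast
      have "b * e = ui f * (f * b * e)" using Q.Ku(1)[OF f(1,2)] by (simp add: mult.assoc)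
      then have "b * e = (ui f * g) * e" unfolding g(2) by (simp add: mult.assoc)
      moreover have "e * b * e = b * e" unfolding eb using e'(1) by (simp add: mult.assoc)
      ultimately show ?thesis using sF(4)[OF Q.Ku(2)[OF f(1,2)] g(1)] by metis
    qed
  qed
qed

end

context class_two
begin

text \<open>For odd p the sign is absorbed by passing from f to -f; for p = 2 a square root i of -1
  would absorb it through i * f.\<close>

lemma nonsplit:
  assumes x: "x \<in> Q" "\<And>f. f \<in> F \<Longrightarrow> f \<noteq> 0 \<Longrightarrow> (f * x) ^ p \<noteq> 1"
  shows "p = 2" "i \<in> F \<Longrightarrow> i * i \<noteq> -1"
proof -
  obtain f where f: "f \<in> F" "f \<noteq> 0" "(f * x) ^ p = -1" using pow_Q[OF x(1)] x(2) by blast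
  show p2: "p = 2"
  proof (rule ccontr)
    assume "p \<noteq> 2"
    then have "odd p" using p by (metis primes_dvd_imp_eq two_is_prime_nat)
    then have "((- f) * x) ^ p = 1" using f(3) by (simp add: power_minus_odd)
    then show False using x(2)[of "- f"] f sF(5) by auto
  qed
  show "i * i \<noteq> -1" if i: "i \<in> F"
  proof
    assume ii: "i * i = -1"
    have "((i * f) * x) ^ p = (i * (f * x)) ^ p" by (simp add: mult.assoc)
    also have "\<dots> = 1" unfolding Fmult_power[OF i] f(3) unfolding p2 using ii by (simp add: power2_eq_square)
    finally have "i * f = 0" using x(2) sF(4)[OF i f(1)] by blast
    then have "i * f * ui f = 0" by simp
    then have "i = 0" using Q.Ku(1)[OF f(1,2)] by (simp add: mult.assoc)
    then show False using ii unit_nonzero[OF units_1] by simp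
  qed
qed

section \<open>The case p = 2 with no square root of -1 in the center\<close>

context
  assumes p2: "p = 2" and no_i: "\<And>i. i \<in> F \<Longrightarrow> i * i \<noteq> -1"
begin

lemma sq_Q: "x \<in> Q \<Longrightarrow> \<exists>f\<in>F. f \<noteq> 0 \<and> ((f * x) * (f * x) = 1 \<or> (f * x) * (f * x) = -1)"
  using pow_Q unfolding p2 power2_eq_square by blast

lemma anticommute: assumes "x \<in> Q" "y \<in> Q" "x * y \<noteq> y * x" shows "x * y = - (y * x)"
proof -
  define z where "z = comm x y"
  have z: "z \<in> F" "x * y = z * (y * x)" "z \<noteq> 1" "z * z = 1" unfolding z_def
    using comm_Q[OF assms(1,2)] comm_swap_Q[OF assms(1,2)] comm_eq_1_iff[OF Q_units[OF assms(1)] Q_units[OF assms(2)]] assms(3)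
      comm_pow[OF assms(1,2)] by (simp_all add: p2 power2_eq_square)
  have "(z - 1) * (z + 1) = 0" using z(4) by (simp add: algebra_simps)
  then have "z + 1 = 0" using divring_mult_eq_0[OF divring_cen sF(6)[OF z(1) sF(2)]] z(3) by auto
  then have "z = -1" by (simp add: eq_neg_iff_add_eq_0)
  then show ?thesis using z(2) by simp
qed

lemma two: "(2 :: ('a, 'n) endo) \<noteq> 0" "ip * 2 = 1" "ip + ip = 1"
  using char_p ip(2) unfolding p2 by (simp_all add: mult_2_right)

lemma double_nonzero: "x \<noteq> 0 \<Longrightarrow> x + x \<noteq> (0 :: ('a, 'n) endo)"
proof
  assume x: "x \<noteq> 0" "x + x = 0"
  have "ip * (x + x) = (ip + ip) * x" by (simp add: algebra_simps)
  then show False using x two(3) by simp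
qed

text \<open>If two anticommuting elements both have square 1, their product has square -1 and
  anticommutes with each of them.\<close>

lemma anticommuting_pair:
  obtains b c where "b \<in> Q" "c \<in> Q" "b * b = -1" "c * c = 1 \<or> c * c = -1" "b * c = - (c * b)" "b \<notin> F" "c \<notin> F"
proof -
  obtain x0 y0 where 0: "x0 \<in> Q" "y0 \<in> Q" "x0 * y0 \<noteq> y0 * x0" using noncomm_Q by blast
  obtain f where f: "f \<in> F" "f \<noteq> 0" "(f * x0) * (f * x0) = 1 \<or> (f * x0) * (f * x0) = -1" using sq_Q[OF 0(1)] by blast
  obtain g where g: "g \<in> F" "g \<noteq> 0" "(g * y0) * (g * y0) = 1 \<or> (g * y0) * (g * y0) = -1" using sq_Q[OF 0(2)] by blast
  define x where "x = f * x0"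
  define y where "y = g * y0"
  have xy: "x \<in> Q" "y \<in> Q" "x * x = 1 \<or> x * x = -1" "y * y = 1 \<or> y * y = -1"
    unfolding x_def y_def using scale_Q 0 f g by auto
  have nc: "x * y \<noteq> y * x" unfolding x_def y_def using 0(3) scale_commute[OF f(1,2), of x0 "g * y0"] scale_commute[OF g(1,2), of y0 x0] by metis
  have an: "x * y = - (y * x)" by (rule anticommute[OF xy(1,2) nc])
  have nF: "x \<notin> F" "y \<notin> F" using nc Fc[of x y] Fc[of y x] by auto
  consider "x * x = -1" | "y * y = -1" | "x * x = 1" "y * y = 1" using xy by blast
  then show thesis
  proof cases
    case 1
    then show thesis using that[of x y] xy an nF by blast
  next
    case 2
    have "y * x = - (x * y)" using an by simp
    then show thesis using that[of y x] 2 xy nF by blast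
  next
    case 3
    have xyr: "x * (x * r) = r" "y * (y * r) = r" "x * (y * r) = - (y * (x * r))" for r
      using 3 an by (simp_all flip: mult.assoc)
    have "(x * y) * (x * y) = -1" by (simp add: mult.assoc an xyr 3)
    moreover have "(x * y) * x = - (x * (x * y))" by (simp add: mult.assoc an xyr 3)
    moreover have "x * y \<notin> F"
    proof
      assume "x * y \<in> F"
      then have "(x * y) * x = x * (x * y)" using Fc by blast
      then have "- y = y" using xyr an 3 by (simp add: mult.assoc)
      then have "y + y = 0" by (metis add.right_inverse)
      then show False using double_nonzero[of y] unit_nonzero[OF Q_units[OF xy(2)]] by blast
    qed
    ultimately show thesis using that[of "x * y" x] xy nF Q.N_mult by blast
  qed
qed

text \<open>The span of the signed square roots of 1 and -1 in \<^term>\<open>Q\<close> over the central part of the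
  integers with 5 inverted does not contain 1/3, hence is proper. Its unit \<^term>\<open>1 + 2 * b\<close> has
  norm 5, and the commutators it produces are not in the span of a single class modulo the center.\<close>

lemma char_zero_contradiction:
  assumes ch: "\<And>n. n > 0 \<Longrightarrow> of_nat n \<noteq> (0 :: ('a, 'n) endo)"
  shows False
proof -
  have ch': "numeral n \<noteq> (0 :: ('a, 'n) endo)" for n using ch[of "numeral n"] by simp
  \<comment> \<open>Scalar multiples are excluded here: over the small ring \<open>A\<close> below,
    arbitrary elements of F must not enter through the group.\<close>
  define Q1 where "Q1 = {x \<in> Q. x * x = 1 \<or> x * x = -1}"
  have g1: "ugrp Q1" unfolding ugrp_def
  proof (intro conjI ballI)
    show "Q1 \<subseteq> units" unfolding Q1_def using Q_units by blast
    show "1 \<in> Q1" unfolding Q1_def using ugrpD(2)[OF grp_Q] by simp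
  next
    fix x y assume xy: "x \<in> Q1" "y \<in> Q1"
    have "y * x = x * y \<or> y * x = - (x * y)" using anticommute[of y x] xy unfolding Q1_def by blast
    then have "(x * y) * (x * y) = x * (x * y) * y \<or> (x * y) * (x * y) = - (x * (x * y) * y)"
      by (metis (no_types, lifting) minus_mult_left minus_mult_right mult.assoc)
    then have "(x * y) * (x * y) = (x * x) * (y * y) \<or> (x * y) * (x * y) = - ((x * x) * (y * y))" by (simp add: mult.assoc)
    then show "x * y \<in> Q1" using xy Q.N_mult unfolding Q1_def by auto
  next
    fix x assume x: "x \<in> Q1"
    then have "x * x = 1 \<or> (- x) * x = 1" unfolding Q1_def by auto
    then have "ui x = x \<or> ui x = - x" using ui_eq[of x x] ui_eq[of x "- x"] by auto
    moreover have "ui x \<in> Q" using x Q.N_ui unfolding Q1_def by blast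
    ultimately show "ui x \<in> Q1" using x unfolding Q1_def by auto
  qed
  have i1: "Minv Q1" unfolding Minv_def
  proof (intro ballI)
    fix m x assume m: "m \<in> M" and x: "x \<in> Q1"
    have mu: "m \<in> units" using M_units[OF m] .
    have "(m * x * ui m) * (m * x * ui m) = m * (x * x) * ui m" using mu by (simp add: mult.assoc)
    then show "m * x * ui m \<in> Q1" using x MinvD[OF inv_Q m] mu unfolding Q1_def by auto
  qed
  have nn: "of_nat i * (of_nat j * r) = of_nat j * (of_nat i * r)" for i j and r :: "('a, 'n) endo"
    by (metis mult.assoc mult_of_nat_commute)
  \<comment> \<open>The elements m / 5^k of F; 5 is inverted because it is the norm of 1 + 2 *
    b.\<close>
  define A where "A = {f \<in> F. \<exists>k m. of_nat (5 ^ k) * f = of_int m}"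
  have sA: "subrng A" unfolding subrng_def
  proof (intro conjI ballI)
    show "0 \<in> A" unfolding A_def using sF(1) by (auto intro: exI[of _ 0])
    show "1 \<in> A" unfolding A_def using sF(2) by (auto intro!: exI[of _ "0::nat"] exI[of _ "1::int"])
  next
    fix x y assume xy: "x \<in> A" "y \<in> A"
    obtain k m where x: "of_nat (5 ^ k) * x = of_int m" using xy A_def by blast
    obtain l n where y: "of_nat (5 ^ l) * y = of_int n" using xy A_def by blast
    have F: "x \<in> F" "y \<in> F" using xy A_def by auto
    have "of_nat (5 ^ (k + l)) * (x + y) = of_nat (5 ^ l) * (of_nat (5 ^ k) * x) + of_nat (5 ^ k) * (of_nat (5 ^ l) * y)"
      by (simp add: distrib_left power_add mult.assoc nn[of "5 ^ k" "5 ^ l" x] del: of_nat_power)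
    also have "\<dots> = of_int (int (5 ^ l) * m + int (5 ^ k) * n)" unfolding x y by simp
    finally show "x + y \<in> A" unfolding A_def using sF(3) F by blast
    have "of_nat (5 ^ (k + l)) * (x * y) = (of_nat (5 ^ k) * x) * (of_nat (5 ^ l) * y)"
    proof -
      have "x * (of_nat (5 ^ l) * r) = of_nat (5 ^ l) * (x * r)" for r by (metis mult.assoc mult_of_nat_commute)
      then show ?thesis by (simp add: power_add mult.assoc del: of_nat_power)
    qed
    also have "\<dots> = of_int (m * n)" unfolding x y by simp
    finally show "x * y \<in> A" unfolding A_def using sF(4) F by blast
  next
    fix x assume "x \<in> A"
    then obtain k m where x: "of_nat (5 ^ k) * x = of_int m" "x \<in> F" using A_def by blast
    have "of_nat (5 ^ k) * (- x) = of_int (- m)" using x by simp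
    then show "- x \<in> A" unfolding A_def using sF(5) x by blast
  qed
  have AF: "A \<subseteq> F" unfolding A_def by blast
  have nA: "n * x * ui n = x" if "n \<in> units" "x \<in> A" for n x
  proof -
    have "n * x = x * n" using Fc[of x n] that AF by auto
    then show ?thesis using that by (simp add: mult.assoc)
  qed
  interpret A: norm_span A Q1
    by unfold_locales (use sA g1 nA ugrpD(1)[OF g1] in auto)
  let ?X = "A.kspan Q1"
  have invA: "Minv A" unfolding Minv_def using nA M_units by auto
  have invX: "Minv ?X" by (rule Minv_kspan[OF A.norm_span_axioms invA i1])
  obtain b c0 where bc0: "b \<in> Q" "c0 \<in> Q" "b * b = -1" "c0 * c0 = 1 \<or> c0 * c0 = -1" "b * c0 = - (c0 * b)" "b \<notin> F" "c0 \<notin> F"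
    by (rule anticommuting_pair)
  define c where "c = c0"
  have b1: "b \<in> Q1" and c1: "c \<in> Q1" unfolding Q1_def c_def using bc0 by auto
  have bu: "b \<in> units" and cu: "c \<in> units" using ugrpD(1)[OF g1] b1 c1 by auto
  have XU: "?X \<noteq> UNIV"
  proof
    assume U: "?X = UNIV"
    have tF: "of_nat 3 \<in> F" by (rule subrng_of_nat[OF subrng_centralizer])
    define t where "t = ui (of_nat 3 :: ('a, 'n) endo)"
    have t: "t \<in> F" "of_nat 3 * t = 1" unfolding t_def using Q.Ku[OF tF] ch[of 3] by auto
    \<comment> \<open>By independence over F only the terms on central elements of \<open>Q1\<close>
      contribute to 1/3. These elements are 1 and -1, so 1/3 would lie in \<open>A\<close> and 3
      would divide a power of 5.\<close>
    have "t \<in> ?X" using U by simp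
    then obtain I f where I: "finite I" "I \<subseteq> Q1" "\<forall>i\<in>I. f i \<in> A" "t = (\<Sum>i\<in>I. f i * i)" unfolding A.kspan_def by blast
    define I0 where "I0 = {i \<in> I. i \<in> F}"
    have spl: "t = (\<Sum>i\<in>I0. f i * i) + (\<Sum>i\<in>I - I0. f i * i)"
      unfolding I(4) using sum.subset_diff[of I0 I "\<lambda>i. f i * i"] I(1) unfolding I0_def by auto
    have pm: "i \<in> A" if i: "i \<in> I0" for i
    proof -
      have "i \<in> F" "i * i = 1" using i I(2) no_i unfolding I0_def Q1_def by auto
      then have "(i - 1) * (i + 1) = 0" by (simp add: algebra_simps)
      then have "i = 1 \<or> i = -1" using divring_mult_eq_0[OF divring_cen sF(6)[OF \<open>i \<in> F\<close> sF(2)]] by (auto simp: eq_neg_iff_add_eq_0)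
      then show ?thesis using A.sK(2) A.sK(5)[OF A.sK(2)] by auto
    qed
    define s where "s = (\<Sum>i\<in>I0. f i * i)"
    have sA': "s \<in> A" unfolding s_def by (rule subrng_sum[OF sA]) (use pm I(3) A.sK(4) I0_def in auto)
    have ts: "t - s = (\<Sum>i\<in>I - I0. f i * i)" using spl unfolding s_def by simp
    let ?P = "{m \<in> Q. m * ui 1 \<notin> F}"
    have "(\<Sum>i\<in>I - I0. f i * i) \<in> Q.kspan ?P"
      by (rule Q.kspanI) (use I AF in \<open>auto simp: I0_def Q1_def\<close>)
    then have tsP: "t - s \<in> Q.kspan ?P" unfolding ts .
    have "t - s = 0"
    proof (rule ccontr)
      assume n: "t - s \<noteq> 0"
      have tsF: "t - s \<in> F" using t(1) sA' AF sF(6) by blast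
      then have "ui (t - s) * (t - s) \<in> Q.kspan ?P" using Q.kspan_scale[OF tsP Q.Ku(2)[OF tsF n]] by simp
      then show False using Q.Ku(1)[OF tsF n] Q.independent[OF ugrpD(2)[OF grp_Q]] by simp
    qed
    then have "t \<in> A" using sA' by simp
    then obtain k m where km: "of_nat (5 ^ k) * t = of_int m" unfolding A_def by blast
    have "of_nat (5 ^ k) = of_nat 3 * (of_nat (5 ^ k) * t)"
      unfolding nn[of 3 "5 ^ k" t] t(2) by simp
    also have "\<dots> = of_int (3 * m)" unfolding km by simp
    finally have e: "(of_int (int (5 ^ k) - 3 * m) :: ('a, 'n) endo) = 0" by simp
    have "int (5 ^ k) - 3 * m = 0"
    proof (rule ccontr)
      assume n: "int (5 ^ k) - 3 * m \<noteq> 0"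
      obtain j where j: "int (5 ^ k) - 3 * m = int j \<or> int (5 ^ k) - 3 * m = - int j" by (metis int_cases2)
      then have "(of_int (int j) :: ('a, 'n) endo) = 0"
      proof
        assume eq: "int (5 ^ k) - 3 * m = int j"
        show ?thesis using e unfolding eq .
      next
        assume eq: "int (5 ^ k) - 3 * m = - int j"
        show ?thesis using e unfolding eq by simp
      qed
      then have "of_nat j = (0 :: ('a, 'n) endo)" by simp
      then show False using ch[of j] j n by auto
    qed
    then have "int 3 dvd int (5 ^ k)" by simp
    then have "3 dvd (5::nat) ^ k" by (simp only: int_dvd_int_iff)
    moreover have "prime (3::nat)" by simp
    ultimately have "3 dvd (5::nat)" using prime_dvd_power[of "3::nat" 5 k] by blast
    then show False by simp
  qed
  have XI: "x \<in> ?X" if "x \<in> Q1" for x using A.kspan_base1 that by blast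
  note sX = subrngD[OF A.subrng_kspan]
  have Q1u: "x \<in> uset ?X" if "x \<in> Q1" for x
    unfolding uset_def using XI that ugrpD(1,4)[OF g1] by auto
  have five: "of_nat 5 \<in> F" by (rule subrng_of_nat[OF subrng_centralizer])
  define fi where "fi = ui (of_nat 5 :: ('a, 'n) endo)"
  have fi: "fi \<in> F" "5 * fi = 1" "fi * 5 = 1" unfolding fi_def using Q.Ku[OF five] ch[of 5] ui_left[OF Q.Ku(1)[OF five]] ui_right[OF Q.Ku(1)[OF five]] by auto
  have "fi \<in> A" unfolding A_def using fi by (auto intro!: exI[of _ 1])
  then have fiX: "fi \<in> ?X" using A.kspan_base[OF ugrpD(2)[OF g1]] by fastforce
  \<comment> \<open>t * t = -4, hence (1 + t) * (1 - t) = 5.\<close>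
  define t where "t = b + b"
  have tt: "t * t = -4" unfolding t_def using bc0(3) by (simp add: algebra_simps)
  have ct: "c * t = - (t * c)" unfolding t_def c_def using bc0(5) by (simp add: algebra_simps)
  define u where "u = 1 + t"
  define v where "v = 1 - t"
  have uv: "u * v = 5" "v * u = 5" unfolding u_def v_def using tt by (simp_all add: algebra_simps)
  have cf: "x * (fi * r) = fi * (x * r)" for x r using Fc2[OF fi(1)] .
  have n5: "x * (5 * r) = 5 * (x * r)" for x r :: "('a, 'n) endo" by (metis mult.assoc mult_of_nat_commute of_nat_numeral)
  have cuv: "c * v = u * c" "c * u = v * c" unfolding u_def v_def using ct by (simp_all add: algebra_simps)
  have "u * (fi * v) = 1" "(fi * v) * u = 1" using uv fi(3) cf by (simp_all add: mult.assoc)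
  then have uu: "u \<in> units" "ui u = fi * v" using unitsI ui_eq by blast+
  have tX: "t \<in> ?X" unfolding t_def by (rule sX(3)[OF XI[OF b1] XI[OF b1]])
  have "u \<in> ?X" "fi * v \<in> ?X" unfolding u_def v_def
    by (rule sX(3)[OF sX(2) tX], rule sX(4)[OF fiX sX(6)[OF sX(2) tX]])
  then have uX: "u \<in> uset ?X" unfolding uset_def using uu by simp
  have u'M: "comm u c \<in> M" using proper_ring(1)[OF A.subrng_kspan invX XU Q1u[OF b1] bc0(6) uX Q1u[OF c1]] .
  \<comment> \<open>Conjugation by c exchanges 1 + t and 1 - t, so the commutator is u * u /
    5.\<close>
  have u'e: "comm u c = fi * (u * u)"
  proof -
    have "comm u c = fi * (u * (c * v) * ui c)" unfolding comm_def uu(2) using cf by (simp add: mult.assoc)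
    then show ?thesis unfolding cuv(1) using cu by (simp add: mult.assoc)
  qed
  have "(fi * (u * u)) * (fi * (v * v)) = fi * fi * (u * (u * v) * v)" by (simp add: mult.assoc cf[of u])
  also have "\<dots> = fi * fi * (5 * (u * v))" unfolding uv(1) by (simp only: mult.assoc n5[of u] uv(1))
  also have "\<dots> = 1" unfolding uv(1) using fi(3) by (metis mult.assoc mult_1_right)
  finally have r1: "(fi * (u * u)) * (fi * (v * v)) = 1" .
  have u'i: "ui (comm u c) = fi * (v * v)"
  proof -
    have "comm u c \<in> units" using uu(1) cu by simp
    then have "ui (comm u c) * (comm u c * (fi * (v * v))) = fi * (v * v)" by simp
    then show ?thesis unfolding u'e r1 by simp
  qed
  \<comment> \<open>This is u^4 / 25 = (-7 - 24 * b) / 25. It lies in Q because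
    \<open>comm u c\<close> is in M, yet it has nonzero coordinates in the two cosets of 1 and
    b.\<close>
  define y where "y = comm (comm u c) c"
  have "comm u c * c * ui (comm u c) \<in> Q" using MinvD[OF inv_Q u'M] bc0(2) c_def by blast
  then have yQ: "y \<in> Q" unfolding y_def comm_def[of "comm u c" c] using Q.N_mult Q.N_ui bc0(2) c_def by blast
  have "y = fi * fi * (u * u * (c * v * v) * ui c)" unfolding y_def comm_def[of "comm u c" c] u'i unfolding u'e by (simp add: mult.assoc cf[of u] cf[of c])
  also have "c * v * v = u * u * c" unfolding cuv(1) mult.assoc[of u c v] by (simp add: cuv(1) mult.assoc)
  also have "fi * fi * (u * u * (u * u * c) * ui c) = fi * fi * ((u * u) * (u * u))" using cu by (simp add: mult.assoc)
  also have "u * u = - 3 + 4 * b"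
  proof -
    have "(4 :: ('a, 'n) endo) = 1 + 1 + (1 + 1)" by simp
    then have "4 * b = t + t" unfolding t_def by (simp only: distrib_right mult_1)
    moreover have "u * u = - 3 + (t + t)" unfolding u_def using tt by (simp add: algebra_simps)
    ultimately show ?thesis by simp
  qed
  also have "(- 3 + 4 * b) * (- 3 + 4 * b) = - 7 + (- 24) * b"
  proof -
    have nb: "b * numeral i = numeral i * b" "b * (numeral i * r) = numeral i * (b * r)" for i r
      by (metis mult_of_nat_commute of_nat_numeral, metis mult.assoc mult_of_nat_commute of_nat_numeral)
    have "(24 :: ('a, 'n) endo) = 12 + 12" by simp
    then have "24 * b = 12 * b + 12 * b" by (simp only: distrib_right)
    then show ?thesis using bc0(3) by (simp add: distrib_left distrib_right left_diff_distrib right_diff_distrib mult.assoc nb)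
  qed
  finally have ye: "y = fi * fi * (- 7) + fi * fi * (- 24) * b" by (simp add: distrib_left mult.assoc right_diff_distrib)
  define \<alpha> where "\<alpha> = fi * fi * (- 7)"
  define \<beta> where "\<beta> = fi * fi * (- 24)"
  have fu: "fi \<in> units" using fi unitsI by blast
  have nF: "of_nat n \<in> F" for n by (rule subrng_of_nat[OF subrng_centralizer])
  have ab: "\<alpha> \<in> F" "\<beta> \<in> F" unfolding \<alpha>_def \<beta>_def
    using sF(4)[OF sF(4)[OF fi(1) fi(1)] sF(5)[OF nF[of 7]]] sF(4)[OF sF(4)[OF fi(1) fi(1)] sF(5)[OF nF[of 24]]] by simp_all
  have ab0: "\<alpha> \<noteq> 0" "\<beta> \<noteq> 0"
  proof -
    have "r \<noteq> 0 \<Longrightarrow> fi * fi * r \<noteq> 0" for r using units_cancel_left[of "fi * fi" r 0] fu by simp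
    then show "\<alpha> \<noteq> 0" "\<beta> \<noteq> 0" unfolding \<alpha>_def \<beta>_def using ch' by simp_all
  qed
  have ye': "y = \<alpha> * 1 + \<beta> * b" using ye unfolding \<alpha>_def \<beta>_def by simp
  have bF: "f = 0" if "f \<in> F" "f * b \<in> F" for f using scale_F[OF that(1)] that(2) bc0(6) by blast
  have y1: "y \<notin> F"
  proof
    assume "y \<in> F"
    then have "y - \<alpha> \<in> F" using sF(6) ab by blast
    then have "\<beta> * b \<in> F" unfolding ye' by simp
    then show False using bF ab ab0 by blast
  qed
  have y2: "y * ui b \<notin> F"
  proof
    assume g: "y * ui b \<in> F"
    have "y = (y * ui b) * b" using bu by (simp add: mult.assoc)
    then have e: "(y * ui b - \<beta>) * b = \<alpha>" using ye' by (simp add: left_diff_distrib)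
    then have "y * ui b - \<beta> = 0" using bF[OF sF(6)[OF g ab(2)]] ab(1) by simp
    then show False using e ab0(1) by simp
  qed
  let ?P = "{m \<in> Q. m * ui y \<notin> F}"
  have "1 \<in> ?P" using y1 Q.K_equiv_sym[OF yQ ugrpD(2)[OF grp_Q]] ugrpD(2)[OF grp_Q] by simp
  moreover have "b \<in> ?P" using y2 Q.K_equiv_sym[OF yQ bc0(1)] bc0(1) by simp
  ultimately have "\<alpha> * 1 + \<beta> * b \<in> Q.kspan ?P" by (intro Q.kspan_add Q.kspan_base ab)
  then show False using Q.independent[OF yQ] ye' by simp
qed

text \<open>In the quaternion algebra spanned by \<^term>\<open>b\<close> and \<^term>\<open>c\<close>, the elements \<^term>\<open>a * b + a' * c\<close> and
  \<^term>\<open>a' * b - a * c\<close> are anticommuting involutions, so the algebra splits.\<close>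

lemma sum_of_squares_contradiction:
  assumes a: "a \<in> F" "a' \<in> F" "a * a + a' * a' = -1"
  shows False
proof -
  have aa: "a * (a * r) + a' * (a' * r) = - r" for r
  proof -
    have "(a * a + a' * a') * r = - r" unfolding a(3) by simp
    then show ?thesis by (simp add: distrib_right mult.assoc)
  qed
  have ca: "x * (a * r) = a * (x * r)" "x * (a' * r) = a' * (x * r)" "a' * (a * r) = a * (a' * r)" for x r
    using Fc2[OF a(1)] Fc2[OF a(2)] by blast+
  \<comment> \<open>The last two identities recover x and y, so the new pair generates the same
    quaternion algebra.\<close>
  have pair: "w * w = 1 \<and> w' * w' = 1 \<and> w * w' = x * y \<and> w' * w = - (x * y) \<and> - (a * w + a' * w') = x \<and> a * w' - a' * w = y"
    if xy: "x * x = -1" "y * y = -1" "x * y = - (y * x)" and w: "w = a * x + a' * y" "w' = a' * x - a * y" for x y w w'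
  proof -
    have yx: "y * x = - (x * y)" using xy(3) by simp
    have xyr: "x * (x * r) = - r" "y * (y * r) = - r" "y * (x * r) = - (x * (y * r))" for r
      using xy(1,2) yx by (simp_all flip: mult.assoc)
    have s: "a * a = -1 - a' * a'" using a(3) by (simp add: algebra_simps eq_diff_eq)
    have sr: "a * (a * r) = - r - a' * (a' * r)" for r using aa[of r] by (simp add: algebra_simps eq_diff_eq)
    show ?thesis unfolding w by (simp add: algebra_simps ca(1)[of x] ca(1)[of y] ca(2)[of x] ca(2)[of y] ca(3) Fc[OF a(2), of a] xy(1,2) yx xyr s sr)
  qed
  have XU: "X = UNIV"
  proof (cases "\<exists>r\<in>Q. r * r = 1 \<and> r \<notin> F")
    case True
    then show ?thesis using root_X unfolding p2 power2_eq_square by blast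
  next
    case False
    obtain x y where xy: "x \<in> Q" "y \<in> Q" "x * x = -1" "y * y = 1 \<or> y * y = -1" "x * y = - (y * x)" "x \<notin> F" "y \<notin> F"
      by (rule anticommuting_pair)
    then have yy: "y * y = -1" using False by blast
    define w where "w = a * x + a' * y"
    define w' where "w' = a' * x - a * y"
    have w: "w * w = 1" "w' * w' = 1" "w * w' = x * y" "w' * w = - (x * y)" using pair[OF xy(3) yy xy(5) w_def w'_def] by auto
    have wr: "w * (w * r) = r" "w' * (w' * r) = r" "w' * (w * r) = - (w * (w' * r))" for r
      using w by (metis mult.assoc mult_1, metis mult.assoc mult_1, metis minus_mult_left mult.assoc)
    have wX: "w \<in> X" "w' \<in> X" unfolding w_def w'_def
      using Q_X[OF xy(1)] Q_X[OF xy(2)] F_X a subrngD(3,4,6)[OF Q.subrng_kspan] by auto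
    have w'u: "w' \<in> units" "ui w' = w'" using w(2) unitsI ui_eq by blast+
    \<comment> \<open>The eigenprojection of the involution \<open>w\<close>; \<open>w'\<close>
      anticommutes with \<open>w\<close> and swaps its two eigenspaces.\<close>
    define e where "e = ip * (1 + w)"
    have ci: "r * (ip * s) = ip * (r * s)" for r s using Fc2[OF ip(1)] .
    have i2: "ip * (r + r) = r" for r
    proof -
      have "ip * (r + r) = (ip + ip) * r" by (simp add: algebra_simps)
      then show ?thesis using two(3) by simp
    qed
    have "(1 + w) * (1 + w) = (1 + w) + (1 + w)" using w(1) by (simp add: algebra_simps)
    then have ee: "e * e = e" unfolding e_def by (simp add: mult.assoc ci i2)
    have "w' * w = - (w * w')" using w(3,4) by simp
    then have "(1 + w) * (w' * (1 + w)) = 0" by (simp add: algebra_simps wr)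
    then have k: "e * w' * e = 0" unfolding e_def by (simp add: mult.assoc ci)
    have e0: "e \<noteq> 0"
    proof
      assume "e = 0"
      then have "1 + w = 0" unfolding e_def using divring_mult_eq_0[OF divring_cen ip(1)] ip(3) by blast
      then have e: "1 = - w" by (simp add: eq_neg_iff_add_eq_0)
      let ?P = "{m \<in> Q. m * ui 1 \<notin> F}"
      have "w \<in> Q.kspan ?P" unfolding w_def using xy by (intro Q.kspan_add Q.kspan_base a) auto
      then have "- w \<in> Q.kspan ?P" by (rule Q.kspan_minus)
      then show False using e Q.independent[OF ugrpD(2)[OF grp_Q]] by simp
    qed
    have "e \<in> X" unfolding e_def using F_X[OF ip(1)] wX F_X[OF sF(2)] subrngD(3,4)[OF Q.subrng_kspan] by blast
    then show ?thesis using matrix_units_X[OF _ ee e0 wX(2) w'u(1)] w'u(2) wX(2) k by simp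
  qed
  obtain e where e: "good e" "\<And>b. b \<in> Q \<Longrightarrow> b ^ p = 1 \<Longrightarrow> e * b = b * e \<Longrightarrow> \<exists>f\<in>F. b * e = f * e" by (rule minimal_good) blast
  have e': "e * e = e" "e \<noteq> 0" using e(1) unfolding good_def by auto
  have eer: "e * (e * r) = e * r" for r using e'(1) by (simp flip: mult.assoc)
  have ebe: "e * b * e = 0 \<or> e * b = b * e \<and> e * b * e = b * e" if "b \<in> Q" for b
  proof (cases "e * b * e = 0")
    case False
    then have "e * b = b * e" using e(1) that unfolding good_def by blast
    then show ?thesis using e'(1) by (simp add: mult.assoc)
  qed simp
  \<comment> \<open>The scalars of the corner. An involution of Q commuting with e is scalar there
    by minimality of e, so a nonscalar element can be scaled only to square -1; this is
    \<open>norm\<close>.\<close>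
  define Fe where "Fe = {f * e | f. f \<in> F}"
  have FeI: "f * e \<in> Fe" if "f \<in> F" for f unfolding Fe_def using that by blast
  have Fe_scale: "f * x \<in> Fe \<Longrightarrow> f \<in> F \<Longrightarrow> f \<noteq> 0 \<Longrightarrow> x \<in> Fe" for f x
  proof -
    assume h: "f * x \<in> Fe" "f \<in> F" "f \<noteq> 0"
    then obtain g where "g \<in> F" "f * x = g * e" unfolding Fe_def by blast
    then have "x = (ui f * g) * e" using Q.Ku(1)[OF h(2,3)] by (metis mult.assoc ui_left2)
    then show ?thesis using FeI sF(4)[OF Q.Ku(2)[OF h(2,3)] \<open>g \<in> F\<close>] by blast
  qed
  have sq_Fe: "d * e \<in> Fe" if "d \<in> Q" "d * d = 1" "e * d = d * e" for d
    using e(2)[OF that(1) _ that(3)] that(2) FeI unfolding p2 power2_eq_square by auto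
  have norm: "\<exists>f\<in>F. f \<noteq> 0 \<and> f * d \<in> Q \<and> (f * d) * (f * d) = -1 \<and> e * (f * d) = (f * d) * e \<and> f * d * e \<notin> Fe"
    if d: "d \<in> Q" "e * d = d * e" "d * e \<notin> Fe" for d
  proof -
    obtain f where f: "f \<in> F" "f \<noteq> 0" "(f * d) * (f * d) = 1 \<or> (f * d) * (f * d) = -1" using sq_Q[OF d(1)] by blast
    have 1: "f * d \<in> Q" "e * (f * d) = (f * d) * e" using scale_Q[OF f(1,2) d(1)] d(2) Fc2[OF f(1)] by (simp_all add: mult.assoc)
    have 2: "f * d * e \<notin> Fe" using Fe_scale[OF _ f(1,2), of "d * e"] d(3) by (auto simp: mult.assoc)
    then have "(f * d) * (f * d) \<noteq> 1" using sq_Fe 1 by blast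
    then show ?thesis using f 1 2 by blast
  qed
  show False
  proof (cases "\<forall>d\<in>Q. e * d = d * e \<longrightarrow> d * e \<in> Fe")
    case True
    show False
    proof (rule scalar_corner[OF XU e'])
      fix d assume d: "d \<in> Q"
      have "0 * e \<in> Fe" by (rule FeI[OF sF(1)])
      then have "e * d * e \<in> Fe" using ebe[OF d] True d by auto
      then show "\<exists>f\<in>F. e * d * e = f * e" unfolding Fe_def by blast
    qed
  next
    case False
    then obtain d where d: "d \<in> Q" "e * d = d * e" "d * e \<notin> Fe" by blast
    obtain f where "f \<in> F" "f \<noteq> 0" "f * d \<in> Q" "(f * d) * (f * d) = -1" "e * (f * d) = (f * d) * e" "f * d * e \<notin> Fe" using norm[OF d] by blast
    then obtain b where b: "b \<in> Q" "b * b = -1" "e * b = b * e" "b * e \<notin> Fe" by blast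
    show False
    proof (cases "\<exists>d\<in>Q. e * d = d * e \<and> d * e \<notin> Fe \<and> d * b \<noteq> b * d")
      case False
      \<comment> \<open>A nonscalar d commuting with b, scaled to square -1, makes b * d an
        involution and hence scalar, so d is a multiple of b. The corner is then spanned by e and b
        * e, which commute.\<close>
      have span2: "\<exists>f\<in>F. \<exists>g\<in>F. e * d * e = f * e + g * (b * e)" if d: "d \<in> Q" for d
      proof (cases "e * d = d * e \<and> d * e \<notin> Fe")
        case n: False
        have "0 * e \<in> Fe" by (rule FeI[OF sF(1)])
        then have "e * d * e \<in> Fe" using ebe[OF d] n by auto
        then obtain f where "f \<in> F" "e * d * e = f * e + 0 * (b * e)" unfolding Fe_def by auto
        then show ?thesis using sF(1) by blast
      next
        case True
        then obtain f where f: "f \<in> F" "f \<noteq> 0" "f * d \<in> Q" "(f * d) * (f * d) = -1" "e * (f * d) = (f * d) * e" using norm[OF d] by blast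
        have "d * b = b * d" using False True d by blast
        then have c: "(f * d) * b = b * (f * d)" using scale_commute[OF f(1,2)] by blast
        have "(b * (f * d)) * (b * (f * d)) = b * ((f * d) * b) * (f * d)" by (simp only: mult.assoc)
        also have "\<dots> = (b * b) * ((f * d) * (f * d))" unfolding c by (simp only: mult.assoc)
        also have "\<dots> = 1" using b(2) f(4) by simp
        finally have "b * (f * d) * e \<in> Fe"
          by (intro sq_Fe) (use Q.N_mult b f(3,5) in \<open>auto simp: mult.assoc\<close>, metis b(3) f(5) mult.assoc)
        then obtain g where g: "g \<in> F" "b * (f * d) * e = g * e" unfolding Fe_def by blast
        have "f * (d * e) = - (b * (b * (f * d) * e))" using b(2) by (simp flip: mult.assoc)
        also have "\<dots> = - (g * (b * e))" unfolding g(2) using Fc2[OF g(1)] by simp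
        finally have "d * e = ui f * (- (g * (b * e)))" using Q.Ku(1)[OF f(1,2)] by (metis ui_left2)
        then have "d * e = 0 * e + (- (ui f * g)) * (b * e)" by (simp add: mult.assoc)
        moreover have "- (ui f * g) \<in> F" using sF(4,5) Q.Ku(2)[OF f(1,2)] g(1) by blast
        moreover have "e * d * e = d * e" using ebe[OF d] True by (metis e'(1) mult.assoc)
        ultimately show ?thesis using sF(1) by metis
      qed
      have all: "\<exists>f\<in>F. \<exists>g\<in>F. e * r * e = f * e + g * (b * e)" for r
      proof -
        have "r \<in> X" using XU by simp
        then obtain I c where I: "finite I" "I \<subseteq> Q" "\<forall>i\<in>I. c i \<in> F" "r = (\<Sum>i\<in>I. c i * i)" unfolding Q.kspan_def by blast
        obtain f g where fg: "\<And>b'. b' \<in> Q \<Longrightarrow> f b' \<in> F \<and> g b' \<in> F \<and> e * b' * e = f b' * e + g b' * (b * e)" using span2 by metis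
        have "e * r * e = (\<Sum>i\<in>I. c i * (e * i * e))" unfolding I(4) sum_distrib_left sum_distrib_right
        proof (rule sum.cong[OF refl])
          fix i assume "i \<in> I"
          then have "c i \<in> F" using I by blast
          then show "e * (c i * i) * e = c i * (e * i * e)" using Fc2[of "c i" e] by (simp add: mult.assoc)
        qed
        also have "\<dots> = (\<Sum>i\<in>I. c i * f i * e + c i * g i * (b * e))"
          by (rule sum.cong) (use I fg in \<open>auto simp: mult.assoc distrib_left\<close>)
        also have "\<dots> = (\<Sum>i\<in>I. c i * f i) * e + (\<Sum>i\<in>I. c i * g i) * (b * e)" by (simp add: sum.distrib sum_distrib_right)
        finally have "e * r * e = (\<Sum>i\<in>I. c i * f i) * e + (\<Sum>i\<in>I. c i * g i) * (b * e)" .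
        moreover have "(\<Sum>i\<in>I. c i * f i) \<in> F" "(\<Sum>i\<in>I. c i * g i) \<in> F"
          by (rule subrng_sum[OF subrng_centralizer sF(4)]; use I fg in auto)+
        ultimately show ?thesis by blast
      qed
      obtain r s where rs: "(e * r * e) * (e * s * e) \<noteq> (e * s * e) * (e * r * e)" using noncommutative_corner[OF e'] by blast
      obtain f g where r: "f \<in> F" "g \<in> F" "e * r * e = f * e + g * (b * e)" using all by blast
      obtain f' g' where s: "f' \<in> F" "g' \<in> F" "e * s * e = f' * e + g' * (b * e)" using all by blast
      have com: "e * (b * e) = (b * e) * e" using b(3) e'(1) by (simp flip: mult.assoc)
      have ff: "(h * x) * (h' * y) = h * (h' * (x * y))" if "h' \<in> F" for h h' x y
        using Fc2[OF that] by (simp add: mult.assoc)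
      have prod: "(h * e + l * (b * e)) * (h' * e + l' * (b * e)) = h * (h' * (e * e)) + (h * (l' * (e * (b * e))) + (l * (h' * (e * (b * e))) + l * (l' * (b * e * (b * e)))))"
        if "h' \<in> F" "l' \<in> F" for h l h' l'
        by (simp only: distrib_left distrib_right ff[OF that(1), of h e e] ff[OF that(2), of h e "b * e"]
          ff[OF that(1), of l "b * e" e] ff[OF that(2), of l "b * e" "b * e"] com add.assoc add.left_commute)
      have hh: "f * (f' * x) = f' * (f * x)" "f * (g' * x) = g' * (f * x)" "g * (f' * x) = f' * (g * x)" "g * (g' * x) = g' * (g * x)" for x
        using Fc2[OF r(1), of f'] Fc2[OF r(1), of g'] Fc2[OF r(2), of f'] Fc2[OF r(2), of g'] by simp_all
      have "(e * r * e) * (e * s * e) = (e * s * e) * (e * r * e)"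
        unfolding r(3) s(3) prod[OF s(1,2)] prod[OF r(1,2)] hh by (simp only: add.left_commute)
      then show False using rs by blast
    next
      case True
      then obtain d where d: "d \<in> Q" "e * d = d * e" "d * e \<notin> Fe" "d * b \<noteq> b * d" by blast
      obtain f where f: "f \<in> F" "f \<noteq> 0" "f * d \<in> Q" "(f * d) * (f * d) = -1" "e * (f * d) = (f * d) * e" using norm[OF d(1-3)] by blast
      define c where "c = f * d"
      have c: "c \<in> Q" "c * c = -1" "e * c = c * e" "c * b \<noteq> b * c" unfolding c_def using f d(4) scale_commute[OF f(1,2)] by auto
      have cb: "c * b = - (b * c)" by (rule anticommute[OF c(1) b(1) c(4)])
      have bc: "b * c = - (c * b)" using cb by simp
      define w where "w = a * b + a' * c"
      define w' where "w' = a' * b - a * c"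
      have w: "w * w = 1" "w' * w' = 1" "w * w' = b * c" "w' * w = - (b * c)" "- (a * w + a' * w') = b" "a * w' - a' * w = c"
        using pair[OF b(2) c(2) bc w_def w'_def] by auto
      have ew: "e * w = w * e" "e * w' = w' * e" unfolding w_def w'_def
        using b(3) c(3) Fc2[OF a(1)] Fc2[OF a(2)] by (simp_all add: algebra_simps)
      have ewr: "e * (w * r) = w * (e * r)" "e * (w' * r) = w' * (e * r)" for r using ew by (simp_all flip: mult.assoc)
      have wr: "w * (w * r) = r" "w' * (w' * r) = r" "w' * (w * r) = - (w * (w' * r))" for r
        using w by (metis mult.assoc mult_1, metis mult.assoc mult_1, metis minus_mult_left mult.assoc)
      have ww: "w' * w = - (w * w')" using w by simp
      have ci: "r * (ip * s) = ip * (r * s)" for r s using Fc2[OF ip(1)] .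
      have i2: "ip * (r + r) = r" for r
      proof -
        have "ip * (r + r) = (ip + ip) * r" by (simp add: algebra_simps)
        then show ?thesis using two(3) by simp
      qed
      \<comment> \<open>The corner is cut once more, by the eigenprojection of w. There w compresses
        to 1 and w' to 0, so b, c and b * c compress to the scalars -a, -a' and 0.\<close>
      define g where "g = ip * (e + w * e)"
      have "(e + w * e) * (e + w * e) = (e + w * e) + (e + w * e)"
        by (simp add: algebra_simps ewr ew e'(1) eer wr w(1))
      then have gg: "g * g = g" unfolding g_def by (simp add: mult.assoc ci i2)
      have gw: "g * w = g" "w * g = g" unfolding g_def by (simp_all add: mult.assoc ci algebra_simps ew wr)
      have ge: "g * e = g" "e * g = g" unfolding g_def by (simp_all add: mult.assoc ci algebra_simps ew ewr eer e'(1))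
      have gw'g: "g * w' * g = 0"
      proof -
        have "g * w' * g = g * (w * w') * g" using gw(1) by (metis mult.assoc)
        also have "w * w' = - (w' * w)" using ww by simp
        also have "g * - (w' * w) * g = - (g * w' * (w * g))" by (simp add: mult.assoc)
        also have "\<dots> = - (g * w' * g)" unfolding gw(2) ..
        finally have "g * w' * g + g * w' * g = 0" by (simp add: eq_neg_iff_add_eq_0)
        then show ?thesis using double_nonzero by blast
      qed
      have g0: "g \<noteq> 0"
      proof
        assume "g = 0"
        then have "e + w * e = 0" unfolding g_def using divring_mult_eq_0[OF divring_cen ip(1)] ip(3) by blast
        then have we: "w * e = - e" by (simp add: eq_neg_iff_add_eq_0 add.commute)
        have "w' * (w * e) = w * (- (w' * e))" using wr(3)[of e] by simp
        also have "w' * e = e * w'" using ew by simp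
        also have "w * (- (e * w')) = - ((w * e) * w')" by (simp add: mult.assoc)
        also have "\<dots> = e * w'" unfolding we by simp
        finally have "- (w' * e) = w' * e" unfolding we using ew by simp
        then have "w' * e + w' * e = 0" by (metis add.right_inverse)
        then have "w' * e = 0" using double_nonzero by blast
        then have "w' * (w' * e) = 0" by simp
        then show False unfolding wr(2) using e'(2) by simp
      qed
      have gsc: "g * x * g = h * g" if "h \<in> F" "e * x * e = h * e" for x h
      proof -
        have "g * x * g = g * (e * x * e) * g" using ge by (metis mult.assoc)
        also have "\<dots> = h * (g * e * g)" unfolding that(2) using Fc2[OF that(1)] by (simp add: mult.assoc)
        finally show ?thesis using ge gg by simp
      qed
      have gb: "g * b * g = (- a) * g"
      proof -
        have "g * b * g = - (a * (g * w * g) + a' * (g * w' * g))"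
          by (subst w(5)[symmetric]) (simp add: algebra_simps Fc2[OF a(1)] Fc2[OF a(2)])
        then show ?thesis using gw'g gw gg by simp
      qed
      have gc: "g * c * g = (- a') * g"
      proof -
        have "g * c * g = a * (g * w' * g) - a' * (g * w * g)"
          by (subst w(6)[symmetric]) (simp add: algebra_simps Fc2[OF a(1)] Fc2[OF a(2)])
        then show ?thesis using gw'g gw gg by simp
      qed
      have gbc: "g * (b * c) * g = 0 * g"
      proof -
        have "g * (b * c) * g = g * w' * g" unfolding w(3)[symmetric] using gw(1) by (metis mult.assoc)
        then show ?thesis using gw'g by simp
      qed
      \<comment> \<open>If d is not scalar already and commutes with x of square -1, then x times a
        scaled d is an involution and scalar in the corner of e. So d is there a multiple of x and
        compresses to a scalar along with x.\<close>
      have red: "\<exists>h\<in>F. g * d * g = h * g" if h: "d \<in> Q" "e * d = d * e" "x \<in> Q" "x * x = -1" "e * x = x * e" "x * d = d * x" "h \<in> F" "g * x * g = h * g" for d x h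
      proof (cases "d * e \<in> Fe")
        case True
        then obtain l where "l \<in> F" "d * e = l * e" unfolding Fe_def by blast
        moreover have "e * d * e = d * e" using h(2) e'(1) by (simp add: mult.assoc)
        ultimately show ?thesis using gsc[of l d] by auto
      next
        case False
        obtain f where f: "f \<in> F" "f \<noteq> 0" "f * d \<in> Q" "(f * d) * (f * d) = -1" "e * (f * d) = (f * d) * e" using norm[OF h(1,2) False] by blast
        have cc: "(f * d) * x = x * (f * d)" using scale_commute[OF f(1,2), of d x] h(6) by simp
        have "(x * (f * d)) * (x * (f * d)) = x * ((f * d) * x) * (f * d)" by (simp only: mult.assoc)
        also have "\<dots> = (x * x) * ((f * d) * (f * d))" unfolding cc by (simp only: mult.assoc)
        also have "\<dots> = 1" using h(4) f(4) by simp
        finally have sq: "(x * (f * d)) * (x * (f * d)) = 1" .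
        have ec: "e * (x * (f * d)) = x * (f * d) * e" using h(5) f(5) by (metis mult.assoc)
        have "x * (f * d) * e \<in> Fe" by (rule sq_Fe[OF Q.N_mult[OF h(3) f(3)] sq ec])
        then obtain l where l: "l \<in> F" "x * (f * d) * e = l * e" unfolding Fe_def by blast
        have "f * (d * e) = - (x * (x * (f * d) * e))" using h(4) by (simp flip: mult.assoc)
        also have "\<dots> = - (l * (x * e))" unfolding l(2) using Fc2[OF l(1)] by simp
        finally have "d * e = ui f * (- (l * (x * e)))" using Q.Ku(1)[OF f(1,2)] by (metis ui_left2)
        then have de: "d * e = (- (ui f * l)) * (x * e)" by (simp add: mult.assoc)
        define m where "m = - (ui f * l)"
        have mF: "m \<in> F" unfolding m_def using sF(4,5) Q.Ku(2)[OF f(1,2)] l(1) by blast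
        have "g * d * g = g * (d * e) * g" using ge by (metis mult.assoc)
        also have "\<dots> = m * (g * x * (e * g))" unfolding de m_def[symmetric] using Fc2[OF mF] by (simp add: mult.assoc)
        also have "\<dots> = (m * h) * g" unfolding ge h(8) by (simp add: mult.assoc)
        finally show ?thesis using sF(4)[OF mF h(7)] by blast
      qed
      have bcQ: "b * c \<in> Q" "(b * c) * (b * c) = -1" "e * (b * c) = (b * c) * e"
      proof -
        show "b * c \<in> Q" using Q.N_mult b c by blast
        have "(b * c) * (b * c) = b * (c * b) * c" by (simp only: mult.assoc)
        also have "\<dots> = - ((b * b) * (c * c))" unfolding cb by (simp add: mult.assoc)
        finally show "(b * c) * (b * c) = -1" using b(2) c(2) by simp
        show "e * (b * c) = (b * c) * e" using b(3) c(3) by (metis mult.assoc)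
      qed
      show False
      proof (rule scalar_corner[OF XU gg g0])
        fix d assume d: "d \<in> Q"
        show "\<exists>h\<in>F. g * d * g = h * g"
        proof (cases "e * d = d * e")
          case False
          then have "e * d * e = 0 * e" using ebe[OF d] by auto
          then show ?thesis using gsc[OF sF(1)] sF(1) by blast
        next
          case ed: True
          show ?thesis
          proof (cases "b * d = d * b")
            case True
            show ?thesis by (rule red[OF d ed b(1,2,3) True sF(5)[OF a(1)] gb])
          next
            case bd: False
            show ?thesis
            proof (cases "c * d = d * c")
              case True
              show ?thesis by (rule red[OF d ed c(1,2,3) True sF(5)[OF a(2)] gc])
            next
              case False
              \<comment> \<open>An element that anticommutes with both b and c commutes with b * c,
                so one of the three choices of x in \<open>red\<close> always fits.\<close>
              have 1: "b * d = - (d * b)" by (rule anticommute[OF b(1) d bd])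
              have 2: "c * d = - (d * c)" by (rule anticommute[OF c(1) d False])
              have "(b * c) * d = b * (c * d)" by (simp only: mult.assoc)
              also have "\<dots> = - ((b * d) * c)" unfolding 2 by (simp add: mult.assoc)
              also have "\<dots> = d * (b * c)" unfolding 1 by (simp add: mult.assoc)
              finally have "(b * c) * d = d * (b * c)" .
              then show ?thesis by (rule red[OF d ed bcQ _ sF(1) gbc])
            qed
          qed
        qed
      qed
    qed
  qed
qed

end

text \<open>Outside the split case p = 2 and -1 has no square root in F. The characteristic decides
  the rest: in odd characteristic l the congruence for l makes -1 a sum of two squares in F.\<close>

lemma class2_contradiction: False
proof (cases "\<forall>x\<in>Q. \<exists>f\<in>F. f \<noteq> 0 \<and> (f * x) ^ p = 1")
  case True
  then show False by (intro split_contradiction) blast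
next
  case False
  then obtain x where x: "x \<in> Q" "\<And>f. f \<in> F \<Longrightarrow> f \<noteq> 0 \<Longrightarrow> (f * x) ^ p \<noteq> 1" by blast
  have p2: "p = 2" and noi: "\<And>i. i \<in> F \<Longrightarrow> i * i \<noteq> -1" using nonsplit[OF x] by blast+
  show False
  proof (cases "\<forall>n>0. of_nat n \<noteq> (0 :: ('a, 'n) endo)")
    case True
    then show False using char_zero_contradiction[OF p2 noi] by blast
  next
    case False
    then obtain n0 where "n0 > 0 \<and> of_nat n0 = (0 :: ('a, 'n) endo)" by blast
    then obtain l where l: "l > 0" "of_nat l = (0 :: ('a, 'n) endo)" "\<And>n. n > 0 \<and> of_nat n = (0 :: ('a, 'n) endo) \<Longrightarrow> l \<le> n"
      using ex_has_least_nat[of "\<lambda>n. n > 0 \<and> of_nat n = (0 :: ('a, 'n) endo)" n0 "\<lambda>n. n"] by blast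
    have nF: "of_nat n \<in> F" for n by (rule subrng_of_nat[OF subrng_centralizer])
    have "prime l"
    proof (rule ccontr)
      assume np: "\<not> prime l"
      have "l \<noteq> 1" using l(2) unit_nonzero[OF units_1] by auto
      then obtain q where q: "prime q" "q dvd l" using prime_factor_nat by blast
      then obtain r where r: "l = q * r" by (auto elim: dvdE)
      have "of_nat q * of_nat r = (0 :: ('a, 'n) endo)" using l(2) r by simp
      then have "of_nat q = (0 :: ('a, 'n) endo) \<or> of_nat r = (0 :: ('a, 'n) endo)" using divring_mult_eq_0[OF divring_cen nF] by blast
      then have "l \<le> q \<or> l \<le> r" using l(3)[of q] l(3)[of r] l(1) r by auto
      moreover have "r \<noteq> 1" using np q r by auto
      then have "1 < r" using r l(1) by (cases r) auto
      then have "q < q * r" "r < q * r" using prime_gt_1_nat[OF q(1)] by simp_all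
      ultimately show False using r by linarith
    qed
    moreover have "l \<noteq> 2" using two(1)[OF p2 noi] l(2) by auto
    ultimately have "odd l" using prime_odd_nat[of l] prime_ge_2_nat[of l] by auto
    then obtain i j where "l dvd i * i + j * j + 1" using sum_two_squares_mod_prime[OF \<open>prime l\<close>] by blast
    then obtain m where "i * i + j * j + 1 = l * m" by (auto elim: dvdE)
    then have "of_nat (i * i + j * j + 1) = (0 :: ('a, 'n) endo)" using l(2) by simp
    then have "of_nat i * of_nat i + of_nat j * of_nat j = (-1 :: ('a, 'n) endo)" by (simp add: eq_neg_iff_add_eq_0 ac_simps)
    then show False using sum_of_squares_contradiction[OF p2 noi nF nF] by blast
  qed
qed

end

section \<open>Obtaining the class-two group from M\<close>

context maximal_solvable
begin

lemma Minv_Int_centralizer: "Minv N \<Longrightarrow> Minv (N \<inter> centralizer N)"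
  using Minv_centralizer[of N] unfolding Minv_def by blast

text \<open>The twisted power formula contributes a triangular power of the commutator z. Since z^p
  = 1, this is 1, or z itself when p = 2, and then z is 1 or -1.\<close>

lemma power_mult_sign:
  assumes p: "prime p" and bc: "b \<in> units" "c \<in> units" "comm c b \<in> F" "c ^ p \<in> F"
  shows "(b * c) ^ p = b ^ p * c ^ p \<or> (b * c) ^ p = - (b ^ p * c ^ p)"
proof -
  define z where "z = comm c b"
  have z: "z \<in> F" "c * b = z * (b * c)" unfolding z_def using bc comm_swap by blast+
  have zp: "z ^ p = 1" unfolding z_def by (rule comm_power_1[OF bc(2,1,3,4)])
  have e: "(b * c) ^ p = z ^ (\<Sum>i<p. i) * (b ^ p * c ^ p)"
    by (rule twisted_power[OF Fc[OF z(1)] Fc[OF z(1)] z(2)])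
  have "z ^ (\<Sum>i<p. i) = 1 \<or> z ^ (\<Sum>i<p. i) = -1"
  proof (cases "z ^ (\<Sum>i<p. i) = 1")
    case False
    then have "p = 2" "z ^ (\<Sum>i<p. i) = z" using power_triangular[OF p zp] by auto
    moreover have "(z - 1) * (z + 1) = 0" using zp \<open>p = 2\<close> by (simp add: algebra_simps power2_eq_square)
    then have "z = 1 \<or> z = -1" using divring_mult_eq_0[OF divring_cen sF(6)[OF z(1) sF(2)]] by (auto simp: eq_neg_iff_add_eq_0)
    ultimately show ?thesis by simp
  qed simp
  then show ?thesis unfolding e by auto
qed

lemma conj_power: "m \<in> units \<Longrightarrow> (m * b * ui m) ^ n = m * b ^ n * ui m"
  by (induction n) (simp_all add: mult.assoc)

lemma conj_F: "m \<in> units \<Longrightarrow> f \<in> F \<Longrightarrow> m * (f * x) * ui m = f * (m * x * ui m)"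
  using Fc2 by (simp add: mult.assoc)

theorem commutative: "\<forall>x\<in>M. \<forall>y\<in>M. x * y = y * x"
proof (rule ccontr)
  assume "\<not> ?thesis"
  then have nc: "\<exists>x\<in>M. \<exists>y\<in>M. x * y \<noteq> y * x" by blast
  have abelian: "A \<subseteq> F" if "A \<subseteq> units" "Minv A" "\<And>a b. a \<in> A \<Longrightarrow> b \<in> A \<Longrightarrow> a * b = b * a" for A
    using abelian_normal_central[OF that nc] .
  \<comment> \<open>The center of an invariant set of units is an invariant abelian set, so it lies
    in F.\<close>
  have central: "x \<in> F" if "A \<subseteq> units" "Minv A" "x \<in> A" "\<And>y. y \<in> A \<Longrightarrow> x * y = y * x" for A x
  proof -
    have "A \<inter> centralizer A \<subseteq> F"
    proof (rule abelian)
      show "A \<inter> centralizer A \<subseteq> units" using that(1) by blast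
      show "Minv (A \<inter> centralizer A)" by (rule Minv_Int_centralizer[OF that(2)])
      show "a * b = b * a" if "a \<in> A \<inter> centralizer A" "b \<in> A \<inter> centralizer A" for a b
        using centralizerD[of a A b] that by blast
    qed
    then show ?thesis using that(3,4) unfolding centralizer_def by blast
  qed
  have "\<not> M \<subseteq> F" using nc Fc by blast
  moreover have "normalizes M M" unfolding normalizes_def using ugrpD(3,4)[OF grp_M] by blast
  moreover have "M \<subseteq> units" using M_units by blast
  ultimately obtain N where N: "N \<subseteq> M" "ugrp N" "normalizes M N" "\<not> N \<subseteq> F" "\<And>x y. x \<in> N \<Longrightarrow> y \<in> N \<Longrightarrow> comm x y \<in> F"
    using last_derived[OF sol_M grp_M, of M F] sF(2) by blast
  have iN: "Minv N" using N(3) unfolding Minv_def normalizes_def .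
  have Nu: "x \<in> units" if "x \<in> N" for x using ugrpD(1)[OF N(2) that] .
  have cr: "crossed F N N" by (rule crossed_F[OF N(2,5)]) (use central[OF _ iN] Nu in blast)+
  interpret N: crossed F N N by (rule cr)
  have iF: "Minv F" unfolding Minv_def
  proof (intro ballI)
    fix m f assume "m \<in> M" "f \<in> F"
    then have "m * f * ui m = f" using M_units Fc2[of f m "ui m"] by (simp add: mult.assoc)
    then show "m * f * ui m \<in> F" using \<open>f \<in> F\<close> by simp
  qed
  have "N \<subseteq> N.kspan N" using N.kspan_base1 by blast
  then obtain x p where x: "x \<in> N" "x \<notin> F" and p: "prime p" and xp: "x ^ p \<in> F"
    using prime_torsion_exists[OF cr iF iN order_refl N(5,4)] by metis
  have Fu: "f \<in> F \<Longrightarrow> f \<noteq> 0 \<Longrightarrow> f \<in> units" for f using N.Ku by blast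
  have Fui: "f \<in> F \<Longrightarrow> f \<noteq> 0 \<Longrightarrow> ui f \<in> F \<and> ui f \<noteq> 0" for f using N.Ku unit_nonzero[OF ui_units] by blast
  have Fp: "f \<in> F \<Longrightarrow> f ^ n \<in> F" for f n by (rule subrng_power[OF subrng_centralizer])
  have F0: "f \<in> F \<Longrightarrow> g \<in> F \<Longrightarrow> f \<noteq> 0 \<Longrightarrow> g \<noteq> 0 \<Longrightarrow> f * g \<in> F \<and> f * g \<noteq> 0" for f g
    using sF(4)[of f g] unit_nonzero[OF units_mult[OF Fu[of f] Fu[of g]]] by simp
  have F1: "1 \<in> F \<and> (1::('a, 'n) endo) \<noteq> 0" using sF(2) by simp
  \<comment> \<open>Dividing b by f may lead out of N, which is not known to contain the scalars; so
    the p-th power of f is kept here and the division is done in Q. The sign makes \<open>B\<close>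
    closed under products.\<close>
  define B where "B = {b \<in> N. \<exists>f\<in>F. f \<noteq> 0 \<and> (b ^ p = f ^ p \<or> b ^ p = - (f ^ p))}"
  have BI: "b \<in> B" if "b \<in> N" "f \<in> F" "f \<noteq> 0" "b ^ p = f ^ p \<or> b ^ p = - (f ^ p)" for b f
    using that unfolding B_def by blast
  have BN: "b \<in> N" "b ^ p \<in> F" "b \<in> units" if b: "b \<in> B" for b
  proof -
    obtain f where "b \<in> N" "f \<in> F" "b ^ p = f ^ p \<or> b ^ p = - (f ^ p)" using b unfolding B_def by blast
    then show "b \<in> N" "b ^ p \<in> F" "b \<in> units" using Fp[of f p] sF(5)[OF Fp[of f p]] Nu by auto
  qed
  have gB: "ugrp B" unfolding ugrp_def
  proof (intro conjI ballI)
    show "B \<subseteq> units" using BN by blast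
    show "1 \<in> B" by (rule BI[OF ugrpD(2)[OF N(2)], of 1]) (use F1 in auto)
  next
    fix b c assume bc: "b \<in> B" "c \<in> B"
    obtain f where f: "f \<in> F" "f \<noteq> 0" "b ^ p = f ^ p \<or> b ^ p = - (f ^ p)" using bc(1) unfolding B_def by blast
    obtain g where g: "g \<in> F" "g \<noteq> 0" "c ^ p = g ^ p \<or> c ^ p = - (g ^ p)" using bc(2) unfolding B_def by blast
    have "(b * c) ^ p = (f * g) ^ p \<or> (b * c) ^ p = - ((f * g) ^ p)"
      using power_mult_sign[OF p BN(3)[OF bc(1)] BN(3)[OF bc(2)] N(5)[OF BN(1)[OF bc(2)] BN(1)[OF bc(1)]] BN(2)[OF bc(2)]] f(3) g(3)
      unfolding Fmult_power[OF f(1)] by auto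
    then show "b * c \<in> B" using BI[OF N.N_mult[OF BN(1)[OF bc(1)] BN(1)[OF bc(2)]], of "f * g"] F0 f g by blast
  next
    fix b assume b: "b \<in> B"
    then obtain f where f: "f \<in> F" "f \<noteq> 0" "b ^ p = f ^ p \<or> b ^ p = - (f ^ p)" unfolding B_def by blast
    have "ui b ^ p = ui f ^ p \<or> ui b ^ p = - (ui f ^ p)"
      unfolding ui_power[OF BN(3)[OF b], symmetric] ui_power[OF Fu[OF f(1,2)], symmetric] using f(3) Fu[OF f(1,2)] by auto
    then show "ui b \<in> B" using BI[OF N.N_ui[OF BN(1)[OF b]], of "ui f"] Fui f by blast
  qed
  have iB: "Minv B" unfolding Minv_def
  proof (intro ballI)
    fix m b assume m: "m \<in> M" and b: "b \<in> B"
    obtain f where f: "f \<in> F" "f \<noteq> 0" "b ^ p = f ^ p \<or> b ^ p = - (f ^ p)" using b unfolding B_def by blast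
    have "(m * b * ui m) ^ p = b ^ p" unfolding conj_power[OF M_units[OF m]]
      using Fc[OF BN(2)[OF b], of m, symmetric] M_units[OF m] by (simp add: mult.assoc)
    then show "m * b * ui m \<in> B" using BI[OF MinvD[OF iN m BN(1)[OF b]], of f] f by simp
  qed
  \<comment> \<open>b and its conjugate by m have the same central p-th power, so the p-th power of
    their quotient is 1 or -1.\<close>
  have commB: "comm m b \<in> B" if m: "m \<in> M" and b: "b \<in> N" "b ^ p \<in> F" for m b
  proof -
    define b' where "b' = m * b * ui m"
    have b': "b' \<in> N" unfolding b'_def by (rule MinvD[OF iN m b(1)])
    have b'p: "b' ^ p = b ^ p" unfolding b'_def conj_power[OF M_units[OF m]]
      using Fc[OF b(2), of m, symmetric] M_units[OF m] by (simp add: mult.assoc)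
    have e: "comm m b = b' * ui b" unfolding comm_def b'_def by (simp add: mult.assoc)
    have u: "b \<in> units" "b' \<in> units" using Nu b b' by auto
    have uF: "ui b ^ p \<in> F" unfolding ui_power[OF u(1), symmetric] using Fui[OF b(2)] unit_nonzero[OF units_power[OF u(1)]] by blast
    have "(b' * ui b) ^ p = b' ^ p * ui b ^ p \<or> (b' * ui b) ^ p = - (b' ^ p * ui b ^ p)"
      by (rule power_mult_sign[OF p u(2) ui_units[OF u(1)] N(5)[OF N.N_ui[OF b(1)] b'] uF])
    then have "(b' * ui b) ^ p = 1 ^ p \<or> (b' * ui b) ^ p = - (1 ^ p)"
      unfolding b'p ui_power[OF u(1), symmetric] using u(1) by simp
    then show ?thesis unfolding e using BI[OF N.N_mult[OF b' N.N_ui[OF b(1)]], of 1] F1 by blast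
  qed
  \<comment> \<open>If \<open>B\<close> were central, conjugation would change x by scalars only,
    and the scalar multiples of powers of x would be an invariant abelian set containing the
    noncentral x.\<close>
  have BF: "\<not> B \<subseteq> F"
  proof
    assume BF: "B \<subseteq> F"
    define A where "A = {f * x ^ i | f i. f \<in> F \<and> f \<noteq> 0}"
    have "A \<subseteq> F"
    proof (rule abelian)
      show "A \<subseteq> units" unfolding A_def using Fu Nu[OF x(1)] by auto
      show "Minv A" unfolding Minv_def
      proof (intro ballI)
        fix m a assume m: "m \<in> M" and "a \<in> A"
        then obtain f i where a: "f \<in> F" "f \<noteq> 0" "a = f * x ^ i" unfolding A_def by blast
        define g where "g = comm m x"
        have g: "g \<in> F" "g \<noteq> 0" unfolding g_def using commB[OF m x(1) xp] BF unit_nonzero[OF BN(3)] by auto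
        have "m * x * ui m = g * x" unfolding g_def comm_def using Nu[OF x(1)] by (simp add: mult.assoc)
        then have "m * a * ui m = f * (g * x) ^ i" unfolding a(3) conj_F[OF M_units[OF m] a(1)] conj_power[OF M_units[OF m], symmetric] by simp
        also have "\<dots> = (f * g ^ i) * x ^ i" unfolding Fmult_power[OF g(1)] by (simp add: mult.assoc)
        finally have "m * a * ui m = (f * g ^ i) * x ^ i" .
        moreover have "f * g ^ i \<in> F \<and> f * g ^ i \<noteq> 0"
          using F0[OF a(1) Fp[OF g(1)] a(2)] unit_nonzero[OF units_power[OF Fu[OF g]]] by blast
        ultimately show "m * a * ui m \<in> A" unfolding A_def by blast
      qed
      show "a * b = b * a" if "a \<in> A" "b \<in> A" for a b
      proof -
        obtain f i where a: "f \<in> F" "a = f * x ^ i" using \<open>a \<in> A\<close> unfolding A_def by blast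
        obtain g j where b: "g \<in> F" "b = g * x ^ j" using \<open>b \<in> A\<close> unfolding A_def by blast
        have "a * b = f * (g * x ^ (i + j))" unfolding a b using Fc2[OF b(1)] by (simp add: mult.assoc power_add)
        moreover have "b * a = g * (f * x ^ (j + i))" unfolding a b using Fc2[OF a(1)] by (simp add: mult.assoc power_add)
        ultimately show ?thesis using Fc2[OF b(1), of f] by (simp add: add.commute)
      qed
    qed
    moreover have "1 * x ^ 1 \<in> A" unfolding A_def using F1 by blast
    ultimately show False using x(2) by auto
  qed
  define Q where "Q = {f * b | f b. f \<in> F \<and> f \<noteq> 0 \<and> b \<in> B}"
  have QI: "f * b \<in> Q" if "f \<in> F" "f \<noteq> 0" "b \<in> B" for f b unfolding Q_def using that by blast
  have QE: thesis if "x \<in> Q" "\<And>f b. f \<in> F \<Longrightarrow> f \<noteq> 0 \<Longrightarrow> b \<in> B \<Longrightarrow> x = f * b \<Longrightarrow> thesis" for x thesis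
    using that unfolding Q_def by blast
  have BQ: "b \<in> Q" if "b \<in> B" for b using QI[of 1 b] F1 that by simp
  have gQ: "ugrp Q" unfolding ugrp_def
  proof (intro conjI ballI)
    show "Q \<subseteq> units" using Fu BN(3) unfolding Q_def by auto
    show "1 \<in> Q" by (rule BQ[OF ugrpD(2)[OF gB]])
  next
    fix y z assume y: "y \<in> Q" and z: "z \<in> Q"
    obtain f b where f: "f \<in> F" "f \<noteq> 0" "b \<in> B" "y = f * b" using y by (rule QE)
    obtain g c where g: "g \<in> F" "g \<noteq> 0" "c \<in> B" "z = g * c" using z by (rule QE)
    have "y * z = (f * g) * (b * c)" unfolding f g using Fc2[OF g(1)] by (simp add: mult.assoc)
    then show "y * z \<in> Q" using QI[of "f * g" "b * c"] F0[OF f(1) g(1) f(2) g(2)] ugrpD(3)[OF gB f(3) g(3)] by simp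
  next
    fix y assume y: "y \<in> Q"
    obtain f b where f: "f \<in> F" "f \<noteq> 0" "b \<in> B" "y = f * b" using y by (rule QE)
    have "ui y = ui f * ui b" unfolding f using Fu[OF f(1,2)] BN(3)[OF f(3)] Fui[OF f(1,2)] Fc by simp
    then show "ui y \<in> Q" using QI[of "ui f" "ui b"] Fui[OF f(1,2)] ugrpD(4)[OF gB f(3)] by simp
  qed
  have iQ: "Minv Q" unfolding Minv_def
  proof (intro ballI)
    fix m y assume m: "m \<in> M" and y: "y \<in> Q"
    obtain f b where f: "f \<in> F" "f \<noteq> 0" "b \<in> B" "y = f * b" using y by (rule QE)
    show "m * y * ui m \<in> Q" unfolding f(4) conj_F[OF M_units[OF m] f(1)] by (rule QI[OF f(1,2) MinvD[OF iB m f(3)]])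
  qed
  interpret class_two G M k Q p
  proof unfold_locales
    show "prime p" "ugrp Q" "Minv Q" using p gQ iQ .
    show "comm y z \<in> F" if y: "y \<in> Q" and z: "z \<in> Q" for y z
    proof -
      obtain f b where f: "f \<in> F" "f \<noteq> 0" "b \<in> B" "y = f * b" using y by (rule QE)
      obtain g c where g: "g \<in> F" "g \<noteq> 0" "c \<in> B" "z = g * c" using z by (rule QE)
      have u: "f \<in> units" "g \<in> units" "b \<in> units" "c \<in> units" using Fu f g BN by auto
      have "y * z = f * (g * (b * c))" unfolding f g using Fc2[OF g(1)] by (simp add: mult.assoc)
      also have "b * c = comm b c * (c * b)" using comm_swap u by blast
      also have "f * (g * (comm b c * (c * b))) = comm b c * (z * y)" unfolding f g
        using Fc2[OF f(1)] Fc2[OF g(1), of f] Fc2[OF f(1), of "comm b c"] Fc2[OF g(1), of "comm b c"] by (simp add: mult.assoc)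
      finally have "comm y z = comm b c" using comm_eq[of y z] ugrpD(1)[OF gQ] y z by blast
      then show ?thesis using N(5)[OF BN(1)[OF f(3)] BN(1)[OF g(3)]] by simp
    qed
    show "f \<in> Q" if "f \<in> F" "f \<noteq> 0" for f using QI[OF that ugrpD(2)[OF gB]] by simp
    show "\<exists>f\<in>F. f \<noteq> 0 \<and> ((f * y) ^ p = 1 \<or> (f * y) ^ p = -1)" if y: "y \<in> Q" for y
    proof -
      obtain f b where f: "f \<in> F" "f \<noteq> 0" "b \<in> B" "y = f * b" using y by (rule QE)
      obtain g where g: "g \<in> F" "g \<noteq> 0" "b ^ p = g ^ p \<or> b ^ p = - (g ^ p)" using f(3) unfolding B_def by blast
      have h: "ui g * ui f \<in> F \<and> ui g * ui f \<noteq> 0" using F0 Fui f g by blast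
      have "(ui g * ui f) * y = ui g * b" unfolding f(4) using Fu[OF f(1,2)] by (simp add: mult.assoc)
      moreover have "ui g ^ p * g ^ p = 1" unfolding ui_power[OF Fu[OF g(1,2)], symmetric] using Fu[OF g(1,2)] by simp
      ultimately have "((ui g * ui f) * y) ^ p = 1 \<or> ((ui g * ui f) * y) ^ p = -1"
        using Fmult_power[of "ui g" b p] Fui[OF g(1,2)] g(3) by auto
      then show ?thesis using h by blast
    qed
    show "y \<in> F" if "y \<in> Q" "\<And>z. z \<in> Q \<Longrightarrow> y * z = z * y" for y
      using central[OF _ iQ that] ugrpD(1)[OF gQ] by blast
    show "\<exists>y\<in>Q. \<exists>z\<in>Q. y * z \<noteq> z * y"
    proof (rule ccontr)
      assume "\<not> ?thesis"
      then have "Q \<subseteq> F" by (intro abelian[OF _ iQ]) (use ugrpD(1)[OF gQ] in blast)+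
      then show False using BF BQ by blast
    qed
  qed
  show False by (rule class2_contradiction)
qed

end

section \<open>Matrices as endomorphisms\<close>

definition endo_of :: "'a::ring_1^'n^'n \<Rightarrow> ('a, 'n::finite) endo" where
  "endo_of A = Abs_endo (\<lambda>v. A *v v)"

lemma matrix_vector_axis: "(A :: 'a::ring_1^'n^'n) *v axis j 1 = (\<chi> i. A $ i $ j)"
proof -
  have "(\<Sum>k\<in>UNIV. A $ i $ k * axis j 1 $ k) = (\<Sum>k\<in>UNIV. if k = j then A $ i $ k else 0)" for i
    by (rule sum.cong) (auto simp: axis_def)
  then show ?thesis by (simp add: vec_eq_iff matrix_vector_mult_def)
qed

lemma ap_endo_of [simp]: "ap (endo_of A) v = A *v v"
  unfolding endo_of_def
proof (rule ap_Abs)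
  show "A *v (v + w) = A *v v + A *v w" for v w
    by (simp add: vec_eq_iff matrix_vector_mult_def distrib_left sum.distrib)
  show "A *v (v \<star> a) = (A *v v) \<star> a" for v a
    by (simp add: vec_eq_iff matrix_vector_mult_def sum_distrib_right mult.assoc)
qed

lemma endo_of_mult [simp]: "endo_of (A ** B) = endo_of A * endo_of B"
  by (rule endo_eqI) (simp add: matrix_vector_mul_assoc)

lemma endo_of_mat_1 [simp]: "endo_of (mat 1) = 1"
  by (rule endo_eqI) (simp add: matrix_vector_mul_lid)

lemma inj_endo_of: "inj endo_of"
proof (rule injI)
  fix A B :: "'a::ring_1^'n^'n" assume "endo_of A = endo_of B"
  then have "A *v axis j 1 = B *v axis j 1" for j by (metis ap_endo_of)
  then show "A = B" unfolding matrix_vector_axis by (simp add: vec_eq_iff)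
qed

lemma surj_endo_of: "\<exists>A. endo_of A = E"
proof -
  have "endo_of (\<chi> i j. ap E (axis j 1) $ i) = E"
    by (rule endo_axis_eqI) (simp add: matrix_vector_axis)
  then show ?thesis by blast
qed

lemma endo_of_eq_iff [simp]: "endo_of A = endo_of B \<longleftrightarrow> A = B"
  using inj_endo_of by (auto dest: injD)

lemma endo_of_units: "endo_of A \<in> units \<longleftrightarrow> invertible A"
proof
  assume u: "endo_of A \<in> units"
  obtain B where "endo_of B = ui (endo_of A)" using surj_endo_of by blast
  then have "endo_of (A ** B) = endo_of (mat 1)" "endo_of (B ** A) = endo_of (mat 1)" using u by simp_all
  then show "invertible A" unfolding endo_of_eq_iff invertible_def by blast
next
  assume "invertible A"
  then obtain B where "A ** B = mat 1" "B ** A = mat 1" unfolding invertible_def by blast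
  then have "endo_of A * endo_of B = 1" "endo_of B * endo_of A = 1" by (simp_all flip: endo_of_mult)
  then show "endo_of A \<in> units" by (rule unitsI)
qed

lemma group_GL: "group (GL :: ('a::division_ring^'n^'n) monoid)"
proof (rule groupI)
  fix A assume "A \<in> carrier (GL :: ('a^'n^'n) monoid)"
  then obtain B where "A ** B = mat 1" "B ** A = mat 1" unfolding GL_def invertible_def by auto
  then show "\<exists>B\<in>carrier GL. B \<otimes>\<^bsub>GL\<^esub> A = \<one>\<^bsub>GL\<^esub>" unfolding GL_def by (auto simp: invertible_def)
next
  fix A B assume "A \<in> carrier (GL :: ('a^'n^'n) monoid)" "B \<in> carrier (GL :: ('a^'n^'n) monoid)"
  then have "endo_of A \<in> units" "endo_of B \<in> units" unfolding GL_def by (simp_all add: endo_of_units)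
  then have "endo_of (A ** B) \<in> units" by simp
  then show "A \<otimes>\<^bsub>GL\<^esub> B \<in> carrier GL" unfolding GL_def by (simp add: endo_of_units del: endo_of_mult)
qed (auto simp: GL_def invertible_def matrix_mul_assoc intro!: exI[of _ "mat 1"])

context
  fixes X :: "('a::division_ring^'n^'n) set" and \<Gamma> :: "('a^'n^'n) monoid"
  assumes grp: "group \<Gamma>" and \<Gamma>: "\<Gamma> = GL\<lparr>carrier := X\<rparr>"
begin

lemma endo_of_inv: assumes "x \<in> carrier \<Gamma>" shows "ui (endo_of x) = endo_of (inv\<^bsub>\<Gamma>\<^esub> x)" "endo_of x \<in> units"
proof -
  have "x \<otimes>\<^bsub>\<Gamma>\<^esub> inv\<^bsub>\<Gamma>\<^esub> x = \<one>\<^bsub>\<Gamma>\<^esub>" "inv\<^bsub>\<Gamma>\<^esub> x \<otimes>\<^bsub>\<Gamma>\<^esub> x = \<one>\<^bsub>\<Gamma>\<^esub>"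
    using group.r_inv[OF grp assms] group.l_inv[OF grp assms] by simp_all
  then have "x ** inv\<^bsub>\<Gamma>\<^esub> x = mat 1" "inv\<^bsub>\<Gamma>\<^esub> x ** x = mat 1" unfolding \<Gamma> GL_def by simp_all
  then have "endo_of x * endo_of (inv\<^bsub>\<Gamma>\<^esub> x) = 1" "endo_of (inv\<^bsub>\<Gamma>\<^esub> x) * endo_of x = 1" by (simp_all flip: endo_of_mult)
  then show "ui (endo_of x) = endo_of (inv\<^bsub>\<Gamma>\<^esub> x)" "endo_of x \<in> units" using ui_eq unitsI by blast+
qed

lemma ugrp_image: assumes "subgroup H \<Gamma>" shows "ugrp (endo_of ` H)"
  unfolding ugrp_def
proof (intro conjI ballI)
  note H = subgroup.mem_carrier[OF assms] subgroup.m_closed[OF assms] subgroup.one_closed[OF assms] subgroup.m_inv_closed[OF assms]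
  show "endo_of ` H \<subseteq> units" using H(1) endo_of_inv(2) by blast
  have "mat 1 \<in> H" using H(3) unfolding \<Gamma> GL_def by simp
  then show "1 \<in> endo_of ` H" by (metis endo_of_mat_1 imageI)
  have "x ** y \<in> H" if "x \<in> H" "y \<in> H" for x y using H(2)[OF that] unfolding \<Gamma> GL_def by simp
  then show "x * y \<in> endo_of ` H" if "x \<in> endo_of ` H" "y \<in> endo_of ` H" for x y
    using that by (auto simp flip: endo_of_mult)
  show "ui x \<in> endo_of ` H" if "x \<in> endo_of ` H" for x
    using that H(1,4) endo_of_inv(1) by auto
qed

lemma sol_image: "subgroup H \<Gamma> \<Longrightarrow> (derived \<Gamma> ^^ n) H = {\<one>\<^bsub>\<Gamma>\<^esub>} \<Longrightarrow> sol n (endo_of ` H)"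
proof (induction n arbitrary: H)
  case 0
  then have "H = {mat 1}" unfolding \<Gamma> GL_def by simp
  then show ?case by simp
next
  case (Suc n)
  have HX: "H \<subseteq> carrier \<Gamma>" by (rule subgroup.subset[OF Suc.prems(1)])
  have s: "subgroup (derived \<Gamma> H) \<Gamma>" by (rule group.derived_is_subgroup[OF grp HX])
  have "(derived \<Gamma> ^^ n) (derived \<Gamma> H) = {\<one>\<^bsub>\<Gamma>\<^esub>}" using Suc.prems(2) by (simp add: funpow_swap1)
  then have "sol n (endo_of ` derived \<Gamma> H)" by (rule Suc.IH[OF s])
  moreover have "comm (endo_of x) (endo_of y) \<in> endo_of ` derived \<Gamma> H" if "x \<in> H" "y \<in> H" for x y
  proof -
    have "x \<otimes>\<^bsub>\<Gamma>\<^esub> y \<otimes>\<^bsub>\<Gamma>\<^esub> inv\<^bsub>\<Gamma>\<^esub> x \<otimes>\<^bsub>\<Gamma>\<^esub> inv\<^bsub>\<Gamma>\<^esub> y \<in> derived \<Gamma> H"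
      unfolding derived_def by (rule generate.incl) (use that in blast)
    then have "x ** y ** inv\<^bsub>\<Gamma>\<^esub> x ** inv\<^bsub>\<Gamma>\<^esub> y \<in> derived \<Gamma> H" unfolding \<Gamma> GL_def by simp
    then have "endo_of (x ** y ** inv\<^bsub>\<Gamma>\<^esub> x ** inv\<^bsub>\<Gamma>\<^esub> y) \<in> endo_of ` derived \<Gamma> H" by (rule imageI)
    moreover have "x \<in> carrier \<Gamma>" "y \<in> carrier \<Gamma>" using that HX by blast+
    ultimately show ?thesis by (simp add: comm_def endo_of_inv(1))
  qed
  ultimately show ?case using ugrp_image[OF s] by auto
qed

lemma normalizes_image: assumes "H \<lhd> \<Gamma>" shows "normalizes (endo_of ` X) (endo_of ` H)"
  unfolding normalizes_def
proof (intro ballI)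
  fix m h assume "m \<in> endo_of ` X" "h \<in> endo_of ` H"
  then obtain x y where x: "x \<in> X" "m = endo_of x" and y: "y \<in> H" "h = endo_of y" by blast
  have xc: "x \<in> carrier \<Gamma>" unfolding \<Gamma> using x by simp
  have "x \<otimes>\<^bsub>\<Gamma>\<^esub> y \<otimes>\<^bsub>\<Gamma>\<^esub> inv\<^bsub>\<Gamma>\<^esub> x \<in> H" using assms xc y(1) unfolding group.normal_inv_iff[OF grp] by blast
  then have "x ** y ** inv\<^bsub>\<Gamma>\<^esub> x \<in> H" unfolding \<Gamma> GL_def by simp
  then have "endo_of (x ** y ** inv\<^bsub>\<Gamma>\<^esub> x) \<in> endo_of ` H" by blast
  then show "m * h * ui m \<in> endo_of ` H" unfolding x(2) y(2) endo_of_inv(1)[OF xc] by simp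
qed

end

lemma subgroup_preimage:
  assumes "ugrp K" shows "subgroup {A. endo_of A \<in> K} (GL :: ('a::division_ring^'n^'n) monoid)"
proof (rule group.subgroupI[OF group_GL])
  have GLe: "(GL :: ('a^'n^'n) monoid) = GL\<lparr>carrier := carrier GL\<rparr>" by simp
  show sub: "{A. endo_of A \<in> K} \<subseteq> carrier GL" using ugrpD(1)[OF assms] endo_of_units unfolding GL_def by auto
  show "{A. endo_of A \<in> K} \<noteq> {}" using ugrpD(2)[OF assms] endo_of_mat_1 by (metis (mono_tags) empty_iff mem_Collect_eq)
  show "inv\<^bsub>GL\<^esub> A \<in> {A. endo_of A \<in> K}" if "A \<in> {A. endo_of A \<in> K}" for A
    using that endo_of_inv(1)[OF group_GL GLe, of A] sub ugrpD(4)[OF assms, of "endo_of A"] by auto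
  show "A \<otimes>\<^bsub>GL\<^esub> B \<in> {A. endo_of A \<in> K}" if "A \<in> {A. endo_of A \<in> K}" "B \<in> {A. endo_of A \<in> K}" for A B
    using that ugrpD(3)[OF assms] unfolding GL_def by simp
qed

text \<open>The subnormal chain is descended from GL: below a term containing \<open>elem\<close>
  the next term is normalized by \<open>elem\<close>, so it is central or contains
  \<open>elem\<close> again.\<close>

lemma subnormal_central_or_elem:
  fixes G :: "('a::division_ring^'n^'n) set"
  assumes n: "CARD('n) \<ge> 2" and a: "a \<in> (cen :: ('a, 'n) endo set)" "a \<noteq> 0" "a * a \<noteq> 1"
    and G: "subnormal G (GL :: ('a^'n^'n) monoid)"
  shows "subgroup G GL \<and> (endo_of ` G \<subseteq> cen \<or> elem \<subseteq> endo_of ` G)"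
proof -
  obtain ks where ks: "ks \<noteq> []" "hd ks = G" "last ks = carrier (GL :: ('a^'n^'n) monoid)"
    "\<And>K. K \<in> set ks \<Longrightarrow> subgroup K GL" "\<And>i. i < length ks - 1 \<Longrightarrow> ks ! i \<lhd> GL\<lparr>carrier := ks ! (i + 1)\<rparr>"
    using G unfolding subnormal_def by blast
  let ?P = "\<lambda>i. endo_of ` (ks ! i) \<subseteq> cen \<or> elem \<subseteq> endo_of ` (ks ! i)"
  have "?P i" if "i \<le> length ks - 1" for i using that
  proof (induction rule: inc_induct)
    case base
    have "e \<in> endo_of ` (carrier GL)" if "e \<in> elem" for e :: "('a, 'n) endo"
    proof -
      obtain A where "endo_of A = e" using surj_endo_of by blast
      then show ?thesis using elem_units[OF that] endo_of_units unfolding GL_def by auto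
    qed
    then show ?case using ks(1,3) by (auto simp: last_conv_nth)
  next
    case (step i)
    define H where "H = ks ! i"
    define K where "K = ks ! Suc i"
    have HK: "H \<lhd> GL\<lparr>carrier := K\<rparr>" using ks(5)[of i] step(2) unfolding H_def K_def by simp
    have sH: "subgroup H GL" and sK: "subgroup K GL" using ks(4) step(2) unfolding H_def K_def by simp_all
    have gK: "group (GL\<lparr>carrier := K\<rparr>)" by (rule group.subgroup_imp_group[OF group_GL sK])
    have "H \<subseteq> K" using subgroup.subset[OF normal_imp_subgroup[OF HK]] by simp
    have uH: "ugrp (endo_of ` H)" by (rule ugrp_image[OF group_GL _ sH, of "carrier GL"]) simp
    have nm: "normalizes (endo_of ` K) (endo_of ` H)" by (rule normalizes_image[OF gK refl HK])
    have "endo_of ` K \<subseteq> cen \<or> elem \<subseteq> endo_of ` K" using step(3) unfolding K_def .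
    then have "endo_of ` H \<subseteq> cen \<or> elem \<subseteq> endo_of ` H"
    proof
      assume "endo_of ` K \<subseteq> cen"
      then show ?thesis using \<open>H \<subseteq> K\<close> by blast
    next
      assume "elem \<subseteq> endo_of ` K"
      then have "normalizes elem (endo_of ` H)" using nm unfolding normalizes_def by blast
      then show ?thesis using elem_subset_normalized[OF n uH _ _ divring_cen order_refl a] by blast
    qed
    then show ?case unfolding H_def .
  qed
  then have "?P 0" by simp
  moreover have "ks ! 0 = G" using ks(1,2) by (simp add: hd_conv_nth)
  moreover have "subgroup G GL" using ks(1,2,4) hd_in_set by metis
  ultimately show ?thesis by simp
qed

theorem theorem3p6:
  fixes G M :: "('a::division_ring ^'n^'n) set"
  assumes noncomm: "\<exists>a b :: 'a. a * b \<noteq> b * a"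
    and n_ge_2: "CARD('n) \<ge> 2"
    and center_ge_5: "infinite (dr_center :: 'a set) \<or> card (dr_center :: 'a set) \<ge> 5"
    and subnormal_G: "subnormal G (GL :: ('a ^'n^'n) monoid)"
    and maximal_M: "maximal_subgroup M ((GL :: ('a ^'n^'n) monoid)\<lparr>carrier := G\<rparr>)"
    and solvable_M: "solvable ((GL :: ('a ^'n^'n) monoid)\<lparr>carrier := M\<rparr>)"
  shows "comm_group ((GL :: ('a ^'n^'n) monoid)\<lparr>carrier := M\<rparr>)"
proof -
  have center5: "\<exists>f\<in>(dr_center :: 'a set). f \<notin> S" if "finite S" "card S < 5" for S
  proof (rule ccontr)
    assume "\<not> ?thesis"
    then have s: "dr_center \<subseteq> S" by blast
    then show False using card_mono[OF that(1) s] finite_subset[OF s that(1)] center_ge_5 that(2) by linarith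
  qed
  obtain a :: "('a, 'n) endo" where a: "a \<in> cen" "a \<noteq> 0" "a * a \<noteq> 1" using cen_square[OF center5] by blast
  have G: "subgroup G GL" and alt: "endo_of ` G \<subseteq> cen \<or> elem \<subseteq> endo_of ` G"
    using subnormal_central_or_elem[OF n_ge_2 a subnormal_G] by blast+
  have M': "subgroup M (GL\<lparr>carrier := G\<rparr>)" "M \<noteq> G"
    and max: "\<And>K. subgroup K (GL\<lparr>carrier := G\<rparr>) \<Longrightarrow> M \<subseteq> K \<Longrightarrow> K = M \<or> K = G"
    using maximal_M unfolding maximal_subgroup_def by auto
  have MG: "M \<subseteq> G" using subgroup.subset[OF M'(1)] by simp
  have M: "subgroup M GL" by (rule group.incl_subgroup[OF group_GL G M'(1)])
  have gM: "group (GL\<lparr>carrier := M\<rparr>)" by (rule group.subgroup_imp_group[OF group_GL M])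
  \<comment> \<open>A central G makes M commutative at once; otherwise G contains
    \<open>elem\<close> and the locale applies.\<close>
  have "x * y = y * x" if xy: "x \<in> endo_of ` M" "y \<in> endo_of ` M" for x y
    using alt
  proof
    assume "endo_of ` G \<subseteq> cen"
    then show ?thesis using xy MG cen_commute by blast
  next
    assume el: "elem \<subseteq> endo_of ` G"
    obtain k where k: "(derived (GL\<lparr>carrier := M\<rparr>) ^^ k) M = {\<one>\<^bsub>GL\<lparr>carrier := M\<rparr>\<^esub>}"
      using solvable_M group.solvable_iff_trivial_derived_seq[OF gM] by auto
    have sM: "subgroup M (GL\<lparr>carrier := M\<rparr>)" using group.subgroup_self[OF gM] by simp
    interpret maximal_solvable "endo_of ` G" "endo_of ` M" k
    proof
      show "CARD('n) \<ge> 2" "\<exists>a b :: 'a. a * b \<noteq> b * a" by fact+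
      show "\<exists>f\<in>(dr_center :: 'a set). f \<notin> S" if "finite S" "card S < 5" for S by (rule center5[OF that])
      show "elem \<subseteq> endo_of ` G" by (rule el)
      show "ugrp (endo_of ` G)" by (rule ugrp_image[OF group_GL _ G, of "carrier GL"]) simp
      show "ugrp (endo_of ` M)" by (rule ugrp_image[OF group_GL _ M, of "carrier GL"]) simp
      show "endo_of ` M \<subseteq> endo_of ` G" using MG by blast
      show "endo_of ` M \<noteq> endo_of ` G" using M'(2) inj_image_eq_iff[OF inj_endo_of] by blast
      show "sol k (endo_of ` M)" by (rule sol_image[OF gM refl sM k])
      fix K :: "('a, 'n) endo set" assume K: "ugrp K" "endo_of ` M \<subseteq> K" "K \<subseteq> endo_of ` G"
      \<comment> \<open>Maximality of M is given for matrices, so K is pulled back along the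
        bijection \<open>endo_of\<close>.\<close>
      define K' where "K' = {A. endo_of A \<in> K}"
      have im: "endo_of ` K' = K"
      proof
        show "K \<subseteq> endo_of ` K'"
        proof
          fix e assume "e \<in> K"
          moreover obtain A where "endo_of A = e" using surj_endo_of by blast
          ultimately show "e \<in> endo_of ` K'" unfolding K'_def by blast
        qed
      qed (auto simp: K'_def)
      have "K' \<subseteq> G"
      proof
        fix A assume "A \<in> K'"
        then have "endo_of A \<in> endo_of ` G" using K(3) unfolding K'_def by blast
        then show "A \<in> G" using inj_image_mem_iff[OF inj_endo_of] by blast
      qed
      then have "subgroup K' (GL\<lparr>carrier := G\<rparr>)"
        using group.subgroup_incl[OF group_GL subgroup_preimage[OF K(1)] G] unfolding K'_def by blast
      moreover have "M \<subseteq> K'" using K(2) unfolding K'_def by blast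
      ultimately have "K' = M \<or> K' = G" by (rule max)
      then show "K = endo_of ` M \<or> K = endo_of ` G" using im by blast
    qed
    show ?thesis using commutative xy by blast
  qed
  then have "endo_of (x ** y) = endo_of (y ** x)" if "x \<in> M" "y \<in> M" for x y using that by simp
  then have "x ** y = y ** x" if "x \<in> M" "y \<in> M" for x y using that unfolding endo_of_eq_iff by blast
  then show ?thesis by (intro group.group_comm_groupI[OF gM]) (simp add: GL_def)
qed

end
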